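(* For any $\delta>0$ there exists a number $V_0(\delta)$, depending only on $\delta$ (in particular not on the Hilbert space), such that the following holds. Let $\mathbb{H}$ be a separable Hilbert space over the reals, let $n\ge1$, let $\alpha_1,\dots,\alpha_n\in(0,1]$, and let $X_1,\dots,X_n$ be independent random elements of $\mathbb{H}$ such that $\mathcal{Q}(X_i)\le\alpha_i$ for each $i$. Let $S_n=\sum_{i=1}^n X_i$. Let $Y_1,\dots,Y_n$ be independent integer-valued random variables with $Y_i\sim\nu_{\alpha_i}$. If $\mathrm{Var}(\sum_{i=1}^n Y_i)\ge V_0(\delta)$ then $$\mathcal{Q}(S_n)\le(1+\delta)\,\mathcal{Q}\Big(\sum_{i=1}^n a_iY_i\Big)$$ for some $a_1,\dots,a_n\in\{-1,1\}$.
   Context: For a random element $X$ of a Hilbert space $\mathbb{H}$ (including $\mathbb{H}=\mathbb{R}$), $\mathcal{Q}(X)=\sup_{x\in\mathbb{H}}\mathbb{P}(X=x)$. For $\alpha\in(0,1]$, $\nu_\alpha$ is the probability measure on $\mathbb{Z}$ with $\nu_\alpha(\{i\})=\alpha$ for $i\in\{0,\dots,\lfloor\alpha^{-1}\rfloor-1\}$ and $\nu_\alpha(\{\lfloor\alpha^{-1}\rfloor\})=1-\alpha\lfloor\alpha^{-1}\rfloor$. *)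

theory Defs
  imports "HOL-Probability.Probability"
begin

section \<open>The sequence space of square-summable real sequences\<close>

text \<open>
  HOL cannot quantify existentially over a constant outside a quantification over types, so a
  constant that does not depend on the Hilbert space is expressed as follows: it exists for one
  fixed separable Hilbert space \<open>ell2\<close>, into which every separable Hilbert space embeds linearly
  and isometrically, and every constant that serves for \<open>ell2\<close> serves for every separable Hilbert
  space type. The same applies to the types of the sample spaces: \<open>nat \<Rightarrow> ell2\<close> and \<open>nat \<Rightarrow> int\<close>
  carry every joint law of \<open>ell2\<close>-valued, respectively integer-valued, random sequences.
\<close>

typedef ell2 = "{x :: nat \<Rightarrow> real. summable (\<lambda>k. (x k)\<^sup>2)}"
  morphisms coord Abs_ell2
  by (rule exI[of _ "\<lambda>_. 0"]) simp

lemma coord_summable: "summable (\<lambda>k. (coord x k)\<^sup>2)"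
  using coord[of x] by simp

lemma coord_Abs: "summable (\<lambda>k. (f k)\<^sup>2) \<Longrightarrow> coord (Abs_ell2 f) = f"
  by (simp add: Abs_ell2_inverse)

lemma ell2_eqI: "(\<And>k. coord x k = coord y k) \<Longrightarrow> x = y"
  by (metis coord_inject ext)

lemma square_summable_mult:
  fixes f g :: "nat \<Rightarrow> real"
  assumes "summable (\<lambda>k. (f k)\<^sup>2)" "summable (\<lambda>k. (g k)\<^sup>2)"
  shows "summable (\<lambda>k. f k * g k)"
proof (rule summable_comparison_test'[where N = 0])
  show "summable (\<lambda>k. (f k)\<^sup>2 + (g k)\<^sup>2)"
    using assms by (rule summable_add)
  fix k :: nat
  have "0 \<le> (\<bar>f k\<bar> - \<bar>g k\<bar>)\<^sup>2" by simp
  then have "2 * (\<bar>f k\<bar> * \<bar>g k\<bar>) \<le> (f k)\<^sup>2 + (g k)\<^sup>2"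
    by (simp add: power2_diff mult.assoc)
  moreover have "0 \<le> \<bar>f k\<bar> * \<bar>g k\<bar>" by simp
  ultimately show "norm (f k * g k) \<le> (f k)\<^sup>2 + (g k)\<^sup>2"
    unfolding real_norm_def abs_mult by linarith
qed

lemma square_summable_add:
  fixes f g :: "nat \<Rightarrow> real"
  assumes "summable (\<lambda>k. (f k)\<^sup>2)" "summable (\<lambda>k. (g k)\<^sup>2)"
  shows "summable (\<lambda>k. (f k + g k)\<^sup>2)"
proof -
  have "summable (\<lambda>k. (f k)\<^sup>2 + (g k)\<^sup>2 + 2 * (f k * g k))"
    using assms by (intro summable_add summable_mult square_summable_mult)
  then show ?thesis
    by (simp add: power2_sum mult.assoc)
qed

lemma square_summable_scale:
  fixes f :: "nat \<Rightarrow> real"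
  shows "summable (\<lambda>k. (f k)\<^sup>2) \<Longrightarrow> summable (\<lambda>k. (c * f k)\<^sup>2)"
  by (simp add: power_mult_distrib summable_mult)

lemma square_summable_uminus:
  fixes f :: "nat \<Rightarrow> real"
  shows "summable (\<lambda>k. (f k)\<^sup>2) \<Longrightarrow> summable (\<lambda>k. (- f k)\<^sup>2)"
  by simp

lemma square_summable_diff:
  fixes f g :: "nat \<Rightarrow> real"
  assumes "summable (\<lambda>k. (f k)\<^sup>2)" "summable (\<lambda>k. (g k)\<^sup>2)"
  shows "summable (\<lambda>k. (f k - g k)\<^sup>2)"
  using square_summable_add[OF assms(1) square_summable_uminus[OF assms(2)]] by simp

instantiation ell2 :: real_inner
begin

definition zero_ell2 :: ell2 where "zero_ell2 = Abs_ell2 (\<lambda>_. 0)"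
definition plus_ell2 :: "ell2 \<Rightarrow> ell2 \<Rightarrow> ell2"
  where "plus_ell2 x y = Abs_ell2 (\<lambda>k. coord x k + coord y k)"
definition uminus_ell2 :: "ell2 \<Rightarrow> ell2" where "uminus_ell2 x = Abs_ell2 (\<lambda>k. - coord x k)"
definition minus_ell2 :: "ell2 \<Rightarrow> ell2 \<Rightarrow> ell2"
  where "minus_ell2 x y = Abs_ell2 (\<lambda>k. coord x k - coord y k)"
definition scaleR_ell2 :: "real \<Rightarrow> ell2 \<Rightarrow> ell2"
  where "scaleR_ell2 c x = Abs_ell2 (\<lambda>k. c * coord x k)"
definition inner_ell2 :: "ell2 \<Rightarrow> ell2 \<Rightarrow> real"
  where "inner_ell2 x y = (\<Sum>k. coord x k * coord y k)"
definition norm_ell2 :: "ell2 \<Rightarrow> real" where "norm_ell2 x = sqrt (inner x x)"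
definition sgn_ell2 :: "ell2 \<Rightarrow> ell2" where "sgn_ell2 x = inverse (norm x) *\<^sub>R x"
definition dist_ell2 :: "ell2 \<Rightarrow> ell2 \<Rightarrow> real" where "dist_ell2 x y = norm (x - y)"
definition uniformity_ell2 :: "(ell2 \<times> ell2) filter"
  where "uniformity_ell2 = (INF e\<in>{0<..}. principal {(x, y). dist x y < e})"
definition open_ell2 :: "ell2 set \<Rightarrow> bool"
  where "open_ell2 U = (\<forall>x\<in>U. eventually (\<lambda>(x', y). x' = x \<longrightarrow> y \<in> U) uniformity)"

lemma coord_0 [simp]: "coord 0 k = 0"
  by (simp add: zero_ell2_def coord_Abs)

lemma coord_add [simp]: "coord (x + y) k = coord x k + coord y k"
  by (simp add: plus_ell2_def coord_Abs square_summable_add coord_summable)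

lemma coord_uminus [simp]: "coord (- x) k = - coord x k"
  by (simp add: uminus_ell2_def coord_Abs coord_summable)

lemma coord_diff [simp]: "coord (x - y) k = coord x k - coord y k"
  by (simp add: minus_ell2_def coord_Abs square_summable_diff coord_summable)

lemma coord_scaleR [simp]: "coord (c *\<^sub>R x) k = c * coord x k"
  by (simp add: scaleR_ell2_def coord_Abs square_summable_scale coord_summable)

lemma coord_mult_summable: "summable (\<lambda>k. coord x k * coord y k)"
  by (simp add: square_summable_mult coord_summable)

instance
proof
  fix x y z :: ell2 and r s :: real
  show "x + y + z = x + (y + z)" "x + y = y + x" "0 + x = x" "- x + x = 0" "x - y = x + - y"
    by (rule ell2_eqI; simp)+
  show "r *\<^sub>R (x + y) = r *\<^sub>R x + r *\<^sub>R y" "(r + s) *\<^sub>R x = r *\<^sub>R x + s *\<^sub>R x"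
    "r *\<^sub>R s *\<^sub>R x = (r * s) *\<^sub>R x" "1 *\<^sub>R x = x"
    by (rule ell2_eqI; simp add: algebra_simps)+
  show "sgn x = inverse (norm x) *\<^sub>R x" by (rule sgn_ell2_def)
  show "dist x y = norm (x - y)" by (rule dist_ell2_def)
  show "(uniformity :: (ell2 \<times> ell2) filter) = (INF e\<in>{0<..}. principal {(x, y). dist x y < e})"
    by (rule uniformity_ell2_def)
  show "open U = (\<forall>x\<in>U. eventually (\<lambda>(x', y). x' = x \<longrightarrow> y \<in> U) uniformity)" for U :: "ell2 set"
    by (rule open_ell2_def)
  show "inner x y = inner y x" by (simp add: inner_ell2_def mult.commute)
  show "inner (x + y) z = inner x z + inner y z"
    by (simp add: inner_ell2_def distrib_right suminf_add coord_mult_summable)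
  show "inner (r *\<^sub>R x) y = r * inner x y"
    by (simp add: inner_ell2_def mult.assoc suminf_mult coord_mult_summable)
  show "0 \<le> inner x x"
    by (simp add: inner_ell2_def suminf_nonneg coord_mult_summable)
  show "inner x x = 0 \<longleftrightarrow> x = 0"
  proof
    assume "inner x x = 0"
    then have "\<forall>k. coord x k * coord x k = 0"
      using suminf_eq_zero_iff[of "\<lambda>k. coord x k * coord x k"]
      by (simp add: inner_ell2_def coord_mult_summable)
    then show "x = 0" by (intro ell2_eqI) simp
  qed (simp add: inner_ell2_def)
  show "norm x = sqrt (inner x x)" by (rule norm_ell2_def)
qed

end

lemma norm_ell2_sq: "(norm x)\<^sup>2 = (\<Sum>k. (coord x k)\<^sup>2)"
  unfolding power2_norm_eq_inner by (simp add: inner_ell2_def power2_eq_square)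

lemma abs_coord_le: "\<bar>coord x k\<bar> \<le> norm x"
proof (rule power2_le_imp_le)
  have "(\<Sum>i\<in>{k}. (coord x i)\<^sup>2) \<le> (\<Sum>i. (coord x i)\<^sup>2)"
    by (rule sum_le_suminf) (auto simp: coord_summable)
  then show "\<bar>coord x k\<bar>\<^sup>2 \<le> (norm x)\<^sup>2" by (simp add: norm_ell2_sq)
qed simp

lemma square_sum_bound:
  fixes f :: "nat \<Rightarrow> real"
  assumes "\<And>K. (\<Sum>k<K. (f k)\<^sup>2) \<le> e\<^sup>2" "0 \<le> e"
  shows "summable (\<lambda>k. (f k)\<^sup>2)" "norm (Abs_ell2 f) \<le> e"
proof -
  show s: "summable (\<lambda>k. (f k)\<^sup>2)"
    using assms(1) by (intro summableI_nonneg_bounded[where x = "e\<^sup>2"]) auto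
  have "(\<Sum>k. (f k)\<^sup>2) \<le> e\<^sup>2" using s assms(1) by (rule suminf_le_const)
  then have "(norm (Abs_ell2 f))\<^sup>2 \<le> e\<^sup>2" by (simp add: norm_ell2_sq coord_Abs s)
  then show "norm (Abs_ell2 f) \<le> e" using assms(2) by (rule power2_le_imp_le)
qed

instance ell2 :: complete_space
proof
  fix X :: "nat \<Rightarrow> ell2"
  assume X: "Cauchy X"
  have "Cauchy (\<lambda>n. coord (X n) k)" for k
  proof (rule metric_CauchyI)
    fix e :: real assume "0 < e"
    then obtain N where N: "\<And>m n. m \<ge> N \<Longrightarrow> n \<ge> N \<Longrightarrow> dist (X m) (X n) < e"
      using metric_CauchyD[OF X] by blast
    have "dist (coord (X m) k) (coord (X n) k) < e" if "m \<ge> N" "n \<ge> N" for m n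
      using abs_coord_le[of "X m - X n" k] N[OF that] by (simp add: dist_norm)
    then show "\<exists>N. \<forall>m\<ge>N. \<forall>n\<ge>N. dist (coord (X m) k) (coord (X n) k) < e" by blast
  qed
  then have "\<exists>l. (\<lambda>n. coord (X n) k) \<longlonglongrightarrow> l" for k
    by (simp add: Cauchy_convergent_iff convergent_def)
  then obtain l where l: "\<And>k. (\<lambda>n. coord (X n) k) \<longlonglongrightarrow> l k" by metis
  have tail: "\<exists>N. \<forall>n\<ge>N. \<forall>K. (\<Sum>k<K. (coord (X n) k - l k)\<^sup>2) \<le> e\<^sup>2" if e: "0 < e" for e
  proof -
    obtain N where N: "\<And>m n. m \<ge> N \<Longrightarrow> n \<ge> N \<Longrightarrow> dist (X m) (X n) < e"
      using metric_CauchyD[OF X e] by blast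
    have "(\<Sum>k<K. (coord (X n) k - l k)\<^sup>2) \<le> e\<^sup>2" if n: "n \<ge> N" for n K
    proof (rule tendsto_upperbound)
      show "(\<lambda>m. \<Sum>k<K. (coord (X n) k - coord (X m) k)\<^sup>2) \<longlonglongrightarrow> (\<Sum>k<K. (coord (X n) k - l k)\<^sup>2)"
        by (intro tendsto_intros l)
      have "(\<Sum>k<K. (coord (X n) k - coord (X m) k)\<^sup>2) \<le> e\<^sup>2" if m: "m \<ge> N" for m
      proof -
        have "(\<Sum>k<K. (coord (X n - X m) k)\<^sup>2) \<le> (\<Sum>k. (coord (X n - X m) k)\<^sup>2)"
          by (rule sum_le_suminf) (auto simp only: coord_summable finite_lessThan zero_le_power2)
        also have "\<dots> = (norm (X n - X m))\<^sup>2" by (simp only: norm_ell2_sq)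
        also have "\<dots> \<le> e\<^sup>2" using N[OF n m] by (intro power_mono) (auto simp: dist_norm)
        finally show ?thesis by simp
      qed
      then show "\<forall>\<^sub>F m in sequentially. (\<Sum>k<K. (coord (X n) k - coord (X m) k)\<^sup>2) \<le> e\<^sup>2"
        by (rule eventually_sequentiallyI)
    qed simp
    then show ?thesis by blast
  qed
  obtain N where N: "\<And>K. (\<Sum>k<K. (coord (X N) k - l k)\<^sup>2) \<le> 1\<^sup>2"
    using tail[of 1] by auto
  have "summable (\<lambda>k. (coord (X N) k - l k)\<^sup>2)" using square_sum_bound(1)[OF N] by simp
  from square_summable_diff[OF coord_summable[of "X N"] this]
  have sl: "summable (\<lambda>k. (l k)\<^sup>2)" by simp
  have "X \<longlonglongrightarrow> Abs_ell2 l"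
  proof (rule metric_LIMSEQ_I)
    fix r :: real assume "0 < r"
    then obtain N where N: "\<And>n K. n \<ge> N \<Longrightarrow> (\<Sum>k<K. (coord (X n) k - l k)\<^sup>2) \<le> (r/2)\<^sup>2"
      using tail[of "r/2"] by auto
    have "dist (X n) (Abs_ell2 l) < r" if "n \<ge> N" for n
    proof -
      have "X n - Abs_ell2 l = Abs_ell2 (\<lambda>k. coord (X n) k - l k)"
        by (simp add: minus_ell2_def coord_Abs sl)
      then show ?thesis
        using square_sum_bound(2)[OF N[OF that]] \<open>0 < r\<close> by (simp add: dist_norm)
    qed
    then show "\<exists>N. \<forall>n\<ge>N. dist (X n) (Abs_ell2 l) < r" by blast
  qed
  then show "convergent X" by (rule convergentI)
qed

definition ell2_unit :: "nat \<Rightarrow> ell2"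
  where "ell2_unit i = Abs_ell2 (\<lambda>k. if k = i then 1 else 0)"

lemma coord_unit: "coord (ell2_unit i) k = (if k = i then 1 else 0)"
proof -
  have "summable (\<lambda>k. (if k = i then 1 else 0 :: real)\<^sup>2)"
    by (rule summable_finite[of "{i}"]) auto
  then show ?thesis by (simp add: ell2_unit_def coord_Abs)
qed

lemma norm_unit: "norm (ell2_unit i) = 1"
proof -
  have "(norm (ell2_unit i))\<^sup>2 = (\<Sum>k\<in>{i}. (coord (ell2_unit i) k)\<^sup>2)"
    unfolding norm_ell2_sq by (rule suminf_finite) (auto simp: coord_unit)
  then show ?thesis using power2_eq_1_iff[of "norm (ell2_unit i)"] norm_ge_zero[of "ell2_unit i"]
    by (auto simp: coord_unit)
qed

lemma coord_sum: "coord (sum f A) k = (\<Sum>i\<in>A. coord (f i) k)"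
  by (induction A rule: infinite_finite_induct) auto

definition ell2_rat :: "rat list \<Rightarrow> ell2"
  where "ell2_rat q = (\<Sum>i<length q. of_rat (q ! i) *\<^sub>R ell2_unit i)"

lemma ell2_rat_dense:
  fixes e :: real
  assumes e: "0 < e"
  shows "\<exists>q. dist x (ell2_rat q) < e"
proof -
  have "\<exists>K. norm (\<Sum>k. (coord x (k + K))\<^sup>2) < (e/2)\<^sup>2"
    using suminf_exist_split[of "(e/2)\<^sup>2", OF _ coord_summable[of x]] e by (auto simp: add.commute)
  then obtain K where K: "\<bar>\<Sum>k. (coord x (k + K))\<^sup>2\<bar> < (e/2)\<^sup>2" by auto
  define t where "t = (\<Sum>i<K. coord x i *\<^sub>R ell2_unit i)"
  have ct: "coord (x - t) k = (if k < K then 0 else coord x k)" for k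
    by (simp add: t_def coord_sum coord_unit if_distrib cong: if_cong)
  have "(norm (x - t))\<^sup>2 = (\<Sum>k. (coord (x - t) (k + K))\<^sup>2) + (\<Sum>k<K. (coord (x - t) k)\<^sup>2)"
    unfolding norm_ell2_sq by (rule suminf_split_initial_segment) (rule coord_summable)
  then have "(norm (x - t))\<^sup>2 < (e/2)\<^sup>2" using K unfolding ct by simp
  then have xt: "norm (x - t) < e/2" using e by (intro power2_less_imp_less[of _ "e/2"]) auto
  define d where "d = e / (2 * (real K + 1))"
  have d: "0 < d" using e by (simp add: d_def)
  have "\<exists>r. \<bar>coord x i - of_rat r\<bar> < d" for i
    using of_rat_dense[of "coord x i - d" "coord x i + d"] d by (auto simp: abs_less_iff)
      (metis add.commute diff_less_eq)
  then obtain r where r: "\<And>i. \<bar>coord x i - of_rat (r i)\<bar> < d" by metis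
  define q where "q = map r [0..<K]"
  have "t - ell2_rat q = (\<Sum>i<K. (coord x i - of_rat (r i)) *\<^sub>R ell2_unit i)"
    by (simp add: t_def ell2_rat_def q_def sum_subtractf scaleR_left_diff_distrib)
  also have "norm \<dots> \<le> (\<Sum>i<K. d)"
    by (rule sum_norm_le) (use r in \<open>simp add: norm_unit less_imp_le\<close>)
  also have "\<dots> \<le> e/2" using e by (simp add: d_def field_simps)
  finally have "norm (t - ell2_rat q) \<le> e/2" .
  then have "norm ((x - t) + (t - ell2_rat q)) < e"
    using xt norm_triangle_ineq[of "x - t" "t - ell2_rat q"] by linarith
  then show ?thesis by (intro exI[of _ q]) (simp add: dist_norm)
qed

instance ell2 :: polish_space
proof
  define B where "B = (\<lambda>(q, r). ball (ell2_rat q) (of_rat r)) ` (UNIV :: (rat list \<times> rat) set)"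
  have "countable B" by (simp add: B_def)
  moreover have "topological_basis B"
  proof (rule topological_basisI)
    show "open U" if "U \<in> B" for U using that by (auto simp: B_def)
    fix U :: "ell2 set" and x assume "open U" "x \<in> U"
    then obtain e where e: "0 < e" "ball x e \<subseteq> U" by (meson openE)
    obtain q where q: "dist x (ell2_rat q) < e/4" using ell2_rat_dense[of "e/4" x] e by auto
    obtain r where r: "e/4 < of_rat r" "of_rat r < e/2" using of_rat_dense[of "e/4" "e/2"] e by auto
    have "ball (ell2_rat q) (of_rat r) \<subseteq> ball x e"
    proof
      fix y assume "y \<in> ball (ell2_rat q) (of_rat r)"
      then have "dist (ell2_rat q) y < e/2" using r by simp
      then show "y \<in> ball x e" using q e dist_triangle[of x y "ell2_rat q"] by simp
    qed
    moreover have "x \<in> ball (ell2_rat q) (of_rat r)" using q r by (simp add: dist_commute)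
    ultimately show "\<exists>V\<in>B. x \<in> V \<and> V \<subseteq> U" using e unfolding B_def by fastforce
  qed
  ultimately show "\<exists>B :: ell2 set set. countable B \<and> open = generate_topology B"
    by (metis topological_basis_imp_subbasis)
qed


section \<open>Concentration\<close>

definition conc :: "'w measure \<Rightarrow> ('w \<Rightarrow> 'b) \<Rightarrow> real"
  where "conc M X = (SUP x. measure M {\<omega> \<in> space M. X \<omega> = x})"

definition nu_mass :: "real \<Rightarrow> int \<Rightarrow> real"
  where "nu_mass \<alpha> i =
    (if i \<in> {0..\<lfloor>1 / \<alpha>\<rfloor> - 1} then \<alpha> else if i = \<lfloor>1 / \<alpha>\<rfloor> then 1 - \<alpha> * of_int \<lfloor>1 / \<alpha>\<rfloor> else 0)"

definition nu :: "real \<Rightarrow> int pmf"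
  where "nu \<alpha> = embed_pmf (nu_mass \<alpha>)"

lemma pmf_nu:
  assumes "0 < \<alpha>" "\<alpha> \<le> 1"
  shows "pmf (nu \<alpha>) i = nu_mass \<alpha> i"
  unfolding nu_def
proof (rule pmf_embed_pmf)
  define m where "m = \<lfloor>1 / \<alpha>\<rfloor>"
  have m0: "0 \<le> m" using assms by (simp add: m_def)
  have "of_int m \<le> 1 / \<alpha>" unfolding m_def by (rule of_int_floor_le)
  then have "\<alpha> * of_int m \<le> 1" using assms by (simp add: field_simps)
  then show nn: "0 \<le> nu_mass \<alpha> i" for i using assms by (simp add: nu_mass_def m_def)
  have "(\<integral>\<^sup>+i. ennreal (nu_mass \<alpha> i) \<partial>count_space UNIV) =
      (\<integral>\<^sup>+i. ennreal (nu_mass \<alpha> i) \<partial>count_space {0..m})"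
    by (rule nn_integral_count_space_eq) (use m0 in \<open>auto simp: nu_mass_def m_def\<close>)
  also have "\<dots> = ennreal (\<Sum>i\<in>{0..m}. nu_mass \<alpha> i)"
    by (simp add: nn_integral_count_space_finite nn)
  also have "{0..m} = insert m {0..m - 1}" using m0 by auto
  also have "(\<Sum>i\<in>insert m {0..m - 1}. nu_mass \<alpha> i) = nu_mass \<alpha> m + (\<Sum>i\<in>{0..m - 1}. nu_mass \<alpha> i)"
    by (rule sum.insert) auto
  also have "(\<Sum>i\<in>{0..m - 1}. nu_mass \<alpha> i) = (\<Sum>i\<in>{0..m - 1}. \<alpha>)"
    by (rule sum.cong) (auto simp: nu_mass_def m_def)
  also have "nu_mass \<alpha> m + \<dots> = 1" using m0 by (simp add: nu_mass_def m_def[symmetric])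
  finally show "(\<integral>\<^sup>+i. ennreal (nu_mass \<alpha> i) \<partial>count_space UNIV) = 1" by simp
qed


section \<open>The variance threshold\<close>

text \<open>
  \<open>variance_threshold TYPE('h) TYPE('w) TYPE('v) \<delta> V\<close>: with the value \<open>V\<close> for the threshold, the
  inequality holds for all random elements of the separable Hilbert space \<open>'h\<close> (Hilbert and
  separable: inner product space, complete, second countable) whose sample space
  has type \<open>'w\<close>, and all \<open>Y\<^sub>i\<close> whose sample space has type \<open>'v\<close>. The \<open>X\<^sub>i\<close> and the \<open>Y\<^sub>i\<close> need not be
  defined on the same probability space.
\<close>

definition variance_threshold ::
  "'h::{real_inner, polish_space} itself \<Rightarrow> 'w itself \<Rightarrow> 'v itself \<Rightarrow> real \<Rightarrow> real \<Rightarrow> bool"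
  where "variance_threshold _ _ _ \<delta> V \<longleftrightarrow>
    (\<forall>(n::nat) (\<alpha> :: nat \<Rightarrow> real) (M :: 'w measure) (X :: nat \<Rightarrow> 'w \<Rightarrow> 'h)
      (N :: 'v measure) (Y :: nat \<Rightarrow> 'v \<Rightarrow> int).
        1 \<le> n \<and>
        (\<forall>i\<in>{1..n}. 0 < \<alpha> i \<and> \<alpha> i \<le> 1) \<and>
        prob_space M \<and>
        prob_space.indep_vars M (\<lambda>_. borel) X {1..n} \<and>
        (\<forall>i\<in>{1..n}. conc M (X i) \<le> \<alpha> i) \<and>
        prob_space N \<and>
        prob_space.indep_vars N (\<lambda>_. count_space UNIV) Y {1..n} \<and>
        (\<forall>i\<in>{1..n}. distr N (count_space UNIV) (Y i) = measure_pmf (nu (\<alpha> i))) \<and>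
        prob_space.variance N (\<lambda>\<omega>. real_of_int (\<Sum>i=1..n. Y i \<omega>)) \<ge> V
      \<longrightarrow> (\<exists>a :: nat \<Rightarrow> int. (\<forall>i\<in>{1..n}. a i \<in> {-1, 1}) \<and>
            conc M (\<lambda>\<omega>. \<Sum>i=1..n. X i \<omega>) \<le>
              (1 + \<delta>) * conc N (\<lambda>\<omega>. real_of_int (\<Sum>i=1..n. a i * Y i \<omega>))))"

end

theory Submission
  imports Defs
begin

text \<open>
  All signs can be taken to be \<open>1\<close>. By the bathtub principle, applied to one summand at a time, each \<open>X\<^sub>i\<close> may be
  replaced by an injective image of \<open>\<nu>\<^sub>\<alpha>\<close>, and a linear functional that is injective on the finitely many points involved
  makes the summands real.

  For real summands whose supports are small against the standard deviation, tilt the \<open>i\<close>-th law by the exponential of the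
  rank of its value. Moving the tilt parameter moves the sum upwards through each fixed point, at a total rate close to the
  variance \<open>\<sigma>\<^sup>2\<close> of the sum of the ranks. Since the mass that crosses a point during the whole motion is at most \<open>1\<close>, this bounds
  the probability of a finite set \<open>D\<close> weighted by a Gaussian factor of the rank sum; with the central limit theorem it follows that
  the probability of \<open>D\<close> is at most about the probability that \<open>\<bar>G\<bar> \<le> card D / (2 * \<sigma>)\<close> for a standard normal \<open>G\<close>. Passing to
  ranks does not decrease the variance, so this is about the probability of the centred window of \<open>card D\<close> integers under
  \<open>\<Sum> Y\<^sub>i\<close>.

  The few summands with a large support have almost uniform laws. Adding a uniform law to both sides preserves the comparison of sets
  with centred windows, as one sees by cutting the matrix of differences of two finite sets into hooks, each of which is a chain. If the
  small summands are negligible against the largest one, the comparison starts from that single uniform law instead.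
\<close>

section \<open>Expectations and tilts of finitely supported laws\<close>

text \<open>The comparison has to hold up to a factor, also for sets far smaller than the standard
  deviation, where the additive error of a central limit theorem says nothing. On the side of the
  X_i the tilt supplies that factor. On the side of the Y_i no local limit theorem is proved: their
  sum is averaged over a uniform shift of width small against \<sigma>, which reduces short windows
  to windows of length comparable with \<sigma>. The shift is free in the end, since some translate
  has at least the average point mass. Sets of all sizes enter because a point mass of a convolution
  with a uniform law is the mass of a set under the other factor. A window with prescribed centre
  exists only for one parity of its length; hooks preserve that parity. The crossing rates are
  bounded only if no atom is too light. A light last atom is therefore absorbed in advance by
  enlarging \<alpha>: for a small summand this costs a little variance, for a large one with
  \<open>k\<close> full atoms it costs mass of order \<open>1 / k\<close>, and a large total
  variance makes the sum of these losses small.\<close>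

abbreviation EE :: "'a pmf \<Rightarrow> ('a \<Rightarrow> real) \<Rightarrow> real"
  where "EE p f \<equiv> measure_pmf.expectation p f"

lemma EE_sum: "finite (set_pmf p) \<Longrightarrow> EE p f = (\<Sum>x\<in>set_pmf p. pmf p x * f x)"
  by (subst integral_measure_pmf[of "set_pmf p"]) auto

lemma EE_mono: "finite (set_pmf p) \<Longrightarrow> (\<And>x. x \<in> set_pmf p \<Longrightarrow> f x \<le> g x) \<Longrightarrow> EE p f \<le> EE p g"
  by (simp add: EE_sum sum_mono mult_left_mono)

lemma EE_nonneg: "(\<And>x. x \<in> set_pmf p \<Longrightarrow> 0 \<le> f x) \<Longrightarrow> 0 \<le> EE p f"
  by (intro integral_nonneg_AE) (auto simp: AE_measure_pmf_iff)

lemma EE_cong: "(\<And>x. x \<in> set_pmf p \<Longrightarrow> f x = g x) \<Longrightarrow> EE p f = EE p g"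
  by (intro integral_cong_AE) (auto simp: AE_measure_pmf_iff)

lemma EE_add: "finite (set_pmf p) \<Longrightarrow> EE p (\<lambda>x. f x + g x) = EE p f + EE p g"
  by (simp add: EE_sum sum.distrib distrib_left)

lemma EE_diff: "finite (set_pmf p) \<Longrightarrow> EE p (\<lambda>x. f x - g x) = EE p f - EE p g"
  by (simp add: EE_sum sum_subtractf right_diff_distrib)

lemma EE_cmult: "EE p (\<lambda>x. c * f x) = c * EE p f"
  by simp

lemma EE_setsum:
  "finite (set_pmf p) \<Longrightarrow> EE p (\<lambda>x. \<Sum>i\<in>I. f i x) = (\<Sum>i\<in>I. EE p (f i))"
  by (simp add: EE_sum sum_distrib_left sum.swap[of _ I])

lemma EE_of_bool: "EE p (\<lambda>x. of_bool (x \<in> A)) = measure_pmf.prob p A"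
proof -
  have "(\<lambda>x. of_bool (x \<in> A) :: real) = indicator A" by (auto simp: indicator_def fun_eq_iff)
  then show ?thesis by simp
qed

lemma EE_of_bool': "EE p (\<lambda>x. of_bool (P x)) = measure_pmf.prob p {x. P x}"
  using EE_of_bool[of p "{x. P x}"] by simp

lemma EE_single: "EE p (\<lambda>x. of_bool (x = c) * f x) = pmf p c * f c"
  by (subst integral_measure_pmf[of "{c}"]) (auto split: if_splits)

lemma EE_pos:
  assumes "finite (set_pmf p)" "\<And>x. x \<in> set_pmf p \<Longrightarrow> 0 < f x"
  shows "0 < EE p f"
  unfolding EE_sum[OF assms(1)]
  by (rule sum_pos) (use assms set_pmf_not_empty in \<open>auto simp: pmf_positive\<close>)

lemma EE_swap:
  "finite (set_pmf p) \<Longrightarrow> finite (set_pmf q) \<Longrightarrow>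
    EE p (\<lambda>x. EE q (f x)) = EE q (\<lambda>y. EE p (\<lambda>x. f x y))"
  by (simp add: EE_sum sum_distrib_left sum.swap[of _ "set_pmf q"] mult.left_commute)

lemma finite_set_Pi_pmf:
  "finite I \<Longrightarrow> (\<And>i. i \<in> I \<Longrightarrow> finite (set_pmf (q i))) \<Longrightarrow> finite (set_pmf (Pi_pmf I d q))"
  by (subst set_Pi_pmf) (auto intro!: finite_PiE_dflt)

lemma EE_Pi_insert:
  assumes "finite I" "i \<notin> I" "\<And>j. j \<in> insert i I \<Longrightarrow> finite (set_pmf (q j))"
  shows "EE (Pi_pmf (insert i I) d q) f = EE (q i) (\<lambda>x. EE (Pi_pmf I d q) (\<lambda>w. f (w(i := x))))"
proof -
  have fin: "finite (set_pmf (Pi_pmf I d q))" using assms by (intro finite_set_Pi_pmf) auto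
  have "Pi_pmf (insert i I) d q = q i \<bind> (\<lambda>y. map_pmf (\<lambda>w. w(i := y)) (Pi_pmf I d q))"
    by (subst Pi_pmf_insert') (use assms in \<open>auto simp: map_pmf_def\<close>)
  then show ?thesis
    using assms fin by (simp only:) (subst pmf_expectation_bind[of "set_pmf (q i)"]; simp add: EE_sum[of "q i"])
qed

lemma EE_Pi_component:
  assumes "finite I" "i \<in> I"
  shows "EE (Pi_pmf I d q) (\<lambda>w. f (w i)) = EE (q i) f"
proof -
  have "EE (q i) f = EE (map_pmf (\<lambda>w. w i) (Pi_pmf I d q)) f"
    using assms by (simp add: Pi_pmf_component)
  then show ?thesis by simp
qed

lemma EE_Pi_sum:
  assumes "finite I" "\<And>i. i \<in> I \<Longrightarrow> finite (set_pmf (q i))"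
  shows "EE (Pi_pmf I d q) (\<lambda>w. \<Sum>i\<in>I. f i (w i)) = (\<Sum>i\<in>I. EE (q i) (f i))"
  using assms by (simp add: EE_setsum finite_set_Pi_pmf EE_Pi_component)

section \<open>Variances and products of finitely supported laws\<close>

definition Var :: "'a pmf \<Rightarrow> ('a \<Rightarrow> real) \<Rightarrow> real"
  where "Var p f = EE p (\<lambda>x. (f x - EE p f)\<^sup>2)"

lemma Var_nonneg: "0 \<le> Var p f"
  unfolding Var_def by (rule EE_nonneg) simp

lemma EE_sq_shift:
  assumes "finite (set_pmf p)"
  shows "EE p (\<lambda>x. (f x - c)\<^sup>2) = Var p f + (EE p f - c)\<^sup>2"
proof -
  have "(f x - c)\<^sup>2 = (f x - EE p f)\<^sup>2 + (2 * (EE p f - c) * (f x - EE p f) + (EE p f - c)\<^sup>2)" for x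
    by (simp add: power2_eq_square algebra_simps)
  then show ?thesis
    unfolding Var_def using assms by (simp add: EE_add EE_diff)
qed

lemma Var_eq: "finite (set_pmf p) \<Longrightarrow> Var p f = EE p (\<lambda>x. (f x)\<^sup>2) - (EE p f)\<^sup>2"
  using EE_sq_shift[of p f 0] by simp

lemma Var_le: "finite (set_pmf p) \<Longrightarrow> Var p f \<le> EE p (\<lambda>x. (f x - c)\<^sup>2)"
  by (simp add: EE_sq_shift)

lemma Var_Pi_sum:
  fixes q :: "'i \<Rightarrow> 'a pmf"
  assumes "finite I" "\<And>i. i \<in> I \<Longrightarrow> finite (set_pmf (q i))"
  shows "Var (Pi_pmf I d q) (\<lambda>w. \<Sum>i\<in>I. f i (w i)) = (\<Sum>i\<in>I. Var (q i) (f i))"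
  using assms
proof (induction I rule: finite_induct)
  case empty
  then show ?case by (simp add: Var_def)
next
  case (insert i I)
  let ?P = "Pi_pmf I d q" and ?S = "\<lambda>w. \<Sum>i\<in>I. f i (w i)"
  have fin: "finite (set_pmf ?P)" using insert by (intro finite_set_Pi_pmf) auto
  have fi: "finite (set_pmf (q i))" using insert by auto
  have S: "(\<Sum>j\<in>insert i I. f j ((w(i := x)) j)) = f i x + ?S w" for w x
    using insert by (auto intro!: sum.cong)
  have m: "EE (Pi_pmf (insert i I) d q) (\<lambda>w. \<Sum>i\<in>insert i I. f i (w i)) = EE (q i) (f i) + EE ?P ?S"
  proof -
    have "EE (Pi_pmf (insert i I) d q) (\<lambda>w. \<Sum>i\<in>insert i I. f i (w i)) = (\<Sum>i\<in>insert i I. EE (q i) (f i))"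
      using insert by (intro EE_Pi_sum) auto
    also have "\<dots> = EE (q i) (f i) + (\<Sum>i\<in>I. EE (q i) (f i))"
      using insert by (intro sum.insert) auto
    also have "(\<Sum>i\<in>I. EE (q i) (f i)) = EE ?P ?S"
      using insert by (intro EE_Pi_sum[symmetric]) auto
    finally show ?thesis .
  qed
  \<comment> \<open>With the new coordinate frozen, the inner expectation is a second moment of the
    old sum about a shifted centre, so \<open>EE_sq_shift\<close> splits off the old
    variance.\<close>
  have "Var (Pi_pmf (insert i I) d q) (\<lambda>w. \<Sum>i\<in>insert i I. f i (w i))
      = EE (q i) (\<lambda>x. EE ?P (\<lambda>w. (?S w - (EE (q i) (f i) + EE ?P ?S - f i x))\<^sup>2))"
    unfolding Var_def m using insert
    by (subst EE_Pi_insert) (simp_all add: S algebra_simps del: sum.insert fun_upd_apply)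
  also have "\<dots> = EE (q i) (\<lambda>x. Var ?P ?S + (f i x - EE (q i) (f i))\<^sup>2)"
    unfolding EE_sq_shift[OF fin] by simp
  also have "\<dots> = Var ?P ?S + Var (q i) (f i)"
    using fi by (simp add: EE_add Var_def)
  finally show ?case using insert by simp
qed

lemma chebyshev_pmf:
  assumes "finite (set_pmf p)" "0 < a"
  shows "EE p (\<lambda>x. of_bool (a \<le> \<bar>f x - EE p f\<bar>)) \<le> Var p f / a\<^sup>2"
proof -
  have "EE p (\<lambda>x. of_bool (a \<le> \<bar>f x - EE p f\<bar>)) \<le> EE p (\<lambda>x. (1 / a\<^sup>2) * (f x - EE p f)\<^sup>2)"
  proof (rule EE_mono[OF assms(1)])
    fix x
    show "of_bool (a \<le> \<bar>f x - EE p f\<bar>) \<le> (1 / a\<^sup>2) * (f x - EE p f)\<^sup>2"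
    proof (cases "a \<le> \<bar>f x - EE p f\<bar>")
      case True
      then have "a\<^sup>2 \<le> (f x - EE p f)\<^sup>2" using assms(2) by (metis abs_le_square_iff abs_of_pos)
      then show ?thesis using assms(2) True by (simp add: field_simps)
    qed simp
  qed
  then show ?thesis unfolding EE_cmult Var_def by simp
qed

text \<open>Change of measure with density proportional to \<open>w\<close>. For
  \<open>w x = exp (t * H x)\<close> this is the exponential family through \<open>p\<close> with
  parameter \<open>t\<close>.\<close>

definition tilt :: "'a pmf \<Rightarrow> ('a \<Rightarrow> real) \<Rightarrow> 'a pmf"
  where "tilt p w = embed_pmf (\<lambda>x. pmf p x * w x / EE p w)"

context
  fixes p :: "'a pmf" and w :: "'a \<Rightarrow> real"
  assumes fin: "finite (set_pmf p)" and pos: "\<And>x. 0 < w x"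
begin

lemma pmf_tilt: "pmf (tilt p w) x = pmf p x * w x / EE p w"
  unfolding tilt_def
proof (rule pmf_embed_pmf)
  have E: "0 < EE p w" using EE_pos[OF fin] pos by simp
  show nn: "0 \<le> pmf p x * w x / EE p w" for x using E pos[of x] by simp
  have "(\<integral>\<^sup>+x. ennreal (pmf p x * w x / EE p w) \<partial>count_space UNIV)
      = (\<integral>\<^sup>+x. ennreal (pmf p x * w x / EE p w) \<partial>count_space (set_pmf p))"
    by (rule nn_integral_count_space_eq) (auto simp: set_pmf_iff)
  also have "\<dots> = ennreal (\<Sum>x\<in>set_pmf p. pmf p x * w x / EE p w)"
    by (simp add: nn_integral_count_space_finite fin nn)
  also have "(\<Sum>x\<in>set_pmf p. pmf p x * w x / EE p w) = 1"
    using E by (simp add: EE_sum[OF fin] flip: sum_divide_distrib)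
  finally show "(\<integral>\<^sup>+x. ennreal (pmf p x * w x / EE p w) \<partial>count_space UNIV) = 1" by simp
qed

lemma set_tilt [simp]: "set_pmf (tilt p w) = set_pmf p"
proof -
  have E: "0 < EE p w" using EE_pos[OF fin] pos by simp
  show ?thesis using pos E by (auto simp: set_pmf_iff pmf_tilt) (metis less_irrefl)+
qed

lemma EE_tilt: "EE (tilt p w) f = EE p (\<lambda>x. f x * w x) / EE p w"
  using fin by (simp add: EE_sum pmf_tilt sum_divide_distrib mult_ac)

end

text \<open>The normalising constant of a product weight factorises under a product law, so
  independence survives the tilt. This is what allows a tilt by the sum of the ranks to be studied
  one coordinate at a time.\<close>

lemma tilt_Pi:
  assumes "finite I" "\<And>i. i \<in> I \<Longrightarrow> finite (set_pmf (q i))" "\<And>i x. 0 < w i x"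
  shows "Pi_pmf I d (\<lambda>i. tilt (q i) (w i)) = tilt (Pi_pmf I d q) (\<lambda>z. \<Prod>i\<in>I. w i (z i))"
proof (rule pmf_eqI)
  fix z
  have fin: "finite (set_pmf (Pi_pmf I d q))" using assms by (intro finite_set_Pi_pmf) auto
  have E: "EE (Pi_pmf I d q) (\<lambda>z. \<Prod>i\<in>I. w i (z i)) = (\<Prod>i\<in>I. EE (q i) (w i))"
    using assms by (intro expectation_prod_Pi_pmf) (auto intro: integrable_measure_pmf_finite less_imp_le)
  show "pmf (Pi_pmf I d (\<lambda>i. tilt (q i) (w i))) z = pmf (tilt (Pi_pmf I d q) (\<lambda>z. \<Prod>i\<in>I. w i (z i))) z"
  proof (cases "\<forall>x. x \<notin> I \<longrightarrow> z x = d")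
    case True
    then show ?thesis using assms fin
      by (simp add: pmf_tilt prod_pos E pmf_Pi prod.distrib prod_dividef del: not_all)
  next
    case False
    then have "pmf (Pi_pmf I d q') z = 0" for q' using assms(1) pmf_Pi_outside[of I z d q'] by blast
    then show ?thesis using assms fin by (simp add: pmf_tilt prod_pos)
  qed
qed

text \<open>The inequality is linear in each coordinate separately, so it tensorises from the case of one coordinate.\<close>

lemma flux_sum_inequality:
  fixes q :: "'i \<Rightarrow> real pmf"
  assumes "finite I" "\<And>i. i \<in> I \<Longrightarrow> finite (set_pmf (q i))"
    and "\<And>i c. i \<in> I \<Longrightarrow> EE (q i) (\<lambda>x. of_bool (x = c) * lam i x) \<le> EE (q i) (\<lambda>x. of_bool (c < x) * g i x)"
  shows "EE (Pi_pmf I d q) (\<lambda>w. of_bool ((\<Sum>i\<in>I. w i) = b) * (\<Sum>i\<in>I. lam i (w i)))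
    \<le> EE (Pi_pmf I d q) (\<lambda>w. of_bool (b < (\<Sum>i\<in>I. w i)) * (\<Sum>i\<in>I. g i (w i)))"
  using assms
proof (induction I arbitrary: b rule: finite_induct)
  case empty
  then show ?case by simp
next
  case (insert i I)
  let ?P = "Pi_pmf I d q" and ?S = "\<lambda>w::'i \<Rightarrow> real. \<Sum>i\<in>I. w i"
  have fin: "finite (set_pmf ?P)" using insert by (intro finite_set_Pi_pmf) auto
  have fi: "finite (set_pmf (q i))" using insert by auto
  have upd: "(\<Sum>j\<in>insert i I. F j ((w(i := x)) j)) = F i x + (\<Sum>j\<in>I. F j (w j))" for w x and F :: "'i \<Rightarrow> real \<Rightarrow> real"
    using insert by (auto intro!: sum.cong)
  have upd': "(\<Sum>j\<in>insert i I. (w(i := x)) j) = x + ?S w" for w x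
    using upd[of "\<lambda>_ y. y"] .
  have exp: "EE (Pi_pmf (insert i I) d q) F = EE (q i) (\<lambda>x. EE ?P (\<lambda>w. F (w(i := x))))" for F
    by (rule EE_Pi_insert) (use insert in auto)
  \<comment> \<open>The total intensity splits into that of the new coordinate and that of the
    others; each part is treated with the complementary coordinates frozen, which merely translates
    the threshold \<open>b\<close>.\<close>
  have e1: "of_bool (x + s = b) * (l + L) = of_bool (s = b - x) * L + of_bool (x = b - s) * l" for x s l L :: real
    by (cases "x + s = b") auto
  have e2: "of_bool (b < x + s) * (l + L) = of_bool (b - x < s) * L + of_bool (b - s < x) * l" for x s l L :: real
    by (cases "b < x + s") auto
  have "EE (Pi_pmf (insert i I) d q) (\<lambda>w. of_bool ((\<Sum>i\<in>insert i I. w i) = b) * (\<Sum>i\<in>insert i I. lam i (w i)))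
      = EE (q i) (\<lambda>x. EE ?P (\<lambda>w. of_bool (?S w = b - x) * (\<Sum>i\<in>I. lam i (w i)) + of_bool (x = b - ?S w) * lam i x))"
    by (simp only: exp upd[of lam] upd' e1)
  also have "\<dots> = EE (q i) (\<lambda>x. EE ?P (\<lambda>w. of_bool (?S w = b - x) * (\<Sum>i\<in>I. lam i (w i))))
      + EE ?P (\<lambda>w. EE (q i) (\<lambda>x. of_bool (x = b - ?S w) * lam i x))"
    by (simp only: EE_add[OF fin] EE_add[OF fi]) (rule arg_cong2[where f="(+)", OF refl EE_swap[OF fi fin]])
  also have "\<dots> \<le> EE (q i) (\<lambda>x. EE ?P (\<lambda>w. of_bool (b - x < ?S w) * (\<Sum>i\<in>I. g i (w i))))
      + EE ?P (\<lambda>w. EE (q i) (\<lambda>x. of_bool (b - ?S w < x) * g i x))"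
    by (intro add_mono EE_mono[OF fin] EE_mono[OF fi] insert.IH insert.prems) (use insert.prems in auto)
  also have "\<dots> = EE (q i) (\<lambda>x. EE ?P (\<lambda>w. of_bool (b - x < ?S w) * (\<Sum>i\<in>I. g i (w i)) + of_bool (b - ?S w < x) * g i x))"
    by (simp only: EE_add[OF fin] EE_add[OF fi]) (rule arg_cong2[where f="(+)", OF refl EE_swap[OF fin fi]])
  also have "\<dots> = EE (Pi_pmf (insert i I) d q) (\<lambda>w. of_bool (b < (\<Sum>i\<in>insert i I. w i)) * (\<Sum>i\<in>insert i I. g i (w i)))"
    by (simp only: exp upd[of g] upd' e2)
  finally show ?case .
qed

text \<open>
  \<open>flux p c\<close> is the derivative at \<open>t = 0\<close> of the mass of \<open>{c<..}\<close> under the tilt of \<open>p\<close> by \<open>exp (t * rk p x)\<close>;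
  \<open>rate p x\<close> is the intensity at which an atom \<open>x\<close> has to send mass upwards to realise that flow.
\<close>

definition rk :: "real pmf \<Rightarrow> real \<Rightarrow> real"
  where "rk p x = real (card {y\<in>set_pmf p. y < x})"

definition flux :: "real pmf \<Rightarrow> real \<Rightarrow> real"
  where "flux p c = EE p (\<lambda>x. of_bool (c < x) * (rk p x - EE p (rk p)))"

definition rate :: "real pmf \<Rightarrow> real \<Rightarrow> real"
  where "rate p x = flux p x / pmf p x"

lemma rk_nonneg: "0 \<le> rk p x"
  by (simp add: rk_def)

lemma rk_mono: "finite (set_pmf p) \<Longrightarrow> x \<le> y \<Longrightarrow> rk p x \<le> rk p y"
  unfolding rk_def by (intro of_nat_mono card_mono) auto

lemma rk_le:
  assumes "finite (set_pmf p)" "x \<in> set_pmf p"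
  shows "rk p x \<le> real (card (set_pmf p)) - 1"
proof -
  have "card {y\<in>set_pmf p. y < x} \<le> card (set_pmf p - {x})"
    using assms by (intro card_mono) auto
  also have "\<dots> = card (set_pmf p) - 1" using assms by (simp add: card_Diff_singleton)
  finally have "card {y\<in>set_pmf p. y < x} \<le> card (set_pmf p) - 1" .
  moreover have "0 < card (set_pmf p)" using assms card_gt_0_iff by blast
  ultimately have "card {y\<in>set_pmf p. y < x} + 1 \<le> card (set_pmf p)" by linarith
  then show ?thesis unfolding rk_def by linarith
qed

text \<open>The centred rank has mean zero, so its integral above \<open>c\<close> is the negative
  of its integral at or below \<open>c\<close>.\<close>

lemma flux_alt:
  assumes "finite (set_pmf p)"
  shows "flux p c = EE p (\<lambda>x. of_bool (x \<le> c) * (EE p (rk p) - rk p x))"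
proof -
  have "flux p c = EE p (\<lambda>x. (rk p x - EE p (rk p)) + of_bool (x \<le> c) * (EE p (rk p) - rk p x))"
    unfolding flux_def by (intro EE_cong) auto
  then show ?thesis using assms by (simp add: EE_add EE_diff)
qed

text \<open>On whichever side of the mean the rank of \<open>c\<close> lies, one of the two
  expressions for the flux has only nonnegative terms, because ranks are monotone.\<close>

lemma flux_nonneg:
  assumes fin: "finite (set_pmf p)"
  shows "0 \<le> flux p c"
proof (cases "EE p (rk p) \<le> rk p c")
  case True
  have "0 \<le> of_bool (c < x) * (rk p x - EE p (rk p))" for x
    using True rk_mono[OF fin, of c x] by (cases "c < x") auto
  then show ?thesis unfolding flux_def by (intro EE_nonneg)
next
  case False
  have "0 \<le> of_bool (x \<le> c) * (EE p (rk p) - rk p x)" for x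
    using False rk_mono[OF fin, of x c] by (cases "x \<le> c") auto
  then show ?thesis unfolding flux_alt[OF fin] by (intro EE_nonneg)
qed

lemma rate_nonneg: "finite (set_pmf p) \<Longrightarrow> 0 \<le> rate p c"
  by (simp add: rate_def flux_nonneg)

text \<open>At an atom this is an equality, by the choice of \<open>rate\<close>; off the support
  the left side vanishes while the flux is nonnegative. It is the one-coordinate input of
  \<open>flux_sum_inequality\<close>.\<close>

lemma rate_inequality:
  assumes fin: "finite (set_pmf p)"
  shows "EE p (\<lambda>x. of_bool (x = c) * rate p x) \<le> EE p (\<lambda>x. of_bool (c < x) * (rk p x - EE p (rk p)))"
  using flux_nonneg[OF fin, of c] unfolding EE_single flux_def[symmetric] by (simp add: rate_def)

text \<open>An atom \<open>x\<close> contributes to the flux through every atom below it, that is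
  \<open>rk p x\<close> times, so the fluxes add up to the covariance of the rank with itself. This
  is the reason for tilting by ranks rather than by values: the gaps between the atoms play no part,
  and the mean intensity is exactly a variance.\<close>

lemma EE_rate:
  assumes fin: "finite (set_pmf p)"
  shows "EE p (rate p) = Var p (rk p)"
proof -
  let ?m = "EE p (rk p)"
  have "EE p (rate p) = (\<Sum>c\<in>set_pmf p. flux p c)"
    by (simp add: EE_sum[OF fin] rate_def set_pmf_iff)
  also have "\<dots> = EE p (\<lambda>x. \<Sum>c\<in>set_pmf p. of_bool (c < x) * (rk p x - ?m))"
    unfolding flux_def by (simp only: EE_setsum[OF fin])
  also have "\<dots> = EE p (\<lambda>x. rk p x * (rk p x - ?m))"
  proof (intro EE_cong)
    fix x
    have "(\<Sum>c\<in>set_pmf p. of_bool (c < x)) = rk p x"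
      by (simp add: rk_def of_bool_def sum.If_cases fin Int_def)
    then show "(\<Sum>c\<in>set_pmf p. of_bool (c < x) * (rk p x - ?m)) = rk p x * (rk p x - ?m)"
      by (simp flip: sum_distrib_right)
  qed
  also have "\<dots> = EE p (\<lambda>x. (rk p x - ?m)\<^sup>2 + ?m * (rk p x - ?m))"
    by (intro EE_cong) (simp add: power2_eq_square algebra_simps)
  also have "\<dots> = Var p (rk p)"
    by (simp add: EE_add EE_diff fin Var_def)
  finally show ?thesis .
qed

text \<open>With more than two atoms, the flux is at most \<open>K\<close> and the mass of an atom
  at least \<open>\<rho> / K\<close>. With at most two atoms the mass cancels instead: the flux
  vanishes at the upper atom, and at the lowest one it is the mass of that atom times the mean
  rank.\<close>

lemma rate_le:
  assumes fin: "finite (set_pmf p)" and x: "x \<in> set_pmf p"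
    and K: "real (card (set_pmf p)) - 1 \<le> K" "1 \<le> K"
    and m: "card (set_pmf p) \<le> 2 \<or> \<rho> \<le> pmf p x * K" and \<rho>: "0 < \<rho>" "\<rho> \<le> 1"
  shows "rate p x \<le> K\<^sup>2 / \<rho>"
proof -
  let ?m = "EE p (rk p)"
  have r: "0 \<le> rk p y" "rk p y \<le> K" if "y \<in> set_pmf p" for y
    using rk_le[OF fin that] K by (auto simp: rk_nonneg)
  have m0: "0 \<le> ?m" using r by (intro EE_nonneg) auto
  have mK: "?m \<le> K" using EE_mono[OF fin, of "rk p" "\<lambda>_. K"] r by simp
  have px: "0 < pmf p x" using x by (simp add: pmf_positive)
  show ?thesis
  proof (cases "card (set_pmf p) \<le> 2")
    case False
    have "flux p x \<le> EE p (\<lambda>_. K)"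
      unfolding flux_def
    proof (intro EE_mono[OF fin])
      fix y assume "y \<in> set_pmf p"
      from r[OF this] show "of_bool (x < y) * (rk p y - ?m) \<le> K" using m0 K by (cases "x < y") auto
    qed
    then have "flux p x \<le> K" by simp
    then have "rate p x \<le> K / pmf p x" using px by (simp add: rate_def divide_right_mono)
    also have "\<dots> \<le> K\<^sup>2 / \<rho>"
    proof -
      have "K * \<rho> \<le> K * (pmf p x * K)" using False m K by (intro mult_left_mono) auto
      then show ?thesis using px \<rho> by (simp add: field_simps power2_eq_square)
    qed
    finally show ?thesis .
  next
    case True
    have "rate p x \<le> K"
    proof (cases "\<exists>y\<in>set_pmf p. y < x")
      case True
      then obtain y where y: "y \<in> set_pmf p" "y < x" by auto
      have "set_pmf p = {y, x}"
        using \<open>card (set_pmf p) \<le> 2\<close> y x fin by (intro card_seteq[symmetric]) auto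
      then have "flux p x = 0" unfolding flux_def using fin y
        by (simp add: EE_sum)
      then show ?thesis using K by (simp add: rate_def)
    next
      case False
      then have "{y\<in>set_pmf p. y < x} = {}" by auto
      then have "rk p x = 0" by (simp only: rk_def) simp
      have "flux p x = EE p (\<lambda>y. of_bool (y = x) * (?m - rk p y))"
        unfolding flux_alt[OF fin] using False by (intro EE_cong) (auto simp: of_bool_def not_less)
      also have "\<dots> = pmf p x * ?m" using \<open>rk p x = 0\<close> by (simp add: EE_single)
      finally show ?thesis using px mK by (simp add: rate_def)
    qed
    also have "K \<le> K\<^sup>2 / \<rho>"
    proof -
      have "K * \<rho> \<le> K * K" using K \<rho> by (intro mult_left_mono) auto
      then show ?thesis using \<rho> by (simp add: field_simps power2_eq_square)
    qed
    finally show ?thesis .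
  qed
qed

lemma rk_tilt: "finite (set_pmf p) \<Longrightarrow> (\<And>x. 0 < w x) \<Longrightarrow> rk (tilt p w) = rk p"
  by (simp add: rk_def fun_eq_iff)

text \<open>By the quotient rule, the derivative of a tilted expectation is the covariance with
  \<open>H\<close> under the tilted law.\<close>

lemma tilt_DERIV:
  assumes fin: "finite (set_pmf P)"
  shows "((\<lambda>t. EE (tilt P (\<lambda>x. exp (t * H x))) f) has_real_derivative
      EE (tilt P (\<lambda>x. exp (t * H x))) (\<lambda>x. f x * (H x - EE (tilt P (\<lambda>x. exp (t * H x))) H))) (at t)"
proof -
  let ?Z = "\<lambda>t. \<Sum>x\<in>set_pmf P. pmf P x * exp (t * H x)"
  let ?N = "\<lambda>f t. \<Sum>x\<in>set_pmf P. pmf P x * (f x * exp (t * H x))"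
  have Z: "?Z t > 0" for t
    using EE_pos[OF fin, of "\<lambda>x. exp (t * H x)"] by (simp add: EE_sum fin)
  have E: "EE (tilt P (\<lambda>x. exp (t * H x))) f = ?N f t / ?Z t" for f t
    using fin by (simp add: EE_tilt EE_sum[OF fin])
  have "((\<lambda>t. ?N f t / ?Z t) has_real_derivative
     ((?N (\<lambda>x. f x * H x) t) * ?Z t - ?N f t * ?N H t) / (?Z t * ?Z t)) (at t)"
    using Z[of t] by (auto intro!: derivative_eq_intros DERIV_divide sum.cong simp: mult_ac)
  moreover have "((?N (\<lambda>x. f x * H x) t) * ?Z t - ?N f t * ?N H t) / (?Z t * ?Z t)
     = EE (tilt P (\<lambda>x. exp (t * H x))) (\<lambda>x. f x * (H x - EE (tilt P (\<lambda>x. exp (t * H x))) H))"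
  proof -
    have "EE (tilt P (\<lambda>x. exp (t * H x))) (\<lambda>x. f x * (H x - c)) =
        EE (tilt P (\<lambda>x. exp (t * H x))) (\<lambda>x. f x * H x) - c * EE (tilt P (\<lambda>x. exp (t * H x))) f" for c
    proof -
      have ft: "finite (set_pmf (tilt P (\<lambda>x. exp (t * H x))))" using fin by simp
      show ?thesis
        unfolding EE_cmult[symmetric] EE_diff[OF ft, symmetric] by (intro EE_cong) (simp add: algebra_simps)
    qed
    from this[of "EE (tilt P (\<lambda>x. exp (t * H x))) H"] show ?thesis
      using Z[of t] unfolding E by (simp add: divide_simps) (simp add: algebra_simps)?
  qed
  ultimately show ?thesis by (simp add: E)
qed

section \<open>The normal distribution\<close>

abbreviation gauss :: "real \<Rightarrow> real" where "gauss \<equiv> std_normal_density"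

definition Gs :: "real \<Rightarrow> real"
  where "Gs y = measure std_normal_distribution {-y..y}"

lemma std_normal_prob_space: "prob_space std_normal_distribution"
  using real_dist_normal_dist by (simp add: real_distribution_def)

lemma integrable_gauss: "integrable lborel gauss"
  by (rule integrable_normal_density) simp

lemma measure_gauss:
  assumes [measurable]: "A \<in> sets borel"
  shows "measure std_normal_distribution A = (LINT x:A|lborel. gauss x)"
proof -
  have "emeasure std_normal_distribution A = (\<integral>\<^sup>+x. ennreal (indicator A x * gauss x) \<partial>lborel)"
    by (subst emeasure_density) (auto intro!: nn_integral_cong simp: indicator_def)
  also have "\<dots> = ennreal (LINT x|lborel. indicator A x * gauss x)"
  proof (intro nn_integral_eq_integral)
    have "integrable lborel (\<lambda>x. gauss x * indicator A x)"
      by (rule integrable_real_mult_indicator[OF _ integrable_gauss]) simp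
    then show "integrable lborel (\<lambda>x. indicator A x * gauss x)" by (simp only: mult.commute)
  qed simp
  finally show ?thesis
    by (simp add: measure_def set_lebesgue_integral_def enn2real_ennreal integral_nonneg_AE)
qed

lemma gauss_has_integral:
  "(gauss has_integral measure std_normal_distribution {a..b}) {a..b}"
proof -
  have "set_integrable lborel {a..b} gauss"
    unfolding set_integrable_def using integrable_mult_indicator[OF _ integrable_gauss, of "{a..b}"] by simp
  note * = set_borel_integral_eq_integral[OF this]
  have "measure std_normal_distribution {a..b} = integral {a..b} gauss"
    unfolding *(2)[symmetric] by (rule measure_gauss) simp
  then show ?thesis using integrable_integral[OF *(1)] by metis
qed

lemma Gs_has_integral: "(gauss has_integral Gs y) {-y..y}"
  unfolding Gs_def by (rule gauss_has_integral)

lemma gauss_pos [simp]: "0 < gauss x" by (simp add: std_normal_density_def)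

lemma gauss_le:
  assumes "\<bar>x\<bar> \<le> \<bar>y\<bar>"
  shows "gauss y \<le> gauss x"
proof -
  have "x\<^sup>2 \<le> y\<^sup>2" using assms by (simp add: abs_le_square_iff)
  then have "exp (- y\<^sup>2 / 2) \<le> exp (- x\<^sup>2 / 2)" by simp
  then show ?thesis unfolding std_normal_density_def by (intro mult_left_mono) auto
qed

lemma gauss_eq: "gauss x = exp (- (x\<^sup>2 / 2)) * gauss 0"
  by (simp add: std_normal_density_def)

lemma gauss_0: "gauss 0 = 1 / sqrt (2 * pi)"
  by (simp add: std_normal_density_def)

lemma gauss_0_le: "gauss 0 \<le> 1"
proof -
  have "1 \<le> sqrt (2 * pi)" using pi_gt3 by simp
  then show ?thesis unfolding gauss_0 by (simp add: divide_le_eq)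
qed

lemma gauss_minus: "gauss (- x) = gauss x" by (simp add: std_normal_density_def)

lemma Gs_half: "0 \<le> y \<Longrightarrow> ((\<lambda>x. 2 * gauss x) has_integral Gs y) {0..y}"
proof -
  assume y: "0 \<le> y"
  define h where "h = integral {0..y} gauss"
  have cont: "continuous_on S gauss" for S
    unfolding std_normal_density_def by (intro continuous_intros) auto
  have 1: "(gauss has_integral h) {0..y}"
    unfolding h_def using cont by (intro integrable_integral integrable_continuous_interval)
  have "((\<lambda>x. gauss (-x)) has_integral h) {-y..-0}"
    using 1 by (subst has_integral_reflect_real) simp
  then have 2: "(gauss has_integral h) {-y..0}" by (simp add: gauss_minus)
  have "(gauss has_integral (h + h)) {-y..y}"
    using has_integral_combine[OF _ y 2 1] y by simp
  then have "h + h = Gs y" using Gs_has_integral by (rule has_integral_unique)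
  then show ?thesis using has_integral_mult_right[OF 1, of 2] by simp
qed

lemma Gs_nonneg: "0 \<le> Gs y" by (simp add: Gs_def)
lemma Gs_mono: "x \<le> y \<Longrightarrow> Gs x \<le> Gs y"
  unfolding Gs_def using std_normal_prob_space
  by (intro finite_measure.finite_measure_mono) (auto simp: prob_space_def)

lemma Gs_upper:
  assumes y: "0 \<le> y"
  shows "Gs y \<le> 2 * y * gauss 0"
proof -
  have "Gs y \<le> (y - 0) *\<^sub>R (2 * gauss 0)"
  proof (rule has_integral_le[OF Gs_half[OF y]])
    show "((\<lambda>_. 2 * gauss 0) has_integral (y - 0) *\<^sub>R (2 * gauss 0)) {0..y}"
      using y has_integral_const_real[of "2 * gauss 0" 0 y] by (simp del: has_integral_const_real)
    show "2 * gauss x \<le> 2 * gauss 0" for x using gauss_le[of 0 x] by linarith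
  qed
  then show ?thesis by (simp add: mult_ac)
qed

lemma Gs_lower:
  assumes y: "0 \<le> y"
  shows "2 * y * gauss y \<le> Gs y"
proof -
  have "(y - 0) *\<^sub>R (2 * gauss y) \<le> Gs y"
  proof (rule has_integral_le[OF _ Gs_half[OF y]])
    show "((\<lambda>_. 2 * gauss y) has_integral (y - 0) *\<^sub>R (2 * gauss y)) {0..y}"
      using y has_integral_const_real[of "2 * gauss y" 0 y] by (simp del: has_integral_const_real)
    show "2 * gauss y \<le> 2 * gauss x" if "x \<in> {0..y}" for x using that gauss_le[of x y] by simp
  qed
  then show ?thesis by (simp add: mult_ac)
qed

lemma Gs_pos: "0 < y \<Longrightarrow> 0 < Gs y"
  using Gs_lower[of y] by (smt (verit) gauss_pos mult_pos_pos)

text \<open>The density decreases away from the centre, so stretching the interval by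
  \<open>c\<close> multiplies its mass by at most \<open>c\<close>. This absorbs a small discrepancy
  between two standard deviations.\<close>

lemma Gs_scale:
  assumes "1 \<le> c" "0 \<le> y"
  shows "Gs (c * y) \<le> c * Gs y"
proof -
  have "((\<lambda>x. 2 * gauss (c * x + 0)) has_integral ((1 / c) *\<^sub>R Gs (c * y))) ((\<lambda>x. (1 / c) *\<^sub>R x + - ((1 / c) *\<^sub>R 0)) ` cbox 0 (c * y))"
    using has_integral_affinity[of "\<lambda>x. 2 * gauss x" "Gs (c * y)" 0 "c * y" c 0] Gs_half[of "c * y"] assms by simp
  moreover have "(\<lambda>x. (1 / c) *\<^sub>R x + - ((1 / c) *\<^sub>R 0)) ` cbox 0 (c * y) = {0..y}"
    using assms image_mult_atLeastAtMost[of "1 / c" 0 "c * y"] by (simp add: field_simps image_def)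
  ultimately have "((\<lambda>x. 2 * gauss (c * x)) has_integral (Gs (c * y) / c)) {0..y}" by simp
  then have "Gs (c * y) / c \<le> Gs y"
  proof (rule has_integral_le[OF _ Gs_half[OF assms(2)]])
    fix x assume "x \<in> {0..y}"
    then have "\<bar>x\<bar> \<le> \<bar>c * x\<bar>" using assms by (simp add: abs_mult mult_le_cancel_right1)
    then show "2 * gauss (c * x) \<le> 2 * gauss x" using gauss_le by simp
  qed
  then show ?thesis using assms by (simp add: field_simps)
qed

text \<open>The density is at most 1, and the constant 2 counts the two ends of the
  interval.\<close>

lemma Gs_lipschitz:
  assumes "x \<le> y" "0 \<le> y"
  shows "Gs y \<le> Gs x + 2 * (y - x)"
proof (cases "0 \<le> x")
  case False
  have "Gs y \<le> 2 * y * gauss 0" by (rule Gs_upper[OF assms(2)])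
  also have "\<dots> \<le> 2 * y * 1" using gauss_0_le assms(2) by (intro mult_left_mono) auto
  finally show ?thesis using Gs_nonneg[of x] False by simp
next
  case True
  have s: "((\<lambda>x. 2 * gauss x) has_integral (Gs y - Gs x)) {x..y}"
  proof -
    have "(\<lambda>x. 2 * gauss x) integrable_on {x..y}"
      unfolding std_normal_density_def by (intro integrable_continuous_interval continuous_intros) auto
    then obtain r where r: "((\<lambda>x. 2 * gauss x) has_integral r) {x..y}" unfolding integrable_on_def by blast
    have "Gs x + r = Gs y"
      using has_integral_combine[OF True assms(1) Gs_half[OF True] r] Gs_half[OF assms(2)] has_integral_unique by blast
    then have "Gs y - Gs x = r" by linarith
    then show ?thesis using r by simp
  qed
  have "2 * gauss z \<le> 2" for z using gauss_le[of 0 z] gauss_0_le by simp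
  then have "Gs y - Gs x \<le> 2 * (y - x)"
    using has_integral_le[OF s has_integral_const_real[of 2 x y]] assms by (simp add: mult.commute)
  then show ?thesis by simp
qed

lemma Gs_tendsto_1: "(Gs \<longlongrightarrow> 1) at_top"
proof -
  interpret prob_space std_normal_distribution by (rule std_normal_prob_space)
  have "(\<lambda>n. prob {- real n .. real n}) \<longlonglongrightarrow> prob (\<Union>n. {- real n .. real n})"
    by (intro finite_Lim_measure_incseq) (auto simp: incseq_def)
  moreover have "(\<Union>n. {- real n .. real n}) = space std_normal_distribution"
  proof -
    have "\<exists>n. x \<in> {- real n .. real n}" for x :: real
      using real_arch_simple[of "\<bar>x\<bar>"] by (auto simp: abs_le_iff minus_le_iff)
    then show ?thesis by auto
  qed
  ultimately have "(\<lambda>n. Gs (real n)) \<longlonglongrightarrow> 1" unfolding Gs_def using prob_space by simp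
  then show ?thesis
    by (intro tendsto_at_topI_sequentially_real[OF _ ]) (auto intro: monoI Gs_mono)
qed

lemma Gs_near_1: "0 < e \<Longrightarrow> \<exists>y>0. 1 - e < Gs y"
proof -
  assume "0 < e"
  then have "eventually (\<lambda>y. 1 - e < Gs y) at_top"
    using order_tendstoD(1)[OF Gs_tendsto_1, of "1 - e"] by simp
  then have "eventually (\<lambda>y. 1 - e < Gs y \<and> 0 < y) at_top"
    using eventually_gt_at_top[of 0] by eventually_elim simp
  then show ?thesis by (auto dest: eventually_happens)
qed

text \<open>Completing the square.\<close>

lemma gauss_mgf_lower:
  assumes "0 < \<delta>" "0 < L"
  obtains T a where "0 < T" "1 < a"
    "\<And>u. (1 - \<delta>) * sqrt (2 * pi) * exp (min (u\<^sup>2) (L\<^sup>2) / 2)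
        \<le> integral {-T..T} (\<lambda>t. exp (t * u - a * t\<^sup>2 / 2))"
proof -
  obtain y where y: "0 < y" "1 - \<delta> / 2 < Gs y" using Gs_near_1[of "\<delta> / 2"] assms by auto
  \<comment> \<open>The interval of radius \<open>T\<close> contains the window of radius
    \<open>y\<close> about every \<open>u\<close> in [0, L], and this window carries nearly all the
    mass of a Gaussian centred at \<open>u\<close>.\<close>
  define T where "T = L + y"
  have T: "0 < T" using y assms by (simp add: T_def)
  \<comment> \<open>A variance factor strictly above 1 leaves room for a moment generating function
    slightly larger than the Gaussian one. It is so close to 1 that on [-T, T] it costs no more than
    the factor \<open>1 - \<delta> / 2\<close>.\<close>
  define a where "a = 1 + min 1 \<delta> / T\<^sup>2"
  have a: "1 < a" using T assms by (simp add: a_def)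
  have e: "1 - \<delta> / 2 \<le> exp (- ((a - 1) * T\<^sup>2 / 2))"
  proof -
    have "1 - \<delta> / 2 \<le> 1 + (- (min 1 \<delta> / 2))" by simp
    also have "\<dots> \<le> exp (- (min 1 \<delta> / 2))" by (rule exp_ge_add_one_self)
    also have "min 1 \<delta> / 2 = (a - 1) * T\<^sup>2 / 2" using T by (simp add: a_def)
    finally show ?thesis .
  qed
  let ?g = "\<lambda>u. integral {-T..T} (\<lambda>t. exp (t * u - a * t\<^sup>2 / 2))"
  have int: "(\<lambda>t. exp (t * u - a * t\<^sup>2 / 2)) integrable_on {x..y}" for u x y
    by (intro integrable_continuous_interval continuous_intros) auto
  have small: "(1 - \<delta>) * sqrt (2 * pi) * exp (u\<^sup>2 / 2) \<le> ?g u" if u: "0 \<le> u" "u \<le> L" for u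
  proof (cases "\<delta> < 1")
    case False
    then have "(1 - \<delta>) * sqrt (2 * pi) * exp (u\<^sup>2 / 2) \<le> 0"
      by (intro mult_nonpos_nonneg) auto
    also have "0 \<le> ?g u" by (intro integral_nonneg int) auto
    finally show ?thesis .
  next
    case True
    have "((\<lambda>t. gauss (1 * t + (- u))) has_integral ((1 / 1) *\<^sub>R Gs y)) ((\<lambda>x. (1 / 1) *\<^sub>R x + - ((1 / 1) *\<^sub>R (- u))) ` cbox (-y) y)"
      using has_integral_affinity[of gauss "Gs y" "-y" y 1 "-u"] Gs_has_integral[of y] by simp
    then have 1: "((\<lambda>t. gauss (t - u)) has_integral Gs y) {u - y..u + y}"
      by (simp add: add.commute image_add_atLeastAtMost[of u "-y" y, simplified])
    let ?c = "(1 - \<delta>/2) * exp (u\<^sup>2 / 2) * sqrt (2 * pi)"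
    have 2: "((\<lambda>t. ?c * gauss (t - u)) has_integral ?c * Gs y) {u - y..u + y}"
      by (rule has_integral_mult_right[OF 1])
    have int2: "(\<lambda>t. ?c * gauss (t - u)) integrable_on {-T..T}"
      unfolding std_normal_density_def by (intro integrable_continuous_interval continuous_intros) auto
    have "?c * Gs y \<le> integral {-T..T} (\<lambda>t. ?c * gauss (t - u))"
      using True u y by (intro has_integral_subset_le[OF _ 2 integrable_integral[OF int2]]) (auto simp: T_def)
    also have "\<dots> \<le> ?g u"
    proof (rule integral_le[OF int2 int])
      fix t assume t: "t \<in> {-T..T}"
      then have "t\<^sup>2 \<le> T\<^sup>2" using T by (intro abs_le_square_iff[THEN iffD1]) auto
      then have "(a - 1) * t\<^sup>2 / 2 \<le> (a - 1) * T\<^sup>2 / 2" using a by (simp add: mult_left_mono)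
      then have "1 - \<delta> / 2 \<le> exp (- ((a - 1) * t\<^sup>2 / 2))" using e by (smt (verit) exp_le_cancel_iff)
      then have "(1 - \<delta> / 2) * exp (t * u - t\<^sup>2 / 2) \<le> exp (- ((a - 1) * t\<^sup>2 / 2)) * exp (t * u - t\<^sup>2 / 2)"
        by (intro mult_right_mono) auto
      also have "\<dots> = exp (t * u - a * t\<^sup>2 / 2)"
        unfolding exp_add[symmetric] by (simp add: algebra_simps diff_divide_distrib)
      also have "(1 - \<delta> / 2) * exp (t * u - t\<^sup>2 / 2) = ?c * gauss (t - u)"
      proof -
        have "exp (t * u - t\<^sup>2 / 2) = exp (u\<^sup>2 / 2) * exp (- (t - u)\<^sup>2 / 2)"
          unfolding exp_add[symmetric] by (simp add: power2_eq_square algebra_simps diff_divide_distrib add_divide_distrib)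
        then show ?thesis by (simp add: std_normal_density_def real_sqrt_mult)
      qed
      finally show "?c * gauss (t - u) \<le> exp (t * u - a * t\<^sup>2 / 2)" .
    qed
    finally have *: "?c * Gs y \<le> ?g u" .
    have "1 - \<delta> \<le> (1 - \<delta>/2) * (1 - \<delta>/2)" by (simp add: algebra_simps)
    also have "\<dots> \<le> (1 - \<delta>/2) * Gs y" using True y by (intro mult_left_mono) auto
    finally have "(1 - \<delta>) * (sqrt (2 * pi) * exp (u\<^sup>2 / 2)) \<le> (1 - \<delta>/2) * Gs y * (sqrt (2 * pi) * exp (u\<^sup>2 / 2))"
      by (intro mult_right_mono) auto
    also have "\<dots> = ?c * Gs y" by (simp only: mult_ac)
    also note *
    finally show ?thesis by (simp only: mult.assoc)
  qed
  \<comment> \<open>Symmetry in \<open>t\<close> shows the integral to be even in \<open>u\<close>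
    and nondecreasing in its modulus, so the bound at \<open>L\<close> persists beyond
    \<open>L\<close>. This produces the truncation by \<open>min\<close>.\<close>
  have cosh: "?g u = integral {-T..T} (\<lambda>t. cosh (t * u) * exp (- (a * t\<^sup>2 / 2)))" for u
  proof -
    have "?g u = integral {-T..T} (\<lambda>t. exp (- t * u - a * t\<^sup>2 / 2))"
      using Henstock_Kurzweil_Integration.integral_reflect_real[of "T" "-T" "\<lambda>t. exp (t * u - a * t\<^sup>2 / 2)"] by simp
    moreover have "(\<lambda>t. exp (- t * u - a * t\<^sup>2 / 2)) integrable_on {-T..T}"
      by (intro integrable_continuous_interval continuous_intros) auto
    ultimately have "2 * ?g u = integral {-T..T} (\<lambda>t. exp (t * u - a * t\<^sup>2 / 2) + exp (- t * u - a * t\<^sup>2 / 2))"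
      by (subst integral_add) (auto intro: int)
    also have "\<dots> = integral {-T..T} (\<lambda>t. 2 * (cosh (t * u) * exp (- (a * t\<^sup>2 / 2))))"
    proof (rule integral_cong)
      fix t
      have d: "exp (x - y) = exp x * exp (- y)" for x y :: real by (simp add: exp_diff exp_minus divide_inverse)
      have "2 * (cosh (t * u) * w) = exp (t * u) * w + exp (- t * u) * w" for w :: real
        by (simp add: cosh_field_def distrib_right)
      then show "exp (t * u - a * t\<^sup>2 / 2) + exp (- t * u - a * t\<^sup>2 / 2) = 2 * (cosh (t * u) * exp (- (a * t\<^sup>2 / 2)))"
        unfolding d by simp
    qed
    finally show ?thesis by simp
  qed
  have intc: "(\<lambda>t. cosh (t * u) * exp (- (a * t\<^sup>2 / 2))) integrable_on {-T..T}" for u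
    by (intro integrable_continuous_interval continuous_intros) auto
  have mono: "?g u \<le> ?g v" if "\<bar>u\<bar> \<le> \<bar>v\<bar>" for u v
    unfolding cosh
  proof (rule integral_le[OF intc intc])
    fix t
    have "cosh \<bar>t * u\<bar> \<le> cosh \<bar>t * v\<bar>"
      using that by (subst cosh_real_nonneg_le_iff) (auto simp: abs_mult mult_left_mono)
    then show "cosh (t * u) * exp (- (a * t\<^sup>2 / 2)) \<le> cosh (t * v) * exp (- (a * t\<^sup>2 / 2))"
      by simp
  qed
  show ?thesis
  proof (rule that[OF T a])
    fix u
    have m: "min (u\<^sup>2) (L\<^sup>2) = (min \<bar>u\<bar> L)\<^sup>2"
    proof (cases "\<bar>u\<bar> \<le> L")
      case True
      then have "u\<^sup>2 \<le> L\<^sup>2" using assms by (intro abs_le_square_iff[THEN iffD1]) auto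
      then show ?thesis using True by (simp add: min_def)
    next
      case False
      then have "L\<^sup>2 \<le> u\<^sup>2" using assms by (intro abs_le_square_iff[THEN iffD1]) auto
      then show ?thesis using False by (auto simp: min_def)
    qed
    have "(1 - \<delta>) * sqrt (2 * pi) * exp ((min \<bar>u\<bar> L)\<^sup>2 / 2) \<le> ?g (min \<bar>u\<bar> L)"
      using assms by (intro small) auto
    also have "\<dots> \<le> ?g u" using assms by (intro mono) auto
    finally show "(1 - \<delta>) * sqrt (2 * pi) * exp (min (u\<^sup>2) (L\<^sup>2) / 2) \<le> ?g u" unfolding m .
  qed
qed

section \<open>Tilting by ranks\<close>

lemma exp_le_quadratic: "exp x \<le> 1 + x + x\<^sup>2 / 2 * exp \<bar>x\<bar>" for x :: real
proof -
  obtain t where t: "\<bar>t\<bar> \<le> \<bar>x\<bar>" "exp x = (\<Sum>m<2. x ^ m / fact m) + exp t / fact 2 * x ^ 2"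
    using Maclaurin_exp_le[of x 2] by blast
  have "exp t / 2 * x\<^sup>2 \<le> exp \<bar>x\<bar> / 2 * x\<^sup>2" using t(1) by (intro mult_right_mono divide_right_mono) auto
  then show ?thesis using t(2) by (simp add: numeral_2_eq_2 mult.commute)
qed

text \<open>The linear term of the expansion has mean zero. The exponent keeps the true variance, up
  to a factor \<open>exp (\<bar>t\<bar> * c)\<close> close to 1; a bound through the range
  \<open>c\<close> alone would lose the sharp Gaussian constant.\<close>

lemma mgf_le:
  assumes fin: "finite (set_pmf p)" and c: "\<And>x. x \<in> set_pmf p \<Longrightarrow> \<bar>f x - EE p f\<bar> \<le> c"
  shows "EE p (\<lambda>x. exp (t * (f x - EE p f))) \<le> exp (t\<^sup>2 / 2 * exp (\<bar>t\<bar> * c) * Var p f)"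
proof -
  let ?g = "\<lambda>x. f x - EE p f"
  have "EE p (\<lambda>x. exp (t * ?g x)) \<le> EE p (\<lambda>x. 1 + t * ?g x + (t\<^sup>2 / 2 * exp (\<bar>t\<bar> * c)) * (?g x)\<^sup>2)"
  proof (rule EE_mono[OF fin])
    fix x assume "x \<in> set_pmf p"
    then have "\<bar>t * ?g x\<bar> \<le> \<bar>t\<bar> * c" by (simp add: abs_mult mult_left_mono c)
    then have "(t * ?g x)\<^sup>2 / 2 * exp \<bar>t * ?g x\<bar> \<le> (t * ?g x)\<^sup>2 / 2 * exp (\<bar>t\<bar> * c)"
      by (intro mult_left_mono) auto
    then show "exp (t * ?g x) \<le> 1 + t * ?g x + (t\<^sup>2 / 2 * exp (\<bar>t\<bar> * c)) * (?g x)\<^sup>2"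
      using exp_le_quadratic[of "t * ?g x"] by (simp add: power_mult_distrib mult_ac)
  qed
  also have "\<dots> = 1 + (t\<^sup>2 / 2 * exp (\<bar>t\<bar> * c)) * Var p f"
    by (simp add: EE_add EE_diff fin Var_def)
  also have "\<dots> \<le> exp (t\<^sup>2 / 2 * exp (\<bar>t\<bar> * c) * Var p f)"
    by (simp add: exp_ge_add_one_self)
  finally show ?thesis .
qed

lemma mgf_Pi_le:
  assumes "finite I" and fin: "\<And>i. i \<in> I \<Longrightarrow> finite (set_pmf (q i))"
    and c: "\<And>i x. i \<in> I \<Longrightarrow> x \<in> set_pmf (q i) \<Longrightarrow> \<bar>f i x - EE (q i) (f i)\<bar> \<le> c"
  shows "EE (Pi_pmf I d q) (\<lambda>w. exp (t * (\<Sum>i\<in>I. f i (w i) - EE (q i) (f i))))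
    \<le> exp (t\<^sup>2 / 2 * exp (\<bar>t\<bar> * c) * (\<Sum>i\<in>I. Var (q i) (f i)))"
proof -
  have "EE (Pi_pmf I d q) (\<lambda>w. exp (t * (\<Sum>i\<in>I. f i (w i) - EE (q i) (f i))))
      = EE (Pi_pmf I d q) (\<lambda>w. \<Prod>i\<in>I. exp (t * (f i (w i) - EE (q i) (f i))))"
    by (simp only: sum_distrib_left exp_sum[OF assms(1)])
  also have "\<dots> = (\<Prod>i\<in>I. EE (q i) (\<lambda>x. exp (t * (f i x - EE (q i) (f i)))))"
    using assms by (intro expectation_prod_Pi_pmf) (auto intro: integrable_measure_pmf_finite)
  also have "\<dots> \<le> (\<Prod>i\<in>I. exp (t\<^sup>2 / 2 * exp (\<bar>t\<bar> * c) * Var (q i) (f i)))"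
    using fin c by (intro prod_mono conjI mgf_le EE_nonneg) auto
  also have "\<dots> = exp (t\<^sup>2 / 2 * exp (\<bar>t\<bar> * c) * (\<Sum>i\<in>I. Var (q i) (f i)))"
    by (simp only: sum_distrib_left exp_sum[OF assms(1)])
  finally show ?thesis .
qed

section \<open>Tilts by weights of bounded ratio\<close>

context
  fixes p :: "'a pmf" and w :: "'a \<Rightarrow> real" and s m :: real
  assumes fin: "finite (set_pmf p)" and pos: "\<And>x. 0 < w x"
    and m: "0 < m" "\<And>x. x \<in> set_pmf p \<Longrightarrow> m \<le> w x" "\<And>x. x \<in> set_pmf p \<Longrightarrow> w x \<le> m * exp s"
begin

lemma EE_weight_bounds: "m \<le> EE p w" "EE p w \<le> m * exp s"
  using EE_mono[OF fin, of "\<lambda>_. m" w] EE_mono[OF fin, of w "\<lambda>_. m * exp s"] m by auto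

lemma pmf_tilt_le: "pmf (tilt p w) x \<le> exp s * pmf p x"
proof (cases "x \<in> set_pmf p")
  case True
  have "pmf p x * w x / EE p w \<le> pmf p x * (m * exp s) / m"
    using EE_weight_bounds m True by (intro frac_le mult_left_mono) auto
  then show ?thesis using m by (simp add: pmf_tilt[OF fin pos] mult.commute)
qed (simp add: pmf_tilt[OF fin pos] set_pmf_iff)

lemma pmf_tilt_ge: "exp (- s) * pmf p x \<le> pmf (tilt p w) x"
proof (cases "x \<in> set_pmf p")
  case True
  have "pmf p x * m / (m * exp s) \<le> pmf p x * w x / EE p w"
    using EE_weight_bounds m True pos[of x] by (intro frac_le mult_left_mono) (auto intro: less_le_trans)
  moreover have "pmf p x * m / (m * exp s) = exp (- s) * pmf p x"
    using m by (simp add: exp_minus field_simps)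
  ultimately show ?thesis by (simp add: pmf_tilt[OF fin pos])
qed (simp add: pmf_tilt[OF fin pos] set_pmf_iff)

text \<open>The variance under \<open>p\<close> is at most the second moment about any centre, in
  particular about the tilted mean; with the centre fixed, the masses are compared atom by
  atom.\<close>

lemma Var_tilt_ge: "exp (- s) * Var p f \<le> Var (tilt p w) f"
proof -
  let ?c = "EE (tilt p w) f"
  have "exp (- s) * Var p f \<le> exp (- s) * EE p (\<lambda>x. (f x - ?c)\<^sup>2)"
    using Var_le[OF fin] by (intro mult_left_mono) auto
  also have "\<dots> = (\<Sum>x\<in>set_pmf p. (exp (- s) * pmf p x) * (f x - ?c)\<^sup>2)"
    by (simp add: EE_sum[OF fin] sum_distrib_left mult.assoc)
  also have "\<dots> \<le> (\<Sum>x\<in>set_pmf p. pmf (tilt p w) x * (f x - ?c)\<^sup>2)"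
    by (intro sum_mono mult_right_mono pmf_tilt_ge) auto
  also have "\<dots> = Var (tilt p w) f"
    using fin by (simp add: Var_def EE_sum set_tilt[OF fin pos])
  finally show ?thesis .
qed

end

lemma rk_Var_le:
  assumes "finite (set_pmf p)" "real (card (set_pmf p)) - 1 \<le> K"
  shows "Var p (rk p) \<le> K\<^sup>2"
proof -
  have "Var p (rk p) \<le> EE p (\<lambda>x. (rk p x - 0)\<^sup>2)" using assms(1) by (rule Var_le)
  also have "\<dots> \<le> EE p (\<lambda>_. K\<^sup>2)"
    using rk_le[OF assms(1)] rk_nonneg[of p] assms by (intro EE_mono power_mono) (auto intro: order_trans)
  finally show ?thesis by simp
qed

text \<open>The second factor is the probability of a large deviation below the mean of the rates of
  all variables but one; the remaining variable keeps a factor of order \<open>1 / K\<close>.\<close>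

lemma rate_mass_lower:
  fixes q :: "nat \<Rightarrow> real pmf"
  assumes I: "finite I" "j \<notin> I" and fin: "\<And>i. i \<in> insert j I \<Longrightarrow> finite (set_pmf (q i))"
    and \<delta>: "0 < \<delta>" "\<delta> < 1" and M: "0 < M" "M \<le> (\<Sum>i\<in>I. Var (q i) (rk (q i)))"
    and B: "\<And>i x. i \<in> I \<Longrightarrow> x \<in> set_pmf (q i) \<Longrightarrow> rate (q i) x \<le> B"
    and c: "\<And>x. pmf (q j) x \<le> c"
  shows "(1 - \<delta>) * M * (EE (Pi_pmf (insert j I) 0 q) (\<lambda>w. of_bool ((\<Sum>i\<in>insert j I. w i) = b)) - B / (\<delta>\<^sup>2 * M) * c)
    \<le> EE (Pi_pmf (insert j I) 0 q) (\<lambda>w. of_bool ((\<Sum>i\<in>insert j I. w i) = b) * (\<Sum>i\<in>insert j I. rate (q i) (w i)))"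
proof -
  let ?P = "Pi_pmf (insert j I) 0 q" and ?P' = "Pi_pmf I 0 q"
  let ?V = "\<Sum>i\<in>I. Var (q i) (rk (q i))"
  let ?L = "\<lambda>w. \<Sum>i\<in>I. rate (q i) (w i)"
  let ?R = "\<lambda>w :: nat \<Rightarrow> real. of_bool ((\<Sum>i\<in>insert j I. w i) = b) :: real"
  define bad where "bad w = (of_bool (?L w < (1 - \<delta>) * ?V) :: real)" for w
  have finP: "finite (set_pmf ?P)" and finP': "finite (set_pmf ?P')"
    using I fin by (auto intro!: finite_set_Pi_pmf)
  have V: "0 < ?V" using M by simp
  have EL: "EE ?P' ?L = ?V"
    using EE_Pi_sum[OF I(1), of q 0 "\<lambda>i. rate (q i)"] fin by (simp add: EE_rate)
  \<comment> \<open>A nonnegative variable bounded by \<open>B\<close> has second moment at most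
    \<open>B\<close> times its mean, and the mean of a rate is a rank variance.\<close>
  have VL: "Var ?P' ?L \<le> B * ?V"
  proof -
    have "Var ?P' ?L = (\<Sum>i\<in>I. Var (q i) (rate (q i)))"
      using I fin by (intro Var_Pi_sum) auto
    also have "\<dots> \<le> (\<Sum>i\<in>I. B * Var (q i) (rk (q i)))"
    proof (rule sum_mono)
      fix i assume i: "i \<in> I"
      have fi: "finite (set_pmf (q i))" using fin i by auto
      have "Var (q i) (rate (q i)) \<le> EE (q i) (\<lambda>x. (rate (q i) x - 0)\<^sup>2)" by (rule Var_le[OF fi])
      also have "\<dots> \<le> EE (q i) (\<lambda>x. B * rate (q i) x)"
        using B[OF i] rate_nonneg[OF fi] by (intro EE_mono[OF fi]) (simp add: power2_eq_square mult_right_mono)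
      also have "\<dots> = B * Var (q i) (rk (q i))" by (simp add: EE_rate[OF fi])
      finally show "Var (q i) (rate (q i)) \<le> B * Var (q i) (rk (q i))" .
    qed
    finally show ?thesis by (simp add: sum_distrib_left)
  qed
  have B0: "0 \<le> B"
  proof -
    have "0 \<le> B * ?V" using VL Var_nonneg[of ?P' ?L] by linarith
    then show ?thesis using V by (simp add: zero_le_mult_iff)
  qed
  have c0: "0 \<le> c" using c[of 0] pmf_nonneg[of "q j" 0] by linarith
  have Ebad: "EE ?P' bad \<le> B / (\<delta>\<^sup>2 * M)"
  proof -
    have "EE ?P' bad \<le> EE ?P' (\<lambda>w. of_bool (\<delta> * ?V \<le> \<bar>?L w - EE ?P' ?L\<bar>))"
      unfolding bad_def EL by (intro EE_mono[OF finP']) (auto simp: algebra_simps)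
    also have "\<dots> \<le> Var ?P' ?L / (\<delta> * ?V)\<^sup>2"
      using \<delta> V by (intro chebyshev_pmf[OF finP']) auto
    also have "\<dots> \<le> (B * ?V) / (\<delta> * ?V)\<^sup>2" by (intro divide_right_mono VL) auto
    also have "\<dots> = B / (\<delta>\<^sup>2 * ?V)" using V by (simp add: power2_eq_square)
    also have "\<dots> \<le> B / (\<delta>\<^sup>2 * M)" using B0 M \<delta> by (intro divide_left_mono mult_left_mono mult_pos_pos) auto
    finally show ?thesis .
  qed
  have bad_j: "bad (w(j := x)) = bad w" for w x
  proof -
    have "?L (w(j := x)) = ?L w" using I by (intro sum.cong) auto
    then show ?thesis by (simp add: bad_def)
  qed
  have R_j: "?R (w(j := x)) = of_bool (x = b - (\<Sum>i\<in>I. w i))" for w x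
  proof -
    have "(\<Sum>i\<in>I. (w(j := x)) i) = (\<Sum>i\<in>I. w i)" using I by (intro sum.cong) auto
    then have "(\<Sum>i\<in>insert j I. (w(j := x)) i) = x + (\<Sum>i\<in>I. w i)" using I by simp
    then show ?thesis by (simp add: eq_diff_eq)
  qed
  \<comment> \<open>The bad event does not involve coordinate \<open>j\<close>. Given the other
    coordinates, the event that the sum equals \<open>b\<close> pins coordinate \<open>j\<close> to
    a single value, of probability at most \<open>c\<close>.\<close>
  have "EE ?P (\<lambda>w. ?R w * bad w) = EE (q j) (\<lambda>x. EE ?P' (\<lambda>w. ?R (w(j := x)) * bad (w(j := x))))"
    using I fin by (intro EE_Pi_insert) auto
  also have "\<dots> = EE ?P' (\<lambda>w. EE (q j) (\<lambda>x. of_bool (x = b - (\<Sum>i\<in>I. w i)) * bad w))"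
    unfolding bad_j R_j using fin by (intro EE_swap finP') auto
  also have "\<dots> = EE ?P' (\<lambda>w. pmf (q j) (b - (\<Sum>i\<in>I. w i)) * bad w)"
    by (simp only: EE_single)
  also have "\<dots> \<le> EE ?P' (\<lambda>w. c * bad w)"
    by (intro EE_mono[OF finP'] mult_right_mono c) (simp add: bad_def)
  also have "\<dots> \<le> B / (\<delta>\<^sup>2 * M) * c"
    using mult_left_mono[OF Ebad c0] by (simp add: mult.commute)
  finally have *: "EE ?P (\<lambda>w. ?R w * bad w) \<le> B / (\<delta>\<^sup>2 * M) * c" .
  let ?X = "EE ?P ?R - B / (\<delta>\<^sup>2 * M) * c"
  have r0: "0 \<le> (\<Sum>i\<in>J. rate (q i) (w i))" if "J \<subseteq> insert j I" for J w
    using that fin by (intro sum_nonneg rate_nonneg) auto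
  have "(1 - \<delta>) * M * ?X \<le> EE ?P (\<lambda>w. ?R w * (\<Sum>i\<in>insert j I. rate (q i) (w i)))"
  proof (cases "0 \<le> ?X")
    case False
    then have "(1 - \<delta>) * M * ?X \<le> 0" using \<delta> M by (intro mult_nonneg_nonpos) auto
    also have "0 \<le> EE ?P (\<lambda>w. ?R w * (\<Sum>i\<in>insert j I. rate (q i) (w i)))"
      by (intro EE_nonneg mult_nonneg_nonneg r0) auto
    finally show ?thesis .
  next
    case True
    have "(1 - \<delta>) * M * ?X \<le> (1 - \<delta>) * ?V * ?X"
      using True \<delta> M by (intro mult_right_mono mult_left_mono) auto
    also have "\<dots> \<le> (1 - \<delta>) * ?V * (EE ?P ?R - EE ?P (\<lambda>w. ?R w * bad w))"
      using * \<delta> V by (intro mult_left_mono) auto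
    also have "\<dots> = EE ?P (\<lambda>w. (1 - \<delta>) * ?V * (?R w - ?R w * bad w))"
      by (simp only: EE_cmult EE_diff[OF finP])
    also have "\<dots> \<le> EE ?P (\<lambda>w. ?R w * (\<Sum>i\<in>insert j I. rate (q i) (w i)))"
    proof (rule EE_mono[OF finP])
      fix w
      have "(1 - \<delta>) * ?V * (1 - bad w) \<le> ?L w"
        using r0[of I w] by (auto simp: bad_def)
      also have "\<dots> \<le> (\<Sum>i\<in>insert j I. rate (q i) (w i))"
        using r0[of "{j}" w] I by simp
      finally have "?R w * ((1 - \<delta>) * ?V * (1 - bad w)) \<le> ?R w * (\<Sum>i\<in>insert j I. rate (q i) (w i))"
        by (intro mult_left_mono) auto
      then show "(1 - \<delta>) * ?V * (?R w - ?R w * bad w) \<le> ?R w * (\<Sum>i\<in>insert j I. rate (q i) (w i))"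
        by (simp add: algebra_simps)
    qed
    finally show ?thesis .
  qed
  then show ?thesis .
qed

text \<open>Let \<open>F t\<close> be the sum over \<open>b\<close> in \<open>D\<close> of the
  tilted probability that the sum exceeds \<open>b\<close>. It stays between 0 and
  \<open>card D\<close>, while its derivative is at least about \<sigma> times the tilted
  probability of \<open>D\<close>, so the integral of the latter over [-T, T] is at most about
  \<open>card D / \<sigma>\<close>. The normaliser of the centred tilt is at most
  \<open>exp (a * t\<^sup>2 / 2)\<close>, which turns this into the stated expectation. The bracket
  tends to \<open>1 / (1 - \<delta>)\<close> as \<epsilon> tends to 0 with the other parameters
  fixed.\<close>

lemma tilt_core:
  fixes q :: "nat \<Rightarrow> real pmf"
  assumes I: "finite I" "j \<in> I" and fin: "\<And>i. i \<in> I \<Longrightarrow> finite (set_pmf (q i))"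
    and K: "\<And>i. i \<in> I \<Longrightarrow> real (card (set_pmf (q i))) - 1 \<le> K" "1 \<le> K"
    and mass: "\<And>i x. i \<in> I \<Longrightarrow> x \<in> set_pmf (q i) \<Longrightarrow> card (set_pmf (q i)) \<le> 2 \<or> \<rho> \<le> pmf (q i) x * K"
    and \<rho>: "0 < \<rho>" "\<rho> \<le> 1" and top: "\<And>x. pmf (q j) x * K \<le> 1"
    and \<sigma>: "0 < \<sigma>" "\<sigma>\<^sup>2 = (\<Sum>i\<in>I. Var (q i) (rk (q i)))" and \<epsilon>: "K \<le> \<epsilon> * \<sigma>" "0 < \<epsilon>" "\<epsilon> < 1"
    and \<delta>: "0 < \<delta>" "\<delta> < 1" and T: "0 < T" "exp (T * \<epsilon>) \<le> a" and D: "finite D"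
  defines "U \<equiv> \<lambda>w. (\<Sum>i\<in>I. rk (q i) (w i) - EE (q i) (rk (q i))) / \<sigma>"
  shows "EE (Pi_pmf I 0 q) (\<lambda>w. of_bool ((\<Sum>i\<in>I. w i) \<in> D) * integral {-T..T} (\<lambda>t. exp (t * U w - a * t\<^sup>2 / 2)))
    \<le> real (card D) / \<sigma> * (exp (T * \<epsilon>) / ((1 - \<delta>) * (1 - \<epsilon>\<^sup>2)) + 2 * T * exp (3 * T * \<epsilon>) * \<epsilon> / (\<rho> * \<delta>\<^sup>2 * (1 - \<epsilon>\<^sup>2)))"
proof -
  define P where "P = Pi_pmf I 0 q"
  define r where "r i = rk (q i)" for i
  define m where "m i = EE (q i) (r i)" for i
  define H where "H w = (\<Sum>i\<in>I. r i (w i)) / \<sigma>" for w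
  define h where "h = (\<Sum>i\<in>I. m i) / \<sigma>"
  have UH: "U w = H w - h" for w
    by (simp add: U_def H_def h_def r_def m_def sum_subtractf diff_divide_distrib)
  have finP: "finite (set_pmf P)" unfolding P_def using I fin by (intro finite_set_Pi_pmf) auto
  define s where "s = T * \<epsilon>"
  have s0: "0 < s" using T \<epsilon> by (simp add: s_def)
  \<comment> \<open>A lower bound for the rank variance that is left after one summand is set aside,
    a share of at most \<open>\<epsilon>\<^sup>2\<close>, and after the tilt, which costs at most
    the factor \<open>exp s\<close>.\<close>
  define M where "M = exp (- s) * (1 - \<epsilon>\<^sup>2) * \<sigma>\<^sup>2"
  have e1: "\<epsilon>\<^sup>2 < 1" using \<epsilon> by (simp add: power_less_one_iff)
  have M: "0 < M" using e1 \<sigma>(1) by (simp add: M_def)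
  define W where "W t i = (\<lambda>x. exp (t * (r i x / \<sigma>)))" for t i
  define Q where "Q t i = tilt (q i) (W t i)" for t i
  \<comment> \<open>The loss per point of \<open>D\<close> from atypically small total rates. It is
    of order \<open>\<epsilon> / \<sigma>\<close>, hence negligible against the main term of order
    \<open>1 / \<sigma>\<close>.\<close>
  define bad where "bad = exp (3 * s) * \<epsilon> / (\<rho> * \<delta>\<^sup>2 * (1 - \<epsilon>\<^sup>2)) / \<sigma>"
  define Pt where "Pt t = tilt P (\<lambda>w. exp (t * H w))" for t
  have Pt: "Pt t = Pi_pmf I 0 (Q t)" for t
  proof -
    have "exp (t * H w) = (\<Prod>i\<in>I. W t i (w i))" for w
      using I by (simp add: H_def W_def sum_divide_distrib sum_distrib_left exp_sum)
    then show ?thesis unfolding Pt_def P_def Q_def using tilt_Pi[OF I(1), of q "W t" 0] fin by (simp add: W_def)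
  qed
  have finPt: "finite (set_pmf (Pt t))" for t using finP by (simp add: Pt_def)
  have setQ: "set_pmf (Q t i) = set_pmf (q i)" if "i \<in> I" for t i
    using fin[OF that] by (simp add: Q_def W_def)
  have rkQ: "rk (Q t i) = r i" if "i \<in> I" for t i
    using fin[OF that] by (simp add: Q_def W_def rk_tilt r_def)
  \<comment> \<open>Ranks are nonnegative, so the weights are at least 1 for nonnegative
    \<open>t\<close> and at most 1 otherwise; \<open>w0\<close> is the lower end of their range,
    whose ratio is at most \<open>exp s\<close> in both cases.\<close>
  define w0 where "w0 t = (if 0 \<le> t then 1 else exp (- s))" for t :: real
  have W: "w0 t \<le> W t i x" "W t i x \<le> w0 t * exp s" "0 < w0 t"
    if "i \<in> I" "x \<in> set_pmf (q i)" "\<bar>t\<bar> \<le> T" for t i x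
  proof -
    have r: "0 \<le> r i x" "r i x \<le> K" using rk_le[OF fin that(2)] K that by (auto simp: r_def rk_nonneg intro: order_trans)
    have "r i x / \<sigma> \<le> \<epsilon>" "0 \<le> r i x / \<sigma>" using r \<epsilon> \<sigma> by (auto simp: field_simps)
    then have "\<bar>t\<bar> * (r i x / \<sigma>) \<le> T * \<epsilon>" "0 \<le> \<bar>t\<bar> * (r i x / \<sigma>)"
      using that(3) T by (intro mult_mono mult_nonneg_nonneg; simp)+
    then have b: "\<bar>t\<bar> * (r i x / \<sigma>) \<le> s" "0 \<le> \<bar>t\<bar> * (r i x / \<sigma>)"
      unfolding s_def .
    show "w0 t \<le> W t i x" "W t i x \<le> w0 t * exp s" "0 < w0 t"
      using b s0 by (auto simp: w0_def W_def exp_add[symmetric] abs_if split: if_splits)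
  qed
  \<comment> \<open>The derivative of the tilted probability of exceeding \<open>b\<close> is at
    least the expected total rate on the event that the sum equals \<open>b\<close>, by
    \<open>flux_sum_inequality\<close>. On this event the total rate is close to
    \<open>\<sigma>\<^sup>2\<close> up to the loss \<open>bad\<close>, by
    \<open>rate_mass_lower\<close>.\<close>
  have key: "(1 - \<delta>) * M * (EE (Pt t) (\<lambda>w. of_bool ((\<Sum>i\<in>I. w i) = b)) - bad)
      \<le> \<sigma> * EE (Pt t) (\<lambda>w. of_bool (b < (\<Sum>i\<in>I. w i)) * (H w - EE (Pt t) H))" if t: "\<bar>t\<bar> \<le> T" for t b
  proof -
    define I' where "I' = I - {j}"
    have I': "I = insert j I'" "finite I'" "j \<notin> I'" using I by (auto simp: I'_def)
    have fQ: "finite (set_pmf (Q t i))" if "i \<in> I" for i using fin[OF that] setQ[OF that] by simp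
    have Vge: "exp (- s) * Var (q i) (r i) \<le> Var (Q t i) (r i)" if "i \<in> I" for i
      unfolding Q_def using fin[OF that] W[OF that _ t] set_pmf_not_empty[of "q i"]
      by (intro Var_tilt_ge[where m = "w0 t"]) (auto simp: W_def)
    have pge: "exp (- s) * pmf (q i) x \<le> pmf (Q t i) x" if "i \<in> I" for i x
      unfolding Q_def using fin[OF that] W[OF that _ t] set_pmf_not_empty[of "q i"]
      by (intro pmf_tilt_ge[where m = "w0 t"]) (auto simp: W_def)
    have ple: "pmf (Q t i) x \<le> exp s * pmf (q i) x" if "i \<in> I" for i x
      unfolding Q_def using fin[OF that] W[OF that _ t] set_pmf_not_empty[of "q i"]
      by (intro pmf_tilt_le[where m = "w0 t"]) (auto simp: W_def)
    let ?B = "K\<^sup>2 / (exp (- s) * \<rho>)" and ?c = "exp s / K"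
    have MV: "M \<le> (\<Sum>i\<in>I'. Var (Q t i) (rk (Q t i)))"
    proof -
      have "Var (q j) (r j) \<le> K\<^sup>2" unfolding r_def using I fin K by (intro rk_Var_le) auto
      also have "\<dots> \<le> (\<epsilon> * \<sigma>)\<^sup>2" using \<epsilon> K by (intro power_mono) auto
      finally have "(1 - \<epsilon>\<^sup>2) * \<sigma>\<^sup>2 \<le> \<sigma>\<^sup>2 - Var (q j) (r j)" by (simp add: power_mult_distrib algebra_simps)
      also have "\<dots> = (\<Sum>i\<in>I'. Var (q i) (r i))" using \<sigma>(2) I' by (simp add: r_def)
      finally have "M \<le> exp (- s) * (\<Sum>i\<in>I'. Var (q i) (r i))" unfolding M_def mult.assoc by (intro mult_left_mono) auto
      also have "\<dots> \<le> (\<Sum>i\<in>I'. Var (Q t i) (r i))"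
        unfolding sum_distrib_left by (intro sum_mono Vge) (auto simp: I')
      also have "\<dots> = (\<Sum>i\<in>I'. Var (Q t i) (rk (Q t i)))"
        by (intro sum.cong refl) (simp add: rkQ I')
      finally show ?thesis .
    qed
    have B: "rate (Q t i) x \<le> ?B" if "i \<in> I'" "x \<in> set_pmf (Q t i)" for i x
    proof (rule rate_le)
      have i: "i \<in> I" using that I' by auto
      show "finite (set_pmf (Q t i))" "x \<in> set_pmf (Q t i)" "real (card (set_pmf (Q t i))) - 1 \<le> K" "1 \<le> K"
        using fQ[OF i] that K i setQ[OF i] by auto
      have "exp (- s) * \<rho> \<le> pmf (Q t i) x * K" if "\<rho> \<le> pmf (q i) x * K"
      proof -
        have "exp (- s) * \<rho> \<le> exp (- s) * (pmf (q i) x * K)" using that by (intro mult_left_mono) auto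
        also have "\<dots> \<le> pmf (Q t i) x * K" using pge[OF i, of x] K by (simp add: mult.assoc[symmetric] mult_right_mono)
        finally show ?thesis .
      qed
      then show "card (set_pmf (Q t i)) \<le> 2 \<or> exp (- s) * \<rho> \<le> pmf (Q t i) x * K"
        using mass[OF i, of x] that setQ[OF i] by auto
      show "0 < exp (- s) * \<rho>" using \<rho> by simp
      show "exp (- s) * \<rho> \<le> 1" using \<rho> s0 by (intro mult_le_one) auto
    qed
    have c: "pmf (Q t j) x \<le> ?c" for x
    proof -
      have "pmf (Q t j) x \<le> exp s * pmf (q j) x" by (rule ple[OF I(2)])
      also have "\<dots> \<le> exp s * (1 / K)" using top[of x] K by (intro mult_left_mono) (auto simp: field_simps)
      finally show ?thesis by simp
    qed
    have badM: "?B / (\<delta>\<^sup>2 * M) * ?c \<le> bad"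
    proof -
      have "?B / (\<delta>\<^sup>2 * M) * ?c = exp (3 * s) / (\<rho> * \<delta>\<^sup>2 * (1 - \<epsilon>\<^sup>2)) / \<sigma>\<^sup>2 * K"
      proof -
        have "exp (3 * s) = exp s * exp s * exp s" by (simp add: exp_add[symmetric])
        moreover have "K\<^sup>2 / (inverse x * \<rho>) / (\<delta>\<^sup>2 * (inverse x * y * \<sigma>\<^sup>2)) * (x / K) = x * x * x / (\<rho> * \<delta>\<^sup>2 * y) / \<sigma>\<^sup>2 * K"
          if "0 < x" "0 < y" for x y
          using that K(2) \<rho>(1) \<delta>(1) \<sigma>(1) by (simp add: field_simps power2_eq_square)
        ultimately show ?thesis using e1 unfolding M_def by (simp add: exp_minus)
      qed
      also have "\<dots> \<le> exp (3 * s) / (\<rho> * \<delta>\<^sup>2 * (1 - \<epsilon>\<^sup>2)) / \<sigma>\<^sup>2 * (\<epsilon> * \<sigma>)"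
        using \<epsilon> \<rho> \<delta> e1 by (intro mult_left_mono) auto
      also have "\<dots> = bad" using \<sigma>(1) by (simp add: bad_def power2_eq_square)
      finally show ?thesis .
    qed
    have 1: "(1 - \<delta>) * M * (EE (Pt t) (\<lambda>w. of_bool ((\<Sum>i\<in>I. w i) = b)) - ?B / (\<delta>\<^sup>2 * M) * ?c)
      \<le> EE (Pt t) (\<lambda>w. of_bool ((\<Sum>i\<in>I. w i) = b) * (\<Sum>i\<in>I. rate (Q t i) (w i)))"
      unfolding Pt I'(1)
    proof (rule rate_mass_lower[OF I'(2,3) _ \<delta> M MV B c])
      show "finite (set_pmf (Q t i))" if "i \<in> insert j I'" for i using that I' fQ by auto
    qed
    have 2: "EE (Pt t) (\<lambda>w. of_bool ((\<Sum>i\<in>I. w i) = b) * (\<Sum>i\<in>I. rate (Q t i) (w i)))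
      \<le> EE (Pt t) (\<lambda>w. of_bool (b < (\<Sum>i\<in>I. w i)) * (\<Sum>i\<in>I. rk (Q t i) (w i) - EE (Q t i) (rk (Q t i))))"
      unfolding Pt using fQ by (intro flux_sum_inequality[OF I(1)] rate_inequality) auto
    have EH: "EE (Pt t) H = (\<Sum>i\<in>I. EE (Q t i) (r i)) / \<sigma>"
    proof -
      have "EE (Pt t) H = EE (Pt t) (\<lambda>w. \<Sum>i\<in>I. r i (w i)) / \<sigma>" unfolding H_def by simp
      then show ?thesis unfolding Pt by (subst (asm) EE_Pi_sum[OF I(1)]) (use fQ in auto)
    qed
    have 3: "(\<Sum>i\<in>I. rk (Q t i) (w i) - EE (Q t i) (rk (Q t i))) = \<sigma> * (H w - EE (Pt t) H)" for w
    proof -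
      have "(\<Sum>i\<in>I. rk (Q t i) (w i) - EE (Q t i) (rk (Q t i))) = (\<Sum>i\<in>I. r i (w i) - EE (Q t i) (r i))"
        by (intro sum.cong refl) (simp add: rkQ)
      then show ?thesis unfolding EH using \<sigma> by (simp add: H_def sum_subtractf right_diff_distrib)
    qed
    have "(1 - \<delta>) * M * (EE (Pt t) (\<lambda>w. of_bool ((\<Sum>i\<in>I. w i) = b)) - bad)
      \<le> (1 - \<delta>) * M * (EE (Pt t) (\<lambda>w. of_bool ((\<Sum>i\<in>I. w i) = b)) - ?B / (\<delta>\<^sup>2 * M) * ?c)"
      using \<delta> M badM by (intro mult_left_mono) auto
    also note 1 also note 2
    also have "EE (Pt t) (\<lambda>w. of_bool (b < (\<Sum>i\<in>I. w i)) * (\<Sum>i\<in>I. rk (Q t i) (w i) - EE (Q t i) (rk (Q t i))))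
      = EE (Pt t) (\<lambda>w. \<sigma> * (of_bool (b < (\<Sum>i\<in>I. w i)) * (H w - EE (Pt t) H)))"
      unfolding 3 by (simp only: mult_ac)
    also have "\<dots> = \<sigma> * EE (Pt t) (\<lambda>w. of_bool (b < (\<Sum>i\<in>I. w i)) * (H w - EE (Pt t) H))"
      by (rule EE_cmult)
    finally show ?thesis .
  qed
  define F where "F t = (\<Sum>b\<in>D. EE (Pt t) (\<lambda>w. of_bool (b < (\<Sum>i\<in>I. w i))))" for t
  define F' where "F' t = (\<Sum>b\<in>D. EE (Pt t) (\<lambda>w. of_bool (b < (\<Sum>i\<in>I. w i)) * (H w - EE (Pt t) H)))" for t
  have F: "(F has_real_derivative F' t) (at t)" for t
    unfolding F_def F'_def Pt_def by (intro DERIV_sum tilt_DERIV finP)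
  have F01: "0 \<le> F t" "F t \<le> real (card D)" for t
  proof -
    show "0 \<le> F t" unfolding F_def by (intro sum_nonneg EE_nonneg) auto
    have "F t \<le> (\<Sum>b\<in>D. 1)" unfolding F_def by (intro sum_mono) (simp add: EE_of_bool')
    then show "F t \<le> real (card D)" by simp
  qed
  have iF: "(F' has_integral (F T - F (- T))) {-T..T}"
    using T F by (intro fundamental_theorem_of_calculus) (auto simp: has_real_derivative_iff_has_vector_derivative[symmetric] intro: has_field_derivative_at_within)
  define c1 where "c1 = (1 - \<delta>) * M / \<sigma>"
  have c1: "0 < c1" using \<delta> M \<sigma> by (simp add: c1_def)
  define in_D where "in_D w = (of_bool ((\<Sum>i\<in>I. w i) \<in> D) :: real)" for w :: "nat \<Rightarrow> real"
  define g where "g t = EE P (\<lambda>w. in_D w * exp (t * U w - a * t\<^sup>2 / 2))" for t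
  define G where "G = EE P (\<lambda>w. in_D w * integral {-T..T} (\<lambda>t. exp (t * U w - a * t\<^sup>2 / 2)))"
  have inD: "in_D w = (\<Sum>b\<in>D. of_bool ((\<Sum>i\<in>I. w i) = b))" for w
    using D by (simp add: in_D_def of_bool_def sum.If_cases Int_def)
  have ig: "(g has_integral G) {-T..T}"
    unfolding g_def G_def EE_sum[OF finP]
    by (intro has_integral_sum has_integral_mult_right finP integrable_integral integrable_continuous_interval continuous_intros) auto
  \<comment> \<open>This expectation normalises the tilt by \<open>U\<close>; bounding it by a
    Gaussian replaces the normaliser by an explicit function of \<open>t\<close>.\<close>
  have mgf: "EE P (\<lambda>w. exp (t * U w)) \<le> exp (a * t\<^sup>2 / 2)" if t: "\<bar>t\<bar> \<le> T" for t
  proof -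
    have "EE P (\<lambda>w. exp (t * U w)) = EE P (\<lambda>w. exp ((t / \<sigma>) * (\<Sum>i\<in>I. r i (w i) - EE (q i) (r i))))"
      by (simp add: U_def r_def)
    also have "\<dots> \<le> exp ((t / \<sigma>)\<^sup>2 / 2 * exp (\<bar>t / \<sigma>\<bar> * K) * (\<Sum>i\<in>I. Var (q i) (r i)))"
      unfolding P_def
    proof (rule mgf_Pi_le[OF I(1) fin])
      fix i x assume i: "i \<in> I" and x: "x \<in> set_pmf (q i)"
      have r: "0 \<le> r i y \<and> r i y \<le> K" if "y \<in> set_pmf (q i)" for y
        using rk_le[OF fin[OF i] that] K(1)[OF i] by (auto simp: r_def rk_nonneg)
      have "0 \<le> EE (q i) (r i)" using r by (intro EE_nonneg) auto
      moreover have "EE (q i) (r i) \<le> EE (q i) (\<lambda>_. K)" using r fin[OF i] by (intro EE_mono) auto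
      ultimately show "\<bar>r i x - EE (q i) (r i)\<bar> \<le> K" using r[OF x] by auto
    qed
    also have "(t / \<sigma>)\<^sup>2 / 2 * exp (\<bar>t / \<sigma>\<bar> * K) * (\<Sum>i\<in>I. Var (q i) (r i)) = t\<^sup>2 / 2 * exp (\<bar>t\<bar> * (K / \<sigma>))"
    proof -
      have "(\<Sum>i\<in>I. Var (q i) (r i)) = \<sigma>\<^sup>2" using \<sigma>(2) by (simp add: r_def)
      then show ?thesis using \<sigma>(1) by (simp add: power_divide)
    qed
    also have "\<dots> \<le> t\<^sup>2 / 2 * a"
    proof (intro mult_left_mono)
      have "K / \<sigma> \<le> \<epsilon>" using \<epsilon>(1) \<sigma>(1) by (simp add: divide_le_eq)
      then have "\<bar>t\<bar> * (K / \<sigma>) \<le> T * \<epsilon>" using t \<sigma>(1) K(2) T(1) by (intro mult_mono) auto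
      then show "exp (\<bar>t\<bar> * (K / \<sigma>)) \<le> a" using T(2) by (meson exp_le_cancel_iff order_trans)
    qed auto
    finally show ?thesis by (simp add: mult.commute)
  qed
  have low: "c1 * (g t - real (card D) * bad) \<le> F' t" if t: "t \<in> {-T..T}" for t
  proof -
    have tT: "\<bar>t\<bar> \<le> T" using t by auto
    have pos: "0 < EE P (\<lambda>w. exp (t * U w))" by (intro EE_pos finP) auto
    have "g t = EE P (\<lambda>w. in_D w * exp (t * U w)) * exp (- (a * t\<^sup>2 / 2))"
    proof -
      have "in_D w * exp (t * U w - a * t\<^sup>2 / 2) = in_D w * exp (t * U w) * exp (- (a * t\<^sup>2 / 2))" for w
        by (simp add: mult_exp_exp)
      then show ?thesis unfolding g_def by (simp only: integral_mult_left_zero)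
    qed
    also have "\<dots> \<le> EE P (\<lambda>w. in_D w * exp (t * U w)) * (1 / EE P (\<lambda>w. exp (t * U w)))"
    proof (rule mult_left_mono)
      show "exp (- (a * t\<^sup>2 / 2)) \<le> 1 / EE P (\<lambda>w. exp (t * U w))"
        unfolding exp_minus inverse_eq_divide using mgf[OF tT] pos by (intro divide_left_mono) auto
      show "0 \<le> EE P (\<lambda>w. in_D w * exp (t * U w))" by (intro EE_nonneg) (simp add: in_D_def)
    qed
    also have "\<dots> = EE (tilt P (\<lambda>w. exp (t * U w))) in_D"
      by (simp add: EE_tilt[OF finP])
    \<comment> \<open>Centring changes the weight by a constant factor only, which the normalisation
      removes.\<close>
    also have "tilt P (\<lambda>w. exp (t * U w)) = Pt t"
    proof (rule pmf_eqI)
      fix w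
      have U: "exp (t * U w) = exp (- t * h) * exp (t * H w)" for w
        unfolding UH exp_add[symmetric] by (simp add: algebra_simps)
      have "pmf (tilt P (\<lambda>w. exp (t * U w))) w = pmf P w * exp (t * U w) / EE P (\<lambda>w. exp (t * U w))"
        by (rule pmf_tilt[OF finP exp_gt_zero])
      also have "\<dots> = pmf P w * exp (t * H w) / EE P (\<lambda>w. exp (t * H w))"
        unfolding U EE_cmult by simp
      also have "\<dots> = pmf (Pt t) w"
        unfolding Pt_def by (rule pmf_tilt[OF finP exp_gt_zero, symmetric])
      finally show "pmf (tilt P (\<lambda>w. exp (t * U w))) w = pmf (Pt t) w" .
    qed
    finally have "g t \<le> (\<Sum>b\<in>D. EE (Pt t) (\<lambda>w. of_bool ((\<Sum>i\<in>I. w i) = b)))"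
      unfolding inD EE_setsum[OF finPt] .
    then have "c1 * (g t - real (card D) * bad) \<le> c1 * (\<Sum>b\<in>D. EE (Pt t) (\<lambda>w. of_bool ((\<Sum>i\<in>I. w i) = b)) - bad)"
      using c1 by (intro mult_left_mono) (auto simp: sum_subtractf)
    also have "\<dots> = (\<Sum>b\<in>D. (1 / \<sigma>) * ((1 - \<delta>) * M * (EE (Pt t) (\<lambda>w. of_bool ((\<Sum>i\<in>I. w i) = b)) - bad)))"
      by (simp add: sum_distrib_left c1_def)
    also have "\<dots> \<le> (\<Sum>b\<in>D. (1 / \<sigma>) * (\<sigma> * EE (Pt t) (\<lambda>w. of_bool (b < (\<Sum>i\<in>I. w i)) * (H w - EE (Pt t) H))))"
      using \<sigma> by (intro sum_mono mult_left_mono key tT) auto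
    also have "\<dots> = F' t" using \<sigma> by (simp add: F'_def)
    finally show ?thesis .
  qed
  have "c1 * (G - (T - - T) *\<^sub>R (real (card D) * bad)) \<le> F T - F (- T)"
  proof (rule has_integral_le[OF _ iF low])
    have "((\<lambda>_. real (card D) * bad) has_integral (T - - T) *\<^sub>R (real (card D) * bad)) {-T..T}"
      using has_integral_const_real[of "real (card D) * bad" "-T" T] T(1) by simp
    then show "((\<lambda>t. c1 * (g t - real (card D) * bad)) has_integral c1 * (G - (T - - T) *\<^sub>R (real (card D) * bad))) {-T..T}"
      by (intro has_integral_mult_right has_integral_diff ig)
  qed
  also have "\<dots> \<le> real (card D)" using F01[of T] F01[of "-T"] by simp
  finally have "(G - 2 * T * (real (card D) * bad)) * c1 \<le> real (card D)" by (simp add: mult.commute)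
  then have "G - 2 * T * (real (card D) * bad) \<le> real (card D) / c1"
    using c1 by (simp only: pos_le_divide_eq)
  then have "G \<le> real (card D) / c1 + 2 * T * (real (card D) * bad)" by simp
  also have "\<dots> = real (card D) / \<sigma> * (exp (T * \<epsilon>) / ((1 - \<delta>) * (1 - \<epsilon>\<^sup>2)) + 2 * T * exp (3 * T * \<epsilon>) * \<epsilon> / (\<rho> * \<delta>\<^sup>2 * (1 - \<epsilon>\<^sup>2)))"
  proof -
    define A where "A = exp (T * \<epsilon>) / ((1 - \<delta>) * (1 - \<epsilon>\<^sup>2))"
    define B where "B = exp (3 * T * \<epsilon>) * \<epsilon> / (\<rho> * \<delta>\<^sup>2 * (1 - \<epsilon>\<^sup>2))"
    have "1 / ((1 - \<delta>) * (inverse x * y * \<sigma>\<^sup>2) / \<sigma>) = (1 / \<sigma>) * (x / ((1 - \<delta>) * y))" if "0 < x" "0 < y" for x y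
      using that \<delta>(2) \<sigma>(1) by (simp add: field_simps power2_eq_square)
    then have "1 / c1 = (1 / \<sigma>) * A"
      using e1 unfolding c1_def M_def s_def A_def by (simp add: exp_minus)
    then have "real (card D) / c1 = real (card D) * ((1 / \<sigma>) * A)"
      by (metis mult.right_neutral times_divide_eq_right)
    moreover have "bad = (1 / \<sigma>) * B"
      by (simp add: bad_def s_def B_def mult.assoc)
    moreover have "2 * T * exp (3 * T * \<epsilon>) * \<epsilon> / (\<rho> * \<delta>\<^sup>2 * (1 - \<epsilon>\<^sup>2)) = 2 * T * B"
      by (simp add: B_def)
    ultimately show ?thesis unfolding A_def[symmetric] by (simp add: algebra_simps)
  qed
  finally show ?thesis by (simp add: G_def in_D_def P_def)
qed

section \<open>A uniform central limit theorem\<close>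

lemma exp_minus_approx:
  fixes y :: real
  assumes "0 \<le> y"
  shows "\<bar>exp (- y) - (1 - y)\<bar> \<le> y\<^sup>2 / 2 * exp y"
proof -
  obtain t where t: "\<bar>t\<bar> \<le> \<bar>- y\<bar>" "exp (- y) = (\<Sum>m<2. (- y) ^ m / fact m) + exp t / fact 2 * (- y) ^ 2"
    using Maclaurin_exp_le[of "- y" 2] by blast
  have "exp t / 2 * y\<^sup>2 \<le> exp y / 2 * y\<^sup>2" using t(1) assms by (intro mult_right_mono divide_right_mono) auto
  then show ?thesis using t(2) by (simp add: numeral_2_eq_2 mult.commute)
qed

text \<open>The characteristic function is compared with its second Taylor polynomial, and this with
  the Gaussian. Both errors are kept proportional to the variance \<open>v\<close>, so that over a
  family of total variance 1 they add up to a bound that does not depend on the number of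
  summands.\<close>

lemma char_approx_bounded:
  assumes "real_distribution \<mu>" and bd: "AE x in \<mu>. \<bar>x\<bar> \<le> e" and e: "0 \<le> e"
    and mean: "integral\<^sup>L \<mu> (\<lambda>x. x) = 0" and var: "integral\<^sup>L \<mu> (\<lambda>x. x\<^sup>2) = v"
  shows "cmod (char \<mu> t - exp (- (t\<^sup>2 * v / 2))) \<le> (\<bar>t\<bar> ^ 3 * e / 6 + t ^ 4 * e\<^sup>2 / 8 * exp (t\<^sup>2 * e\<^sup>2 / 2)) * v"
proof -
  interpret real_distribution \<mu> by fact
  have i1: "integrable \<mu> (\<lambda>x. x)" using bd by (intro integrable_const_bound[of _ e]) auto
  have bd2: "AE x in \<mu>. x\<^sup>2 \<le> e\<^sup>2"
    using bd by eventually_elim (metis abs_ge_zero power2_abs power_mono)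
  have i2: "integrable \<mu> (\<lambda>x. x\<^sup>2)" using bd2 by (intro integrable_const_bound[of _ "e\<^sup>2"]) auto
  have v: "0 \<le> v" unfolding var[symmetric] by simp
  have ve: "v \<le> e\<^sup>2"
  proof -
    have "v \<le> integral\<^sup>L \<mu> (\<lambda>_. e\<^sup>2)" unfolding var[symmetric] using bd2 i2 by (intro integral_mono_AE) auto
    then show ?thesis using prob_space by simp
  qed
  have "cmod (char \<mu> t - (1 - t\<^sup>2 * v / 2)) \<le> (t\<^sup>2 / 6) * expectation (\<lambda>x. min (6 * x\<^sup>2) (\<bar>t\<bar> * \<bar>x\<bar> ^ 3))"
    by (rule char_approx3[OF i1 mean i2]) (simp add: mean var)
  also have "\<dots> \<le> (t\<^sup>2 / 6) * expectation (\<lambda>x. (\<bar>t\<bar> * e) * x\<^sup>2)"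
  proof (intro mult_left_mono integral_mono_AE)
    show "AE x in \<mu>. min (6 * x\<^sup>2) (\<bar>t\<bar> * \<bar>x\<bar> ^ 3) \<le> \<bar>t\<bar> * e * x\<^sup>2"
      using bd
    proof eventually_elim
      fix x assume x: "\<bar>x\<bar> \<le> e"
      have "\<bar>t\<bar> * \<bar>x\<bar> ^ 3 = \<bar>t\<bar> * \<bar>x\<bar> * x\<^sup>2" by (simp add: power3_eq_cube power2_eq_square abs_mult_self_eq mult.assoc)
      also have "\<dots> \<le> \<bar>t\<bar> * e * x\<^sup>2" using x by (intro mult_right_mono mult_left_mono) auto
      finally show "min (6 * x\<^sup>2) (\<bar>t\<bar> * \<bar>x\<bar> ^ 3) \<le> \<bar>t\<bar> * e * x\<^sup>2" by simp
    qed
    show "integrable \<mu> (\<lambda>x. \<bar>t\<bar> * e * x\<^sup>2)" using i2 by simp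
    show "integrable \<mu> (\<lambda>x. min (6 * x\<^sup>2) (\<bar>t\<bar> * \<bar>x\<bar> ^ 3))"
      using i2 by (intro Bochner_Integration.integrable_bound[OF integrable_mult_right[OF i2, of 6]]) auto
  qed auto
  also have "\<dots> = \<bar>t\<bar> ^ 3 * e / 6 * v"
    using var by (simp add: power3_eq_cube power2_eq_square abs_mult_self_eq)
  finally have 1: "cmod (char \<mu> t - (1 - t\<^sup>2 * v / 2)) \<le> \<bar>t\<bar> ^ 3 * e / 6 * v" .
  define y where "y = t\<^sup>2 * v / 2"
  have y0: "0 \<le> y" using v by (simp add: y_def)
  have "cmod (complex_of_real (1 - y) - complex_of_real (exp (- y))) = \<bar>exp (- y) - (1 - y)\<bar>"
    unfolding of_real_diff[symmetric] norm_of_real by simp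
  also have "\<dots> \<le> y\<^sup>2 / 2 * exp y" by (rule exp_minus_approx[OF y0])
  also have "y\<^sup>2 / 2 = t ^ 4 / 8 * v * v"
    by (simp add: y_def power2_eq_square power4_eq_xxxx)
  also have "t ^ 4 / 8 * v * v * exp y \<le> t ^ 4 / 8 * v * e\<^sup>2 * exp (t\<^sup>2 * e\<^sup>2 / 2)"
  proof (rule mult_mono)
    show "t ^ 4 / 8 * v * v \<le> t ^ 4 / 8 * v * e\<^sup>2" using v ve by (intro mult_left_mono) auto
    show "exp y \<le> exp (t\<^sup>2 * e\<^sup>2 / 2)" using ve by (simp add: y_def mult_left_mono)
    show "0 \<le> t ^ 4 / 8 * v * e\<^sup>2" using v by simp
  qed simp
  finally have 2: "cmod (complex_of_real (1 - y) - complex_of_real (exp (- y))) \<le> t ^ 4 * e\<^sup>2 / 8 * exp (t\<^sup>2 * e\<^sup>2 / 2) * v"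
    by (simp add: mult_ac)
  have "cmod (char \<mu> t - exp (- y)) \<le> cmod (char \<mu> t - (1 - y)) + cmod (complex_of_real (1 - y) - complex_of_real (exp (- y)))"
    using norm_triangle_ineq[of "char \<mu> t - (1 - y)" "complex_of_real (1 - y) - complex_of_real (exp (- y))"] by simp
  also have "\<dots> \<le> \<bar>t\<bar> ^ 3 * e / 6 * v + t ^ 4 * e\<^sup>2 / 8 * exp (t\<^sup>2 * e\<^sup>2 / 2) * v"
    using 1 2 by (intro add_mono) (auto simp: y_def)
  finally show ?thesis by (simp add: y_def distrib_right)
qed

definition std_sum :: "nat set \<Rightarrow> (nat \<Rightarrow> 'a pmf) \<Rightarrow> (nat \<Rightarrow> 'a \<Rightarrow> real) \<Rightarrow> real \<Rightarrow> (nat \<Rightarrow> 'a) \<Rightarrow> real"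
  where "std_sum I q f \<sigma> w = (\<Sum>i\<in>I. f i (w i) - EE (q i) (f i)) / \<sigma>"

text \<open>Every summand is bounded by the multiple \<open>e\<close> of the total standard
  deviation, which is stronger than Lindeberg's condition and easy to verify. With \<open>e\<close>
  as a parameter the limit theorem can be stated for single families, without sequences.\<close>

definition lindeberg :: "real \<Rightarrow> nat set \<Rightarrow> (nat \<Rightarrow> 'a pmf) \<Rightarrow> (nat \<Rightarrow> 'a \<Rightarrow> real) \<Rightarrow> real \<Rightarrow> bool"
  where "lindeberg e I q f \<sigma> \<longleftrightarrow> finite I \<and> 0 < \<sigma> \<and> \<sigma>\<^sup>2 = (\<Sum>i\<in>I. Var (q i) (f i)) \<and>
    (\<forall>i\<in>I. finite (set_pmf (q i)) \<and> (\<forall>x\<in>set_pmf (q i). \<bar>f i x - EE (q i) (f i)\<bar> \<le> e * \<sigma>))"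

text \<open>Products of numbers of modulus at most 1 differ by no more than the sum of the
  differences of their factors, so the errors of the single characteristic functions add up.\<close>

lemma char_std_sum:
  assumes L: "lindeberg e I q f \<sigma>" and e: "0 < e"
  shows "cmod (char (distr (Pi_pmf I d q) borel (std_sum I q f \<sigma>)) t - exp (- (t\<^sup>2 / 2)))
    \<le> \<bar>t\<bar> ^ 3 * e / 6 + t ^ 4 * e\<^sup>2 / 8 * exp (t\<^sup>2 * e\<^sup>2 / 2)"
proof -
  have I: "finite I" and \<sigma>: "0 < \<sigma>" "\<sigma>\<^sup>2 = (\<Sum>i\<in>I. Var (q i) (f i))"
    and fin: "\<And>i. i \<in> I \<Longrightarrow> finite (set_pmf (q i))"
    and bd: "\<And>i x. i \<in> I \<Longrightarrow> x \<in> set_pmf (q i) \<Longrightarrow> \<bar>f i x - EE (q i) (f i)\<bar> \<le> e * \<sigma>"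
    using L by (auto simp: lindeberg_def)
  let ?P = "Pi_pmf I d q"
  define g where "g i x = (f i x - EE (q i) (f i)) / \<sigma>" for i x
  define \<mu> where "\<mu> i = distr (q i) borel (g i)" for i
  define v where "v i = Var (q i) (f i) / \<sigma>\<^sup>2" for i
  have v1: "(\<Sum>i\<in>I. v i) = 1" using \<sigma>(1) unfolding v_def sum_divide_distrib[symmetric] \<sigma>(2)[symmetric] by simp
  have comp: "distr ?P borel (\<lambda>w. g i (w i)) = \<mu> i" if "i \<in> I" for i
  proof -
    have "distr ?P borel (\<lambda>w. g i (w i)) = distr (distr ?P (count_space UNIV) (\<lambda>w. w i)) borel (g i)"
      by (subst distr_distr) (auto simp: o_def)
    also have "distr ?P (count_space UNIV) (\<lambda>w. w i) = measure_pmf (map_pmf (\<lambda>w. w i) ?P)"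
      by (simp add: map_pmf_rep_eq)
    also have "map_pmf (\<lambda>w. w i) ?P = q i" using that I by (simp add: Pi_pmf_component)
    finally show ?thesis by (simp add: \<mu>_def)
  qed
  have "std_sum I q f \<sigma> = (\<lambda>w. \<Sum>i\<in>I. g i (w i))"
    by (simp add: std_sum_def g_def sum_divide_distrib fun_eq_iff)
  then have "char (distr ?P borel (std_sum I q f \<sigma>)) t = char (distr ?P borel (\<lambda>w. \<Sum>i\<in>I. g i (w i))) t" by simp
  also have "\<dots> = (\<Prod>i\<in>I. char (distr ?P borel (\<lambda>w. g i (w i))) t)"
  proof (rule prob_space.char_distr_sum[OF measure_pmf.prob_space_axioms])
    show "prob_space.indep_vars ?P (\<lambda>i. borel) (\<lambda>i w. g i (w i)) I"
      using indep_vars_Pi_pmf[OF I, of d q]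
      by (rule prob_space.indep_vars_compose2[OF measure_pmf.prob_space_axioms]) auto
  qed
  also have "\<dots> = (\<Prod>i\<in>I. char (\<mu> i) t)" by (intro prod.cong refl) (simp add: comp)
  finally have c: "char (distr ?P borel (std_sum I q f \<sigma>)) t = (\<Prod>i\<in>I. char (\<mu> i) t)" .
  have rd: "real_distribution (\<mu> i)" for i
    unfolding \<mu>_def by (rule prob_space.real_distribution_distr[OF measure_pmf.prob_space_axioms]) simp
  have "exp (- (t\<^sup>2 / 2)) = exp (\<Sum>i\<in>I. - (t\<^sup>2 * v i / 2))"
    using v1 by (simp add: sum_negf flip: sum_divide_distrib sum_distrib_left)
  also have "\<dots> = (\<Prod>i\<in>I. exp (- (t\<^sup>2 * v i / 2)))" by (rule exp_sum[OF I])
  finally have n: "complex_of_real (exp (- (t\<^sup>2 / 2))) = (\<Prod>i\<in>I. complex_of_real (exp (- (t\<^sup>2 * v i / 2))))"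
    by simp
  have "cmod (char (distr ?P borel (std_sum I q f \<sigma>)) t - exp (- (t\<^sup>2 / 2)))
      \<le> (\<Sum>i\<in>I. cmod (char (\<mu> i) t - exp (- (t\<^sup>2 * v i / 2))))"
    unfolding c n
  proof (rule norm_prod_diff)
    fix i assume "i \<in> I"
    show "cmod (char (\<mu> i) t) \<le> 1" by (rule real_distribution.cmod_char_le_1[OF rd])
    have "0 \<le> t\<^sup>2 * v i / 2" using Var_nonneg[of "q i" "f i"] by (simp add: v_def)
    then show "cmod (complex_of_real (exp (- (t\<^sup>2 * v i / 2)))) \<le> 1" by (simp del: of_real_exp)
  qed
  also have "\<dots> \<le> (\<Sum>i\<in>I. (\<bar>t\<bar> ^ 3 * e / 6 + t ^ 4 * e\<^sup>2 / 8 * exp (t\<^sup>2 * e\<^sup>2 / 2)) * v i)"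
  proof (intro sum_mono char_approx_bounded rd)
    fix i assume i: "i \<in> I"
    have "\<bar>g i x\<bar> \<le> e" if "x \<in> set_pmf (q i)" for x
      using bd[OF i that] \<sigma>(1) by (simp add: g_def field_simps)
    then show "AE x in \<mu> i. \<bar>x\<bar> \<le> e"
      unfolding \<mu>_def by (subst AE_distr_iff) (auto simp: AE_measure_pmf_iff)
    have g: "g i = (\<lambda>x. (f i x - EE (q i) (f i)) / \<sigma>)" by (simp add: g_def fun_eq_iff)
    show "integral\<^sup>L (\<mu> i) (\<lambda>x. x) = 0"
      unfolding \<mu>_def using fin[OF i] by (subst integral_distr) (auto simp: g EE_diff)
    show "(LINT x|\<mu> i. x\<^sup>2) = v i"
      unfolding \<mu>_def using fin[OF i] by (subst integral_distr) (auto simp: g v_def Var_def power_divide)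
  qed (use e in auto)
  also have "\<dots> = \<bar>t\<bar> ^ 3 * e / 6 + t ^ 4 * e\<^sup>2 / 8 * exp (t\<^sup>2 * e\<^sup>2 / 2)"
    unfolding sum_distrib_left[symmetric] v1 by simp
  finally show ?thesis .
qed

lemma isCont_cdf_normal: "isCont (cdf std_normal_distribution) x"
proof -
  interpret real_distribution std_normal_distribution by (rule real_dist_normal_dist)
  have "measure std_normal_distribution {x} = 0"
    using gauss_has_integral[of x x] by (auto simp: has_integral_refl(2) dest: has_integral_unique)
  then show ?thesis by (simp add: isCont_cdf)
qed

text \<open>If no \<open>e\<close> served, violating families with \<open>e = 1 / (n + 1)\<close>
  would form a sequence whose characteristic functions converge to the Gaussian one, against Levy's
  continuity theorem. This gives uniformity over all families without any rate of
  convergence.\<close>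

lemma clt_pointwise:
  assumes "0 < \<delta>"
  shows "\<exists>e>0. \<forall>I (q :: nat \<Rightarrow> 'a pmf) f \<sigma>. lindeberg e I q f \<sigma> \<longrightarrow>
    \<bar>measure_pmf.prob (Pi_pmf I d q) {w. std_sum I q f \<sigma> w \<le> x} - cdf std_normal_distribution x\<bar> < \<delta>"
proof (rule ccontr)
  assume neg: "\<not> ?thesis"
  let ?bad = "\<lambda>(I, q :: nat \<Rightarrow> 'a pmf, f, \<sigma>).
    \<delta> \<le> \<bar>measure_pmf.prob (Pi_pmf I d q) {w. std_sum I q f \<sigma> w \<le> x} - cdf std_normal_distribution x\<bar>"
  have "\<forall>n. \<exists>z. (case z of (I, q, f, \<sigma>) \<Rightarrow> lindeberg (1 / (real n + 1)) I q f \<sigma>) \<and> ?bad z"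
  proof
    fix n
    have pos: "0 < 1 / (real n + 1)" by simp
    have "\<not> (\<forall>I (q :: nat \<Rightarrow> 'a pmf) f \<sigma>. lindeberg (1 / (real n + 1)) I q f \<sigma> \<longrightarrow>
        \<bar>measure_pmf.prob (Pi_pmf I d q) {w. std_sum I q f \<sigma> w \<le> x} - cdf std_normal_distribution x\<bar> < \<delta>)" (is "\<not> ?Q")
    proof
      assume ?Q
      with pos have "\<exists>e>0. \<forall>I (q :: nat \<Rightarrow> 'a pmf) f \<sigma>. lindeberg e I q f \<sigma> \<longrightarrow>
        \<bar>measure_pmf.prob (Pi_pmf I d q) {w. std_sum I q f \<sigma> w \<le> x} - cdf std_normal_distribution x\<bar> < \<delta>" by (intro exI[of _ "1 / (real n + 1)"] conjI)
      with neg show False by (rule notE)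
    qed
    then obtain I and q :: "nat \<Rightarrow> 'a pmf" and f \<sigma> where "lindeberg (1 / (real n + 1)) I q f \<sigma>" "?bad (I, q, f, \<sigma>)"
      by (auto simp: not_less)
    then show "\<exists>z. (case z of (I, q, f, \<sigma>) \<Rightarrow> lindeberg (1 / (real n + 1)) I q f \<sigma>) \<and> ?bad z"
      by (intro exI[of _ "(I, q, f, \<sigma>)"]) simp
  qed
  from choice[OF this] obtain z where
    z: "\<forall>n. (case z n of (I, q, f, \<sigma>) \<Rightarrow> lindeberg (1 / (real n + 1)) I q f \<sigma>) \<and> ?bad (z n)"
    by (rule exE)
  define I where "I n = fst (z n)" for n
  define q where "q n = fst (snd (z n))" for n
  define f where "f n = fst (snd (snd (z n)))" for n
  define \<sigma> where "\<sigma> n = snd (snd (snd (z n)))" for n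
  have zn: "z n = (I n, q n, f n, \<sigma> n)" for n by (simp add: I_def q_def f_def \<sigma>_def)
  have L: "lindeberg (1 / (real n + 1)) (I n) (q n) (f n) (\<sigma> n)"
    and far: "\<delta> \<le> \<bar>measure_pmf.prob (Pi_pmf (I n) d (q n)) {w. std_sum (I n) (q n) (f n) (\<sigma> n) w \<le> x} - cdf std_normal_distribution x\<bar>" for n
    using spec[OF z, of n] unfolding zn prod.case by (rule conjunct1, rule conjunct2)
  define M where "M n = distr (Pi_pmf (I n) d (q n)) borel (std_sum (I n) (q n) (f n) (\<sigma> n))" for n
  have "weak_conv_m M std_normal_distribution"
  proof (rule levy_continuity)
    show "real_distribution (M n)" for n
      unfolding M_def by (rule prob_space.real_distribution_distr[OF measure_pmf.prob_space_axioms]) simp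
    show "real_distribution std_normal_distribution" by (rule real_dist_normal_dist)
    fix t :: real
    have e: "(\<lambda>n. 1 / (real n + 1)) \<longlonglongrightarrow> 0" using LIMSEQ_inverse_real_of_nat by (simp add: inverse_eq_divide add.commute)
    let ?h = "\<lambda>e. \<bar>t\<bar> ^ 3 * e / 6 + t ^ 4 * e\<^sup>2 / 8 * exp (t\<^sup>2 * e\<^sup>2 / 2)"
    have "isCont ?h 0" by (intro continuous_intros) auto
    from isCont_tendsto_compose[OF this e] have h: "(\<lambda>n. ?h (1 / (real n + 1))) \<longlonglongrightarrow> 0" by simp
    have "(\<lambda>n. char (M n) t - exp (- (t\<^sup>2 / 2))) \<longlonglongrightarrow> 0"
    proof (rule Lim_null_comparison[OF always_eventually h])
      have "cmod (char (M n) t - exp (- (t\<^sup>2 / 2))) \<le> ?h (1 / (real n + 1))" for n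
        unfolding M_def by (rule char_std_sum[OF L]) simp
      then show "\<forall>n. norm (char (M n) t - exp (- (t\<^sup>2 / 2))) \<le> ?h (1 / (real n + 1))" by blast
    qed
    then have "(\<lambda>n. char (M n) t) \<longlonglongrightarrow> exp (- (t\<^sup>2 / 2))" by (rule LIM_zero_cancel)
    then show "(\<lambda>n. char (M n) t) \<longlonglongrightarrow> char std_normal_distribution t"
      by (simp add: char_std_normal_distribution)
  qed
  then have "(\<lambda>n. cdf (M n) x) \<longlonglongrightarrow> cdf std_normal_distribution x"
    using isCont_cdf_normal by (simp add: weak_conv_m_def weak_conv_def)
  then have "\<forall>\<^sub>F n in sequentially. \<bar>cdf (M n) x - cdf std_normal_distribution x\<bar> < \<delta>"
    using assms by (auto simp: tendsto_iff dist_real_def)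
  then obtain n where "\<bar>cdf (M n) x - cdf std_normal_distribution x\<bar> < \<delta>"
    using eventually_happens by force
  moreover have "cdf (M n) x = measure_pmf.prob (Pi_pmf (I n) d (q n)) {w. std_sum (I n) (q n) (f n) (\<sigma> n) w \<le> x}"
    by (simp add: cdf_def M_def measure_distr vimage_def)
  ultimately show False using far[of n] by simp
qed

lemma lindeberg_mono:
  assumes "lindeberg e I q f \<sigma>" "e \<le> e'"
  shows "lindeberg e' I q f \<sigma>"
proof -
  have "e * \<sigma> \<le> e' * \<sigma>" using assms by (intro mult_right_mono) (auto simp: lindeberg_def)
  then show ?thesis using assms(1) unfolding lindeberg_def by (meson order_trans)
qed

text \<open>Polya's theorem: distribution functions that are close at the quantiles of a fine grid
  are close everywhere, because they are monotone and the limit is continuous.\<close>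

lemma clt_uniform:
  assumes \<delta>: "0 < \<delta>"
  shows "\<exists>e>0. \<forall>I (q :: nat \<Rightarrow> 'a pmf) f \<sigma> x. lindeberg e I q f \<sigma> \<longrightarrow>
    \<bar>measure_pmf.prob (Pi_pmf I d q) {w. std_sum I q f \<sigma> w \<le> x} - cdf std_normal_distribution x\<bar> < \<delta>"
proof -
  interpret N: real_distribution std_normal_distribution by (rule real_dist_normal_dist)
  let ?F = "cdf std_normal_distribution"
  \<comment> \<open>The grid spacing and the error at the grid points share \<delta> equally. The
    case distinctions below are for points to the left or right of all quantiles, where 0 and 1
    replace the missing neighbour.\<close>
  obtain m :: nat where m: "1 / real (Suc m) < \<delta> / 2"
    using nat_approx_posE[of "\<delta> / 2"] \<delta> by auto
  have "\<forall>k\<in>{1..m}. \<exists>x. ?F x = real k / real (Suc m)"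
  proof
    fix k assume k: "k \<in> {1..m}"
    let ?y = "real k / real (Suc m)"
    have y: "0 < ?y" "?y < 1" using k by auto
    obtain a where a: "?F a < ?y"
      using eventually_happens[OF order_tendstoD(2)[OF N.cdf_lim_at_bot y(1)]] by auto
    obtain b where b: "?y < ?F b"
      using eventually_happens[OF order_tendstoD(1)[OF N.cdf_lim_at_top_prob y(2)]] by auto
    have "a \<le> b" using a b N.cdf_nondecreasing[of b a] by force
    then have "\<exists>x\<ge>a. x \<le> b \<and> ?F x = ?y"
      using a b isCont_cdf_normal by (intro IVT) auto
    then show "\<exists>x. ?F x = ?y" by auto
  qed
  then obtain X where X: "\<And>k. k \<in> {1..m} \<Longrightarrow> ?F (X k) = real k / real (Suc m)" by metis
  have "\<forall>k. \<exists>e>0. \<forall>I (q :: nat \<Rightarrow> 'a pmf) f \<sigma>. lindeberg e I q f \<sigma> \<longrightarrow>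
    \<bar>measure_pmf.prob (Pi_pmf I d q) {w. std_sum I q f \<sigma> w \<le> X k} - ?F (X k)\<bar> < \<delta> / 2"
    using clt_pointwise[of "\<delta> / 2"] \<delta> by auto
  from choice[OF this] obtain E where E0: "\<forall>k. 0 < E k \<and> (\<forall>I (q :: nat \<Rightarrow> 'a pmf) f \<sigma>. lindeberg (E k) I q f \<sigma> \<longrightarrow>
    \<bar>measure_pmf.prob (Pi_pmf I d q) {w. std_sum I q f \<sigma> w \<le> X k} - ?F (X k)\<bar> < \<delta> / 2)" by (rule exE)
  have E: "0 < E k" "lindeberg (E k) I q f \<sigma> \<Longrightarrow>
    \<bar>measure_pmf.prob (Pi_pmf I d q) {w. std_sum I q f \<sigma> w \<le> X k} - ?F (X k)\<bar> < \<delta> / 2" for k I f \<sigma> and q :: "nat \<Rightarrow> 'a pmf"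
    using E0 by blast+
  define e where "e = Min (insert 1 (E ` {1..m}))"
  have e1: "0 < e" unfolding e_def using E(1) by (subst Min_gr_iff) auto
  have e2: "e \<le> E k" if "k \<in> {1..m}" for k unfolding e_def using that by (intro Min_le) auto
  show ?thesis
  proof (intro exI[of _ e] conjI e1 allI impI)
    fix I and q :: "nat \<Rightarrow> 'a pmf" and f \<sigma> x assume L: "lindeberg e I q f \<sigma>"
    let ?G = "\<lambda>x. measure_pmf.prob (Pi_pmf I d q) {w. std_sum I q f \<sigma> w \<le> x}"
    have G: "\<bar>?G (X k) - real k / real (Suc m)\<bar> < \<delta> / 2" if "k \<in> {1..m}" for k
      using E(2)[OF lindeberg_mono[OF L e2[OF that]]] X[OF that] by simp
    have monoG: "?G a \<le> ?G b" if "a \<le> b" for a b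
      using that by (intro measure_pmf.finite_measure_mono) auto
    define k where "k = nat \<lfloor>?F x * real (Suc m)\<rfloor>"
    have k: "real k \<le> ?F x * real (Suc m)" "?F x * real (Suc m) < real k + 1"
      using N.cdf_nonneg[of x] by (auto simp: k_def)
    have km: "k \<le> Suc m"
    proof -
      have "?F x * real (Suc m) \<le> 1 * real (Suc m)" by (intro mult_right_mono N.cdf_bounded_prob) auto
      from order_trans[OF k(1) this] have "real k \<le> real (Suc m)" by (simp only: mult_1)
      then show ?thesis by (simp only: of_nat_le_iff)
    qed
    have kF: "real k / real (Suc m) \<le> ?F x" "?F x < (real k + 1) / real (Suc m)"
      using k by (auto simp: field_simps)
    have step: "(real k + 1) / real (Suc m) = real k / real (Suc m) + 1 / real (Suc m)" by (simp add: add_divide_distrib)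
    have up: "?G x < ?F x + \<delta>"
    proof (cases "k + 1 \<in> {1..m}")
      case True
      have k1: "real (k + 1) = real k + 1" by simp
      have "?F x < ?F (X (k + 1))" using kF(2) unfolding X[OF True] k1 .
      then have "x \<le> X (k + 1)" using N.cdf_nondecreasing[of "X (k + 1)" x] by force
      then have "?G x \<le> ?G (X (k + 1))" by (rule monoG)
      also have "\<dots> < (real k + 1) / real (Suc m) + \<delta> / 2" using G[OF True] unfolding k1 by linarith
      finally show ?thesis using kF(1) step m by linarith
    next
      case False
      then have "m \<le> k" by simp
      then have "real m / real (Suc m) \<le> real k / real (Suc m)" by (intro divide_right_mono) auto
      moreover have "real m / real (Suc m) = 1 - 1 / real (Suc m)" by (simp add: field_simps)
      moreover have "?G x \<le> 1" by simp
      ultimately show ?thesis using kF(1) m \<delta> by linarith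
    qed
    have dn: "?F x - \<delta> < ?G x"
    proof (cases "k \<in> {1..m}")
      case True
      show ?thesis
      proof (cases "X k \<le> x")
        case True
        then have "?G (X k) \<le> ?G x" by (rule monoG)
        then show ?thesis using G[OF \<open>k \<in> {1..m}\<close>] kF(2) step m by linarith
      next
        case False
        then have "?F x \<le> ?F (X k)" by (intro N.cdf_nondecreasing) simp
        then have eq: "?F x = real k / real (Suc m)" using kF(1) X[OF True] by simp
        show ?thesis
        proof (cases "k - 1 \<in> {1..m}")
          case k1: True
          have r: "real (k - 1) = real k - 1" using True by (simp add: of_nat_diff)
          have "?F (X (k - 1)) < ?F x" unfolding X[OF k1] eq r by (intro divide_strict_right_mono) auto
          then have "X (k - 1) \<le> x" using N.cdf_nondecreasing[of x "X (k - 1)"] by force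
          then have "?G (X (k - 1)) \<le> ?G x" by (rule monoG)
          moreover have "real (k - 1) / real (Suc m) - \<delta> / 2 < ?G (X (k - 1))" using G[OF k1] by linarith
          moreover have "real (k - 1) / real (Suc m) = ?F x - 1 / real (Suc m)" unfolding eq r by (simp add: diff_divide_distrib)
          ultimately show ?thesis using m by linarith
        next
          case k1: False
          then have "k = 1" using True by auto
          then have "?F x < \<delta> / 2" using eq m by simp
          moreover have "0 \<le> ?G x" by simp
          ultimately show ?thesis using \<delta> by linarith
        qed
      qed
    next
      case False
      then consider "k = 0" | "k = Suc m" using km by force
      then show ?thesis
      proof cases
        case 1
        then have "?F x < \<delta> / 2" using kF(2) m by simp
        moreover have "0 \<le> ?G x" by simp
        ultimately show ?thesis using \<delta> by linarith
      next
        case 2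
        show ?thesis
        proof (cases "1 \<le> m")
          case True
          have mm: "m \<in> {1..m}" using True by simp
          have "real m / real (Suc m) < real (Suc m) / real (Suc m)" by (intro divide_strict_right_mono) auto
          also have "\<dots> \<le> ?F x" using kF(1) unfolding 2 .
          finally have "?F (X m) < ?F x" unfolding X[OF mm] .
          then have "X m \<le> x" using N.cdf_nondecreasing[of x "X m"] by force
          then have "?G (X m) \<le> ?G x" by (rule monoG)
          moreover have "real m / real (Suc m) - \<delta> / 2 < ?G (X m)" using G[OF mm] by linarith
          moreover have "real m / real (Suc m) = 1 - 1 / real (Suc m)" by (simp add: field_simps)
          moreover have "?F x \<le> 1" by (rule N.cdf_bounded_prob)
          ultimately show ?thesis using m by linarith
        next
          case False
          then have "m = 0" by simp
          then have "2 < \<delta>" using m by simp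
          moreover have "0 \<le> ?G x" "?F x \<le> 1" using N.cdf_bounded_prob by auto
          ultimately show ?thesis by linarith
        qed
      qed
    qed
    show "\<bar>?G x - ?F x\<bar> < \<delta>" using up dn by linarith
  qed
qed

text \<open>The hypotheses of \<open>tilt_core\<close> and of the limit theorem in one predicate.
  \<open>K\<close> bounds all support sizes less one and is not excessive: some law has all its
  atoms of mass at most \<open>1 / K\<close>. That law is the one set aside in
  \<open>rate_mass_lower\<close>.\<close>

definition rank_family :: "real \<Rightarrow> real \<Rightarrow> real \<Rightarrow> nat set \<Rightarrow> (nat \<Rightarrow> real pmf) \<Rightarrow> real \<Rightarrow> bool"
  where "rank_family \<epsilon> \<rho> K I q \<sigma> \<longleftrightarrow> finite I \<and> 1 \<le> K \<and> K \<le> \<epsilon> * \<sigma> \<and> 0 < \<sigma> \<and>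
    \<sigma>\<^sup>2 = (\<Sum>i\<in>I. Var (q i) (rk (q i))) \<and> (\<exists>j\<in>I. \<forall>x. pmf (q j) x * K \<le> 1) \<and>
    (\<forall>i\<in>I. finite (set_pmf (q i)) \<and> real (card (set_pmf (q i))) - 1 \<le> K \<and>
      (\<forall>x\<in>set_pmf (q i). card (set_pmf (q i)) \<le> 2 \<or> \<rho> \<le> pmf (q i) x * K))"

lemma rank_family_mono:
  assumes "rank_family \<epsilon> \<rho> K I q \<sigma>" "\<epsilon> \<le> \<epsilon>'"
  shows "rank_family \<epsilon>' \<rho> K I q \<sigma>"
proof -
  have "\<epsilon> * \<sigma> \<le> \<epsilon>' * \<sigma>" using assms by (intro mult_right_mono) (auto simp: rank_family_def)
  then show ?thesis using assms(1) unfolding rank_family_def by (meson order_trans)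
qed

lemma rank_family_lindeberg:
  assumes "rank_family \<epsilon> \<rho> K I q \<sigma>"
  shows "lindeberg \<epsilon> I q (\<lambda>i. rk (q i)) \<sigma>"
  unfolding lindeberg_def
proof (intro conjI ballI)
  show "finite I" "0 < \<sigma>" "\<sigma>\<^sup>2 = (\<Sum>i\<in>I. Var (q i) (rk (q i)))" using assms by (auto simp: rank_family_def)
  fix i assume i: "i \<in> I"
  show fin: "finite (set_pmf (q i))" using assms i by (auto simp: rank_family_def)
  fix x assume x: "x \<in> set_pmf (q i)"
  have K: "real (card (set_pmf (q i))) - 1 \<le> K" "K \<le> \<epsilon> * \<sigma>" using assms i by (auto simp: rank_family_def)
  have r: "0 \<le> rk (q i) y \<and> rk (q i) y \<le> K" if "y \<in> set_pmf (q i)" for y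
    using rk_le[OF fin that] K by (auto simp: rk_nonneg)
  have "0 \<le> EE (q i) (rk (q i))" using r by (intro EE_nonneg) auto
  moreover have "EE (q i) (rk (q i)) \<le> EE (q i) (\<lambda>_. K)" using r by (intro EE_mono fin) auto
  ultimately show "\<bar>rk (q i) x - EE (q i) (rk (q i))\<bar> \<le> \<epsilon> * \<sigma>" using r[OF x] K(2) by auto
qed

text \<open>The order of choices matters: \<open>T\<close> and \<open>a\<close> depend on
  \<open>L\<close> and \<delta> only, and \<epsilon> is then taken so small that the bound of
  \<open>tilt_core\<close> is near its limit at \<epsilon> = 0.\<close>

lemma tilt_bound:
  assumes \<delta>: "0 < \<delta>" and \<rho>: "0 < \<rho>" "\<rho> \<le> 1" and L: "0 < L"
  shows "\<exists>\<epsilon>>0. \<forall>K I q \<sigma> D. rank_family \<epsilon> \<rho> K I q \<sigma> \<longrightarrow> finite D \<longrightarrow>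
    EE (Pi_pmf I 0 q) (\<lambda>w. of_bool ((\<Sum>i\<in>I. w i) \<in> D) * exp (min ((std_sum I q (\<lambda>i. rk (q i)) \<sigma> w)\<^sup>2) (L\<^sup>2) / 2))
    \<le> (1 + \<delta>) * (real (card D) / \<sigma> * gauss 0)"
proof -
  \<comment> \<open>Three factors \<open>1 - d\<close> are lost, one in the Gaussian integral and
    two in the bound of \<open>tilt_core\<close>. Bernoulli's inequality shows that
    \<open>1 + \<delta>\<close> makes up for them.\<close>
  define d where "d = \<delta> / (3 * (1 + \<delta>))"
  have d: "0 < d" "d < 1" using \<delta> by (auto simp: d_def field_simps)
  have d3: "1 \<le> (1 + \<delta>) * (1 - d) ^ 3"
  proof -
    have "1 + real 3 * (- d) \<le> (1 + (- d)) ^ 3" by (rule Bernoulli_inequality) (use d in auto)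
    moreover have "1 - 3 * d = 1 / (1 + \<delta>)" using \<delta> by (simp add: d_def field_simps)
    ultimately have "1 / (1 + \<delta>) \<le> (1 - d) ^ 3" by simp
    then show ?thesis using \<delta> by (simp add: field_simps)
  qed
  have "\<exists>T a. 0 < T \<and> 1 < a \<and> (\<forall>u. (1 - d) * sqrt (2 * pi) * exp (min (u\<^sup>2) (L\<^sup>2) / 2)
        \<le> integral {-T..T} (\<lambda>t. exp (t * u - a * t\<^sup>2 / 2)))"
    by (rule gauss_mgf_lower[OF d(1) L]) (intro exI conjI allI)
  then obtain T a where T: "0 < T" and a: "1 < a" and low': "\<forall>u. (1 - d) * sqrt (2 * pi) * exp (min (u\<^sup>2) (L\<^sup>2) / 2)
        \<le> integral {-T..T} (\<lambda>t. exp (t * u - a * t\<^sup>2 / 2))"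
    by (elim exE conjE)
  note low = spec[OF low']
  let ?B = "\<lambda>\<epsilon>. exp (T * \<epsilon>) / ((1 - d) * (1 - \<epsilon>\<^sup>2)) + 2 * T * exp (3 * T * \<epsilon>) * \<epsilon> / (\<rho> * d\<^sup>2 * (1 - \<epsilon>\<^sup>2))"
  have "isCont ?B 0" using d \<rho> by (intro continuous_intros) auto
  then have "(?B \<longlongrightarrow> ?B 0) (at_right 0)"
    unfolding isCont_def by (rule filterlim_mono[OF _ order_refl]) (simp add: at_le)
  moreover have "?B 0 < 1 / (1 - d)\<^sup>2"
  proof -
    have "(1 - d) * (1 - d) < 1 * (1 - d)" using d by (intro mult_strict_right_mono) auto
    then have "1 / (1 - d) < 1 / (1 - d)\<^sup>2"
      using d by (intro divide_strict_left_mono) (auto simp: power2_eq_square)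
    then show ?thesis by simp
  qed
  ultimately have e1: "\<forall>\<^sub>F \<epsilon> in at_right 0. ?B \<epsilon> < 1 / (1 - d)\<^sup>2" by (rule order_tendstoD(2))
  have "isCont (\<lambda>\<epsilon>. exp (T * \<epsilon>)) 0" by (intro continuous_intros)
  then have "((\<lambda>\<epsilon>. exp (T * \<epsilon>)) \<longlongrightarrow> exp (T * 0)) (at_right 0)"
    unfolding isCont_def by (rule filterlim_mono[OF _ order_refl]) (simp add: at_le)
  then have e2: "\<forall>\<^sub>F \<epsilon> in at_right 0. exp (T * \<epsilon>) < a" using a by (intro order_tendstoD(2)[of _ 1]) auto
  have e3: "\<forall>\<^sub>F \<epsilon> in at_right (0::real). \<epsilon> \<in> {0<..<1}" by (rule eventually_at_right_real) simp
  have "\<forall>\<^sub>F \<epsilon> in at_right 0. ?B \<epsilon> < 1 / (1 - d)\<^sup>2 \<and> exp (T * \<epsilon>) < a \<and> \<epsilon> \<in> {0<..<1}"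
    using e1 e2 e3 by (intro eventually_conj)
  from eventually_happens'[OF trivial_limit_at_right_real this]
  obtain \<epsilon> where \<epsilon>': "?B \<epsilon> < 1 / (1 - d)\<^sup>2 \<and> exp (T * \<epsilon>) < a \<and> \<epsilon> \<in> {0<..<1}" by (rule exE)
  then have \<epsilon>: "?B \<epsilon> < 1 / (1 - d)\<^sup>2" "exp (T * \<epsilon>) < a" "0 < \<epsilon>" "\<epsilon> < 1" by simp_all
  show ?thesis
  proof (intro exI[of _ \<epsilon>] conjI \<epsilon>(3) allI impI)
    fix K I q \<sigma> and D :: "real set" assume F: "rank_family \<epsilon> \<rho> K I q \<sigma>" and D: "finite D"
    let ?P = "Pi_pmf I 0 q" and ?U = "std_sum I q (\<lambda>i. rk (q i)) \<sigma>"
    have \<sigma>: "0 < \<sigma>" using F by (auto simp: rank_family_def)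
    have fin: "finite (set_pmf ?P)" using F by (intro finite_set_Pi_pmf) (auto simp: rank_family_def)
    obtain j where j: "j \<in> I" "\<And>x. pmf (q j) x * K \<le> 1" using F by (auto simp: rank_family_def)
    let ?in = "\<lambda>w. of_bool ((\<Sum>i\<in>I. w i) \<in> D) :: real"
    let ?A = "EE ?P (\<lambda>w. ?in w * exp (min ((?U w)\<^sup>2) (L\<^sup>2) / 2))"
    have "((1 - d) * sqrt (2 * pi)) * ?A = EE ?P (\<lambda>w. ((1 - d) * sqrt (2 * pi)) * (?in w * exp (min ((?U w)\<^sup>2) (L\<^sup>2) / 2)))"
      by (simp only: EE_cmult)
    also have "\<dots> \<le> EE ?P (\<lambda>w. ?in w * integral {-T..T} (\<lambda>t. exp (t * ?U w - a * t\<^sup>2 / 2)))"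
    proof (rule EE_mono[OF fin])
      fix w
      show "((1 - d) * sqrt (2 * pi)) * (?in w * exp (min ((?U w)\<^sup>2) (L\<^sup>2) / 2)) \<le> ?in w * integral {-T..T} (\<lambda>t. exp (t * ?U w - a * t\<^sup>2 / 2))"
        using low[of "?U w"] by (cases "(\<Sum>i\<in>I. w i) \<in> D") (auto simp: mult.assoc)
    qed
    also have "\<dots> \<le> real (card D) / \<sigma> * ?B \<epsilon>"
      unfolding std_sum_def
    proof (rule tilt_core[where K = K and j = j])
      show "finite I" "j \<in> I" "1 \<le> K" "0 < \<rho>" "\<rho> \<le> 1" "0 < \<sigma>" "\<sigma>\<^sup>2 = (\<Sum>i\<in>I. Var (q i) (rk (q i)))"
        "K \<le> \<epsilon> * \<sigma>" "0 < \<epsilon>" "\<epsilon> < 1" "0 < d" "d < 1" "0 < T" "exp (T * \<epsilon>) \<le> a" "finite D"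
        using F \<rho> j \<epsilon> d T D by (auto simp: rank_family_def)
      show "pmf (q j) x * K \<le> 1" for x by (rule j(2))
      fix i assume i: "i \<in> I"
      show "finite (set_pmf (q i))" "real (card (set_pmf (q i))) - 1 \<le> K"
        using F i by (auto simp: rank_family_def)
      show "card (set_pmf (q i)) \<le> 2 \<or> \<rho> \<le> pmf (q i) x * K" if "x \<in> set_pmf (q i)" for x
        using F i that by (auto simp: rank_family_def)
    qed
    also have "\<dots> \<le> real (card D) / \<sigma> * (1 / (1 - d)\<^sup>2)"
      using \<epsilon>(1) \<sigma> by (intro mult_left_mono) auto
    finally have "((1 - d) * sqrt (2 * pi)) * ?A * ((1 - d)\<^sup>2 * gauss 0) \<le> real (card D) / \<sigma> * (1 / (1 - d)\<^sup>2) * ((1 - d)\<^sup>2 * gauss 0)"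
      using d by (intro mult_right_mono) auto
    moreover have "((1 - d) * sqrt (2 * pi)) * ?A * ((1 - d)\<^sup>2 * gauss 0) = (1 - d) ^ 3 * ?A"
      unfolding gauss_0 by (simp add: power3_eq_cube power2_eq_square)
    moreover have "real (card D) / \<sigma> * (1 / (1 - d)\<^sup>2) * ((1 - d)\<^sup>2 * gauss 0) = real (card D) / \<sigma> * gauss 0"
      using d by simp
    ultimately have A: "(1 - d) ^ 3 * ?A \<le> real (card D) / \<sigma> * gauss 0" by linarith
    have "0 \<le> ?A" by (intro EE_nonneg) auto
    then have "1 * ?A \<le> (1 + \<delta>) * (1 - d) ^ 3 * ?A" using d3 by (intro mult_right_mono) auto
    also have "\<dots> \<le> (1 + \<delta>) * (real (card D) / \<sigma> * gauss 0)"
      unfolding mult.assoc using A \<delta> by (intro mult_left_mono) auto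
    finally show "?A \<le> (1 + \<delta>) * (real (card D) / \<sigma> * gauss 0)" by simp
  qed
qed

section \<open>Normal probabilities of intervals and layer-cake integrals\<close>

lemma cdf_normal_diff: "a \<le> b \<Longrightarrow> cdf std_normal_distribution b - cdf std_normal_distribution a = measure std_normal_distribution {a<..b}"
proof -
  interpret N: real_distribution std_normal_distribution by (rule real_dist_normal_dist)
  assume "a \<le> b"
  then show ?thesis
    by (cases "a = b") (simp_all add: N.cdf_diff_eq)
qed

lemma measure_normal_Ioc: "measure std_normal_distribution {a<..b} = measure std_normal_distribution {a..b}"
proof -
  interpret N: real_distribution std_normal_distribution by (rule real_dist_normal_dist)
  have z: "measure std_normal_distribution {a} = 0"
    using gauss_has_integral[of a a] by (auto simp: has_integral_refl(2) dest: has_integral_unique)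
  show ?thesis
  proof (cases "a \<le> b")
    case True
    have "{a..b} = {a} \<union> {a<..b}" using True by auto
    moreover have "measure std_normal_distribution ({a} \<union> {a<..b}) = measure std_normal_distribution {a} + measure std_normal_distribution {a<..b}"
      by (intro N.finite_measure_Union) auto
    ultimately show ?thesis using z by simp
  qed simp
qed

lemma cdf_normal_sym: "0 \<le> s \<Longrightarrow> cdf std_normal_distribution s - cdf std_normal_distribution (- s) = Gs s"
  by (simp add: cdf_normal_diff measure_normal_Ioc Gs_def)

lemma cdf_normal_ge:
  assumes "a \<le> b" "\<bar>a\<bar> \<le> r" "\<bar>b\<bar> \<le> r"
  shows "(b - a) * gauss r \<le> cdf std_normal_distribution b - cdf std_normal_distribution a"
  unfolding cdf_normal_diff[OF assms(1)] measure_normal_Ioc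
proof (rule has_integral_le[OF _ gauss_has_integral])
  show "((\<lambda>_. gauss r) has_integral (b - a) * gauss r) {a..b}"
    using has_integral_const_real[of "gauss r" a b] assms by simp
  show "gauss r \<le> gauss x" if "x \<in> {a..b}" for x using that assms by (intro gauss_le) auto
qed

lemma Gs_DERIV:
  assumes "0 \<le> s" "s \<le> y"
  shows "(Gs has_real_derivative 2 * gauss s) (at s within {0..y})"
proof -
  have "continuous_on {0..y} (\<lambda>x. 2 * gauss x)"
    unfolding std_normal_density_def by (intro continuous_intros) auto
  from integral_has_real_derivative[OF this, of s]
  have "((\<lambda>x. integral {0..x} (\<lambda>x. 2 * gauss x)) has_real_derivative 2 * gauss s) (at s within {0..y})"
    using assms by simp
  then show ?thesis
  proof (rule has_field_derivative_transform_within[OF _ zero_less_one])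
    show "s \<in> {0..y}" using assms by simp
    show "integral {0..x} (\<lambda>x. 2 * gauss x) = Gs x" if "x \<in> {0..y}" for x
      using Gs_half[of x] that by (intro integral_unique) simp
  qed
qed

text \<open>The deficit \<open>1 - exp ((u\<^sup>2 - y\<^sup>2) / 2)\<close> is written as a mixture
  of the indicators of \<open>\<bar>u\<bar> < s\<close>, so that its expectation is controlled by
  distribution functions.\<close>

lemma layer_cake:
  fixes u y :: real
  assumes "0 \<le> y"
  shows "((\<lambda>s. of_bool (\<bar>u\<bar> < s) * (s * exp ((s\<^sup>2 - y\<^sup>2) / 2))) has_integral (if \<bar>u\<bar> < y then 1 - exp ((u\<^sup>2 - y\<^sup>2) / 2) else 0)) {0..y}"
proof (cases "\<bar>u\<bar> < y")
  case True
  let ?g = "\<lambda>s. s * exp ((s\<^sup>2 - y\<^sup>2) / 2)"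
  have "(?g has_integral (exp ((y\<^sup>2 - y\<^sup>2) / 2) - exp ((\<bar>u\<bar>\<^sup>2 - y\<^sup>2) / 2))) {\<bar>u\<bar>..y}"
    using True by (intro fundamental_theorem_of_calculus)
      (auto intro!: derivative_eq_intros simp: has_real_derivative_iff_has_vector_derivative[symmetric])
  then have "((\<lambda>s. if s \<in> {\<bar>u\<bar>..y} then ?g s else 0) has_integral (1 - exp ((u\<^sup>2 - y\<^sup>2) / 2))) {0..y}"
    by (subst has_integral_restrict) auto
  then have "((\<lambda>s. of_bool (\<bar>u\<bar> < s) * ?g s) has_integral (1 - exp ((u\<^sup>2 - y\<^sup>2) / 2))) {0..y}"
    by (rule has_integral_spike_finite[of "{\<bar>u\<bar>}", rotated 2]) auto
  then show ?thesis using True by simp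
next
  case False
  have "((\<lambda>s. 0) has_integral 0) {0..y}" by simp
  then have "((\<lambda>s. of_bool (\<bar>u\<bar> < s) * (s * exp ((s\<^sup>2 - y\<^sup>2) / 2))) has_integral 0) {0..y}"
    by (rule has_integral_eq[rotated]) (use False in auto)
  then show ?thesis using False by simp
qed

text \<open>Integration by parts gives the expected deficit of a standard normal variable. The
  subtracted term \<open>2 * y * gauss y\<close> is what the tilt contributes in
  \<open>conc_upper\<close>, so the two cancel and exactly \<open>Gs y\<close> remains.\<close>

lemma layer_cake_gauss:
  fixes y :: real
  assumes "0 \<le> y"
  shows "((\<lambda>s. Gs s * (s * exp ((s\<^sup>2 - y\<^sup>2) / 2))) has_integral (Gs y - 2 * y * gauss y)) {0..y}"
proof -
  let ?h = "\<lambda>s. exp ((s\<^sup>2 - y\<^sup>2) / 2)"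
  have e: "2 * gauss s * ?h s = 2 * gauss y" for s
  proof -
    have "gauss s * ?h s = exp (- (s\<^sup>2 / 2)) * exp ((s\<^sup>2 - y\<^sup>2) / 2) * gauss 0" by (simp add: gauss_eq[of s])
    also have "\<dots> = exp (- (y\<^sup>2 / 2)) * gauss 0" unfolding exp_add[symmetric] by (simp add: diff_divide_distrib)
    also have "\<dots> = gauss y" by (rule gauss_eq[symmetric])
    finally show ?thesis by simp
  qed
  have "((\<lambda>s. 2 * gauss y + Gs s * (s * ?h s)) has_integral (Gs y * ?h y - Gs 0 * ?h 0)) {0..y}"
  proof (rule fundamental_theorem_of_calculus[OF assms])
    fix s assume s: "s \<in> {0..y}"
    have "((\<lambda>s. Gs s * ?h s) has_real_derivative 2 * gauss s * ?h s + Gs s * (s * ?h s)) (at s within {0..y})"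
      using s by (auto intro!: derivative_eq_intros Gs_DERIV)
    then show "((\<lambda>s. Gs s * ?h s) has_vector_derivative 2 * gauss y + Gs s * (s * ?h s)) (at s within {0..y})"
      unfolding e by (simp add: has_real_derivative_iff_has_vector_derivative)
  qed
  moreover have "Gs 0 = 0" using Gs_upper[of 0] Gs_nonneg[of 0] by simp
  ultimately have 1: "((\<lambda>s. 2 * gauss y + Gs s * (s * ?h s)) has_integral Gs y) {0..y}" by simp
  have 2: "((\<lambda>s. 2 * gauss y) has_integral (y - 0) * (2 * gauss y)) {0..y}"
    using has_integral_const_real[of "2 * gauss y" 0 y] assms by simp
  show ?thesis using has_integral_diff[OF 1 2] by (simp add: mult_ac)
qed

text \<open>Under a bound on the mass weighted by \<open>exp (U\<^sup>2 / 2)\<close>, the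
  probability is largest for a centred interval, as in the Neyman-Pearson lemma. Pointwise: the
  indicator of \<open>D\<close> is at most \<open>exp (- y\<^sup>2 / 2)\<close> times its weighted
  form, plus the deficit of \<open>U\<close> inside the interval of radius \<open>y\<close>. The
  first term is bounded by \<open>tilt_bound\<close>, the second by the limit theorem. For small
  \<open>y\<close> the additive error of the limit theorem would be too large, and dropping the
  weight suffices; for large \<open>y\<close> the right side is at least 1.\<close>

lemma conc_upper:
  assumes \<delta>: "0 < \<delta>" and \<rho>: "0 < \<rho>" "\<rho> \<le> 1"
  shows "\<exists>\<epsilon>>0. \<forall>K I q \<sigma> D. rank_family \<epsilon> \<rho> K I q \<sigma> \<longrightarrow> finite D \<longrightarrow>
    EE (Pi_pmf I 0 q) (\<lambda>w. of_bool ((\<Sum>i\<in>I. w i) \<in> D)) \<le> (1 + \<delta>) * Gs (real (card D) / (2 * \<sigma>))"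
proof -
  have "0 < 1 - 1 / (1 + \<delta>)" using \<delta> by (simp add: field_simps)
  then obtain L where L: "0 < L" "1 / (1 + \<delta>) < Gs L" using Gs_near_1[of "1 - 1 / (1 + \<delta>)"] by auto
  have L1: "1 \<le> (1 + \<delta>) * Gs L" using L \<delta> by (simp add: field_simps)
  \<comment> \<open>The radius at which the factor \<open>exp (y\<^sup>2 / 2)\<close> uses up the
    gap between \<open>1 + \<delta> / 2\<close> and \<open>1 + \<delta>\<close>. From here on
    \<open>Gs y\<close> is bounded below, so an additive error is affordable.\<close>
  define y0 where "y0 = sqrt (2 * ln ((1 + \<delta>) / (1 + \<delta> / 2)))"
  have r: "1 < (1 + \<delta>) / (1 + \<delta> / 2)" using \<delta> by (simp add: field_simps)
  have y0: "0 < y0" "(1 + \<delta> / 2) * exp (y0\<^sup>2 / 2) = 1 + \<delta>"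
    using r \<delta> by (auto simp: y0_def ln_gt_zero)
  define \<delta>1 where "\<delta>1 = \<delta> / 4 * Gs y0"
  have \<delta>1: "0 < \<delta>1" using Gs_pos[OF y0(1)] \<delta> by (simp add: \<delta>1_def)
  obtain \<epsilon>1 where \<epsilon>1: "0 < \<epsilon>1" "\<And>K I q \<sigma> D. rank_family \<epsilon>1 \<rho> K I q \<sigma> \<Longrightarrow> finite D \<Longrightarrow>
    EE (Pi_pmf I 0 q) (\<lambda>w. of_bool ((\<Sum>i\<in>I. w i) \<in> D) * exp (min ((std_sum I q (\<lambda>i. rk (q i)) \<sigma> w)\<^sup>2) (L\<^sup>2) / 2))
    \<le> (1 + \<delta> / 2) * (real (card D) / \<sigma> * gauss 0)"
    using tilt_bound[of "\<delta> / 2" \<rho> L] \<delta> \<rho> L by auto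
  obtain \<epsilon>2 where \<epsilon>2: "0 < \<epsilon>2" "\<And>I (q :: nat \<Rightarrow> real pmf) f \<sigma> x. lindeberg \<epsilon>2 I q f \<sigma> \<Longrightarrow>
    \<bar>measure_pmf.prob (Pi_pmf I 0 q) {w. std_sum I q f \<sigma> w \<le> x} - cdf std_normal_distribution x\<bar> < \<delta>1"
    using clt_uniform[OF \<delta>1, where 'a = real and d = 0] by blast
  define \<epsilon> where "\<epsilon> = min \<epsilon>1 \<epsilon>2"
  have \<epsilon>: "0 < \<epsilon>" "\<epsilon> \<le> \<epsilon>1" "\<epsilon> \<le> \<epsilon>2" using \<epsilon>1 \<epsilon>2 by (auto simp: \<epsilon>_def)
  show ?thesis
  proof (intro exI[of _ \<epsilon>] conjI \<epsilon>(1) allI impI)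
    fix K I q \<sigma> and D :: "real set" assume F: "rank_family \<epsilon> \<rho> K I q \<sigma>" and D: "finite D"
    let ?P = "Pi_pmf I 0 q" and ?U = "std_sum I q (\<lambda>i. rk (q i)) \<sigma>"
    let ?in = "\<lambda>w. of_bool ((\<Sum>i\<in>I. w i) \<in> D) :: real"
    have \<sigma>: "0 < \<sigma>" using F by (auto simp: rank_family_def)
    have fin: "finite (set_pmf ?P)" using F by (intro finite_set_Pi_pmf) (auto simp: rank_family_def)
    define y where "y = real (card D) / (2 * \<sigma>)"
    have y: "0 \<le> y" using \<sigma> by (simp add: y_def)
    have tb: "EE ?P (\<lambda>w. ?in w * exp (min ((?U w)\<^sup>2) (L\<^sup>2) / 2)) \<le> (1 + \<delta> / 2) * (2 * y * gauss 0)"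
      using \<epsilon>1(2)[OF rank_family_mono[OF F \<epsilon>(2)] D] by (simp add: y_def)
    have gy: "exp (- (y\<^sup>2 / 2)) * (2 * y * gauss 0) \<le> Gs y"
      using Gs_lower[OF y] gauss_eq[of y] by (simp add: mult_ac)
    consider "L < y" | "y < y0" | "y0 \<le> y" "y \<le> L" by linarith
    then have "EE ?P ?in \<le> (1 + \<delta>) * Gs y"
    proof cases
      case 1
      have "EE ?P ?in \<le> 1" by (simp add: EE_of_bool')
      also note L1
      also have "(1 + \<delta>) * Gs L \<le> (1 + \<delta>) * Gs y" using 1 \<delta> by (intro mult_left_mono Gs_mono) auto
      finally show ?thesis .
    next
      case 2
      have "EE ?P ?in \<le> EE ?P (\<lambda>w. ?in w * exp (min ((?U w)\<^sup>2) (L\<^sup>2) / 2))"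
        by (intro EE_mono[OF fin]) simp
      also note tb
      also have "2 * y * gauss 0 \<le> exp (y\<^sup>2 / 2) * Gs y"
        using mult_left_mono[OF gy, of "exp (y\<^sup>2 / 2)"] by (simp add: mult.assoc[symmetric] exp_add[symmetric])
      then have "(1 + \<delta> / 2) * (2 * y * gauss 0) \<le> (1 + \<delta> / 2) * (exp (y\<^sup>2 / 2) * Gs y)"
        using \<delta> by (intro mult_left_mono) auto
      also have "\<dots> \<le> (1 + \<delta> / 2) * (exp (y0\<^sup>2 / 2) * Gs y)"
      proof -
        have "y\<^sup>2 \<le> y0\<^sup>2" using 2 y by (intro power_mono) auto
        then show ?thesis using \<delta> Gs_nonneg by (intro mult_left_mono mult_right_mono) auto
      qed
      also have "\<dots> = (1 + \<delta>) * Gs y" unfolding y0(2)[symmetric] by simp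
      finally show ?thesis .
    next
      case 3
      let ?g = "\<lambda>s. s * exp ((s\<^sup>2 - y\<^sup>2) / 2)"
      define f where "f u = (if \<bar>u\<bar> < y then 1 - exp ((u\<^sup>2 - y\<^sup>2) / 2) else 0)" for u
      have pw: "?in w \<le> exp (- (y\<^sup>2 / 2)) * (?in w * exp (min ((?U w)\<^sup>2) (L\<^sup>2) / 2)) + f (?U w)" for w
      proof -
        let ?u = "?U w"
        show ?thesis
        proof (cases "\<bar>?u\<bar> < y")
          case True
          then have u: "?u\<^sup>2 \<le> y\<^sup>2" using y by (intro abs_le_square_iff[THEN iffD1]) auto
          moreover have "y\<^sup>2 \<le> L\<^sup>2" using 3 y by (intro power_mono) auto
          ultimately have "min (?u\<^sup>2) (L\<^sup>2) = ?u\<^sup>2" by simp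
          moreover have "exp (- (y\<^sup>2 / 2)) * exp (?u\<^sup>2 / 2) = exp ((?u\<^sup>2 - y\<^sup>2) / 2)"
            unfolding exp_add[symmetric] by (simp add: diff_divide_distrib)
          moreover have "exp ((?u\<^sup>2 - y\<^sup>2) / 2) \<le> 1" using u by simp
          ultimately show ?thesis using True by (simp add: f_def)
        next
          case False
          then have "y\<^sup>2 \<le> ?u\<^sup>2" using y by (intro abs_le_square_iff[THEN iffD1]) auto
          moreover have "y\<^sup>2 \<le> L\<^sup>2" using 3 y by (intro power_mono) auto
          ultimately have "1 \<le> exp (- (y\<^sup>2 / 2)) * exp (min (?u\<^sup>2) (L\<^sup>2) / 2)"
            unfolding exp_add[symmetric] by simp
          then show ?thesis using False by (simp add: f_def)
        qed
      qed
      have i1: "((\<lambda>s. EE ?P (\<lambda>w. of_bool (\<bar>?U w\<bar> < s) * ?g s)) has_integral EE ?P (\<lambda>w. f (?U w))) {0..y}"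
        unfolding EE_sum[OF fin] f_def
        by (intro has_integral_sum has_integral_mult_right layer_cake[OF y]) (simp add: fin)
      have i2: "((\<lambda>s. Gs s * ?g s + 2 * \<delta>1 * ?g s) has_integral (Gs y - 2 * y * gauss y) + 2 * \<delta>1 * (1 - exp (- (y\<^sup>2 / 2)))) {0..y}"
      proof (intro has_integral_add layer_cake_gauss[OF y] has_integral_mult_right)
        have "(?g has_integral (exp ((y\<^sup>2 - y\<^sup>2) / 2) - exp ((0\<^sup>2 - y\<^sup>2) / 2))) {0..y}"
          using y by (intro fundamental_theorem_of_calculus)
            (auto intro!: derivative_eq_intros simp: has_real_derivative_iff_has_vector_derivative[symmetric])
        then show "(?g has_integral (1 - exp (- (y\<^sup>2 / 2)))) {0..y}" by simp
      qed
      have "EE ?P (\<lambda>w. f (?U w)) \<le> (Gs y - 2 * y * gauss y) + 2 * \<delta>1 * (1 - exp (- (y\<^sup>2 / 2)))"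
      proof (rule has_integral_le[OF i1 i2])
        fix s assume s: "s \<in> {0..y}"
        have lin: "lindeberg \<epsilon>2 I q (\<lambda>i. rk (q i)) \<sigma>"
          by (rule lindeberg_mono[OF rank_family_lindeberg[OF F] \<epsilon>(3)])
        let ?pr = "\<lambda>A. measure_pmf.prob ?P A"
        have "?pr {w. \<bar>?U w\<bar> < s} \<le> ?pr ({w. ?U w \<le> s} - {w. ?U w \<le> - s})"
          by (intro measure_pmf.finite_measure_mono) auto
        also have "\<dots> = ?pr {w. ?U w \<le> s} - ?pr {w. ?U w \<le> - s}"
          using s by (intro measure_pmf.finite_measure_Diff) auto
        also have "\<dots> \<le> (cdf std_normal_distribution s + \<delta>1) - (cdf std_normal_distribution (- s) - \<delta>1)"
          using \<epsilon>2(2)[OF lin, of s] \<epsilon>2(2)[OF lin, of "- s"] by (intro diff_mono; linarith)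
        also have "\<dots> = Gs s + 2 * \<delta>1" using cdf_normal_sym[of s] s by simp
        finally have "?pr {w. \<bar>?U w\<bar> < s} \<le> Gs s + 2 * \<delta>1" .
        then have "?pr {w. \<bar>?U w\<bar> < s} * ?g s \<le> (Gs s + 2 * \<delta>1) * ?g s"
          using s by (intro mult_right_mono) auto
        moreover have "EE ?P (\<lambda>w. of_bool (\<bar>?U w\<bar> < s) * ?g s) = ?pr {w. \<bar>?U w\<bar> < s} * ?g s"
          by (simp only: integral_mult_left_zero EE_of_bool')
        ultimately show "EE ?P (\<lambda>w. of_bool (\<bar>?U w\<bar> < s) * ?g s) \<le> Gs s * ?g s + 2 * \<delta>1 * ?g s"
          by (simp only: distrib_right)
      qed
      also have "\<dots> \<le> (Gs y - 2 * y * gauss y) + 2 * \<delta>1 * 1"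
        using \<delta>1 by (intro add_left_mono mult_left_mono) auto
      finally have f: "EE ?P (\<lambda>w. f (?U w)) \<le> Gs y - 2 * y * gauss y + 2 * \<delta>1" by simp
      have "EE ?P ?in \<le> EE ?P (\<lambda>w. exp (- (y\<^sup>2 / 2)) * (?in w * exp (min ((?U w)\<^sup>2) (L\<^sup>2) / 2)) + f (?U w))"
        by (intro EE_mono[OF fin] pw)
      also have "\<dots> = exp (- (y\<^sup>2 / 2)) * EE ?P (\<lambda>w. ?in w * exp (min ((?U w)\<^sup>2) (L\<^sup>2) / 2)) + EE ?P (\<lambda>w. f (?U w))"
        by (simp only: EE_add[OF fin] EE_cmult)
      also have "\<dots> \<le> exp (- (y\<^sup>2 / 2)) * ((1 + \<delta> / 2) * (2 * y * gauss 0)) + (Gs y - 2 * y * gauss y + 2 * \<delta>1)"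
        using tb f by (intro add_mono mult_left_mono) auto
      also have "\<dots> = Gs y + \<delta> / 2 * (exp (- (y\<^sup>2 / 2)) * (2 * y * gauss 0)) + 2 * \<delta>1"
        unfolding gauss_eq[of y] by (simp add: algebra_simps)
      also have "\<dots> \<le> Gs y + \<delta> / 2 * Gs y + \<delta> / 2 * Gs y"
      proof -
        have "2 * \<delta>1 \<le> \<delta> / 2 * Gs y" unfolding \<delta>1_def using Gs_mono[OF 3(1)] \<delta> by simp
        moreover have "\<delta> / 2 * (exp (- (y\<^sup>2 / 2)) * (2 * y * gauss 0)) \<le> \<delta> / 2 * Gs y"
          using gy \<delta> by (intro mult_left_mono) auto
        ultimately show ?thesis by linarith
      qed
      also have "\<dots> = (1 + \<delta>) * Gs y" by (simp add: distrib_right)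
      finally show ?thesis .
    qed
    then show "EE ?P ?in \<le> (1 + \<delta>) * Gs (real (card D) / (2 * \<sigma>))" by (simp add: y_def)
  qed
qed

section \<open>Lower bounds for centred windows of integers\<close>

lemma cdf_window_lower:
  fixes q :: "nat \<Rightarrow> int pmf"
  defines "S \<equiv> \<lambda>I w. \<Sum>i\<in>I. w i"
  assumes \<sigma>: "0 < \<sigma>" and cl: "\<And>x. \<bar>measure_pmf.prob (Pi_pmf I 0 q) {w. std_sum I q (\<lambda>_. real_of_int) \<sigma> w \<le> x} - cdf std_normal_distribution x\<bar> < \<delta>1"
    and ab: "a \<le> b" and m: "m = (\<Sum>i\<in>I. EE (q i) real_of_int)"
  shows "cdf std_normal_distribution ((b - m) / \<sigma>) - cdf std_normal_distribution ((a - m) / \<sigma>) - 2 * \<delta>1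
    \<le> EE (Pi_pmf I 0 q) (\<lambda>w. of_bool (a < real_of_int (S I w) \<and> real_of_int (S I w) \<le> b))"
proof -
  let ?P = "Pi_pmf I 0 q" and ?U = "std_sum I q (\<lambda>_. real_of_int) \<sigma>"
  have U: "?U w \<le> (x - m) / \<sigma> \<longleftrightarrow> real_of_int (S I w) \<le> x" for w x
    using \<sigma> by (simp add: std_sum_def S_def m sum_subtractf divide_le_cancel)
  let ?pr = "\<lambda>A. measure_pmf.prob ?P A"
  have "EE ?P (\<lambda>w. of_bool (a < real_of_int (S I w) \<and> real_of_int (S I w) \<le> b))
      = ?pr ({w. ?U w \<le> (b - m) / \<sigma>} - {w. ?U w \<le> (a - m) / \<sigma>})"
    unfolding EE_of_bool' U by (rule arg_cong[where f = ?pr]) auto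
  also have "\<dots> = ?pr {w. ?U w \<le> (b - m) / \<sigma>} - ?pr {w. ?U w \<le> (a - m) / \<sigma>}"
    unfolding U using ab by (intro measure_pmf.finite_measure_Diff) auto
  finally show ?thesis using cl[of "(b - m) / \<sigma>"] cl[of "(a - m) / \<sigma>"] by linarith
qed

lemma card_centered_interval:
  fixes e :: int and l :: nat
  assumes "odd (int l + e)"
  shows "finite {z :: int. \<bar>2 * z - e\<bar> < int l}" "card {z :: int. \<bar>2 * z - e\<bar> < int l} = l"
proof -
  obtain c where c: "int l + e = 2 * c + 1" using assms by (elim oddE)
  have "{z :: int. \<bar>2 * z - e\<bar> < int l} = {c - int l + 1..c}"
    using c by (auto simp: abs_less_iff)
  then show "finite {z :: int. \<bar>2 * z - e\<bar> < int l}" "card {z :: int. \<bar>2 * z - e\<bar> < int l} = l"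
    by simp_all
qed

text \<open>Averaged over a shift in {-h..h}, the probability of a short window is
  \<open>1 / (2 * h + 1)\<close> times a sum over its \<open>l\<close> points of probabilities of
  windows of length \<open>2 * h + 1\<close>. Their length is of order
  \<open>\<eta> * \<sigma>\<close>, where the error of the limit theorem is relatively small. If
  \<open>l\<close> is at least \<open>2 * y0 * \<sigma>\<close>, every single shift is harmless,
  because \<open>Gs\<close> is Lipschitz. The shift width \<open>h\<close> is the same for all
  \<open>l\<close> and \<open>e\<close>.\<close>

lemma spread_lower:
  assumes \<delta>: "0 < \<delta>" "\<delta> < 1"
  shows "\<exists>\<epsilon>>0. \<forall>I (q :: nat \<Rightarrow> int pmf) \<sigma>. lindeberg \<epsilon> I q (\<lambda>_. real_of_int) \<sigma> \<longrightarrow> 1 \<le> \<epsilon> * \<sigma> \<longrightarrow>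
    (\<exists>h::nat. \<forall>(e::int) (l::nat). \<bar>real_of_int e - 2 * (\<Sum>i\<in>I. EE (q i) real_of_int)\<bar> \<le> 1 \<longrightarrow> 1 \<le> l \<longrightarrow> odd (int l + e) \<longrightarrow>
      (1 - \<delta>) * Gs (real l / (2 * \<sigma>)) \<le>
      EE (pmf_of_set {- int h..int h}) (\<lambda>i. EE (Pi_pmf I 0 q) (\<lambda>w. of_bool (\<bar>2 * (i + (\<Sum>i\<in>I. w i)) - e\<bar> < int l))))"
proof -
  \<comment> \<open>Within this radius the normal density keeps the share
    \<open>1 - \<delta> / 2\<close> of its maximum; short windows remain inside it after
    shifting.\<close>
  define r where "r = sqrt \<delta>"
  have r: "0 < r" "r\<^sup>2 = \<delta>" using \<delta> by (auto simp: r_def)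
  have gr: "(1 - \<delta> / 2) * gauss 0 \<le> gauss r"
  proof -
    have "1 - \<delta> / 2 \<le> exp (- (\<delta> / 2))" using exp_ge_add_one_self[of "- (\<delta> / 2)"] by simp
    then show ?thesis unfolding gauss_eq[of r] r(2) by (intro mult_right_mono) auto
  qed
  define y0 where "y0 = r / 2"
  have y0: "0 < y0" using r by (simp add: y0_def)
  have G0: "0 < Gs y0" by (rule Gs_pos[OF y0])
  \<comment> \<open>The shift width relative to \<sigma>: small against \<open>r\<close>, and small
    against \<open>\<delta> * Gs y0\<close>, which pays for the Lipschitz loss in long windows. The
    error \<open>\<delta>1\<close> chosen next is small against the mass of a long window and
    against that of a window of relative width \<eta>.\<close>
  define \<eta> where "\<eta> = min (r / 8) (\<delta> * Gs y0 / 16)"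
  have \<eta>: "0 < \<eta>" "\<eta> \<le> r / 8" "\<eta> \<le> \<delta> * Gs y0 / 16" using r \<delta> G0 by (auto simp: \<eta>_def)
  define \<delta>1 where "\<delta>1 = min (\<delta> * Gs y0 / 8) (\<eta> * \<delta> * gauss 0 / 4)"
  have g0: "0 < gauss 0" by simp
  have \<delta>1: "0 < \<delta>1" "\<delta>1 \<le> \<delta> * Gs y0 / 8" "\<delta>1 \<le> \<eta> * \<delta> * gauss 0 / 4"
    using \<eta> \<delta> G0 mult_pos_pos[OF mult_pos_pos[OF \<eta>(1) \<delta>(1)] g0] by (auto simp: \<delta>1_def)
  obtain \<epsilon>1 where \<epsilon>1: "0 < \<epsilon>1" "\<And>I (q :: nat \<Rightarrow> int pmf) f \<sigma> x. lindeberg \<epsilon>1 I q f \<sigma> \<Longrightarrow>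
    \<bar>measure_pmf.prob (Pi_pmf I 0 q) {w. std_sum I q f \<sigma> w \<le> x} - cdf std_normal_distribution x\<bar> < \<delta>1"
    using clt_uniform[OF \<delta>1(1), where 'a = int and d = 0] by blast
  define \<epsilon> where "\<epsilon> = min \<epsilon>1 (min \<eta> (r / 16))"
  have \<epsilon>: "0 < \<epsilon>" "\<epsilon> \<le> \<epsilon>1" "\<epsilon> \<le> \<eta>" "\<epsilon> \<le> r / 16" using \<epsilon>1 \<eta> r by (auto simp: \<epsilon>_def)
  show ?thesis
  proof (intro exI[of _ \<epsilon>] conjI \<epsilon>(1) allI impI)
    fix I and q :: "nat \<Rightarrow> int pmf" and \<sigma>
    assume lin: "lindeberg \<epsilon> I q (\<lambda>_. real_of_int) \<sigma>" and \<epsilon>\<sigma>: "1 \<le> \<epsilon> * \<sigma>"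
    have \<sigma>: "0 < \<sigma>" using lin by (simp add: lindeberg_def)
    have i\<sigma>: "1 / \<sigma> \<le> \<epsilon>" using \<epsilon>\<sigma> \<sigma> by (simp add: field_simps)
    let ?P = "Pi_pmf I 0 q"
    let ?S = "\<lambda>w. \<Sum>i\<in>I. w i"
    define m where "m = (\<Sum>i\<in>I. EE (q i) real_of_int)"
    have fin: "finite (set_pmf ?P)" using lin by (intro finite_set_Pi_pmf) (auto simp: lindeberg_def)
    note win = cdf_window_lower[OF \<sigma> \<epsilon>1(2)[OF lindeberg_mono[OF lin \<epsilon>(2)]] _ m_def]
    define h where "h = nat \<lfloor>\<eta> * \<sigma>\<rfloor>"
    have h: "real h \<le> \<eta> * \<sigma>" "\<eta> * \<sigma> < real h + 1" using \<eta> \<sigma> by (auto simp: h_def)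
    have h1: "(real h + 1) / \<sigma> \<le> \<eta> + \<epsilon>"
    proof -
      have "real h / \<sigma> \<le> \<eta>" using h(1) \<sigma> by (simp add: field_simps)
      then show ?thesis using i\<sigma> by (simp add: add_divide_distrib)
    qed
    let ?W = "pmf_of_set {- int h..int h}"
    have ne: "finite {- int h..int h}" "{- int h..int h} \<noteq> {}" by auto
    have cW: "card {- int h..int h} = 2 * h + 1" by simp
    have EW: "EE ?W f = (\<Sum>i\<in>{- int h..int h}. f i) / real (2 * h + 1)" for f
      using integral_pmf_of_set[OF ne(2,1), of f] cW by simp
    show "\<exists>h::nat. \<forall>(e::int) (l::nat). \<bar>real_of_int e - 2 * (\<Sum>i\<in>I. EE (q i) real_of_int)\<bar> \<le> 1 \<longrightarrow> 1 \<le> l \<longrightarrow> odd (int l + e) \<longrightarrow>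
      (1 - \<delta>) * Gs (real l / (2 * \<sigma>)) \<le>
      EE (pmf_of_set {- int h..int h}) (\<lambda>i. EE (Pi_pmf I 0 q) (\<lambda>w. of_bool (\<bar>2 * (i + (\<Sum>i\<in>I. w i)) - e\<bar> < int l)))"
    proof (intro exI[of _ h] allI impI, unfold m_def[symmetric])
      fix e :: int and l :: nat assume e: "\<bar>real_of_int e - 2 * m\<bar> \<le> 1" and l: "1 \<le> l" and par: "odd (int l + e)"
      define y where "y = real l / (2 * \<sigma>)"
      have y: "0 < y" using l \<sigma> by (simp add: y_def)
      let ?f = "\<lambda>i. EE ?P (\<lambda>w. of_bool (\<bar>2 * (i + ?S w) - e\<bar> < int l))"
      have "(1 - \<delta>) * Gs y \<le> EE ?W ?f"
      proof (cases "y0 \<le> y")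
        case True
        have "(1 - \<delta>) * Gs y \<le> ?f i" if i: "i \<in> {- int h..int h}" for i
        proof -
          define s where "s = y - (real h + 1) / \<sigma>"
          have "(real h + 1) / \<sigma> \<le> y" using h1 \<eta> \<epsilon> True r unfolding y0_def by linarith
          then have s0: "0 \<le> s" by (simp add: s_def)
          have G: "Gs y \<le> Gs s + 2 * ((real h + 1) / \<sigma>)"
          proof -
            have "y - s = (real h + 1) / \<sigma>" "s \<le> y" using \<sigma> by (auto simp: s_def)
            then show ?thesis using Gs_lipschitz[of s y] y by simp
          qed
          have ab: "(m + s * \<sigma> - m) / \<sigma> = s" "(m - s * \<sigma> - m) / \<sigma> = - s" using \<sigma> by auto
          have "Gs s - 2 * \<delta>1 \<le> EE ?P (\<lambda>w. of_bool (m - s * \<sigma> < real_of_int (?S w) \<and> real_of_int (?S w) \<le> m + s * \<sigma>))"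
            using win[of "m - s * \<sigma>" "m + s * \<sigma>"] s0 \<sigma> unfolding ab cdf_normal_sym[OF s0] by simp
          also have "\<dots> \<le> ?f i"
          proof (rule EE_mono[OF fin])
            fix w
            have "\<bar>2 * (i + ?S w) - e\<bar> < int l" if "\<bar>real_of_int (?S w) - m\<bar> \<le> s * \<sigma>"
            proof -
              have "s * \<sigma> = real l / 2 - (real h + 1)" using \<sigma> by (simp add: s_def y_def left_diff_distrib)
              then have "\<bar>2 * (real_of_int i + real_of_int (?S w)) - real_of_int e\<bar> < real l"
                using that e i by (auto simp: abs_le_iff abs_less_iff)
              then have "real_of_int \<bar>2 * (i + ?S w) - e\<bar> < real_of_int (int l)" by simp
              then show ?thesis by (simp only: of_int_less_iff)
            qed
            then show "of_bool (m - s * \<sigma> < real_of_int (?S w) \<and> real_of_int (?S w) \<le> m + s * \<sigma>)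
                \<le> (of_bool (\<bar>2 * (i + ?S w) - e\<bar> < int l) :: real)"
              by (auto simp: abs_le_iff)
          qed
          finally have "Gs s - 2 * \<delta>1 \<le> ?f i" .
          moreover have "\<delta> * Gs y0 \<le> \<delta> * Gs y" using True \<delta> by (intro mult_left_mono Gs_mono) auto
          ultimately have "Gs y - \<delta> * Gs y \<le> ?f i" using G h1 \<eta> \<epsilon> \<delta>1 by linarith
          then show ?thesis by (simp add: left_diff_distrib)
        qed
        then have "(\<Sum>i\<in>{- int h..int h}. (1 - \<delta>) * Gs y) \<le> (\<Sum>i\<in>{- int h..int h}. ?f i)" by (rule sum_mono)
        then show ?thesis unfolding EW by (simp add: field_simps)
      next
        case False
        define J where "J = {z :: int. \<bar>2 * z - e\<bar> < int l}"
        have J: "finite J" "card J = l" unfolding J_def using card_centered_interval[OF par] by auto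
        have each: "(real (2 * h + 1) / \<sigma>) * gauss r - 2 * \<delta>1
          \<le> EE ?P (\<lambda>w. \<Sum>i\<in>{- int h..int h}. of_bool (i + ?S w = z))" if z: "z \<in> J" for z
        proof -
          have "real_of_int \<bar>2 * z - e\<bar> < real_of_int (int l)" using z unfolding J_def of_int_less_iff by simp
          then have z': "\<bar>2 * real_of_int z - real_of_int e\<bar> < real l" by simp
          let ?a = "real_of_int z - real h - 1" and ?b = "real_of_int z + real h"
          have bnd: "\<bar>x\<bar> / \<sigma> \<le> r" if "\<bar>x\<bar> \<le> real l / 2 + 1/2 + real h + 1" for x
          proof -
            have "\<bar>x\<bar> / \<sigma> \<le> (real l / 2 + 1/2 + real h + 1) / \<sigma>" using that \<sigma> by (intro divide_right_mono) auto
            also have "\<dots> = y + (1/2) * (1 / \<sigma>) + (real h + 1) / \<sigma>" by (simp add: y_def add_divide_distrib)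
            also have "\<dots> \<le> r / 2 + (1/2) * \<epsilon> + (\<eta> + \<epsilon>)"
              using False h1 i\<sigma> by (intro add_mono mult_left_mono) (auto simp: y0_def)
            also have "\<dots> \<le> r" using \<epsilon> \<eta> r by linarith
            finally show ?thesis .
          qed
          have za: "\<bar>?a - m\<bar> \<le> real l / 2 + 1/2 + real h + 1" "\<bar>?b - m\<bar> \<le> real l / 2 + 1/2 + real h + 1"
            using z' e by linarith+
          have "((?b - m) / \<sigma> - (?a - m) / \<sigma>) * gauss r \<le> cdf std_normal_distribution ((?b - m) / \<sigma>) - cdf std_normal_distribution ((?a - m) / \<sigma>)"
            using bnd[OF za(1)] bnd[OF za(2)] \<sigma> by (intro cdf_normal_ge divide_right_mono) (auto simp: abs_divide)
          moreover have "(?b - m) / \<sigma> - (?a - m) / \<sigma> = real (2 * h + 1) / \<sigma>" by (simp add: diff_divide_distrib[symmetric])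
          ultimately have "(real (2 * h + 1) / \<sigma>) * gauss r - 2 * \<delta>1 \<le> EE ?P (\<lambda>w. of_bool (?a < real_of_int (?S w) \<and> real_of_int (?S w) \<le> ?b))"
            using win[of ?a ?b] by simp
          also have "\<dots> \<le> EE ?P (\<lambda>w. \<Sum>i\<in>{- int h..int h}. of_bool (i + ?S w = z))"
          proof (rule EE_mono[OF fin])
            fix w
            show "of_bool (?a < real_of_int (?S w) \<and> real_of_int (?S w) \<le> ?b) \<le> (\<Sum>i\<in>{- int h..int h}. of_bool (i + ?S w = z) :: real)"
            proof (cases "?a < real_of_int (?S w) \<and> real_of_int (?S w) \<le> ?b")
              case True
              then have "real_of_int (z - int h - 1) < real_of_int (?S w)" "real_of_int (?S w) \<le> real_of_int (z + int h)"
                by simp_all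
              then have "z - ?S w \<in> {- int h..int h}" unfolding of_int_less_iff of_int_le_iff by auto
              moreover have "(\<Sum>i\<in>{- int h..int h}. of_bool (i + ?S w = z) :: real) = (\<Sum>i\<in>{- int h..int h}. if i = z - ?S w then 1 else 0)"
                by (intro sum.cong) auto
              ultimately have "(\<Sum>i\<in>{- int h..int h}. of_bool (i + ?S w = z) :: real) = 1" by simp
              then show ?thesis using True by (simp only: of_bool_eq simp_thms order_refl)
            next
              case False
              have "0 \<le> (\<Sum>i\<in>{- int h..int h}. of_bool (i + ?S w = z) :: real)" by (intro sum_nonneg) simp
              then show ?thesis using False by (simp only: of_bool_eq simp_thms)
            qed
          qed
          finally show ?thesis .
        qed
        have "real l * ((real (2 * h + 1) / \<sigma>) * gauss r - 2 * \<delta>1)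
          \<le> (\<Sum>z\<in>J. EE ?P (\<lambda>w. \<Sum>i\<in>{- int h..int h}. of_bool (i + ?S w = z)))"
          using sum_mono[of J "\<lambda>_. (real (2 * h + 1) / \<sigma>) * gauss r - 2 * \<delta>1", OF each] J by simp
        also have "\<dots> = EE ?P (\<lambda>w. \<Sum>z\<in>J. \<Sum>i\<in>{- int h..int h}. of_bool (i + ?S w = z))"
          by (rule EE_setsum[OF fin, symmetric])
        also have "\<dots> = EE ?P (\<lambda>w. \<Sum>i\<in>{- int h..int h}. of_bool (\<bar>2 * (i + ?S w) - e\<bar> < int l))"
        proof (rule EE_cong)
          fix w
          have "(\<Sum>z\<in>J. of_bool (i + ?S w = z) :: real) = of_bool (\<bar>2 * (i + ?S w) - e\<bar> < int l)" for i
            using J(1) by (simp add: of_bool_def J_def)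
          then show "(\<Sum>z\<in>J. \<Sum>i\<in>{- int h..int h}. of_bool (i + ?S w = z) :: real) = (\<Sum>i\<in>{- int h..int h}. of_bool (\<bar>2 * (i + ?S w) - e\<bar> < int l))"
            by (subst sum.swap) simp
        qed
        also have "\<dots> = (\<Sum>i\<in>{- int h..int h}. ?f i)" by (rule EE_setsum[OF fin])
        finally have main: "real l * ((real (2 * h + 1) / \<sigma>) * gauss r - 2 * \<delta>1) / real (2 * h + 1) \<le> EE ?W ?f"
          unfolding EW by (rule divide_right_mono) simp
        have "2 * \<delta>1 / real (2 * h + 1) \<le> (1 / \<sigma>) * (\<delta> / 2 * gauss 0)"
        proof -
          have "\<eta> * \<sigma> \<le> real (2 * h + 1)" using h(2) \<eta> \<epsilon> \<epsilon>\<sigma> \<sigma> mult_right_mono[OF \<epsilon>(3), of \<sigma>] by linarith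
          then have "2 * \<delta>1 / real (2 * h + 1) \<le> 2 * \<delta>1 / (\<eta> * \<sigma>)"
            using \<delta>1 \<eta> \<sigma> by (intro divide_left_mono mult_pos_pos) auto
          also have "\<dots> \<le> 2 * (\<eta> * \<delta> * gauss 0 / 4) / (\<eta> * \<sigma>)"
            using \<delta>1 \<eta> \<sigma> by (intro divide_right_mono mult_left_mono) auto
          also have "\<dots> = (1 / \<sigma>) * (\<delta> / 2 * gauss 0)" using \<eta> by simp
          finally show ?thesis .
        qed
        then have "(1 / \<sigma>) * gauss r - (1 / \<sigma>) * (\<delta> / 2 * gauss 0) \<le> (1 / \<sigma>) * gauss r - 2 * \<delta>1 / real (2 * h + 1)" by simp
        also have "\<dots> = ((real (2 * h + 1) / \<sigma>) * gauss r - 2 * \<delta>1) / real (2 * h + 1)"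
          by (simp add: diff_divide_distrib)
        finally have "real l * ((1 / \<sigma>) * gauss r - (1 / \<sigma>) * (\<delta> / 2 * gauss 0)) \<le> EE ?W ?f"
          using main by (smt (verit, best) mult_left_mono of_nat_0_le_iff times_divide_eq_right)
        moreover have "(1 - \<delta>) * Gs y \<le> real l * ((1 / \<sigma>) * gauss r - (1 / \<sigma>) * (\<delta> / 2 * gauss 0))"
        proof -
          have "(1 - \<delta>) * Gs y \<le> (1 - \<delta>) * (2 * y * gauss 0)"
            using \<delta> y by (intro mult_left_mono Gs_upper) auto
          also have "\<dots> = real l * (1 / \<sigma>) * ((1 - \<delta> / 2) * gauss 0 - \<delta> / 2 * gauss 0)"
          proof -
            have "real l * (1 / \<sigma>) = 2 * y" by (simp add: y_def)
            then show ?thesis by (simp only:) (simp add: algebra_simps)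
          qed
          also have "\<dots> \<le> real l * (1 / \<sigma>) * (gauss r - \<delta> / 2 * gauss 0)"
            using gr \<sigma> by (intro mult_left_mono) auto
          finally show ?thesis by (simp add: algebra_simps)
        qed
        ultimately show ?thesis by linarith
      qed
      then show "(1 - \<delta>) * Gs (real l / (2 * \<sigma>)) \<le> EE ?W ?f" by (simp add: y_def)
    qed
  qed
qed

section \<open>Convolution with uniform distributions\<close>

definition conv :: "'a::comm_monoid_add pmf \<Rightarrow> 'a pmf \<Rightarrow> 'a pmf"
  where "conv p q = map_pmf (\<lambda>(x, y). x + y) (pair_pmf p q)"

definition psum :: "'i set \<Rightarrow> ('i \<Rightarrow> 'a::comm_monoid_add pmf) \<Rightarrow> 'a pmf"
  where "psum I q = map_pmf (\<lambda>w. \<Sum>i\<in>I. w i) (Pi_pmf I 0 q)"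

lemma conv_alt: "conv p q = p \<bind> (\<lambda>x. map_pmf (\<lambda>y. x + y) q)"
  by (simp add: conv_def pair_pmf_def map_pmf_def bind_assoc_pmf bind_return_pmf)

lemma set_conv: "finite (set_pmf p) \<Longrightarrow> finite (set_pmf q) \<Longrightarrow> finite (set_pmf (conv p q))"
  by (simp add: conv_def)

lemma conv_left_commute: "conv p (conv q r) = conv q (conv p r)"
  unfolding conv_alt by (simp add: map_bind_pmf pmf.map_comp o_def) (subst bind_commute_pmf, simp add: add.left_commute)

lemma EE_conv:
  assumes "finite (set_pmf p)" "finite (set_pmf q)"
  shows "EE (conv p q) f = EE p (\<lambda>x. EE q (\<lambda>y. f (x + y)))"
  unfolding conv_alt using assms
  by (subst pmf_expectation_bind[of "set_pmf p"]) (auto simp: EE_sum[of p])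

lemma finite_set_psum: "finite I \<Longrightarrow> (\<And>i. i \<in> I \<Longrightarrow> finite (set_pmf (q i))) \<Longrightarrow> finite (set_pmf (psum I q))"
  by (simp add: psum_def finite_set_Pi_pmf)

lemma EE_psum: "EE (psum I q) f = EE (Pi_pmf I 0 q) (\<lambda>w. f (\<Sum>i\<in>I. w i))"
  by (simp add: psum_def)

lemma psum_insert:
  assumes "finite I" "i \<notin> I"
  shows "psum (insert i I) q = conv (q i) (psum I q)"
proof -
  have "(\<Sum>j\<in>insert i I. (w(i := x)) j) = x + (\<Sum>j\<in>I. w j)" for w :: "'a \<Rightarrow> 'b" and x
  proof -
    have "(\<Sum>j\<in>I. (w(i := x)) j) = (\<Sum>j\<in>I. w j)" using assms by (intro sum.cong) auto
    then show ?thesis using assms by simp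
  qed
  then show ?thesis
    unfolding psum_def conv_alt Pi_pmf_insert'[OF assms]
    by (simp add: map_bind_pmf map_pmf_def bind_assoc_pmf bind_return_pmf del: sum.insert fun_upd_apply)
qed

text \<open>Peeling a \<open>k\<close> by \<open>d\<close> matrix by one row together with one
  column splits it into \<open>min k d\<close> hooks, of sizes \<open>k + d - 1\<close>,
  \<open>k + d - 3\<close>, and so on. All sizes have the same parity.\<close>

fun hooks :: "(nat \<Rightarrow> real) \<Rightarrow> nat \<Rightarrow> nat \<Rightarrow> real" where
  "hooks B 0 d = 0"
| "hooks B (Suc k) 0 = 0"
| "hooks B (Suc k) (Suc d) = B (k + d + 1) + hooks B k d"

lemma hooks_cmult: "hooks (\<lambda>l. c * B l) k d = c * hooks B k d"
  by (induction B k d rule: hooks.induct) (simp_all add: distrib_left)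

text \<open>Peeling off a hook: the differences of the maximum of \<open>A\<close> from the elements of \<open>D\<close>, followed by
  the differences of the elements of \<open>A\<close> from the maximum of \<open>D\<close>, form a strictly monotone chain.\<close>

lemma double_sum_le_hooks:
  fixes f :: "'a::linordered_ab_group_add \<Rightarrow> real"
  assumes "finite A" "finite D"
    and "\<And>C. finite C \<Longrightarrow> C \<noteq> {} \<Longrightarrow> odd (int (card C) + e) \<Longrightarrow> (\<Sum>z\<in>C. f z) \<le> B (card C)"
    and "even (int (card A) + int (card D) + e)"
  shows "(\<Sum>a\<in>A. \<Sum>y\<in>D. f (y - a)) \<le> hooks B (card A) (card D)"
  using assms
proof (induction "card A" arbitrary: A D)
  case 0
  then show ?case by simp
next
  case (Suc k)
  show ?case
  proof (cases "card D")
    case 0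
    then show ?thesis using Suc.prems Suc.hyps(2)[symmetric] by simp
  next
    case (Suc d)
    have A: "finite A" "A \<noteq> {}" using Suc.hyps(2) by (auto intro: card_ge_0_finite)
    have D: "finite D" "D \<noteq> {}" using Suc by (auto intro: card_ge_0_finite)
    define a where "a = Max A" define y where "y = Max D"
    have a: "a \<in> A" "\<And>x. x \<in> A \<Longrightarrow> x \<le> a" and y: "y \<in> D" "\<And>x. x \<in> D \<Longrightarrow> x \<le> y"
      using A D by (auto simp: a_def y_def)
    define A' where "A' = A - {a}" define D' where "D' = D - {y}"
    have cA: "card A' = k" and cD: "card D' = d" using a y Suc Suc.hyps(2) A D by (auto simp: A'_def D'_def)
    let ?C1 = "(\<lambda>x. x - a) ` D" and ?C2 = "(\<lambda>x. y - x) ` A'"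
    have disj: "?C1 \<inter> ?C2 = {}"
    proof (rule ccontr)
      assume "?C1 \<inter> ?C2 \<noteq> {}"
      then obtain u v where uv: "u \<in> D" "v \<in> A'" "u - a = y - v" by auto
      have "v < a" using uv a(2)[of v] by (auto simp: A'_def order_le_less)
      then have "y - a < y - v" by simp
      moreover have "u - a \<le> y - a" using y(2)[OF uv(1)] by simp
      ultimately show False using uv(3) by simp
    qed
    have fC: "finite ?C1" "finite ?C2" using A D by (auto simp: A'_def)
    have cC: "card (?C1 \<union> ?C2) = k + d + 1"
      using disj fC cA Suc by (simp add: card_Un_disjoint card_image inj_on_def)
    have "(\<Sum>a\<in>A. \<Sum>y\<in>D. f (y - a)) = (\<Sum>x\<in>D. f (x - a)) + (\<Sum>x\<in>A'. \<Sum>y\<in>D. f (y - x))"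
      unfolding A'_def using A a by (simp add: sum.remove)
    also have "(\<Sum>x\<in>A'. \<Sum>y\<in>D. f (y - x)) = (\<Sum>x\<in>A'. f (y - x)) + (\<Sum>x\<in>A'. \<Sum>y\<in>D'. f (y - x))"
      unfolding D'_def using D y by (simp add: sum.remove sum.distrib)
    also have "(\<Sum>x\<in>D. f (x - a)) + ((\<Sum>x\<in>A'. f (y - x)) + (\<Sum>x\<in>A'. \<Sum>y\<in>D'. f (y - x)))
      = (\<Sum>z\<in>?C1 \<union> ?C2. f z) + (\<Sum>x\<in>A'. \<Sum>y\<in>D'. f (y - x))"
      using disj fC by (simp add: sum.union_disjoint sum.reindex inj_on_def)
    also have "\<dots> \<le> B (k + d + 1) + hooks B k d"
    proof (rule add_mono)
      have par: "odd (int (k + d + 1) + e)" using Suc.prems(4) Suc.hyps(2)[symmetric] Suc by simp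
      show "(\<Sum>z\<in>?C1 \<union> ?C2. f z) \<le> B (k + d + 1)"
        using Suc.prems(3)[of "?C1 \<union> ?C2"] fC D par unfolding cC by simp
      have "(\<Sum>x\<in>A'. \<Sum>y\<in>D'. f (y - x)) \<le> hooks B (card A') (card D')"
      proof (rule Suc.hyps(1))
        show "k = card A'" "finite A'" "finite D'" using cA A D by (auto simp: A'_def D'_def)
        show "even (int (card A') + int (card D') + e)"
          using par unfolding cA cD of_nat_add of_nat_1 by presburger
      qed (rule Suc.prems(3))
      then show "(\<Sum>x\<in>A'. \<Sum>y\<in>D'. f (y - x)) \<le> hooks B k d" unfolding cA cD .
    qed
    also have "\<dots> = hooks B (card A) (card D)" unfolding Suc Suc.hyps(2)[symmetric] by simp
    finally show ?thesis .
  qed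
qed

text \<open>For two intervals each hook of differences is itself an interval, and peeling keeps its
  centre. The bound for general sets is thus attained.\<close>

lemma double_sum_interval_eq_hooks:
  fixes f :: "int \<Rightarrow> real" and u v :: int
  shows "(\<Sum>a\<in>{u..u + int k - 1}. \<Sum>y\<in>{v..v + int d - 1}. f (y - a))
    = hooks (\<lambda>l. \<Sum>z\<in>{z. \<bar>2 * z - (2 * v + int d - 2 * u - int k)\<bar> < int l}. f z) k d"
proof (induction k arbitrary: d)
  case 0
  then show ?case by simp
next
  case (Suc k)
  show ?case
  proof (cases d)
    case 0
    then show ?thesis by simp
  next
    case (Suc d')
    let ?c = "2 * v + int d - 2 * u - int (Suc k)"
    have e1: "{u..u + int (Suc k) - 1} = insert (u + int k) {u..u + int k - 1}"
      and e2: "{v..v + int d - 1} = insert (v + int d') {v..v + int d' - 1}" using Suc by auto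
    let ?X = "(\<lambda>y. y - (u + int k)) ` {v..v + int d - 1}" and ?Y = "(\<lambda>a. v + int d' - a) ` {u..u + int k - 1}"
    have X: "?X = {v - u - int k..v + int d' - u - int k}"
      using Suc by (simp add: image_diff_atLeastAtMost algebra_simps)
    have Y: "?Y = {v + int d' - u - int k + 1..v + int d' - u}"
      by (simp add: algebra_simps)
    have c: "?c = 2 * v + int d' - 2 * u - int k" using Suc by simp
    have hook: "{z. \<bar>2 * z - ?c\<bar> < int (k + d' + 1)} = ?X \<union> ?Y"
      unfolding X Y c by (intro set_eqI, simp only: mem_Collect_eq Un_iff atLeastAtMost_iff of_nat_add of_nat_1) presburger
    have disj: "?X \<inter> ?Y = {}" unfolding X Y by (intro equals0I, simp only: Int_iff atLeastAtMost_iff) presburger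
    have "(\<Sum>a\<in>{u..u + int (Suc k) - 1}. \<Sum>y\<in>{v..v + int d - 1}. f (y - a))
      = (\<Sum>y\<in>{v..v + int d - 1}. f (y - (u + int k))) + (\<Sum>a\<in>{u..u + int k - 1}. \<Sum>y\<in>{v..v + int d - 1}. f (y - a))"
      unfolding e1 by (subst sum.insert) auto
    also have "(\<Sum>a\<in>{u..u + int k - 1}. \<Sum>y\<in>{v..v + int d - 1}. f (y - a))
      = (\<Sum>a\<in>{u..u + int k - 1}. f (v + int d' - a)) + (\<Sum>a\<in>{u..u + int k - 1}. \<Sum>y\<in>{v..v + int d' - 1}. f (y - a))"
      unfolding e2 by (subst sum.insert) (auto simp: sum.distrib)
    also have "(\<Sum>y\<in>{v..v + int d - 1}. f (y - (u + int k))) + ((\<Sum>a\<in>{u..u + int k - 1}. f (v + int d' - a)) + (\<Sum>a\<in>{u..u + int k - 1}. \<Sum>y\<in>{v..v + int d' - 1}. f (y - a)))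
      = (\<Sum>z\<in>?X \<union> ?Y. f z) + (\<Sum>a\<in>{u..u + int k - 1}. \<Sum>y\<in>{v..v + int d' - 1}. f (y - a))"
    proof -
      have "(\<Sum>z\<in>?X \<union> ?Y. f z) = (\<Sum>z\<in>?X. f z) + (\<Sum>z\<in>?Y. f z)"
        by (rule sum.union_disjoint[OF _ _ disj]) auto
      moreover have "(\<Sum>z\<in>?X. f z) = (\<Sum>y\<in>{v..v + int d - 1}. f (y - (u + int k)))"
        by (subst sum.reindex) (auto simp: inj_on_def)
      moreover have "(\<Sum>z\<in>?Y. f z) = (\<Sum>a\<in>{u..u + int k - 1}. f (v + int d' - a))"
        by (subst sum.reindex) (auto simp: inj_on_def)
      ultimately show ?thesis by linarith
    qed
    also have "\<dots> = (\<Sum>z\<in>{z. \<bar>2 * z - ?c\<bar> < int (k + d' + 1)}. f z) + hooks (\<lambda>l. \<Sum>z\<in>{z. \<bar>2 * z - ?c\<bar> < int l}. f z) k d'"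
    proof -
      have "2 * v + int d' - 2 * u - int k = ?c" using Suc by simp
      then show ?thesis unfolding hook Suc.IH by (simp only:)
    qed
    also have "\<dots> = hooks (\<lambda>l. \<Sum>z\<in>{z. \<bar>2 * z - ?c\<bar> < int l}. f z) (Suc k) d"
    proof -
      have "hooks B (Suc k) d = B (k + d' + 1) + hooks B k d'" for B using Suc by simp
      then show ?thesis by simp
    qed
    finally show ?thesis .
  qed
qed

text \<open>
  Sets of size \<open>l\<close> are compared with the window of \<open>l\<close> consecutive integers centred at \<open>e / 2\<close>; the parity
  condition says that such a window exists.
\<close>

definition dominated :: "real \<Rightarrow> real pmf \<Rightarrow> int pmf \<Rightarrow> int \<Rightarrow> bool"
  where "dominated C p \<zeta> e \<longleftrightarrow> (\<forall>D. finite D \<longrightarrow> D \<noteq> {} \<longrightarrow> odd (int (card D) + e) \<longrightarrow>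
    measure_pmf.prob p D \<le> C * measure_pmf.prob \<zeta> {z. \<bar>2 * z - e\<bar> < int (card D)})"

lemma prob_conv_uniform:
  fixes A :: "'a::ab_group_add set"
  assumes A: "finite A" "A \<noteq> {}" and p: "finite (set_pmf p)" and D: "finite D"
  shows "measure_pmf.prob (conv (pmf_of_set A) p) D = (\<Sum>a\<in>A. \<Sum>y\<in>D. pmf p (y - a)) / real (card A)"
proof -
  have "measure_pmf.prob (conv (pmf_of_set A) p) D = EE (conv (pmf_of_set A) p) (\<lambda>x. of_bool (x \<in> D))"
    by (simp only: EE_of_bool)
  also have "\<dots> = EE (pmf_of_set A) (\<lambda>a. EE p (\<lambda>x. of_bool (a + x \<in> D)))"
    using A p by (intro EE_conv) auto
  also have "\<dots> = EE (pmf_of_set A) (\<lambda>a. \<Sum>y\<in>D. pmf p (y - a))"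
  proof (rule EE_cong)
    fix a
    have "EE p (\<lambda>x. of_bool (a + x \<in> D)) = measure_pmf.prob p ((\<lambda>y. y - a) ` D)"
      unfolding EE_of_bool' by (rule arg_cong[where f = "measure_pmf.prob p"]) (force simp: image_iff algebra_simps)
    also have "\<dots> = (\<Sum>y\<in>D. pmf p (y - a))"
      using D by (simp add: measure_measure_pmf_finite sum.reindex inj_on_def)
    finally show "EE p (\<lambda>x. of_bool (a + x \<in> D)) = (\<Sum>y\<in>D. pmf p (y - a))" .
  qed
  also have "\<dots> = (\<Sum>a\<in>A. \<Sum>y\<in>D. pmf p (y - a)) / real (card A)"
    by (rule integral_pmf_of_set[OF A(2,1)])
  finally show ?thesis .
qed

lemma centered_interval:
  fixes e :: int and l :: nat
  assumes "odd (int l + e)"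
  shows "\<exists>v. 2 * v + int l - 1 = e \<and> {z :: int. \<bar>2 * z - e\<bar> < int l} = {v..v + int l - 1}"
proof -
  obtain c where c: "int l + e = 2 * c + 1" using assms by (elim oddE)
  show ?thesis by (rule exI[of _ "c - int l + 1"]) (use c in \<open>auto simp: abs_less_iff\<close>)
qed

text \<open>The hooks of the differences between \<open>D\<close> and \<open>A\<close> all have the
  parity required by the hypothesis, which bounds each of them by a window. The interval and the
  centred window of the same sizes have the same hook lengths, and there the windows are the hooks.
  As \<open>e\<close> is twice a centre, it moves by \<open>k - 1\<close>, twice the mean of the
  uniform law.\<close>

lemma dominated_conv:
  assumes dom: "dominated C p \<zeta> e" and A: "finite A" "card A = k" "0 < k"
    and p: "finite (set_pmf p)" and \<zeta>: "finite (set_pmf \<zeta>)"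
  shows "dominated C (conv (pmf_of_set A) p) (conv (pmf_of_set {0..int k - 1}) \<zeta>) (e + int k - 1)"
  unfolding dominated_def
proof (intro allI impI)
  fix D :: "real set" assume D: "finite D" "D \<noteq> {}" and par: "odd (int (card D) + (e + int k - 1))"
  have A0: "A \<noteq> {}" using A by auto
  let ?B = "\<lambda>l. measure_pmf.prob \<zeta> {z. \<bar>2 * z - e\<bar> < int l}"
  have "measure_pmf.prob (conv (pmf_of_set A) p) D = (\<Sum>a\<in>A. \<Sum>y\<in>D. pmf p (y - a)) / real k"
    unfolding A(2)[symmetric] by (rule prob_conv_uniform[OF A(1) A0 p D(1)])
  also have "(\<Sum>a\<in>A. \<Sum>y\<in>D. pmf p (y - a)) \<le> hooks (\<lambda>l. C * ?B l) (card A) (card D)"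
  proof (rule double_sum_le_hooks[OF A(1) D(1)])
    show "(\<Sum>z\<in>E. pmf p z) \<le> C * ?B (card E)" if "finite E" "E \<noteq> {}" "odd (int (card E) + e)" for E
      using dom that unfolding dominated_def by (metis measure_measure_pmf_finite)
    show "even (int (card A) + int (card D) + e)" using par unfolding A(2) by presburger
  qed
  also have "\<dots> = C * hooks ?B k (card D)" unfolding hooks_cmult A(2) ..
  also have "hooks ?B k (card D) = (\<Sum>a\<in>{0..int k - 1}. \<Sum>y\<in>{z. \<bar>2 * z - (e + int k - 1)\<bar> < int (card D)}. pmf \<zeta> (y - a))"
  proof -
    obtain v where v: "2 * v + int (card D) - 1 = e + int k - 1"
      "{z :: int. \<bar>2 * z - (e + int k - 1)\<bar> < int (card D)} = {v..v + int (card D) - 1}"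
      using centered_interval[OF par] by auto
    have e: "2 * v + int (card D) - 2 * 0 - int k = e" using v(1) by simp
    have "finite {z. \<bar>2 * z - e\<bar> < int l}" for l
      by (rule finite_subset[of _ "{- \<bar>e\<bar> - int l..\<bar>e\<bar> + int l}"]) (auto simp: abs_less_iff)
    then have "?B = (\<lambda>l. \<Sum>z\<in>{z. \<bar>2 * z - e\<bar> < int l}. pmf \<zeta> z)"
      by (simp add: measure_measure_pmf_finite)
    then show ?thesis
      unfolding v(2) using double_sum_interval_eq_hooks[where f = "pmf \<zeta>" and u = 0 and k = k and v = v and d = "card D"] unfolding e add_0 by (simp only:)
  qed
  also have "C * (\<Sum>a\<in>{0..int k - 1}. \<Sum>y\<in>{z. \<bar>2 * z - (e + int k - 1)\<bar> < int (card D)}. pmf \<zeta> (y - a)) / real k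
    = C * measure_pmf.prob (conv (pmf_of_set {0..int k - 1}) \<zeta>) {z. \<bar>2 * z - (e + int k - 1)\<bar> < int (card D)}"
  proof -
    have "finite {z. \<bar>2 * z - (e + int k - 1)\<bar> < int (card D)}"
      using centered_interval[OF par] by auto
    then show ?thesis using A(3) \<zeta> by (subst prob_conv_uniform) auto
  qed
  finally show "measure_pmf.prob (conv (pmf_of_set A) p) D
    \<le> C * measure_pmf.prob (conv (pmf_of_set {0..int k - 1}) \<zeta>) {z. \<bar>2 * z - (e + int k - 1)\<bar> < int (card D)}"
    by (simp add: divide_right_mono)
qed

text \<open>One use of \<open>dominated_conv\<close> per index of \<open>J\<close>. The auxiliary
  law \<open>W\<close> commutes with all convolutions and is carried along unchanged.\<close>

lemma dominated_psum:
  fixes k :: "nat \<Rightarrow> nat"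
  assumes "finite J" "finite S" "S \<inter> J = {}"
    and dom: "dominated C (psum S q) (conv W (psum S r)) e"
    and S: "\<And>i. i \<in> S \<Longrightarrow> finite (set_pmf (q i)) \<and> finite (set_pmf (r i))" and W: "finite (set_pmf W)"
    and J: "\<And>j. j \<in> J \<Longrightarrow> finite (A j) \<and> card (A j) = k j \<and> 0 < k j \<and> q j = pmf_of_set (A j) \<and> r j = pmf_of_set {0..int (k j) - 1}"
  shows "dominated C (psum (J \<union> S) q) (conv W (psum (J \<union> S) r)) (e + (\<Sum>j\<in>J. int (k j) - 1))"
  using assms(1,3) J
proof (induction J rule: finite_induct)
  case empty
  then show ?case using dom by simp
next
  case (insert j J)
  have fin: "finite (set_pmf (q i)) \<and> finite (set_pmf (r i))" if "i \<in> J \<union> S" for i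
  proof (cases "i \<in> J")
    case True
    then have "A i \<noteq> {}" "finite (A i)" "0 < k i" "q i = pmf_of_set (A i)" "r i = pmf_of_set {0..int (k i) - 1}"
      using insert.prems(2)[of i] by auto
    then show ?thesis by simp
  qed (use that S in auto)
  have IH: "dominated C (psum (J \<union> S) q) (conv W (psum (J \<union> S) r)) (e + (\<Sum>j\<in>J. int (k j) - 1))"
    using insert by auto
  have j: "finite (A j)" "card (A j) = k j" "0 < k j" "q j = pmf_of_set (A j)" "r j = pmf_of_set {0..int (k j) - 1}"
    using insert.prems(2)[of j] by auto
  have nJ: "finite (J \<union> S)" "j \<notin> J \<union> S" using insert assms(2) by auto
  have "dominated C (conv (pmf_of_set (A j)) (psum (J \<union> S) q)) (conv (pmf_of_set {0..int (k j) - 1}) (conv W (psum (J \<union> S) r)))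
    ((e + (\<Sum>j\<in>J. int (k j) - 1)) + int (k j) - 1)"
    using fin nJ W by (intro dominated_conv[OF IH j(1-3)] set_conv finite_set_psum) auto
  then show ?case
    unfolding j(4,5)[symmetric] conv_left_commute[of "r j" W]
    using nJ insert.hyps by (simp add: psum_insert algebra_simps)
qed

text \<open>For a singleton the window is the single point \<open>e / 2\<close>, an integer since
  \<open>e\<close> is even. The mass of \<open>conv W P\<close> there is an average of point masses
  of \<open>P\<close>, so some point of \<open>P\<close> has at least that mass, and the auxiliary
  law disappears.\<close>

lemma dominated_pmf_le:
  assumes dom: "dominated C p (conv W P) e" and e: "even e" and W: "finite (set_pmf W)" and P: "finite (set_pmf P)"
    and C: "0 \<le> C"
  shows "\<exists>z. \<forall>s. pmf p s \<le> C * pmf P z"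
proof -
  obtain c where c: "e = 2 * c" using e by (elim evenE)
  have i: "{z :: int. \<bar>2 * z - e\<bar> < int (card {s :: real})} = {c}" for s unfolding c by auto
  have 1: "pmf p s \<le> C * pmf (conv W P) c" for s
  proof -
    have "measure_pmf.prob p {s} \<le> C * measure_pmf.prob (conv W P) {z. \<bar>2 * z - e\<bar> < int (card {s})}"
      using dom e unfolding dominated_def by (intro dom[unfolded dominated_def, rule_format]) auto
    then show ?thesis unfolding i measure_pmf_single .
  qed
  have "pmf (conv W P) c = EE (conv W P) (\<lambda>x. of_bool (x = c) * 1)" by (simp only: EE_single)
  also have "\<dots> = EE W (\<lambda>x. EE P (\<lambda>y. of_bool (y = c - x) * 1))"
    by (subst EE_conv[OF W P]) (simp add: eq_diff_eq algebra_simps)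
  also have "\<dots> = EE W (\<lambda>x. pmf P (c - x))" unfolding EE_single by simp
  also have "\<dots> \<le> EE W (\<lambda>x. Max ((\<lambda>x. pmf P (c - x)) ` set_pmf W))"
    using W by (intro EE_mono) auto
  finally have 2: "pmf (conv W P) c \<le> Max ((\<lambda>x. pmf P (c - x)) ` set_pmf W)" by simp
  have "Max ((\<lambda>x. pmf P (c - x)) ` set_pmf W) \<in> (\<lambda>x. pmf P (c - x)) ` set_pmf W"
    using W set_pmf_not_empty by (intro Max_in) auto
  then obtain x where "Max ((\<lambda>x. pmf P (c - x)) ` set_pmf W) = pmf P (c - x)" by auto
  then have "pmf p s \<le> C * pmf P (c - x)" for s
    using 1[of s] 2 C by (smt (verit) mult_left_mono)
  then show ?thesis by blast
qed

section \<open>The extremal distributions\<close>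

definition num_full :: "real \<Rightarrow> nat" where "num_full \<alpha> = nat \<lfloor>1 / \<alpha>\<rfloor>"

abbreviation nu_variance :: "real \<Rightarrow> real" where "nu_variance \<alpha> \<equiv> Var (nu \<alpha>) real_of_int"

lemma num_full_bounds:
  assumes "0 < \<alpha>" "\<alpha> \<le> 1"
  shows "1 \<le> num_full \<alpha>" "\<alpha> * real (num_full \<alpha>) \<le> 1" "1 < \<alpha> * (real (num_full \<alpha>) + 1)" "int (num_full \<alpha>) = \<lfloor>1 / \<alpha>\<rfloor>"
proof -
  have "1 \<le> 1 / \<alpha>" using assms by simp
  then have f: "1 \<le> \<lfloor>1 / \<alpha>\<rfloor>" by (simp add: le_floor_iff)
  have "0 \<le> \<lfloor>1 / \<alpha>\<rfloor>" using f by linarith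
  then show i: "int (num_full \<alpha>) = \<lfloor>1 / \<alpha>\<rfloor>" by (simp only: num_full_def nat_0_le)
  have "int 1 \<le> int (num_full \<alpha>)" using f unfolding i by simp
  then show "1 \<le> num_full \<alpha>" by (simp only: of_nat_le_iff)
  have r: "real (num_full \<alpha>) = real_of_int \<lfloor>1 / \<alpha>\<rfloor>" using i by (metis of_int_of_nat_eq)
  have "real (num_full \<alpha>) \<le> 1 / \<alpha>" unfolding r by (rule of_int_floor_le)
  then show "\<alpha> * real (num_full \<alpha>) \<le> 1" using assms by (simp add: field_simps)
  have "1 / \<alpha> < real (num_full \<alpha>) + 1" unfolding r by linarith
  then show "1 < \<alpha> * (real (num_full \<alpha>) + 1)" using assms by (simp add: field_simps)
qed

lemma pmf_nu_alt:
  assumes "0 < \<alpha>" "\<alpha> \<le> 1"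
  shows "pmf (nu \<alpha>) i = (if i \<in> {0..<int (num_full \<alpha>)} then \<alpha> else if i = int (num_full \<alpha>) then 1 - \<alpha> * real (num_full \<alpha>) else 0)"
proof -
  have "real (num_full \<alpha>) = real_of_int \<lfloor>1 / \<alpha>\<rfloor>" using num_full_bounds(4)[OF assms] by (metis of_int_of_nat_eq)
  then show ?thesis
    unfolding pmf_nu[OF assms] nu_mass_def num_full_bounds(4)[OF assms, symmetric] by auto
qed

lemma set_nu:
  assumes "0 < \<alpha>" "\<alpha> \<le> 1"
  shows "set_pmf (nu \<alpha>) = (if \<alpha> * real (num_full \<alpha>) = 1 then {0..<int (num_full \<alpha>)} else {0..int (num_full \<alpha>)})"
  using assms by (auto simp: set_pmf_iff pmf_nu_alt split: if_splits)

lemma finite_set_nu [simp]: "0 < \<alpha> \<Longrightarrow> \<alpha> \<le> 1 \<Longrightarrow> finite (set_pmf (nu \<alpha>))"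
  by (simp add: set_nu)

lemma set_nu_bound: "0 < \<alpha> \<Longrightarrow> \<alpha> \<le> 1 \<Longrightarrow> x \<in> set_pmf (nu \<alpha>) \<Longrightarrow> 0 \<le> x \<and> x \<le> int (num_full \<alpha>)"
  by (auto simp: set_nu split: if_splits)

lemma pmf_nu_le: "0 < \<alpha> \<Longrightarrow> \<alpha> \<le> 1 \<Longrightarrow> pmf (nu \<alpha>) i \<le> \<alpha>"
  using num_full_bounds(3)[of \<alpha>] by (auto simp: pmf_nu_alt algebra_simps)

lemma EE_nu:
  assumes "0 < \<alpha>" "\<alpha> \<le> 1"
  shows "EE (nu \<alpha>) g = \<alpha> * (\<Sum>i<num_full \<alpha>. g (int i)) + (1 - \<alpha> * real (num_full \<alpha>)) * g (int (num_full \<alpha>))"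
proof -
  have "EE (nu \<alpha>) g = (\<Sum>i\<in>{0..int (num_full \<alpha>)}. g i * pmf (nu \<alpha>) i)"
    using set_nu_bound[OF assms] by (subst integral_measure_pmf[of "{0..int (num_full \<alpha>)}"]) (auto simp: mult.commute)
  also have "{0..int (num_full \<alpha>)} = insert (int (num_full \<alpha>)) (int ` {..<num_full \<alpha>})"
    using image_int_atLeastLessThan[of 0 "num_full \<alpha>"] by (auto simp: atLeast0LessThan)
  also have "(\<Sum>i\<in>\<dots>. g i * pmf (nu \<alpha>) i) = g (int (num_full \<alpha>)) * pmf (nu \<alpha>) (int (num_full \<alpha>)) + (\<Sum>i<num_full \<alpha>. g (int i) * pmf (nu \<alpha>) (int i))"
    by (subst sum.insert) (auto simp: sum.reindex)
  also have "(\<Sum>i<num_full \<alpha>. g (int i) * pmf (nu \<alpha>) (int i)) = (\<Sum>i<num_full \<alpha>. \<alpha> * g (int i))"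
    using assms by (intro sum.cong) (auto simp: pmf_nu_alt)
  finally show ?thesis using assms by (simp add: pmf_nu_alt sum_distrib_left mult.commute)
qed

lemma sum_real_lessThan: "(\<Sum>i<k. real i) = real k * (real k - 1) / 2"
  by (induction k) (auto simp: field_simps)

lemma sum_sq_centered: "(\<Sum>i<k. (real i - (real k - 1) / 2)\<^sup>2) = real k * ((real k)\<^sup>2 - 1) / 12"
proof -
  have q: "(\<Sum>i<k. (real i)\<^sup>2) = real k * (real k - 1) * (2 * real k - 1) / 6"
    by (induction k) (auto simp: field_simps power2_eq_square)
  have "(\<Sum>i<k. (real i - c)\<^sup>2) = (\<Sum>i<k. (real i)\<^sup>2) - 2 * c * (\<Sum>i<k. real i) + real k * c\<^sup>2" for c
    by (simp add: power2_diff sum.distrib sum_subtractf sum_distrib_left mult_ac)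
  from this[of "(real k - 1) / 2"] show ?thesis
    unfolding q sum_real_lessThan by (simp add: field_simps power2_eq_square)
qed

lemma sum_sq_ge_centered: "real k * ((real k)\<^sup>2 - 1) / 12 \<le> (\<Sum>i<k. (real i - c)\<^sup>2)"
proof -
  let ?m = "(real k - 1) / 2"
  have "(\<Sum>i<k. (real i - c)\<^sup>2) = (\<Sum>i<k. (real i - ?m)\<^sup>2 + (2 * (?m - c) * (real i - ?m) + (?m - c)\<^sup>2))"
    by (intro sum.cong) (auto simp: power2_eq_square field_simps)
  also have "\<dots> = (\<Sum>i<k. (real i - ?m)\<^sup>2) + (2 * (?m - c) * (\<Sum>i<k. real i - ?m) + real k * (?m - c)\<^sup>2)"
    by (simp only: sum.distrib sum_distrib_left) simp
  also have "(\<Sum>i<k. real i - ?m) = 0" by (simp add: sum_subtractf sum_real_lessThan)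
  finally show ?thesis unfolding sum_sq_centered by simp
qed

text \<open>Second moment about the centre of the full atoms, from which the last atom has distance
  \<open>(k + 1) / 2\<close>.\<close>

lemma nu_variance_upper:
  assumes "0 < \<alpha>" "\<alpha> \<le> 1"
  shows "nu_variance \<alpha> \<le> ((real (num_full \<alpha>))\<^sup>2 - 1) / 12 + (1 - \<alpha> * real (num_full \<alpha>)) * (real (num_full \<alpha>) + 1)\<^sup>2 / 4"
proof -
  let ?k = "real (num_full \<alpha>)" let ?c = "(?k - 1) / 2"
  have k: "1 \<le> ?k" "\<alpha> * ?k \<le> 1" using num_full_bounds[OF assms] by auto
  have "nu_variance \<alpha> \<le> EE (nu \<alpha>) (\<lambda>x. (real_of_int x - ?c)\<^sup>2)" using assms by (intro Var_le) auto
  also have "\<dots> = (\<alpha> * ?k) * ((?k\<^sup>2 - 1) / 12) + (1 - \<alpha> * ?k) * (?k - ?c)\<^sup>2"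
    unfolding EE_nu[OF assms] using sum_sq_centered[of "num_full \<alpha>"] by (simp add: mult_ac)
  also have "(?k - ?c)\<^sup>2 = (?k + 1)\<^sup>2 / 4" by (simp add: power2_eq_square field_simps)
  also have "(\<alpha> * ?k) * ((?k\<^sup>2 - 1) / 12) \<le> 1 * ((?k\<^sup>2 - 1) / 12)"
    using k by (intro mult_right_mono) (auto simp: one_le_power)
  finally show ?thesis by simp
qed

text \<open>The \<open>k\<close> full atoms alone suffice: each has mass at least
  \<open>1 / (k + 1)\<close>, which gives \<open>k * (k - 1) / 12\<close>, and this is at least
  \<open>k\<^sup>2 / 24\<close> for \<open>k\<close> at least 2.\<close>

lemma nu_variance_lower:
  assumes "0 < \<alpha>" "\<alpha> \<le> 1" "2 \<le> num_full \<alpha>"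
  shows "(real (num_full \<alpha>))\<^sup>2 / 24 \<le> nu_variance \<alpha>"
proof -
  let ?k = "real (num_full \<alpha>)" let ?m = "EE (nu \<alpha>) real_of_int"
  have k: "2 \<le> ?k" using assms(3) by simp
  have "?k\<^sup>2 / 24 \<le> (1 / (?k + 1)) * (?k * (?k\<^sup>2 - 1) / 12)"
  proof -
    have A: "(1 / (?k + 1)) * (?k * (?k\<^sup>2 - 1) / 12) = ?k * (?k - 1) / 12"
      using k by (simp add: field_simps power2_eq_square)
    have "?k * ?k \<le> ?k * (2 * (?k - 1))" using k by (intro mult_left_mono) auto
    then have "?k * ?k / 24 \<le> ?k * (?k - 1) / 12" by (simp add: field_simps)
    then show ?thesis unfolding A by (simp only: power2_eq_square)
  qed
  also have "\<dots> \<le> \<alpha> * (\<Sum>i<num_full \<alpha>. (real i - ?m)\<^sup>2)"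
  proof (rule mult_mono)
    show "1 / (?k + 1) \<le> \<alpha>" using num_full_bounds(3)[OF assms(1,2)] k by (simp add: field_simps)
    show "?k * (?k\<^sup>2 - 1) / 12 \<le> (\<Sum>i<num_full \<alpha>. (real i - ?m)\<^sup>2)" by (rule sum_sq_ge_centered)
    show "0 \<le> ?k * (?k\<^sup>2 - 1) / 12" using k by (simp add: one_le_power)
  qed (use assms in auto)
  also have "\<dots> \<le> nu_variance \<alpha>"
    unfolding Var_def EE_nu[OF assms(1,2)] using num_full_bounds(2)[OF assms(1,2)] by simp
  finally show ?thesis .
qed

lemma nu_inverse:
  assumes "1 \<le> k"
  shows "num_full (1 / real k) = k" "nu (1 / real k) = pmf_of_set {0..int k - 1}"
proof -
  show k: "num_full (1 / real k) = k" by (simp add: num_full_def)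
  have a: "0 < 1 / real k" "1 / real k \<le> 1" using assms by auto
  show "nu (1 / real k) = pmf_of_set {0..int k - 1}"
    by (rule pmf_eqI) (use assms a in \<open>auto simp: pmf_nu_alt k pmf_of_set indicator_def\<close>)
qed

lemma bij_rk:
  assumes "finite (set_pmf p)"
  shows "bij_betw (rk p) (set_pmf p) (real ` {..<card (set_pmf p)})"
proof -
  have inj: "inj_on (rk p) (set_pmf p)"
  proof (rule linorder_inj_onI)
    fix x y assume "x < y" "x \<in> set_pmf p" "y \<in> set_pmf p"
    then have "card {z \<in> set_pmf p. z < x} < card {z \<in> set_pmf p. z < y}"
      using assms by (intro psubset_card_mono) auto
    then show "rk p x \<noteq> rk p y" by (simp add: rk_def)
  qed auto
  have "rk p ` set_pmf p \<subseteq> real ` {..<card (set_pmf p)}"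
  proof
    fix r assume "r \<in> rk p ` set_pmf p"
    then obtain x where x: "x \<in> set_pmf p" "r = rk p x" by auto
    have "card {z \<in> set_pmf p. z < x} < card (set_pmf p)"
      using assms x by (intro psubset_card_mono) auto
    then show "r \<in> real ` {..<card (set_pmf p)}" using x by (auto simp: rk_def)
  qed
  then have "rk p ` set_pmf p = real ` {..<card (set_pmf p)}"
    using inj by (intro card_subset_eq) (auto simp: card_image inj_on_def)
  then show ?thesis using inj by (simp add: bij_betw_def)
qed

text \<open>Among all placements of the atom of mass \<open>\<beta>\<close>, an end of the support gives the smallest variance.\<close>

lemma Var_rk_ge:
  assumes \<alpha>: "0 < \<alpha>" "\<alpha> \<le> 1" and inj: "inj_on f (set_pmf (nu \<alpha>))"
  defines "p \<equiv> map_pmf f (nu \<alpha>)"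
  shows "nu_variance \<alpha> \<le> Var p (rk p)"
proof -
  define k where "k = num_full \<alpha>" define \<beta> where "\<beta> = 1 - \<alpha> * real k"
  have \<beta>: "0 \<le> \<beta>" "\<beta> < \<alpha>" using num_full_bounds[OF \<alpha>] by (auto simp: \<beta>_def k_def algebra_simps)
  have fin: "finite (set_pmf p)" using \<alpha> by (simp add: p_def)
  have sp: "set_pmf p = f ` set_pmf (nu \<alpha>)" by (simp add: p_def)
  have cp: "card (set_pmf p) = card (set_pmf (nu \<alpha>))" unfolding sp by (rule card_image[OF inj])
  have V: "Var p (rk p) = EE p (\<lambda>x. (rk p x)\<^sup>2) - (EE p (rk p))\<^sup>2" "nu_variance \<alpha> = EE (nu \<alpha>) (\<lambda>x. (real_of_int x)\<^sup>2) - (EE (nu \<alpha>) real_of_int)\<^sup>2"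
    using fin \<alpha> by (auto intro!: Var_eq)
  show ?thesis
  proof (cases "\<beta> = 0")
    case True
    then have s: "set_pmf (nu \<alpha>) = {0..<int k}" using \<alpha> by (simp add: set_nu \<beta>_def k_def)
    have "EE p (\<lambda>x. g (rk p x)) = EE (nu \<alpha>) (\<lambda>x. g (real_of_int x))" for g
    proof -
      have "EE p (\<lambda>x. g (rk p x)) = EE (nu \<alpha>) (\<lambda>x. g (rk p (f x)))" by (simp add: p_def)
      also have "\<dots> = (\<Sum>x\<in>set_pmf (nu \<alpha>). \<alpha> * g (rk p (f x)))"
        using \<alpha> unfolding EE_sum[OF finite_set_nu[OF \<alpha>]] by (intro sum.cong) (auto simp: s pmf_nu_alt k_def)
      also have "\<dots> = \<alpha> * (\<Sum>y\<in>set_pmf p. g (rk p y))"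
        unfolding sp sum.reindex[OF inj] by (simp add: sum_distrib_left)
      also have "(\<Sum>y\<in>set_pmf p. g (rk p y)) = (\<Sum>r\<in>real ` {..<card (set_pmf p)}. g r)"
        by (rule sum.reindex_bij_betw[OF bij_rk[OF fin]])
      also have "\<dots> = (\<Sum>i<k. g (real i))" unfolding cp s by (simp add: sum.reindex)
      finally show ?thesis unfolding EE_nu[OF \<alpha>] using True by (simp add: \<beta>_def k_def)
    qed
    from this[of "\<lambda>x. x\<^sup>2"] this[of "\<lambda>x. x"] show ?thesis unfolding V by simp
  next
    case False
    then have s: "set_pmf (nu \<alpha>) = {0..int k}" using \<alpha> by (simp add: set_nu \<beta>_def k_def)
    define j where "j = rk p (f (int k))"
    have jk: "0 \<le> j" "j \<le> real k"
      using rk_nonneg[of p "f (int k)"] rk_le[OF fin, of "f (int k)"] unfolding cp by (auto simp: j_def sp s)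
    have "EE p (\<lambda>x. g (rk p x)) = \<alpha> * (\<Sum>i<Suc k. g (real i)) - (\<alpha> - \<beta>) * g j" for g
    proof -
      have "EE p (\<lambda>x. g (rk p x)) = EE (nu \<alpha>) (\<lambda>x. g (rk p (f x)))" by (simp add: p_def)
      also have "\<dots> = (\<Sum>x\<in>set_pmf (nu \<alpha>). \<alpha> * g (rk p (f x)) - (if x = int k then (\<alpha> - \<beta>) * g (rk p (f x)) else 0))"
        using \<alpha> unfolding EE_sum[OF finite_set_nu[OF \<alpha>]]
        by (intro sum.cong) (auto simp: s pmf_nu_alt k_def \<beta>_def algebra_simps)
      also have "\<dots> = \<alpha> * (\<Sum>y\<in>set_pmf p. g (rk p y)) - (\<alpha> - \<beta>) * g j"
        unfolding sp sum.reindex[OF inj] sum_subtractf by (simp add: sum_distrib_left s j_def)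
      also have "(\<Sum>y\<in>set_pmf p. g (rk p y)) = (\<Sum>r\<in>real ` {..<card (set_pmf p)}. g r)"
        by (rule sum.reindex_bij_betw[OF bij_rk[OF fin]])
      also have "\<dots> = (\<Sum>i<Suc k. g (real i))"
      proof -
        have "card {0..int k} = Suc k" by simp
        then show ?thesis unfolding cp s by (simp only:) (simp add: sum.reindex del: sum.lessThan_Suc)
      qed
      finally show ?thesis .
    qed
    note E = this[of "\<lambda>x. x\<^sup>2"] this[of "\<lambda>x. x"]
    have E': "EE (nu \<alpha>) g = \<alpha> * (\<Sum>i<Suc k. g (int i)) - (\<alpha> - \<beta>) * g (int k)" for g
      unfolding EE_nu[OF \<alpha>] by (simp add: k_def \<beta>_def algebra_simps)
    define \<gamma> where "\<gamma> = \<alpha> - \<beta>"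
    define Q where "Q = (\<Sum>i<Suc k. (real i)\<^sup>2)"
    have P: "\<alpha> * (\<Sum>i<Suc k. real i) = real k * (1 + \<gamma>) / 2"
    proof -
      have s: "(\<Sum>i<Suc k. real i) = (real k + 1) * real k / 2"
        using sum_real_lessThan[of "Suc k"] by (simp add: add.commute)
      have "\<alpha> * ((real k + 1) * real k / 2) = (\<alpha> * (real k + 1)) * real k / 2" by simp
      also have "\<alpha> * (real k + 1) = 1 + \<gamma>" by (simp add: \<gamma>_def \<beta>_def algebra_simps)
      finally show ?thesis unfolding s by (simp only: mult.commute)
    qed
    \<comment> \<open>Here \<open>j\<close> is the rank of the light atom, which falls short of a
      full atom by the mass \<gamma>. The difference vanishes exactly when that atom is at one end,
      \<open>j = 0\<close> or \<open>j = k\<close>.\<close>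
    have "Var p (rk p) - nu_variance \<alpha> = \<gamma> * (real k - j) * ((1 + \<gamma>) * j)"
      unfolding V E unfolding E'[of "\<lambda>x. (real_of_int x)\<^sup>2"] E'[of real_of_int] of_int_of_nat_eq P Q_def[symmetric] \<gamma>_def[symmetric]
      by (simp add: power2_eq_square field_simps)
    moreover have "0 \<le> \<gamma> * (real k - j) * ((1 + \<gamma>) * j)"
      using jk \<beta> by (intro mult_nonneg_nonneg) (auto simp: \<gamma>_def)
    ultimately show ?thesis by linarith
  qed
qed

text \<open>A last atom of mass below \<open>\<rho>\<close> is removed by enlarging \<open>\<alpha>\<close> to the reciprocal of an integer.\<close>

definition round_up :: "real \<Rightarrow> real \<Rightarrow> real"
  where "round_up \<rho> \<alpha> = (if 2 \<le> num_full \<alpha> \<and> 1 - \<alpha> * real (num_full \<alpha>) < \<rho> then 1 / real (num_full \<alpha>) else \<alpha>)"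

text \<open>The last clause is the mass condition of \<open>rank_family\<close>. With more than two
  atoms, a law that is left alone has no atom lighter than \<rho>; one that is rounded becomes
  uniform on \<open>k\<close> points, and \<open>(k - 1) / k\<close> is at least 1/2.\<close>

lemma round_up:
  assumes \<alpha>: "0 < \<alpha>" "\<alpha> \<le> 1" and \<rho>: "0 < \<rho>" "\<rho> \<le> 1/2"
  shows "0 < round_up \<rho> \<alpha>" "round_up \<rho> \<alpha> \<le> 1" "\<alpha> \<le> round_up \<rho> \<alpha>" "num_full (round_up \<rho> \<alpha>) = num_full \<alpha>"
    "nu_variance \<alpha> \<le> (1 + 9 * \<rho>) * nu_variance (round_up \<rho> \<alpha>)"
    "x \<in> set_pmf (nu (round_up \<rho> \<alpha>)) \<Longrightarrow> card (set_pmf (nu (round_up \<rho> \<alpha>))) \<le> 2 \<or>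
      \<rho> \<le> pmf (nu (round_up \<rho> \<alpha>)) x * (real (card (set_pmf (nu (round_up \<rho> \<alpha>)))) - 1)"
proof -
  let ?k = "num_full \<alpha>" let ?a = "round_up \<rho> \<alpha>"
  note k = num_full_bounds[OF \<alpha>]
  have k0: "0 < real ?k" using k(1) by simp
  show a: "0 < ?a" "?a \<le> 1" "\<alpha> \<le> ?a" "num_full ?a = ?k"
    using \<alpha> k k0 nu_inverse(1)[of ?k] by (auto simp: round_up_def field_simps)
  show "nu_variance \<alpha> \<le> (1 + 9 * \<rho>) * nu_variance ?a"
  proof (cases "2 \<le> ?k \<and> 1 - \<alpha> * real ?k < \<rho>")
    case False
    then have "?a = \<alpha>" by (simp only: round_up_def if_False)
    moreover have "1 * nu_variance \<alpha> \<le> (1 + 9 * \<rho>) * nu_variance \<alpha>" using \<rho> Var_nonneg by (intro mult_right_mono) auto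
    ultimately show ?thesis by simp
  next
    case True
    let ?r = "real ?k" let ?b = "1 - \<alpha> * ?r"
    have r: "2 \<le> ?r" and b: "0 \<le> ?b" "?b \<le> \<rho>" using True k by auto
    have a': "?a = 1 / ?r" using True by (simp add: round_up_def)
    have "(?r\<^sup>2 - 1) / 12 \<le> nu_variance ?a"
    proof -
      have "(?r\<^sup>2 - 1) / 12 = (1 / ?r) * (?r * (?r\<^sup>2 - 1) / 12)" using r by simp
      also have "\<dots> \<le> (1 / ?r) * (\<Sum>i<?k. (real i - EE (nu ?a) real_of_int)\<^sup>2)"
        by (intro mult_left_mono sum_sq_ge_centered) auto
      also have "\<dots> = nu_variance ?a" unfolding Var_def EE_nu[OF a(1,2)] a(4) using r by (simp add: a')
      finally show ?thesis .
    qed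
    moreover have "nu_variance \<alpha> \<le> (1 + 9 * \<rho>) * ((?r\<^sup>2 - 1) / 12)"
    proof -
      \<comment> \<open>Origin of the 9: for \<open>k\<close> at least 2, \<open>k + 1\<close> is at
        most \<open>3 * (k - 1)\<close>, so the squared distance of the last atom is at most 9 times
        the variance of the uniform law on \<open>k\<close> points.\<close>
      have "(?r + 1) * (?r + 1) \<le> (3 * (?r - 1)) * (?r + 1)" using r by (intro mult_right_mono) auto
      also have "(3 * (?r - 1)) * (?r + 1) = 3 * (?r\<^sup>2 - 1)" by (simp add: power2_eq_square algebra_simps)
      finally have "(?r + 1)\<^sup>2 \<le> 3 * (?r\<^sup>2 - 1)" unfolding power2_eq_square[of "?r + 1"] .
      then have "(?r + 1)\<^sup>2 / 4 \<le> 9 * ((?r\<^sup>2 - 1) / 12)" by linarith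
      then have "?b * ((?r + 1)\<^sup>2 / 4) \<le> \<rho> * (9 * ((?r\<^sup>2 - 1) / 12))" using b by (intro mult_mono) auto
      moreover have "?b * (?r + 1)\<^sup>2 / 4 = ?b * ((?r + 1)\<^sup>2 / 4)" by (rule times_divide_eq_right[symmetric])
      moreover have "(1 + 9 * \<rho>) * ((?r\<^sup>2 - 1) / 12) = (?r\<^sup>2 - 1) / 12 + \<rho> * (9 * ((?r\<^sup>2 - 1) / 12))"
        by (simp only: distrib_right mult_1_left mult_ac)
      ultimately show ?thesis using nu_variance_upper[OF \<alpha>] by linarith
    qed
    ultimately show ?thesis using \<rho> by (smt (verit) mult_left_mono)
  qed
  assume x: "x \<in> set_pmf (nu ?a)"
  show "card (set_pmf (nu ?a)) \<le> 2 \<or> \<rho> \<le> pmf (nu ?a) x * (real (card (set_pmf (nu ?a))) - 1)"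
  proof (cases "2 \<le> ?k \<and> 1 - \<alpha> * real ?k < \<rho>")
    case True
    then have a': "?a = 1 / real ?k" by (simp add: round_up_def)
    have n: "nu ?a = pmf_of_set {0..int ?k - 1}" unfolding a' by (rule nu_inverse(2)[OF k(1)])
    have ne: "{0..int ?k - 1} \<noteq> {}" using k(1) by auto
    have c: "card (set_pmf (nu ?a)) = ?k" unfolding n using ne by simp
    have p: "pmf (nu ?a) x = 1 / real ?k" using x unfolding n using ne by simp
    have "\<rho> \<le> 1 / real ?k * (real ?k - 1)"
    proof -
      have "1 / real ?k * (real ?k - 1) = 1 - 1 / real ?k" using k0 by (simp add: field_simps)
      moreover have "1 / real ?k \<le> 1 / 2" using True by (intro divide_left_mono) auto
      ultimately show ?thesis using \<rho> by linarith
    qed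
    then show ?thesis unfolding c p by simp
  next
    case False
    then have a': "?a = \<alpha>" by (simp only: round_up_def if_False)
    show ?thesis
    proof (cases "2 \<le> ?k")
      case True
      then have b: "\<rho> \<le> 1 - \<alpha> * real ?k" using False by simp
      then have s: "set_pmf (nu \<alpha>) = {0..int ?k}" using \<alpha> \<rho> by (simp add: set_nu)
      have "1 - \<alpha> * real ?k \<le> \<alpha>" using k(3) by (simp add: algebra_simps)
      then have "\<rho> \<le> pmf (nu \<alpha>) x" using x b \<alpha> unfolding a' s by (auto simp: pmf_nu_alt)
      moreover have "1 \<le> real (card (set_pmf (nu \<alpha>))) - 1" unfolding s using k(1) by simp
      ultimately have "\<rho> * 1 \<le> pmf (nu \<alpha>) x * (real (card (set_pmf (nu \<alpha>))) - 1)" using \<rho> by (intro mult_mono) auto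
      then show ?thesis unfolding a' by simp
    next
      case False
      then have "?k = 1" using k(1) by simp
      then have "set_pmf (nu \<alpha>) \<subseteq> {0, 1}" using set_nu_bound[OF \<alpha>] by force
      then have "card (set_pmf (nu \<alpha>)) \<le> card {0 :: int, 1}" by (intro card_mono) auto
      then show ?thesis unfolding a' by simp
    qed
  qed
qed

section \<open>The two regimes: many small summands, or one dominant summand\<close>

lemma exists_even_near: "\<exists>e :: int. even (e + p) \<and> \<bar>real_of_int e - x\<bar> \<le> 1"
proof -
  let ?y = "(x + real_of_int p) / 2"
  define t where "t = real_of_int (round ?y) - ?y"
  have "\<bar>t\<bar> \<le> 1 / 2" unfolding t_def by (rule of_int_round_abs_le)
  moreover have eq: "real_of_int (2 * round ?y - p) - x = 2 * t" by (simp add: t_def field_simps)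
  ultimately have "\<bar>real_of_int (2 * round ?y - p) - x\<bar> \<le> 1" unfolding eq by simp
  moreover have "even ((2 * round ?y - p) + p)" by simp
  ultimately show ?thesis by blast
qed

lemma card_set_nu:
  assumes "0 < \<alpha>" "\<alpha> \<le> 1"
  shows "real (card (set_pmf (nu \<alpha>))) - 1 \<le> real (num_full \<alpha>)"
proof -
  have "set_pmf (nu \<alpha>) \<subseteq> {0..int (num_full \<alpha>)}" using set_nu_bound[OF assms] by auto
  then have "card (set_pmf (nu \<alpha>)) \<le> card {0..int (num_full \<alpha>)}" by (intro card_mono) auto
  then show ?thesis by simp
qed

lemma nu_deviation:
  assumes "0 < \<alpha>" "\<alpha> \<le> 1" "x \<in> set_pmf (nu \<alpha>)"
  shows "\<bar>real_of_int x - EE (nu \<alpha>) real_of_int\<bar> \<le> real (num_full \<alpha>)"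
proof -
  have b: "0 \<le> real_of_int y \<and> real_of_int y \<le> real (num_full \<alpha>)" if "y \<in> set_pmf (nu \<alpha>)" for y
    using set_nu_bound[OF assms(1,2) that] by simp
  have "0 \<le> EE (nu \<alpha>) real_of_int" using b by (intro EE_nonneg) auto
  moreover have "EE (nu \<alpha>) real_of_int \<le> EE (nu \<alpha>) (\<lambda>_. real (num_full \<alpha>))" using b assms by (intro EE_mono) auto
  ultimately show ?thesis using b[OF assms(3)] by auto
qed

text \<open>\<open>K\<close> is the largest support size less one; the law attaining it has atoms of
  mass at most its rounded \<alpha>, hence at most \<open>1 / K\<close>. By
  \<open>Var_rk_ge\<close>, passing to ranks costs no variance beyond the rounding loss. The
  division of \<epsilon> by 3 allows for \<open>sqrt (1 + 9 * \<rho>)\<close>, which is at most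
  3.\<close>

lemma rank_family_nu:
  assumes S: "finite S" and \<alpha>: "\<And>i. i \<in> S \<Longrightarrow> 0 < \<alpha> i \<and> \<alpha> i \<le> 1" and \<rho>: "0 < \<rho>" "\<rho> \<le> 1/2"
    and inj: "\<And>i. i \<in> S \<Longrightarrow> inj_on (f i) (set_pmf (nu (round_up \<rho> (\<alpha> i))))"
    and \<sigma>: "0 < \<sigma>" "\<sigma>\<^sup>2 = (\<Sum>i\<in>S. nu_variance (\<alpha> i))" and k: "\<And>i. i \<in> S \<Longrightarrow> real (num_full (\<alpha> i)) \<le> \<epsilon> / 3 * \<sigma>"
    and \<epsilon>: "0 < \<epsilon>" and q: "\<And>i. i \<in> S \<Longrightarrow> q i = map_pmf (f i) (nu (round_up \<rho> (\<alpha> i)))"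
  shows "\<exists>K \<sigma>'. rank_family \<epsilon> \<rho> K S q \<sigma>' \<and> \<sigma> \<le> sqrt (1 + 9 * \<rho>) * \<sigma>'"
proof -
  let ?a = "\<lambda>i. round_up \<rho> (\<alpha> i)"
  have a: "0 < ?a i" "?a i \<le> 1" "num_full (?a i) = num_full (\<alpha> i)" "nu_variance (\<alpha> i) \<le> (1 + 9 * \<rho>) * nu_variance (?a i)" if "i \<in> S" for i
    using round_up[of "\<alpha> i" \<rho>] \<alpha>[OF that] \<rho> by auto
  have fq: "finite (set_pmf (q i))" if "i \<in> S" for i using a[OF that] q[OF that] by simp
  have cq: "card (set_pmf (q i)) = card (set_pmf (nu (?a i)))" if "i \<in> S" for i
    using q[OF that] inj[OF that] by (simp add: card_image)
  define V where "V = (\<Sum>i\<in>S. Var (q i) (rk (q i)))"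
  have "\<sigma>\<^sup>2 \<le> (\<Sum>i\<in>S. (1 + 9 * \<rho>) * Var (q i) (rk (q i)))"
    unfolding \<sigma>(2)
  proof (rule sum_mono)
    fix i assume i: "i \<in> S"
    have "nu_variance (?a i) \<le> Var (q i) (rk (q i))" unfolding q[OF i] by (rule Var_rk_ge[OF a(1,2)[OF i] inj[OF i]])
    then have "(1 + 9 * \<rho>) * nu_variance (?a i) \<le> (1 + 9 * \<rho>) * Var (q i) (rk (q i))" using \<rho> by (intro mult_left_mono) auto
    then show "nu_variance (\<alpha> i) \<le> (1 + 9 * \<rho>) * Var (q i) (rk (q i))" using a(4)[OF i] by linarith
  qed
  then have sV: "\<sigma>\<^sup>2 \<le> (1 + 9 * \<rho>) * V" by (simp add: V_def sum_distrib_left)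
  have V: "0 < V"
  proof (rule ccontr)
    assume "\<not> 0 < V"
    then have "(1 + 9 * \<rho>) * V \<le> 0" using \<rho> by (intro mult_nonneg_nonpos) auto
    then show False using sV \<sigma>(1) by (smt (verit) zero_less_power)
  qed
  define \<sigma>' where "\<sigma>' = sqrt V"
  have \<sigma>': "0 < \<sigma>'" "\<sigma>'\<^sup>2 = V" using V by (auto simp: \<sigma>'_def)
  have s1: "\<sigma> \<le> sqrt (1 + 9 * \<rho>) * \<sigma>'"
    unfolding \<sigma>'_def real_sqrt_mult[symmetric] by (rule real_le_rsqrt[OF sV])
  have "sqrt (1 + 9 * \<rho>) \<le> sqrt (3\<^sup>2)" using \<rho> by (intro real_sqrt_le_mono) (simp add: power2_eq_square)
  then have c3: "sqrt (1 + 9 * \<rho>) \<le> 3" by simp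
  have s3: "\<epsilon> / 3 * \<sigma> \<le> \<epsilon> * \<sigma>'"
  proof -
    have "\<sigma> \<le> 3 * \<sigma>'" using s1 mult_right_mono[OF c3, of \<sigma>'] \<sigma>' by linarith
    then have "\<epsilon> / 3 * \<sigma> \<le> \<epsilon> / 3 * (3 * \<sigma>')" using \<epsilon> by (intro mult_left_mono) auto
    then show ?thesis by simp
  qed
  have S0: "S \<noteq> {}" using V by (auto simp: V_def)
  let ?c = "\<lambda>i. real (card (set_pmf (q i))) - 1"
  define K where "K = Max (?c ` S)"
  have K: "?c i \<le> K" if "i \<in> S" for i unfolding K_def using S that by simp
  have "K \<in> ?c ` S" unfolding K_def using S S0 by (intro Max_in) auto
  then obtain j where j: "j \<in> S" "K = ?c j" by auto
  have ck: "?c i \<le> real (num_full (\<alpha> i))" if "i \<in> S" for i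
    using card_set_nu[OF a(1,2)[OF that]] unfolding cq[OF that] a(3)[OF that] .
  have K1: "1 \<le> K"
  proof (rule ccontr)
    assume "\<not> 1 \<le> K"
    have "Var (q i) (rk (q i)) \<le> 0" if i: "i \<in> S" for i
    proof -
      have "card (set_pmf (q i)) \<le> 1" using K[OF i] \<open>\<not> 1 \<le> K\<close> by linarith
      moreover have "card (set_pmf (q i)) \<noteq> 0" using fq[OF i] by (simp add: set_pmf_not_empty)
      ultimately have "?c i = 0" by simp
      then show ?thesis using rk_Var_le[OF fq[OF i], of 0] by simp
    qed
    then have "V \<le> 0" unfolding V_def by (rule sum_nonpos)
    then show False using V by simp
  qed
  have pq: "\<exists>y\<in>set_pmf (nu (?a i)). pmf (q i) x = pmf (nu (?a i)) y" if "i \<in> S" "x \<in> set_pmf (q i)" for i x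
    using that q[OF that(1)] inj[OF that(1)] by (auto simp: pmf_map_inj)
  have "rank_family \<epsilon> \<rho> K S q \<sigma>'"
    unfolding rank_family_def
  proof (intro conjI ballI)
    show "finite S" "1 \<le> K" "0 < \<sigma>'" "\<sigma>'\<^sup>2 = (\<Sum>i\<in>S. Var (q i) (rk (q i)))" using S K1 \<sigma>' by (auto simp: V_def)
    show "K \<le> \<epsilon> * \<sigma>'" using ck[OF j(1)] k[OF j(1)] s3 j(2) by linarith
    show "\<exists>j\<in>S. \<forall>x. pmf (q j) x * K \<le> 1"
    proof (intro bexI[OF _ j(1)] allI)
      fix x
      have "pmf (q j) x \<le> ?a j"
        using pq[OF j(1), of x] pmf_nu_le[OF a(1,2)[OF j(1)]] a(1)[OF j(1)] by (cases "x \<in> set_pmf (q j)") (auto simp: set_pmf_iff)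
      then have "pmf (q j) x * K \<le> ?a j * real (num_full (?a j))"
        using ck[OF j(1)] j(2) K1 a[OF j(1)] by (intro mult_mono) auto
      also have "\<dots> \<le> 1" by (rule num_full_bounds(2)[OF a(1,2)[OF j(1)]])
      finally show "pmf (q j) x * K \<le> 1" .
    qed
    fix i assume i: "i \<in> S"
    show "finite (set_pmf (q i))" "?c i \<le> K" by (rule fq[OF i], rule K[OF i])
    fix x assume x: "x \<in> set_pmf (q i)"
    obtain y where y: "y \<in> set_pmf (nu (?a i))" "pmf (q i) x = pmf (nu (?a i)) y" using pq[OF i x] by auto
    have "card (set_pmf (q i)) \<le> 2 \<or> \<rho> \<le> pmf (q i) x * ?c i"
      using round_up(6)[of "\<alpha> i" \<rho> y] \<alpha>[OF i] \<rho> y cq[OF i] by auto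
    moreover have "pmf (q i) x * ?c i \<le> pmf (q i) x * K" by (intro mult_left_mono K[OF i]) auto
    ultimately show "card (set_pmf (q i)) \<le> 2 \<or> \<rho> \<le> pmf (q i) x * K" by linarith
  qed
  then show ?thesis using s1 by blast
qed

lemma uniform_image:
  assumes "1 \<le> k" "inj_on f (set_pmf (nu (1 / real k)))"
  shows "finite (f ` {0..int k - 1})" "card (f ` {0..int k - 1}) = k" "map_pmf f (nu (1 / real k)) = pmf_of_set (f ` {0..int k - 1})"
proof -
  have ne: "{0..int k - 1} \<noteq> {}" using assms(1) by simp
  have inj: "inj_on f {0..int k - 1}" using assms ne by (simp add: nu_inverse)
  show "finite (f ` {0..int k - 1})" "card (f ` {0..int k - 1}) = k" using inj by (auto simp: card_image)
  show "map_pmf f (nu (1 / real k)) = pmf_of_set (f ` {0..int k - 1})"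
    unfolding nu_inverse(2)[OF assms(1)] by (rule map_pmf_of_set_inj[OF inj ne]) simp
qed

text \<open>For the indices in \<open>S\<close>, \<open>conc_upper\<close> bounds the probability of
  a set from above and \<open>spread_lower\<close> bounds a window from below by nearly the same
  Gaussian mass. This is the base of \<open>dominated_psum\<close>, which adds the uniform laws of
  \<open>J\<close>, however large their supports are.\<close>

lemma many_small_case:
  assumes \<delta>: "0 < \<delta>"
  shows "\<exists>\<epsilon>>0. \<exists>\<rho>>0. \<rho> \<le> 1/2 \<and> (\<forall>(S :: nat set) J \<alpha> \<sigma> (f :: nat \<Rightarrow> int \<Rightarrow> real). finite S \<longrightarrow> finite J \<longrightarrow> S \<inter> J = {} \<longrightarrow>
    (\<forall>i\<in>J \<union> S. 0 < \<alpha> i \<and> \<alpha> i \<le> 1) \<longrightarrow> 0 < \<sigma> \<longrightarrow> \<sigma>\<^sup>2 = (\<Sum>i\<in>S. nu_variance (\<alpha> i)) \<longrightarrow> (\<forall>i\<in>S. real (num_full (\<alpha> i)) \<le> \<epsilon> * \<sigma>) \<longrightarrow>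
    (\<forall>i\<in>J \<union> S. inj_on (f i) (set_pmf (nu (if i \<in> S then round_up \<rho> (\<alpha> i) else 1 / real (num_full (\<alpha> i)))))) \<longrightarrow>
    (\<exists>z. \<forall>s. pmf (psum (J \<union> S) (\<lambda>i. map_pmf (f i) (nu (if i \<in> S then round_up \<rho> (\<alpha> i) else 1 / real (num_full (\<alpha> i)))))) s
      \<le> (1 + \<delta>) * pmf (psum (J \<union> S) (\<lambda>i. nu (if i \<in> S then \<alpha> i else 1 / real (num_full (\<alpha> i))))) z))"
proof -
  define d where "d = min (\<delta> / 8) (1 / 4)"
  have d: "0 < d" "d \<le> 1/4" "8 * d \<le> \<delta>" using \<delta> by (auto simp: d_def)
  \<comment> \<open>Makes the rounding loss \<open>1 + 9 * \<rho>\<close> in the variance equal to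
    \<open>1 + d\<close>.\<close>
  define \<rho> where "\<rho> = d / 9"
  have \<rho>: "0 < \<rho>" "\<rho> \<le> 1/2" using d by (auto simp: \<rho>_def)
  define c where "c = sqrt (1 + 9 * \<rho>)"
  have c: "1 \<le> c" "c \<le> 1 + d"
  proof -
    show "1 \<le> c" using \<rho> by (simp add: c_def)
    have "1 + d \<le> (1 + d)\<^sup>2" using d by (simp add: power2_eq_square algebra_simps)
    then show "c \<le> 1 + d" unfolding c_def using d by (intro real_le_lsqrt) (auto simp: \<rho>_def)
  qed
  define C where "C = (1 + d) * c / (1 - d)"
  have C: "0 \<le> C" "C \<le> 1 + \<delta>"
  proof -
    show "0 \<le> C" using d c by (simp add: C_def)
    have "(1 + d) * c \<le> (1 + d) * (1 + d)" using c d by (intro mult_left_mono) auto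
    also have "\<dots> \<le> (1 + 8 * d) * (1 - d)"
    proof -
      have "d * d \<le> d * (1/4)" using d by (intro mult_left_mono) auto
      then show ?thesis using d by (simp add: algebra_simps)
    qed
    also have "\<dots> \<le> (1 + \<delta>) * (1 - d)" using d by (intro mult_right_mono) auto
    finally show "C \<le> 1 + \<delta>" using d by (simp add: C_def divide_le_eq)
  qed
  obtain \<epsilon>1 where \<epsilon>1: "0 < \<epsilon>1" "\<And>K I q \<sigma> D. rank_family \<epsilon>1 \<rho> K I q \<sigma> \<Longrightarrow> finite D \<Longrightarrow>
    EE (Pi_pmf I 0 q) (\<lambda>w. of_bool ((\<Sum>i\<in>I. w i) \<in> D)) \<le> (1 + d) * Gs (real (card D) / (2 * \<sigma>))"
    using conc_upper[of d \<rho>] d \<rho> by auto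
  obtain \<epsilon>2 where \<epsilon>2: "0 < \<epsilon>2" "\<And>I (q :: nat \<Rightarrow> int pmf) \<sigma>. lindeberg \<epsilon>2 I q (\<lambda>_. real_of_int) \<sigma> \<Longrightarrow> 1 \<le> \<epsilon>2 * \<sigma> \<Longrightarrow>
    (\<exists>h::nat. \<forall>(e::int) (l::nat). \<bar>real_of_int e - 2 * (\<Sum>i\<in>I. EE (q i) real_of_int)\<bar> \<le> 1 \<longrightarrow> 1 \<le> l \<longrightarrow> odd (int l + e) \<longrightarrow>
      (1 - d) * Gs (real l / (2 * \<sigma>)) \<le>
      EE (pmf_of_set {- int h..int h}) (\<lambda>i. EE (Pi_pmf I 0 q) (\<lambda>w. of_bool (\<bar>2 * (i + (\<Sum>i\<in>I. w i)) - e\<bar> < int l))))"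
    using spread_lower[of d] d by auto
  define \<epsilon> where "\<epsilon> = min (\<epsilon>1 / 3) \<epsilon>2"
  have \<epsilon>: "0 < \<epsilon>" "\<epsilon> \<le> \<epsilon>1 / 3" "\<epsilon> \<le> \<epsilon>2" using \<epsilon>1 \<epsilon>2 by (auto simp: \<epsilon>_def)
  show ?thesis
  proof (rule exI[of _ \<epsilon>], rule conjI[OF \<epsilon>(1)], rule exI[of _ \<rho>], intro conjI \<rho> allI impI)
    fix S J :: "nat set" and \<alpha> \<sigma> and f :: "nat \<Rightarrow> int \<Rightarrow> real"
    assume S: "finite S" and J: "finite J" and SJ: "S \<inter> J = {}" and \<alpha>: "\<forall>i\<in>J \<union> S. 0 < \<alpha> i \<and> \<alpha> i \<le> 1"
      and \<sigma>: "0 < \<sigma>" "\<sigma>\<^sup>2 = (\<Sum>i\<in>S. nu_variance (\<alpha> i))" and k: "\<forall>i\<in>S. real (num_full (\<alpha> i)) \<le> \<epsilon> * \<sigma>"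
      and inj: "\<forall>i\<in>J \<union> S. inj_on (f i) (set_pmf (nu (if i \<in> S then round_up \<rho> (\<alpha> i) else 1 / real (num_full (\<alpha> i)))))"
    define q where "q i = map_pmf (f i) (nu (if i \<in> S then round_up \<rho> (\<alpha> i) else 1 / real (num_full (\<alpha> i))))" for i
    define r where "r i = nu (if i \<in> S then \<alpha> i else 1 / real (num_full (\<alpha> i)))" for i
    have \<alpha>S: "0 < \<alpha> i \<and> \<alpha> i \<le> 1" if "i \<in> S" for i using \<alpha> that by auto
    have kS: "real (num_full (\<alpha> i)) \<le> \<epsilon>1 / 3 * \<sigma>" "real (num_full (\<alpha> i)) \<le> \<epsilon>2 * \<sigma>" if "i \<in> S" for i
    proof -
      have "real (num_full (\<alpha> i)) \<le> \<epsilon> * \<sigma>" using k that by blast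
      then show "real (num_full (\<alpha> i)) \<le> \<epsilon>1 / 3 * \<sigma>" "real (num_full (\<alpha> i)) \<le> \<epsilon>2 * \<sigma>"
        using mult_right_mono[OF \<epsilon>(2), of \<sigma>] mult_right_mono[OF \<epsilon>(3), of \<sigma>] \<sigma>(1) by linarith+
    qed
    have injS: "inj_on (f i) (set_pmf (nu (round_up \<rho> (\<alpha> i))))" if "i \<in> S" for i
      using bspec[OF inj, of i] that by (simp only: Un_iff simp_thms if_True)
    have "\<exists>K \<sigma>'. rank_family \<epsilon>1 \<rho> K S q \<sigma>' \<and> \<sigma> \<le> sqrt (1 + 9 * \<rho>) * \<sigma>'"
    proof (rule rank_family_nu[where f = f, OF S \<alpha>S \<rho> injS \<sigma> kS(1) \<epsilon>1(1)])
      show "q i = map_pmf (f i) (nu (round_up \<rho> (\<alpha> i)))" if "i \<in> S" for i unfolding q_def using that by simp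
    qed
    then obtain K \<sigma>' where rf: "rank_family \<epsilon>1 \<rho> K S q \<sigma>'" and cs: "\<sigma> \<le> c * \<sigma>'" by (auto simp: c_def)
    have \<sigma>': "0 < \<sigma>'" using rf by (simp add: rank_family_def)
    have lin: "lindeberg \<epsilon>2 S r (\<lambda>_. real_of_int) \<sigma>"
      unfolding lindeberg_def
    proof (intro conjI ballI)
      show "finite S" "0 < \<sigma>" by fact+
      show "\<sigma>\<^sup>2 = (\<Sum>i\<in>S. Var (r i) real_of_int)" unfolding \<sigma>(2) by (intro sum.cong) (auto simp: r_def)
      fix i assume i: "i \<in> S"
      show "finite (set_pmf (r i))" using \<alpha>S[OF i] i by (simp add: r_def)
      fix x assume "x \<in> set_pmf (r i)"
      then have "\<bar>real_of_int x - EE (r i) real_of_int\<bar> \<le> real (num_full (\<alpha> i))"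
        using nu_deviation[of "\<alpha> i" x] \<alpha>S[OF i] i by (simp add: r_def)
      then show "\<bar>real_of_int x - EE (r i) real_of_int\<bar> \<le> \<epsilon>2 * \<sigma>" using kS(2)[OF i] by linarith
    qed
    have S0: "S \<noteq> {}" using \<sigma> by auto
    then obtain i0 where i0: "i0 \<in> S" by auto
    have "1 \<le> \<epsilon>2 * \<sigma>" using kS(2)[OF i0] num_full_bounds(1)[of "\<alpha> i0"] \<alpha>S[OF i0] by linarith
    from \<epsilon>2(2)[OF lin this] obtain h where h: "\<And>(e::int) (l::nat). \<bar>real_of_int e - 2 * (\<Sum>i\<in>S. EE (r i) real_of_int)\<bar> \<le> 1 \<Longrightarrow> 1 \<le> l \<Longrightarrow> odd (int l + e) \<Longrightarrow>
      (1 - d) * Gs (real l / (2 * \<sigma>)) \<le>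
      EE (pmf_of_set {- int h..int h}) (\<lambda>i. EE (Pi_pmf S 0 r) (\<lambda>w. of_bool (\<bar>2 * (i + (\<Sum>i\<in>S. w i)) - e\<bar> < int l)))"
      by blast
    define W where "W = pmf_of_set {- int h..int h}"
    have fW: "finite (set_pmf W)" by (simp add: W_def)
    have fS: "finite (set_pmf (q i)) \<and> finite (set_pmf (r i))" if "i \<in> S" for i
      using round_up(1,2)[of "\<alpha> i" \<rho>] \<alpha>S[OF that] \<rho> that by (simp add: q_def r_def)
    \<comment> \<open>The centre \<open>e / 2\<close> must be within 1/2 of the mean, while the
      parity of \<open>e\<close> is dictated by the end: after all the shifts by
      \<open>k - 1\<close> the doubled centre has to be even, so that a single point is a
      window.\<close>
    obtain e where e: "even (e + (\<Sum>j\<in>J. int (num_full (\<alpha> j)) - 1))" "\<bar>real_of_int e - 2 * (\<Sum>i\<in>S. EE (r i) real_of_int)\<bar> \<le> 1"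
      using exists_even_near by blast
    have base: "dominated C (psum S q) (conv W (psum S r)) e"
      unfolding dominated_def
    proof (intro allI impI)
      fix D :: "real set" assume D: "finite D" "D \<noteq> {}" "odd (int (card D) + e)"
      let ?l = "card D"
      have l: "1 \<le> ?l" using D by (simp add: Suc_le_eq card_gt_0_iff)
      have "measure_pmf.prob (psum S q) D = EE (Pi_pmf S 0 q) (\<lambda>w. of_bool ((\<Sum>i\<in>S. w i) \<in> D))"
        unfolding EE_of_bool[symmetric] EE_psum ..
      also have "\<dots> \<le> (1 + d) * Gs (real ?l / (2 * \<sigma>'))" by (rule \<epsilon>1(2)[OF rf D(1)])
      also have "\<dots> \<le> (1 + d) * (c * Gs (real ?l / (2 * \<sigma>)))"
      proof (rule mult_left_mono)
        have "Gs (real ?l / (2 * \<sigma>')) \<le> Gs (c * (real ?l / (2 * \<sigma>)))"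
        proof (rule Gs_mono)
          have "real ?l * \<sigma> \<le> real ?l * (c * \<sigma>')" using cs by (intro mult_left_mono) auto
          then show "real ?l / (2 * \<sigma>') \<le> c * (real ?l / (2 * \<sigma>))" using \<sigma>(1) \<sigma>' by (simp add: field_simps)
        qed
        also have "\<dots> \<le> c * Gs (real ?l / (2 * \<sigma>))" using c \<sigma>(1) by (intro Gs_scale) auto
        finally show "Gs (real ?l / (2 * \<sigma>')) \<le> c * Gs (real ?l / (2 * \<sigma>))" .
      qed (use d in auto)
      also have "\<dots> = C * ((1 - d) * Gs (real ?l / (2 * \<sigma>)))" using d by (simp add: C_def)
      also have "\<dots> \<le> C * measure_pmf.prob (conv W (psum S r)) {z. \<bar>2 * z - e\<bar> < int ?l}"
      proof (rule mult_left_mono[OF _ C(1)])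
        have "measure_pmf.prob (conv W (psum S r)) {z. \<bar>2 * z - e\<bar> < int ?l}
          = EE (conv W (psum S r)) (\<lambda>z. of_bool (\<bar>2 * z - e\<bar> < int ?l))" by (simp only: EE_of_bool')
        also have "\<dots> = EE W (\<lambda>i. EE (psum S r) (\<lambda>z. of_bool (\<bar>2 * (i + z) - e\<bar> < int ?l)))"
          using S fS by (intro EE_conv fW finite_set_psum) auto
        also have "\<dots> = EE W (\<lambda>i. EE (Pi_pmf S 0 r) (\<lambda>w. of_bool (\<bar>2 * (i + (\<Sum>i\<in>S. w i)) - e\<bar> < int ?l)))"
          by (simp only: EE_psum)
        finally show "(1 - d) * Gs (real ?l / (2 * \<sigma>)) \<le> measure_pmf.prob (conv W (psum S r)) {z. \<bar>2 * z - e\<bar> < int ?l}"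
          using h[OF e(2) l D(3)] by (simp add: W_def)
      qed
      finally show "measure_pmf.prob (psum S q) D \<le> C * measure_pmf.prob (conv W (psum S r)) {z. \<bar>2 * z - e\<bar> < int ?l}" .
    qed
    have JA: "finite (f j ` {0..int (num_full (\<alpha> j)) - 1}) \<and> card (f j ` {0..int (num_full (\<alpha> j)) - 1}) = num_full (\<alpha> j) \<and> 0 < num_full (\<alpha> j) \<and>
        q j = pmf_of_set (f j ` {0..int (num_full (\<alpha> j)) - 1}) \<and> r j = pmf_of_set {0..int (num_full (\<alpha> j)) - 1}" if j: "j \<in> J" for j
    proof -
      have jS: "j \<notin> S" using j SJ by auto
      have k1: "1 \<le> num_full (\<alpha> j)" using \<alpha> j by (intro num_full_bounds(1)) auto
      have "inj_on (f j) (set_pmf (nu (1 / real (num_full (\<alpha> j)))))" using bspec[OF inj, of j] j jS by (simp only: Un_iff simp_thms if_False)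
      from uniform_image[OF k1 this] show ?thesis using jS k1 nu_inverse(2)[OF k1] by (simp add: q_def r_def)
    qed
    have "dominated C (psum (J \<union> S) q) (conv W (psum (J \<union> S) r)) (e + (\<Sum>j\<in>J. int (num_full (\<alpha> j)) - 1))"
      by (rule dominated_psum[OF J S SJ base fS fW JA])
    then have "\<exists>z. \<forall>s. pmf (psum (J \<union> S) q) s \<le> C * pmf (psum (J \<union> S) r) z"
    proof (rule dominated_pmf_le[OF _ e(1) fW _ C(1)])
      show "finite (set_pmf (psum (J \<union> S) r))"
        using J S fS JA by (intro finite_set_psum) (auto simp: card_gt_0_iff)
    qed
    then obtain z where z: "\<And>s. pmf (psum (J \<union> S) q) s \<le> C * pmf (psum (J \<union> S) r) z" by blast
    have "pmf (psum (J \<union> S) q) s \<le> (1 + \<delta>) * pmf (psum (J \<union> S) r) z" for s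
      using z[of s] mult_right_mono[OF C(2), of "pmf (psum (J \<union> S) r) z"] by simp
    then show "\<exists>z. \<forall>s. pmf (psum (J \<union> S) (\<lambda>i. map_pmf (f i) (nu (if i \<in> S then round_up \<rho> (\<alpha> i) else 1 / real (num_full (\<alpha> i)))))) s
      \<le> (1 + \<delta>) * pmf (psum (J \<union> S) (\<lambda>i. nu (if i \<in> S then \<alpha> i else 1 / real (num_full (\<alpha> i))))) z"
      unfolding q_def[symmetric] r_def[symmetric] by blast
  qed
qed

text \<open>The size of the overlap of two intervals is the least of four differences of end points.
  Two of them give \<open>k\<close> and \<open>d\<close>; the mixed ones are close to
  \<open>(k + d) / 2\<close> if the centres nearly agree.\<close>

lemma overlap_count:
  fixes v z e :: int and k d :: nat
  assumes v: "2 * v + int d - 1 = e" and k: "0 < k" "0 < d" and s: "0 < \<delta>" "\<delta> \<le> 1"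
    and z: "\<bar>real_of_int z - real_of_int (e - int k + 1) / 2\<bar> \<le> \<delta> * real k / 4"
  shows "(1 - \<delta>) * real (min k d) \<le> (\<Sum>a\<in>{0..int k - 1}. of_bool (z + a \<in> {v..v + int d - 1}))"
proof -
  have "(\<Sum>a\<in>{0..int k - 1}. of_bool (z + a \<in> {v..v + int d - 1}) :: real) = real (card {max 0 (v - z)..min (int k - 1) (v + int d - 1 - z)})"
  proof -
    have "{0..int k - 1} \<inter> {a. z + a \<in> {v..v + int d - 1}} = {max 0 (v - z)..min (int k - 1) (v + int d - 1 - z)}" by auto
    then show ?thesis by (simp add: of_bool_def sum.If_cases)
  qed
  also have "\<dots> \<ge> real_of_int (min (int k - 1) (v + int d - 1 - z) - max 0 (v - z) + 1)" by simp
  finally have 1: "real_of_int (min (int k - 1) (v + int d - 1 - z) - max 0 (v - z) + 1)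
    \<le> (\<Sum>a\<in>{0..int k - 1}. of_bool (z + a \<in> {v..v + int d - 1}))" .
  define t where "t = real_of_int z - real_of_int (e - int k + 1) / 2"
  have t: "\<bar>t\<bar> \<le> \<delta> * real k / 4" using z by (simp add: t_def)
  have ve: "real_of_int v = real_of_int e / 2 - real d / 2 + 1 / 2"
  proof -
    have "real_of_int (2 * v + int d - 1) = real_of_int e" using v by simp
    then have "2 * real_of_int v + real d - 1 = real_of_int e" by simp
    then show ?thesis by linarith
  qed
  define M where "M = (1 - \<delta>) * real (min k d)"
  define x where "x = \<delta> * real k"
  define y where "y = \<delta> * real d"
  have xy: "0 \<le> x" "0 \<le> y" "x \<le> real k" using s by (auto simp: x_def y_def mult_left_le_one_le)
  have m: "M \<le> real k" "M \<le> real d"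
  proof -
    have "M \<le> real (min k d)" unfolding M_def using s by (simp add: mult_left_le_one_le)
    then show "M \<le> real k" "M \<le> real d" by linarith+
  qed
  \<comment> \<open>If \<open>d\<close> is much smaller than \<open>k\<close>, the displacement, a
    fraction of \<open>k\<close>, need not be small against \<open>d\<close>; but then the term
    \<open>k / 2\<close> outweighs it.\<close>
  have mid: "M \<le> real k / 2 + real d / 2 - x / 4"
  proof (cases "k \<le> d")
    case True
    then have "M = real k - x" by (simp add: left_diff_distrib M_def x_def)
    moreover have "real k \<le> real d" using True by simp
    ultimately show ?thesis using xy by linarith
  next
    case False
    then have dk: "real d \<le> real k" "M = real d - y" by (auto simp: left_diff_distrib M_def y_def)
    show ?thesis
    proof (cases "real k \<le> 2 * real d")
      case True
      then have "\<delta> * real k \<le> \<delta> * (2 * real d)" using s by (intro mult_left_mono) auto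
      then have "x \<le> 2 * y" by (simp add: x_def y_def)
      then show ?thesis using dk xy by linarith
    next
      case False
      then show ?thesis using dk xy by linarith
    qed
  qed
  have "M \<le> real_of_int (int k - 1 - 0 + 1)" "M \<le> real_of_int (v + int d - 1 - z - (v - z) + 1)"
    using m by auto
  moreover have "M \<le> real_of_int (int k - 1 - (v - z) + 1)" "M \<le> real_of_int (v + int d - 1 - z - 0 + 1)"
  proof -
    have zt: "real_of_int z = t + (real_of_int e / 2 - real k / 2 + 1 / 2)" by (simp add: t_def add_divide_distrib diff_divide_distrib)
    have tx: "t \<le> x / 4" "- t \<le> x / 4" using t unfolding x_def by linarith+
    have "real_of_int (int k - 1 - (v - z) + 1) = real k - real_of_int v + real_of_int z" by simp
    then show "M \<le> real_of_int (int k - 1 - (v - z) + 1)" using mid zt tx ve by linarith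
    have "real_of_int (v + int d - 1 - z - 0 + 1) = real_of_int v + real d - real_of_int z" by simp
    then show "M \<le> real_of_int (v + int d - 1 - z - 0 + 1)" using mid zt tx ve by linarith
  qed
  ultimately have "M \<le> real_of_int (min (int k - 1) (v + int d - 1 - z) - max 0 (v - z) + 1)"
    by (auto simp: min_def max_def)
  then show ?thesis using 1 unfolding M_def by linarith
qed

text \<open>A uniform law on \<open>k\<close> points gives a set of size \<open>l\<close>
  probability at most \<open>min k l / k\<close>, whatever independent variable is added. On the
  other side the sum over \<open>S\<close> is concentrated on a scale small against
  \<open>k\<close>, by Chebyshev's inequality, so the centred window nearly attains this value. This
  replaces the Gaussian comparison as the base of the induction over \<open>J\<close>, and no
  averaging is called for: the auxiliary law is the point mass at 0.\<close>

lemma one_large_case: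
  assumes \<delta>: "0 < \<delta>"
  shows "\<exists>\<eta>>0. \<forall>(S :: nat set) J j1 \<alpha> \<sigma> (f :: nat \<Rightarrow> int \<Rightarrow> real) q. finite S \<longrightarrow> finite J \<longrightarrow> S \<inter> J = {} \<longrightarrow>
    (\<forall>i\<in>J \<union> S. 0 < \<alpha> i \<and> \<alpha> i \<le> 1) \<longrightarrow> 0 \<le> \<sigma> \<longrightarrow> \<sigma>\<^sup>2 = (\<Sum>i\<in>S. nu_variance (\<alpha> i)) \<longrightarrow> j1 \<in> J \<longrightarrow>
    \<sigma> \<le> \<eta> * real (num_full (\<alpha> j1)) \<longrightarrow> 1 \<le> \<eta> * real (num_full (\<alpha> j1)) \<longrightarrow> (\<forall>i\<in>S. finite (set_pmf (q i))) \<longrightarrow>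
    (\<forall>j\<in>J. inj_on (f j) (set_pmf (nu (1 / real (num_full (\<alpha> j))))) \<and> q j = map_pmf (f j) (nu (1 / real (num_full (\<alpha> j))))) \<longrightarrow>
    (\<exists>z. \<forall>s. pmf (psum (J \<union> S) q) s \<le> (1 + \<delta>) * pmf (psum (J \<union> S) (\<lambda>i. nu (if i \<in> S then \<alpha> i else 1 / real (num_full (\<alpha> i))))) z)"
proof -
  define d where "d = min (\<delta> / 8) (1 / 4)"
  have d: "0 < d" "d \<le> 1/4" "8 * d \<le> \<delta>" using \<delta> by (auto simp: d_def)
  define C where "C = 1 / (1 - d)\<^sup>2"
  have C: "0 \<le> C" "C \<le> 1 + \<delta>"
  proof -
    show "0 \<le> C" by (simp add: C_def)
    have "1 \<le> (1 + 8 * d) * (1 - d)\<^sup>2"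
    proof -
      have "d * d \<le> d * (1/4)" using d by (intro mult_left_mono) auto
      moreover have "(1 + 8 * d) * (1 - d)\<^sup>2 = 1 + 6 * d - 15 * (d * d) + 8 * (d * d * d)" by (simp add: power2_eq_square algebra_simps)
      moreover have "0 \<le> d * d * d" using d by simp
      ultimately show ?thesis using d by linarith
    qed
    also have "\<dots> \<le> (1 + \<delta>) * (1 - d)\<^sup>2" using d by (intro mult_right_mono) auto
    finally show "C \<le> 1 + \<delta>" using d by (simp add: C_def divide_le_eq)
  qed
  \<comment> \<open>Chebyshev's bound for a deviation of \<open>d * k / 8\<close> becomes
    \<open>d\<^sup>2\<close>. The same \<eta> forces this deviation to be at least 1, which absorbs
    the rounding of \<open>e\<close>.\<close>
  define \<eta> where "\<eta> = d * d / 8"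
  have \<eta>: "0 < \<eta>" using d by (simp add: \<eta>_def)
  show ?thesis
  proof (rule exI[of _ \<eta>], rule conjI[OF \<eta>], intro allI impI)
    fix S J :: "nat set" and j1 \<alpha> \<sigma> and f :: "nat \<Rightarrow> int \<Rightarrow> real" and q
    assume S: "finite S" and J: "finite J" and SJ: "S \<inter> J = {}" and \<alpha>: "\<forall>i\<in>J \<union> S. 0 < \<alpha> i \<and> \<alpha> i \<le> 1"
      and \<sigma>: "0 \<le> \<sigma>" "\<sigma>\<^sup>2 = (\<Sum>i\<in>S. nu_variance (\<alpha> i))" and j1: "j1 \<in> J"
      and k1: "\<sigma> \<le> \<eta> * real (num_full (\<alpha> j1))" "1 \<le> \<eta> * real (num_full (\<alpha> j1))"
      and qS: "\<forall>i\<in>S. finite (set_pmf (q i))"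
      and qJ: "\<forall>j\<in>J. inj_on (f j) (set_pmf (nu (1 / real (num_full (\<alpha> j))))) \<and> q j = map_pmf (f j) (nu (1 / real (num_full (\<alpha> j))))"
    define r where "r i = nu (if i \<in> S then \<alpha> i else 1 / real (num_full (\<alpha> i)))" for i
    have fS: "finite (set_pmf (q i)) \<and> finite (set_pmf (r i))" if "i \<in> S" for i
      using qS \<alpha> that by (simp add: r_def)
    have JA: "finite (f j ` {0..int (num_full (\<alpha> j)) - 1}) \<and> card (f j ` {0..int (num_full (\<alpha> j)) - 1}) = num_full (\<alpha> j) \<and> 0 < num_full (\<alpha> j) \<and>
        q j = pmf_of_set (f j ` {0..int (num_full (\<alpha> j)) - 1}) \<and> r j = pmf_of_set {0..int (num_full (\<alpha> j)) - 1}" if j: "j \<in> J" for j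
    proof -
      have jS: "j \<notin> S" using j SJ by auto
      have k1: "1 \<le> num_full (\<alpha> j)" using \<alpha> j by (intro num_full_bounds(1)) auto
      have "inj_on (f j) (set_pmf (nu (1 / real (num_full (\<alpha> j)))))" "q j = map_pmf (f j) (nu (1 / real (num_full (\<alpha> j))))"
        using bspec[OF qJ j] by simp_all
      then show ?thesis using uniform_image[OF k1, of "f j"] jS k1 nu_inverse(2)[OF k1] by (simp add: r_def)
    qed
    define k where "k = num_full (\<alpha> j1)"
    define A where "A = f j1 ` {0..int k - 1}"
    have A: "finite A" "card A = k" "0 < k" "q j1 = pmf_of_set A" "r j1 = pmf_of_set {0..int k - 1}"
      using JA[OF j1] by (auto simp: A_def k_def)
    have A0: "A \<noteq> {}" using A by auto
    define J' where "J' = J - {j1}"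
    define S' where "S' = insert j1 S"
    have JS': "finite J'" "finite S'" "S' \<inter> J' = {}" "J' \<union> S' = J \<union> S" using J S SJ j1 by (auto simp: J'_def S'_def)
    have jS: "j1 \<notin> S" using j1 SJ by auto
    have fin1: "finite (set_pmf (psum S q))" "finite (set_pmf (psum S r))" using S fS by (auto intro!: finite_set_psum)
    define m where "m = (\<Sum>i\<in>S. EE (r i) real_of_int)"
    obtain e where e: "even (e + (\<Sum>j\<in>J'. int (num_full (\<alpha> j)) - 1))" "\<bar>real_of_int e - (2 * m + real k - 1)\<bar> \<le> 1"
      using exists_even_near by blast
    have concZ: "1 - d \<le> EE (psum S r) (\<lambda>z. of_bool (\<bar>real_of_int z - real_of_int (e - int k + 1) / 2\<bar> \<le> d * real k / 4))"
    proof -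
      let ?Z = "psum S r" let ?t = "d * real k / 8"
      have kd: "8 / (d * d) \<le> real k" using k1(2) d unfolding k_def[symmetric] \<eta>_def by (simp add: field_simps)
      have t1: "1 \<le> ?t"
      proof -
        have "8 / d \<le> 8 / (d * d)" using d by (intro divide_left_mono) auto
        then have "8 / d \<le> real k" using kd by linarith
        then show ?thesis using d by (simp add: field_simps)
      qed
      have mZ: "EE ?Z real_of_int = m" unfolding EE_psum m_def
        using EE_Pi_sum[OF S, of r 0 "\<lambda>_. real_of_int"] fS by simp
      have VZ: "Var ?Z real_of_int = \<sigma>\<^sup>2"
      proof -
        have "Var ?Z real_of_int = Var (Pi_pmf S 0 r) (\<lambda>w. \<Sum>i\<in>S. real_of_int (w i))"
          unfolding Var_def EE_psum by simp
        also have "\<dots> = (\<Sum>i\<in>S. Var (r i) real_of_int)" using S fS by (intro Var_Pi_sum) auto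
        also have "\<dots> = \<sigma>\<^sup>2" unfolding \<sigma>(2) by (intro sum.cong) (auto simp: r_def)
        finally show ?thesis .
      qed
      have "EE ?Z (\<lambda>z. of_bool (?t \<le> \<bar>real_of_int z - EE ?Z real_of_int\<bar>)) \<le> Var ?Z real_of_int / ?t\<^sup>2"
        using t1 by (intro chebyshev_pmf fin1) auto
      also have "\<dots> \<le> (\<eta> * real k)\<^sup>2 / ?t\<^sup>2"
        unfolding VZ k_def using k1(1) \<sigma>(1) by (intro divide_right_mono power_mono) auto
      also have "\<dots> = d\<^sup>2" using A(3) d by (simp add: \<eta>_def power2_eq_square)
      also have "\<dots> \<le> d" using d by (simp add: power2_eq_square mult_left_le)
      finally have b: "EE ?Z (\<lambda>z. of_bool (?t \<le> \<bar>real_of_int z - m\<bar>)) \<le> d" unfolding mZ .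
      have "1 - EE ?Z (\<lambda>z. of_bool (?t \<le> \<bar>real_of_int z - m\<bar>)) = EE ?Z (\<lambda>z. 1 - of_bool (?t \<le> \<bar>real_of_int z - m\<bar>))"
        using fin1 by (simp add: EE_diff)
      also have "\<dots> \<le> EE ?Z (\<lambda>z. of_bool (\<bar>real_of_int z - real_of_int (e - int k + 1) / 2\<bar> \<le> d * real k / 4))"
      proof (rule EE_mono[OF fin1(2)])
        fix z
        have "\<bar>real_of_int z - real_of_int (e - int k + 1) / 2\<bar> \<le> d * real k / 4" if "\<bar>real_of_int z - m\<bar> < ?t"
        proof -
          define x where "x = d * real k"
          have "1 \<le> x / 8" "\<bar>real_of_int z - m\<bar> < x / 8" using t1 that by (simp_all only: x_def)
          then have "\<bar>real_of_int z - (real_of_int e / 2 - real k / 2 + 1 / 2)\<bar> \<le> x / 4" using e(2) by linarith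
          moreover have "real_of_int (e - int k + 1) / 2 = real_of_int e / 2 - real k / 2 + 1 / 2" by (simp add: add_divide_distrib diff_divide_distrib)
          ultimately show ?thesis by (simp only: x_def)
        qed
        then show "1 - of_bool (?t \<le> \<bar>real_of_int z - m\<bar>) \<le> (of_bool (\<bar>real_of_int z - real_of_int (e - int k + 1) / 2\<bar> \<le> d * real k / 4) :: real)"
          by (cases "\<bar>real_of_int z - m\<bar> < ?t") auto
      qed
      finally show ?thesis using b by linarith
    qed
    let ?W = "return_pmf (0 :: int)"
    have convW: "conv ?W p = p" for p :: "int pmf" by (simp add: conv_alt bind_return_pmf map_pmf_def bind_return_pmf')
    have base: "dominated C (psum S' q) (conv ?W (psum S' r)) e"
      unfolding dominated_def convW
    proof (intro allI impI)
      fix D :: "real set" assume D: "finite D" "D \<noteq> {}" "odd (int (card D) + e)"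
      let ?l = "card D"
      have l: "0 < ?l" using D by (simp add: card_gt_0_iff)
      \<comment> \<open>After swapping the sums, the masses at \<open>y - a\<close> add up to at
        most 1 for each \<open>y\<close>, which gives \<open>l / k\<close>; the other bound is just
        that a probability is at most 1.\<close>
      have up: "measure_pmf.prob (psum S' q) D \<le> real (min k ?l) / real k"
      proof -
        have "measure_pmf.prob (psum S' q) D = (\<Sum>a\<in>A. \<Sum>y\<in>D. pmf (psum S q) (y - a)) / real (card A)"
          unfolding S'_def psum_insert[OF S jS] A(4) by (rule prob_conv_uniform[OF A(1) A0 fin1(1) D(1)])
        also have "(\<Sum>a\<in>A. \<Sum>y\<in>D. pmf (psum S q) (y - a)) = (\<Sum>y\<in>D. \<Sum>a\<in>A. pmf (psum S q) (y - a))"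
          by (rule sum.swap)
        also have "\<dots> \<le> (\<Sum>y\<in>D. 1)"
        proof (rule sum_mono)
          fix y
          have "(\<Sum>a\<in>A. pmf (psum S q) (y - a)) = (\<Sum>x\<in>(\<lambda>a. y - a) ` A. pmf (psum S q) x)"
            by (subst sum.reindex) (auto simp: inj_on_def)
          also have "\<dots> = measure_pmf.prob (psum S q) ((\<lambda>a. y - a) ` A)" using A by (simp add: measure_measure_pmf_finite)
          also have "\<dots> \<le> 1" by simp
          finally show "(\<Sum>a\<in>A. pmf (psum S q) (y - a)) \<le> 1" .
        qed
        finally have "measure_pmf.prob (psum S' q) D \<le> real ?l / real k" using A by (simp add: divide_right_mono)
        moreover have "measure_pmf.prob (psum S' q) D \<le> real k / real k" using A by simp
        ultimately show ?thesis by (auto simp: min_def)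
      qed
      obtain v where v: "2 * v + int ?l - 1 = e" "{z :: int. \<bar>2 * z - e\<bar> < int ?l} = {v..v + int ?l - 1}"
        using centered_interval[OF D(3)] by auto
      have "(1 - d) * ((1 - d) * real (min k ?l)) \<le> EE (psum S r) (\<lambda>z. of_bool (\<bar>real_of_int z - real_of_int (e - int k + 1) / 2\<bar> \<le> d * real k / 4)) * ((1 - d) * real (min k ?l))"
        using concZ d by (intro mult_right_mono) auto
      also have "\<dots> = EE (psum S r) (\<lambda>z. of_bool (\<bar>real_of_int z - real_of_int (e - int k + 1) / 2\<bar> \<le> d * real k / 4) * ((1 - d) * real (min k ?l)))"
        by (simp only: integral_mult_left_zero)
      also have "\<dots> \<le> EE (psum S r) (\<lambda>z. \<Sum>a\<in>{0..int k - 1}. of_bool (z + a \<in> {v..v + int ?l - 1}))"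
      proof (rule EE_mono[OF fin1(2)])
        fix z
        show "of_bool (\<bar>real_of_int z - real_of_int (e - int k + 1) / 2\<bar> \<le> d * real k / 4) * ((1 - d) * real (min k ?l))
          \<le> (\<Sum>a\<in>{0..int k - 1}. of_bool (z + a \<in> {v..v + int ?l - 1}))"
        proof (cases "\<bar>real_of_int z - real_of_int (e - int k + 1) / 2\<bar> \<le> d * real k / 4")
          case True
          then show ?thesis using overlap_count[OF v(1) A(3) l, of d z] d by (simp only: of_bool_eq mult_1_left)
        next
          case False
          then show ?thesis by (simp only: of_bool_eq mult_zero_left) (simp add: sum_nonneg)
        qed
      qed
      also have "\<dots> = (\<Sum>a\<in>{0..int k - 1}. EE (psum S r) (\<lambda>z. of_bool (a + z \<in> {v..v + int ?l - 1})))"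
        by (simp only: EE_setsum[OF fin1(2)] add.commute)
      also have "\<dots> = real k * EE (pmf_of_set {0..int k - 1}) (\<lambda>a. EE (psum S r) (\<lambda>z. of_bool (a + z \<in> {v..v + int ?l - 1})))"
        using A(3) by (subst integral_pmf_of_set) auto
      also have "EE (pmf_of_set {0..int k - 1}) (\<lambda>a. EE (psum S r) (\<lambda>z. of_bool (a + z \<in> {v..v + int ?l - 1})))
        = EE (psum S' r) (\<lambda>z. of_bool (z \<in> {v..v + int ?l - 1}))"
        unfolding S'_def psum_insert[OF S jS] A(5) using A(3) by (subst EE_conv[OF _ fin1(2)]) auto
      also have "\<dots> = measure_pmf.prob (psum S' r) {z. \<bar>2 * z - e\<bar> < int ?l}" unfolding v(2) by (rule EE_of_bool)
      finally have low: "(1 - d)\<^sup>2 * (real (min k ?l) / real k) \<le> measure_pmf.prob (psum S' r) {z. \<bar>2 * z - e\<bar> < int ?l}"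
        using A(3) by (simp add: field_simps power2_eq_square)
      have "real (min k ?l) / real k = C * ((1 - d)\<^sup>2 * (real (min k ?l) / real k))" using d by (simp add: C_def)
      also have "\<dots> \<le> C * measure_pmf.prob (psum S' r) {z. \<bar>2 * z - e\<bar> < int ?l}" by (rule mult_left_mono[OF low C(1)])
      finally show "measure_pmf.prob (psum S' q) D \<le> C * measure_pmf.prob (psum S' r) {z. \<bar>2 * z - e\<bar> < int ?l}" using up by linarith
    qed
    have fS': "finite (set_pmf (q i)) \<and> finite (set_pmf (r i))" if "i \<in> S'" for i
    proof (cases "i = j1")
      case True
      have "finite (set_pmf (pmf_of_set A))" "finite (set_pmf (pmf_of_set {0..int k - 1}))"
        using A A0 set_pmf_of_set[OF A0 A(1)] by auto
      then show ?thesis unfolding True A(4,5) by simp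
    qed (use that fS in \<open>auto simp: S'_def\<close>)
    have JA': "finite (f j ` {0..int (num_full (\<alpha> j)) - 1}) \<and> card (f j ` {0..int (num_full (\<alpha> j)) - 1}) = num_full (\<alpha> j) \<and> 0 < num_full (\<alpha> j) \<and>
        q j = pmf_of_set (f j ` {0..int (num_full (\<alpha> j)) - 1}) \<and> r j = pmf_of_set {0..int (num_full (\<alpha> j)) - 1}" if j: "j \<in> J'" for j
      using JA[of j] j by (simp add: J'_def)
    have "dominated C (psum (J' \<union> S') q) (conv ?W (psum (J' \<union> S') r)) (e + (\<Sum>j\<in>J'. int (num_full (\<alpha> j)) - 1))"
    proof (rule dominated_psum[OF JS'(1-3) base])
      show "finite (set_pmf ?W)" by simp
    qed (fact fS' JA')+
    then have "\<exists>z. \<forall>s. pmf (psum (J' \<union> S') q) s \<le> C * pmf (psum (J' \<union> S') r) z"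
    proof (rule dominated_pmf_le[OF _ e(1) _ _ C(1)])
      show "finite (set_pmf (psum (J' \<union> S') r))"
      proof (rule finite_set_psum)
        fix i assume "i \<in> J' \<union> S'"
        then show "finite (set_pmf (r i))"
        proof (cases "i \<in> S'")
          case False
          then have "i \<in> J'" using \<open>i \<in> J' \<union> S'\<close> by blast
          then show ?thesis using JA'[of i] by simp
        qed (use fS' in blast)
      qed (use JS'(1,2) in simp)
    qed simp
    then obtain z where z: "\<And>s. pmf (psum (J \<union> S) q) s \<le> C * pmf (psum (J \<union> S) r) z" unfolding JS'(4) by blast
    have "pmf (psum (J \<union> S) q) s \<le> (1 + \<delta>) * pmf (psum (J \<union> S) r) z" for s
      using z[of s] mult_right_mono[OF C(2), of "pmf (psum (J \<union> S) r) z"] by simp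
    then show "\<exists>z. \<forall>s. pmf (psum (J \<union> S) q) s \<le> (1 + \<delta>) * pmf (psum (J \<union> S) (\<lambda>i. nu (if i \<in> S then \<alpha> i else 1 / real (num_full (\<alpha> i))))) z"
      unfolding r_def[symmetric] by blast
  qed
qed

section \<open>Removing the last atoms of the large summands, and the assembly\<close>

lemma pmf_conv:
  fixes p q :: "'a::ab_group_add pmf"
  assumes "finite A" "set_pmf p \<subseteq> A" "finite (set_pmf q)"
  shows "pmf (conv p q) z = (\<Sum>x\<in>A. pmf p x * pmf q (z - x))"
proof -
  have fp: "finite (set_pmf p)" using assms finite_subset by blast
  have "pmf (conv p q) z = EE (conv p q) (\<lambda>y. of_bool (y = z))"
    using EE_of_bool[of "conv p q" "{z}"] by (simp add: measure_pmf_single)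
  also have "\<dots> = EE p (\<lambda>x. EE q (\<lambda>y. of_bool (x + y = z)))" by (rule EE_conv[OF fp assms(3)])
  also have "\<dots> = EE p (\<lambda>x. pmf q (z - x))"
  proof (rule arg_cong[where f = "EE p"], rule ext)
    fix x
    have "EE q (\<lambda>y. of_bool (x + y = z)) = EE q (\<lambda>y. of_bool (y \<in> {z - x}))"
      by (rule arg_cong[where f = "EE q"]) (auto simp: fun_eq_iff)
    then show "EE q (\<lambda>y. of_bool (x + y = z)) = pmf q (z - x)" unfolding EE_of_bool by (simp add: measure_pmf_single)
  qed
  also have "\<dots> = (\<Sum>x\<in>A. pmf p x * pmf q (z - x))"
    using assms by (subst integral_measure_pmf[of A]) auto
  finally show ?thesis .
qed

text \<open>A pointwise minorisation of each law by a multiple of another passes through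
  convolution, and the factors multiply.\<close>

lemma pmf_psum_mono:
  fixes p r :: "nat \<Rightarrow> int pmf"
  assumes "finite I" "\<And>i. i \<in> I \<Longrightarrow> finite (set_pmf (p i)) \<and> finite (set_pmf (r i))"
    and "\<And>i. i \<in> I \<Longrightarrow> 0 \<le> c i" "\<And>i x. i \<in> I \<Longrightarrow> c i * pmf (r i) x \<le> pmf (p i) x"
  shows "(\<Prod>i\<in>I. c i) * pmf (psum I r) z \<le> pmf (psum I p) z"
  using assms
proof (induction I arbitrary: z rule: finite_induct)
  case empty
  then show ?case by (simp add: psum_def)
next
  case (insert i I)
  define A where "A = set_pmf (p i) \<union> set_pmf (r i)"
  have A: "finite A" "set_pmf (p i) \<subseteq> A" "set_pmf (r i) \<subseteq> A" using insert.prems(1)[of i] by (auto simp: A_def)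
  have fin: "finite (set_pmf (psum I p))" "finite (set_pmf (psum I r))"
    using insert.hyps insert.prems(1) by (auto intro!: finite_set_psum)
  have IH: "(\<Prod>i\<in>I. c i) * pmf (psum I r) y \<le> pmf (psum I p) y" for y
    by (rule insert.IH) (use insert.prems in auto)
  have "(\<Prod>j\<in>insert i I. c j) * pmf (psum (insert i I) r) z
    = (\<Sum>x\<in>A. (c i * pmf (r i) x) * ((\<Prod>j\<in>I. c j) * pmf (psum I r) (z - x)))"
    unfolding psum_insert[OF insert.hyps] pmf_conv[OF A(1,3) fin(2)] prod.insert[OF insert.hyps] sum_distrib_left
    by (intro sum.cong refl) (simp only: ac_simps)
  also have "\<dots> \<le> (\<Sum>x\<in>A. pmf (p i) x * pmf (psum I p) (z - x))"
    using insert.prems(2-3) by (intro sum_mono mult_mono IH mult_nonneg_nonneg prod_nonneg) auto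
  also have "\<dots> = pmf (psum (insert i I) p) z"
    unfolding psum_insert[OF insert.hyps] pmf_conv[OF A(1,2) fin(1)] ..
  finally show ?case .
qed

lemma prod_one_minus_ge:
  fixes f :: "nat \<Rightarrow> real"
  assumes "finite A" "\<And>i. i \<in> A \<Longrightarrow> 0 \<le> f i \<and> f i \<le> 1"
  shows "1 - (\<Sum>i\<in>A. f i) \<le> (\<Prod>i\<in>A. 1 - f i) \<and> (\<Prod>i\<in>A. 1 - f i) \<le> 1"
  using assms
proof (induction A rule: finite_induct)
  case (insert a A)
  let ?P = "\<Prod>i\<in>A. 1 - f i"
  have IH: "1 - (\<Sum>i\<in>A. f i) \<le> ?P" "?P \<le> 1" using insert by auto
  have P0: "0 \<le> ?P" using insert by (intro prod_nonneg) auto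
  have a: "0 \<le> f a" "f a \<le> 1" using insert by auto
  have "f a * ?P \<le> f a" "0 \<le> f a * ?P" using a IH(2) P0 by (auto intro: mult_left_le)
  moreover have "(1 - f a) * ?P = ?P - f a * ?P" by (simp add: left_diff_distrib)
  ultimately show ?case using IH unfolding prod.insert[OF insert.hyps] sum.insert[OF insert.hyps] by linarith
qed simp

text \<open>A full atom has mass at least \<open>1 / (k + 1)\<close>, which equals
  \<open>(1 - 1 / (k + 1)) * (1 / k)\<close>.\<close>

lemma nu_loss:
  assumes "0 < \<alpha>" "\<alpha> \<le> 1"
  shows "(1 - 1 / (real (num_full \<alpha>) + 1)) * pmf (nu (1 / real (num_full \<alpha>))) x \<le> pmf (nu \<alpha>) x"
proof -
  let ?k = "real (num_full \<alpha>)"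
  note k = num_full_bounds[OF assms]
  have a: "0 < 1 / ?k" "1 / ?k \<le> 1" using k(1) by auto
  show ?thesis
  proof (cases "x \<in> {0..<int (num_full \<alpha>)}")
    case True
    then have "pmf (nu (1 / ?k)) x = 1 / ?k" "pmf (nu \<alpha>) x = \<alpha>"
      using pmf_nu_alt[OF a, of x] pmf_nu_alt[OF assms, of x] nu_inverse(1)[OF k(1)] by simp_all
    moreover have "(1 - 1 / (?k + 1)) * (1 / ?k) = 1 / (?k + 1)" using k(1) by (simp add: field_simps)
    moreover have "1 / (?k + 1) \<le> \<alpha>" using k(3) by (simp add: divide_le_eq)
    ultimately show ?thesis by simp
  next
    case False
    then have "pmf (nu (1 / ?k)) x = 0"
      using pmf_nu_alt[OF a, of x] nu_inverse(1)[OF k(1)] k(1) by simp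
    then show ?thesis by simp
  qed
qed

text \<open>The enlarged \<open>\<alpha>'\<close> is chosen before the maps \<open>f\<close>,
  because the reduction that produces \<open>f\<close> is carried out with \<open>\<alpha>'\<close>.
  If every support is small against \<sigma>, all summands count as small. Otherwise those with
  support at most \<open>\<theta> * \<sigma>\<close> do, and their standard deviation is either
  comparable with \<sigma>, which leads to \<open>many_small_case\<close>, or negligible against the
  largest support, which leads to \<open>one_large_case\<close>.\<close>

lemma core_inequality:
  assumes \<delta>: "0 < \<delta>"
  shows "\<exists>V. \<forall>(I :: nat set) \<alpha>. finite I \<longrightarrow> (\<forall>i\<in>I. 0 < \<alpha> i \<and> \<alpha> i \<le> 1) \<longrightarrow> V \<le> (\<Sum>i\<in>I. nu_variance (\<alpha> i)) \<longrightarrow>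
    (\<exists>\<alpha>'. (\<forall>i\<in>I. \<alpha> i \<le> \<alpha>' i \<and> \<alpha>' i \<le> 1) \<and>
      (\<forall>f :: nat \<Rightarrow> int \<Rightarrow> real. (\<forall>i\<in>I. inj_on (f i) (set_pmf (nu (\<alpha>' i)))) \<longrightarrow>
        (\<exists>z. \<forall>s. pmf (psum I (\<lambda>i. map_pmf (f i) (nu (\<alpha>' i)))) s \<le> (1 + \<delta>) * pmf (psum I (\<lambda>i. nu (\<alpha> i))) z)))"
proof -
  define d where "d = min (\<delta> / 4) (1 / 4)"
  have d: "0 < d" "d \<le> 1/4" "4 * d \<le> \<delta>" using \<delta> by (auto simp: d_def)
  have d\<delta>: "1 + d \<le> (1 + \<delta>) * (1 - d)"
  proof -
    have "d * d \<le> d * (1/4)" using d by (intro mult_left_mono) auto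
    then have "1 + d \<le> (1 + 4 * d) * (1 - d)" using d by (simp add: algebra_simps)
    also have "\<dots> \<le> (1 + \<delta>) * (1 - d)" using d by (intro mult_right_mono) auto
    finally show ?thesis .
  qed
  from many_small_case[OF d(1)] obtain \<epsilon> \<rho> where \<epsilon>: "0 < \<epsilon>" and \<rho>: "0 < \<rho>" "\<rho> \<le> 1/2"
    and manyO: "\<forall>(S :: nat set) J \<alpha> \<sigma> (f :: nat \<Rightarrow> int \<Rightarrow> real). finite S \<longrightarrow> finite J \<longrightarrow> S \<inter> J = {} \<longrightarrow>
      (\<forall>i\<in>J \<union> S. 0 < \<alpha> i \<and> \<alpha> i \<le> 1) \<longrightarrow> 0 < \<sigma> \<longrightarrow> \<sigma>\<^sup>2 = (\<Sum>i\<in>S. nu_variance (\<alpha> i)) \<longrightarrow>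
      (\<forall>i\<in>S. real (num_full (\<alpha> i)) \<le> \<epsilon> * \<sigma>) \<longrightarrow>
      (\<forall>i\<in>J \<union> S. inj_on (f i) (set_pmf (nu (if i \<in> S then round_up \<rho> (\<alpha> i) else 1 / real (num_full (\<alpha> i)))))) \<longrightarrow>
      (\<exists>z. \<forall>s. pmf (psum (J \<union> S) (\<lambda>i. map_pmf (f i) (nu (if i \<in> S then round_up \<rho> (\<alpha> i) else 1 / real (num_full (\<alpha> i)))))) s
        \<le> (1 + d) * pmf (psum (J \<union> S) (\<lambda>i. nu (if i \<in> S then \<alpha> i else 1 / real (num_full (\<alpha> i))))) z)"
    by (elim exE conjE) (rule that)
  note many = manyO[THEN spec, THEN spec, THEN spec, THEN spec, THEN spec,
    THEN mp, THEN mp, THEN mp, THEN mp, THEN mp, THEN mp, THEN mp, THEN mp]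
  from one_large_case[OF d(1)] obtain \<eta> where \<eta>: "0 < \<eta>"
    and oneO: "\<forall>(S :: nat set) J j1 \<alpha> \<sigma> (f :: nat \<Rightarrow> int \<Rightarrow> real) q. finite S \<longrightarrow> finite J \<longrightarrow> S \<inter> J = {} \<longrightarrow>
      (\<forall>i\<in>J \<union> S. 0 < \<alpha> i \<and> \<alpha> i \<le> 1) \<longrightarrow> 0 \<le> \<sigma> \<longrightarrow> \<sigma>\<^sup>2 = (\<Sum>i\<in>S. nu_variance (\<alpha> i)) \<longrightarrow> j1 \<in> J \<longrightarrow>
      \<sigma> \<le> \<eta> * real (num_full (\<alpha> j1)) \<longrightarrow> 1 \<le> \<eta> * real (num_full (\<alpha> j1)) \<longrightarrow> (\<forall>i\<in>S. finite (set_pmf (q i))) \<longrightarrow>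
      (\<forall>j\<in>J. inj_on (f j) (set_pmf (nu (1 / real (num_full (\<alpha> j))))) \<and> q j = map_pmf (f j) (nu (1 / real (num_full (\<alpha> j))))) \<longrightarrow>
      (\<exists>z. \<forall>s. pmf (psum (J \<union> S) q) s \<le> (1 + d) * pmf (psum (J \<union> S) (\<lambda>i. nu (if i \<in> S then \<alpha> i else 1 / real (num_full (\<alpha> i))))) z)"
    by (elim exE conjE) (rule that)
  note one = oneO[THEN spec, THEN spec, THEN spec, THEN spec, THEN spec, THEN spec, THEN spec,
    THEN mp, THEN mp, THEN mp, THEN mp, THEN mp, THEN mp, THEN mp, THEN mp, THEN mp, THEN mp, THEN mp]
  define a where "a = min \<epsilon> 1"
  define b where "b = min \<eta> 1"
  have ab: "0 < a" "a \<le> 1" "a \<le> \<epsilon>" "0 < b" "b \<le> 1" "b \<le> \<eta>" using \<epsilon> \<eta> by (auto simp: a_def b_def)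
  \<comment> \<open>The product serves both alternatives. If the small part has standard deviation
    at least \<open>b * a * \<sigma>\<close>, its supports are at most \<open>a\<close> times that;
    if not, its standard deviation is below \<open>b\<close> times a support that exceeds
    \<open>a * \<sigma>\<close>.\<close>
  define \<theta> where "\<theta> = a * (b * a)"
  have ba: "0 < b * a" "b * a \<le> 1" using ab by (auto simp: mult_le_one)
  have \<theta>: "0 < \<theta>" "\<theta> \<le> a" using ba ab by (auto simp: \<theta>_def mult_left_le)
  \<comment> \<open>Lower bounds for \<sigma> with three purposes: large summands have
    \<open>k > 2\<close>, the total loss \<open>24 / (\<theta> ^ 3 * \<sigma>)\<close> is at most
    \<open>d\<close>, and \<open>b * a * \<sigma>\<close> is at least 1.\<close>
  define B where "B = max (2 / \<theta>) (max (24 / (\<theta> ^ 3 * d)) (1 / (b * a)))"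
  have B0: "0 < B" using \<theta> by (simp add: B_def less_max_iff_disj)
  show ?thesis
  proof (rule exI[of _ "B\<^sup>2"], intro allI impI)
    fix I :: "nat set" and \<alpha> assume I: "finite I" and \<alpha>: "\<forall>i\<in>I. 0 < \<alpha> i \<and> \<alpha> i \<le> 1" and V: "B\<^sup>2 \<le> (\<Sum>i\<in>I. nu_variance (\<alpha> i))"
    define \<sigma> where "\<sigma> = sqrt (\<Sum>i\<in>I. nu_variance (\<alpha> i))"
    have vv0: "0 \<le> nu_variance (\<alpha> i)" for i by (simp add: Var_def)
    have \<sigma>2: "\<sigma>\<^sup>2 = (\<Sum>i\<in>I. nu_variance (\<alpha> i))" unfolding \<sigma>_def by (rule real_sqrt_pow2) (simp add: sum_nonneg vv0)
    have \<sigma>B: "B \<le> \<sigma>" unfolding \<sigma>_def by (rule real_le_rsqrt[OF V])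
    have \<sigma>0: "0 < \<sigma>" using \<sigma>B B0 by linarith
    have t2: "2 \<le> \<theta> * \<sigma>"
    proof -
      have "2 / \<theta> \<le> \<sigma>" using \<sigma>B by (simp add: B_def)
      then show ?thesis using \<theta> by (simp add: divide_le_eq mult.commute)
    qed
    have t3: "24 / (\<theta> ^ 3 * \<sigma>) \<le> d"
    proof -
      have "24 / (\<theta> ^ 3 * d) \<le> \<sigma>" using \<sigma>B by (simp add: B_def)
      then have "24 \<le> \<sigma> * (\<theta> ^ 3 * d)" using \<theta> d by (simp add: divide_le_eq)
      then show ?thesis using \<theta> \<sigma>0 by (simp add: divide_le_eq ac_simps)
    qed
    have t1: "1 \<le> b * a * \<sigma>"
    proof -
      have "1 / (b * a) \<le> \<sigma>" using \<sigma>B by (simp add: B_def)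
      then show ?thesis using ba by (simp add: divide_le_eq ac_simps)
    qed
    define small where "small \<longleftrightarrow> (\<forall>i\<in>I. real (num_full (\<alpha> i)) \<le> a * \<sigma>)"
    define S where "S = (if small then I else {i\<in>I. real (num_full (\<alpha> i)) \<le> \<theta> * \<sigma>})"
    define J where "J = I - S"
    have SI: "S \<subseteq> I" by (auto simp: S_def)
    have SJ: "finite S" "finite J" "S \<inter> J = {}" "J \<union> S = I" using I SI finite_subset[OF SI] by (auto simp: J_def)
    have Jk: "\<theta> * \<sigma> < real (num_full (\<alpha> j))" "j \<in> I" if "j \<in> J" for j
      using that by (auto simp: J_def S_def split: if_splits)
    have \<alpha>JS: "\<forall>i\<in>J \<union> S. 0 < \<alpha> i \<and> \<alpha> i \<le> 1" using \<alpha> unfolding SJ(4) .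
    define c where "c i = (if i \<in> J then 1 - 1 / (real (num_full (\<alpha> i)) + 1) else 1)" for i
    define r where "r i = nu (if i \<in> S then \<alpha> i else 1 / real (num_full (\<alpha> i)))" for i
    define \<alpha>' where "\<alpha>' i = (if i \<in> S then round_up \<rho> (\<alpha> i) else 1 / real (num_full (\<alpha> i)))" for i
    have rb: "0 < 1 / real (num_full (\<alpha> i)) \<and> 1 / real (num_full (\<alpha> i)) \<le> 1 \<and> \<alpha> i \<le> 1 / real (num_full (\<alpha> i))" if "i \<in> I" for i
      using \<alpha> that num_full_bounds(1,2)[of "\<alpha> i"] by (auto simp: le_divide_eq)
    have loss: "1 - d \<le> (\<Prod>i\<in>I. c i)"
    proof -
      \<comment> \<open>Each loss is at most \<open>k\<^sup>2 / (\<theta> * \<sigma>) ^ 3\<close>,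
        and \<open>k\<^sup>2 / 24\<close> is at most the variance of the summand. The losses are
        thus paid from the total variance, however many large summands there are.\<close>
      have "(\<Sum>j\<in>J. 1 / (real (num_full (\<alpha> j)) + 1)) \<le> (\<Sum>j\<in>J. 24 / (\<theta> * \<sigma>) ^ 3 * nu_variance (\<alpha> j))"
      proof (rule sum_mono)
        fix j assume j: "j \<in> J"
        let ?k = "real (num_full (\<alpha> j))"
        have k: "\<theta> * \<sigma> < ?k" "2 < ?k" using Jk(1)[OF j] t2 by linarith+
        have v: "?k\<^sup>2 / 24 \<le> nu_variance (\<alpha> j)" using \<alpha> Jk(2)[OF j] k(2) by (intro nu_variance_lower) auto
        have "1 / (?k + 1) \<le> 1 / ?k" using k by (intro divide_left_mono) auto
        also have "\<dots> = ?k\<^sup>2 / ?k ^ 3" using k by (simp add: power2_eq_square power3_eq_cube)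
        also have "\<dots> \<le> ?k\<^sup>2 / (\<theta> * \<sigma>) ^ 3" using k t2 \<theta>(1) \<sigma>0 by (intro divide_left_mono power_mono mult_pos_pos zero_less_power) auto
        also have "\<dots> = 24 / (\<theta> * \<sigma>) ^ 3 * (?k\<^sup>2 / 24)" by simp
        also have "\<dots> \<le> 24 / (\<theta> * \<sigma>) ^ 3 * nu_variance (\<alpha> j)" using v t2 by (intro mult_left_mono) auto
        finally show "1 / (?k + 1) \<le> 24 / (\<theta> * \<sigma>) ^ 3 * nu_variance (\<alpha> j)" .
      qed
      also have "\<dots> = 24 / (\<theta> * \<sigma>) ^ 3 * (\<Sum>j\<in>J. nu_variance (\<alpha> j))" by (simp only: sum_distrib_left)
      also have "\<dots> \<le> 24 / (\<theta> * \<sigma>) ^ 3 * \<sigma>\<^sup>2"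
        unfolding \<sigma>2 using I vv0 t2 by (intro mult_left_mono sum_mono2) (auto simp: J_def)
      also have "\<dots> = 24 / (\<theta> ^ 3 * \<sigma>)" using \<sigma>0 by (simp add: power2_eq_square power3_eq_cube)
      finally have "(\<Sum>j\<in>J. 1 / (real (num_full (\<alpha> j)) + 1)) \<le> d" using t3 by linarith
      then have "1 - d \<le> 1 - (\<Sum>j\<in>J. 1 / (real (num_full (\<alpha> j)) + 1))" by linarith
      also have "\<dots> \<le> (\<Prod>j\<in>J. 1 - 1 / (real (num_full (\<alpha> j)) + 1))"
        using prod_one_minus_ge[OF SJ(2), of "\<lambda>j. 1 / (real (num_full (\<alpha> j)) + 1)"] by simp
      also have "\<dots> = (\<Prod>i\<in>I. c i)"
        by (rule prod.mono_neutral_cong_left[OF I]) (auto simp: c_def J_def)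
      finally show ?thesis .
    qed
    have mono: "(1 - d) * pmf (psum I r) z \<le> pmf (psum I (\<lambda>i. nu (\<alpha> i))) z" for z
    proof -
      have "(1 - d) * pmf (psum I r) z \<le> (\<Prod>i\<in>I. c i) * pmf (psum I r) z" using loss by (intro mult_right_mono) auto
      also have "\<dots> \<le> pmf (psum I (\<lambda>i. nu (\<alpha> i))) z"
      proof (rule pmf_psum_mono[OF I])
        fix i assume i: "i \<in> I"
        then have ai: "0 < \<alpha> i" "\<alpha> i \<le> 1" using \<alpha> by auto
        show "finite (set_pmf (nu (\<alpha> i))) \<and> finite (set_pmf (r i))" using ai rb[OF i] by (simp add: r_def)
        show "0 \<le> c i" by (simp add: c_def)
        show "c i * pmf (r i) x \<le> pmf (nu (\<alpha> i)) x" for x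
        proof (cases "i \<in> S")
          case True
          then have "i \<notin> J" using SJ(3) by blast
          then show ?thesis using True by (simp add: c_def r_def)
        next
          case False
          then have "i \<in> J" using i by (simp add: J_def)
          then show ?thesis using nu_loss[OF ai, of x] False by (simp add: c_def r_def)
        qed
      qed
      finally show ?thesis .
    qed
    have main: "\<exists>z. \<forall>s. pmf (psum I (\<lambda>i. map_pmf (f i) (nu (\<alpha>' i)))) s \<le> (1 + d) * pmf (psum I r) z"
      if inj: "\<forall>i\<in>I. inj_on (f i) (set_pmf (nu (\<alpha>' i)))" for f :: "nat \<Rightarrow> int \<Rightarrow> real"
    proof -
      define \<sigma>S where "\<sigma>S = sqrt (\<Sum>i\<in>S. nu_variance (\<alpha> i))"
      have \<sigma>S2: "\<sigma>S\<^sup>2 = (\<Sum>i\<in>S. nu_variance (\<alpha> i))" unfolding \<sigma>S_def by (rule real_sqrt_pow2) (simp add: sum_nonneg vv0)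
      have \<sigma>S0: "0 \<le> \<sigma>S" by (simp add: \<sigma>S_def sum_nonneg vv0)
      have A: ?thesis if k: "\<forall>i\<in>S. real (num_full (\<alpha> i)) \<le> \<epsilon> * \<sigma>S" and p: "0 < \<sigma>S"
      proof -
        have inj': "\<forall>i\<in>J \<union> S. inj_on (f i) (set_pmf (nu (if i \<in> S then round_up \<rho> (\<alpha> i) else 1 / real (num_full (\<alpha> i)))))"
          using inj unfolding SJ(4) \<alpha>'_def .
        show ?thesis
          using many[OF SJ(1-3) \<alpha>JS p \<sigma>S2 k inj'] unfolding SJ(4) \<alpha>'_def[symmetric] r_def[symmetric] .
      qed
      consider "small" | "\<not> small" "b * a * \<sigma> \<le> \<sigma>S" | "\<not> small" "\<sigma>S < b * a * \<sigma>" by linarith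
      then show ?thesis
      proof cases
        case 1
        then have S: "S = I" by (simp add: S_def)
        have \<sigma>S: "\<sigma>S = \<sigma>" by (simp add: \<sigma>S_def \<sigma>_def S)
        show ?thesis
        proof (rule A)
          show "\<forall>i\<in>S. real (num_full (\<alpha> i)) \<le> \<epsilon> * \<sigma>S"
          proof
            fix i assume "i \<in> S"
            then have "real (num_full (\<alpha> i)) \<le> a * \<sigma>" using 1 S by (simp add: small_def)
            also have "\<dots> \<le> \<epsilon> * \<sigma>" using ab \<sigma>0 by (intro mult_right_mono) auto
            finally show "real (num_full (\<alpha> i)) \<le> \<epsilon> * \<sigma>S" unfolding \<sigma>S .
          qed
        qed (use \<sigma>0 \<sigma>S in simp)
      next
        case 2
        show ?thesis
        proof (rule A)
          show "\<forall>i\<in>S. real (num_full (\<alpha> i)) \<le> \<epsilon> * \<sigma>S"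
          proof
            fix i assume "i \<in> S"
            then have "real (num_full (\<alpha> i)) \<le> a * (b * a * \<sigma>)" using 2 by (simp add: S_def \<theta>_def ac_simps)
            also have "\<dots> \<le> a * \<sigma>S" using ab 2 by (intro mult_left_mono) auto
            also have "\<dots> \<le> \<epsilon> * \<sigma>S" using ab \<sigma>S0 by (intro mult_right_mono) auto
            finally show "real (num_full (\<alpha> i)) \<le> \<epsilon> * \<sigma>S" .
          qed
          show "0 < \<sigma>S" using 2(2) t1 by linarith
        qed
      next
        case 3
        then obtain j1 where j1: "j1 \<in> I" "a * \<sigma> < real (num_full (\<alpha> j1))" unfolding small_def by (auto simp: not_le)
        have "\<theta> * \<sigma> \<le> a * \<sigma>" using \<theta> \<sigma>0 by (intro mult_right_mono) auto
        then have "j1 \<in> J" using j1 3 by (simp add: J_def S_def)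
        have "b * a * \<sigma> \<le> b * real (num_full (\<alpha> j1))" using j1 ab by (simp add: mult.assoc)
        also have "\<dots> \<le> \<eta> * real (num_full (\<alpha> j1))" using ab by (intro mult_right_mono) auto
        finally have kj: "b * a * \<sigma> \<le> \<eta> * real (num_full (\<alpha> j1))" .
        have k1: "\<sigma>S \<le> \<eta> * real (num_full (\<alpha> j1))" "1 \<le> \<eta> * real (num_full (\<alpha> j1))" using kj 3(2) t1 by linarith+
        have fS: "\<forall>i\<in>S. finite (set_pmf (map_pmf (f i) (nu (\<alpha>' i))))"
        proof
          fix i assume "i \<in> S"
          then show "finite (set_pmf (map_pmf (f i) (nu (\<alpha>' i))))"
            using \<alpha> SI \<rho> round_up(1,2)[of "\<alpha> i" \<rho>] by (auto simp: \<alpha>'_def)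
        qed
        have fJ: "\<forall>j\<in>J. inj_on (f j) (set_pmf (nu (1 / real (num_full (\<alpha> j))))) \<and>
          map_pmf (f j) (nu (\<alpha>' j)) = map_pmf (f j) (nu (1 / real (num_full (\<alpha> j))))"
        proof
          fix j assume j: "j \<in> J"
          then have "\<alpha>' j = 1 / real (num_full (\<alpha> j))" using SJ(3) by (auto simp: \<alpha>'_def)
          then show "inj_on (f j) (set_pmf (nu (1 / real (num_full (\<alpha> j))))) \<and>
            map_pmf (f j) (nu (\<alpha>' j)) = map_pmf (f j) (nu (1 / real (num_full (\<alpha> j))))"
            using inj Jk(2)[OF j] by auto
        qed
        show ?thesis
          using one[OF SJ(1-3) \<alpha>JS \<sigma>S0 \<sigma>S2 \<open>j1 \<in> J\<close> k1 fS fJ] unfolding SJ(4) r_def[symmetric] .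
      qed
    qed
    show "\<exists>\<alpha>'. (\<forall>i\<in>I. \<alpha> i \<le> \<alpha>' i \<and> \<alpha>' i \<le> 1) \<and>
      (\<forall>f :: nat \<Rightarrow> int \<Rightarrow> real. (\<forall>i\<in>I. inj_on (f i) (set_pmf (nu (\<alpha>' i)))) \<longrightarrow>
        (\<exists>z. \<forall>s. pmf (psum I (\<lambda>i. map_pmf (f i) (nu (\<alpha>' i)))) s \<le> (1 + \<delta>) * pmf (psum I (\<lambda>i. nu (\<alpha> i))) z))"
    proof (rule exI[of _ \<alpha>'], intro conjI ballI allI impI)
      fix i assume i: "i \<in> I"
      show "\<alpha> i \<le> \<alpha>' i" "\<alpha>' i \<le> 1" using \<alpha> i \<rho> round_up(2,3)[of "\<alpha> i" \<rho>] rb[OF i] by (auto simp: \<alpha>'_def)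
    next
      fix f :: "nat \<Rightarrow> int \<Rightarrow> real" assume inj: "\<forall>i\<in>I. inj_on (f i) (set_pmf (nu (\<alpha>' i)))"
      from main[OF inj] obtain z where z: "\<And>s. pmf (psum I (\<lambda>i. map_pmf (f i) (nu (\<alpha>' i)))) s \<le> (1 + d) * pmf (psum I r) z" by blast
      have "(1 + d) * pmf (psum I r) z \<le> (1 + \<delta>) * ((1 - d) * pmf (psum I r) z)"
        using mult_right_mono[OF d\<delta>, of "pmf (psum I r) z"] by (simp add: mult.assoc)
      also have "\<dots> \<le> (1 + \<delta>) * pmf (psum I (\<lambda>i. nu (\<alpha> i))) z" using mono \<delta> by (intro mult_left_mono) auto
      finally show "\<exists>z. \<forall>s. pmf (psum I (\<lambda>i. map_pmf (f i) (nu (\<alpha>' i)))) s \<le> (1 + \<delta>) * pmf (psum I (\<lambda>i. nu (\<alpha> i))) z"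
        by (intro exI[of _ z] allI order_trans[OF z])
    qed
  qed
qed

section \<open>Reduction to finitely many atoms\<close>

text \<open>A summable nonnegative function reaches a given positive level only finitely often, so
  its supremum outside a finite set is attained. If it vanishes there, any new point serves.\<close>

lemma arg_max_outside_finite:
  fixes c :: "'b \<Rightarrow> real"
  assumes inf: "infinite (UNIV :: 'b set)" and c: "\<And>y. 0 \<le> c y" "\<And>F. finite F \<Longrightarrow> (\<Sum>y\<in>F. c y) \<le> B" and F: "finite F"
  shows "\<exists>x. x \<notin> F \<and> (\<forall>y. y \<notin> F \<longrightarrow> c y \<le> c x)"
proof (cases "\<forall>y. y \<notin> F \<longrightarrow> c y = 0")
  case True
  obtain x where "x \<notin> F" using ex_new_if_finite[OF inf F] by blast
  then show ?thesis using True c(1)[of x] by (intro exI[of _ x]) auto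
next
  case False
  then obtain y0 where y0: "y0 \<notin> F" "c y0 \<noteq> 0" by blast
  then have t: "0 < c y0" using c(1)[of y0] by simp
  have fin: "finite {y. c y0 \<le> c y}"
  proof (rule ccontr)
    assume inf': "infinite {y. c y0 \<le> c y}"
    obtain n where n: "B < real n * c y0" using reals_Archimedean3[OF t] by blast
    obtain G where G: "finite G" "card G = n" "G \<subseteq> {y. c y0 \<le> c y}"
      using infinite_arbitrarily_large[OF inf', of n] by blast
    have "real n * c y0 = (\<Sum>y\<in>G. c y0)" using G by simp
    also have "\<dots> \<le> (\<Sum>y\<in>G. c y)" using G(3) by (intro sum_mono) auto
    finally show False using c(2)[OF G(1)] n by simp
  qed
  let ?A = "{y. c y0 \<le> c y} - F"
  have A: "finite (c ` ?A)" "c ` ?A \<noteq> {}" using fin y0 by auto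
  have "Max (c ` ?A) \<in> c ` ?A" using A by (rule Max_in)
  then obtain x where x: "x \<in> ?A" "c x = Max (c ` ?A)" by (metis imageE)
  show ?thesis
  proof (intro exI[of _ x] conjI allI impI)
    show "x \<notin> F" using x by simp
    fix y assume y: "y \<notin> F"
    show "c y \<le> c x"
    proof (cases "c y0 \<le> c y")
      case True
      then have "c y \<in> c ` ?A" using y by simp
      then show ?thesis unfolding x(2) using A(1) by (rule Max_ge[rotated])
    next
      case False
      then show ?thesis using x(1) by simp
    qed
  qed
qed

text \<open>Greedy choice: each point maximises \<open>c\<close> outside those already
  taken.\<close>

lemma decreasing_enumeration:
  fixes c :: "'b \<Rightarrow> real"
  assumes inf: "infinite (UNIV :: 'b set)" and c: "\<And>y. 0 \<le> c y" "\<And>F. finite F \<Longrightarrow> (\<Sum>y\<in>F. c y) \<le> B"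
  shows "\<exists>p :: nat \<Rightarrow> 'b. inj p \<and> (\<forall>j y. y \<notin> p ` {..<j} \<longrightarrow> c y \<le> c (p j))"
proof -
  have "\<forall>F. \<exists>x. finite F \<longrightarrow> x \<notin> F \<and> (\<forall>y. y \<notin> F \<longrightarrow> c y \<le> c x)"
    using arg_max_outside_finite[OF inf c] by blast
  then have "\<exists>g. \<forall>F. finite F \<longrightarrow> g F \<notin> F \<and> (\<forall>y. y \<notin> F \<longrightarrow> c y \<le> c (g F))" by (rule choice)
  then obtain g where g0: "\<forall>F. finite F \<longrightarrow> g F \<notin> F \<and> (\<forall>y. y \<notin> F \<longrightarrow> c y \<le> c (g F))" ..
  have g: "g F \<notin> F" "y \<notin> F \<Longrightarrow> c y \<le> c (g F)" if "finite F" for F y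
    using g0[rule_format, OF that] by simp_all
  define G where "G = rec_nat {} (\<lambda>_ F. insert (g F) F)"
  define p where "p n = g (G n)" for n
  have G: "G 0 = {}" "G (Suc n) = insert (p n) (G n)" for n by (simp_all add: G_def p_def)
  have Gp: "G n = p ` {..<n}" for n by (induction n) (simp_all add: G lessThan_Suc)
  have fG: "finite (G n)" for n by (simp add: Gp)
  have new: "p n \<notin> p ` {..<n}" for n
  proof -
    have "p n \<notin> G n" unfolding p_def by (rule g(1)[OF fG])
    then show ?thesis by (simp only: Gp not_False_eq_True)
  qed
  have "inj p"
  proof (rule injI)
    fix x y assume e: "p x = p y"
    have less: False if "u < v" "p u = p v" for u v
    proof -
      have "p u \<in> p ` {..<v}" using that(1) by (intro imageI) simp
      then show False using new[of v] unfolding that(2) by contradiction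
    qed
    show "x = y"
    proof (rule ccontr)
      assume "x \<noteq> y"
      then consider "x < y" | "y < x" by linarith
      then show False by cases (rule less, assumption, simp only: e)+
    qed
  qed
  moreover have "c y \<le> c (p j)" if "y \<notin> p ` {..<j}" for j y
  proof -
    have "y \<notin> G j" using that by (simp only: Gp not_False_eq_True)
    then show ?thesis unfolding p_def by (rule g(2)[OF fG])
  qed
  ultimately show ?thesis by blast
qed

text \<open>The bathtub principle: among laws with atoms of mass at most \<open>\<alpha>\<close>, an expectation is largest when
  mass \<open>\<alpha>\<close> sits on each of the largest values of the integrand.\<close>

lemma bathtub:
  fixes c :: "'b::{second_countable_topology, t2_space} \<Rightarrow> real" and N :: "'b measure"
  assumes "prob_space N" and N: "sets N = sets borel" and atom: "\<And>y. measure N {y} \<le> \<alpha>" and \<alpha>: "0 < \<alpha>" "\<alpha> \<le> 1"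
    and inf: "infinite (UNIV :: 'b set)" and cm: "c \<in> borel_measurable borel"
    and c: "\<And>y. 0 \<le> c y" "\<And>F. finite F \<Longrightarrow> (\<Sum>y\<in>F. c y) \<le> B"
  shows "\<exists>p :: int \<Rightarrow> 'b. inj_on p (set_pmf (nu \<alpha>)) \<and> integral\<^sup>L N c \<le> EE (nu \<alpha>) (\<lambda>i. c (p i))"
proof -
  interpret prob_space N by fact
  from decreasing_enumeration[OF inf c] obtain q :: "nat \<Rightarrow> 'b" where q: "inj q" "\<And>j y. y \<notin> q ` {..<j} \<Longrightarrow> c y \<le> c (q j)" by blast
  let ?k = "num_full \<alpha>"
  define p where "p i = q (nat i)" for i
  have inj: "inj_on p (set_pmf (nu \<alpha>))"
  proof (rule inj_onI)
    fix x y assume "x \<in> set_pmf (nu \<alpha>)" "y \<in> set_pmf (nu \<alpha>)" and e: "p x = p y"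
    then have "0 \<le> x" "0 \<le> y" using set_nu_bound[OF \<alpha>] by auto
    then show "x = y" using injD[OF q(1) e[unfolded p_def]] by simp
  qed
  have dec: "c (q ?k) \<le> c (q j)" if "j < ?k" for j
  proof (rule q(2))
    show "q ?k \<notin> q ` {..<j}" using q(1) that by (auto simp: inj_eq)
  qed
  have sing: "{y} \<in> sets N" for y using N by simp
  have cN: "c \<in> borel_measurable N" using cm by (simp add: measurable_cong_sets[OF N refl])
  \<comment> \<open>A majorant of \<open>c\<close> made of a constant and of indicators of the
    \<open>k\<close> best points. Its integral involves only masses of atoms, each at most \<alpha>,
    and its coefficients are nonnegative.\<close>
  let ?g = "\<lambda>x. c (q ?k) + (\<Sum>j<?k. (c (q j) - c (q ?k)) * indicator {q j} x)"
  have ig: "integrable N (indicator {y} :: 'b \<Rightarrow> real)" for y using sing by (simp add: emeasure_eq_measure)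
  have int: "integrable N ?g" by (intro Bochner_Integration.integrable_add Bochner_Integration.integrable_sum integrable_mult_right ig integrable_const)
  have up: "c x \<le> ?g x" for x
  proof (cases "x \<in> q ` {..<?k}")
    case True
    then obtain j where j: "j < ?k" "x = q j" by auto
    have "(\<Sum>i<?k. (c (q i) - c (q ?k)) * indicator {q i} x) = (\<Sum>i<?k. if i = j then c (q j) - c (q ?k) else 0)"
      using q(1) j by (intro sum.cong) (auto simp: inj_eq indicator_def)
    also have "\<dots> = c (q j) - c (q ?k)" using j by simp
    finally show ?thesis using j by simp
  next
    case False
    have "0 \<le> (\<Sum>j<?k. (c (q j) - c (q ?k)) * indicator {q j} x)" using dec by (intro sum_nonneg mult_nonneg_nonneg) auto
    then show ?thesis using q(2)[OF False] by linarith
  qed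
  have "integral\<^sup>L N c \<le> integral\<^sup>L N ?g"
  proof (rule integral_mono[OF _ int up])
    show "integrable N c" by (rule Bochner_Integration.integrable_bound[OF int cN])
      (rule AE_I2, simp only: real_norm_def abs_of_nonneg[OF c(1)], rule order_trans[OF up abs_ge_self])
  qed
  also have "\<dots> = c (q ?k) + (\<Sum>j<?k. (c (q j) - c (q ?k)) * measure N {q j})"
  proof -
    let ?h = "\<lambda>j x. (c (q j) - c (q ?k)) * indicator {q j} x :: real"
    have ih: "integrable N (?h j)" for j by (intro integrable_mult_right ig)
    have "integral\<^sup>L N ?g = integral\<^sup>L N (\<lambda>x. c (q ?k)) + integral\<^sup>L N (\<lambda>x. \<Sum>j<?k. ?h j x)"
      by (rule Bochner_Integration.integral_add) (intro integrable_const Bochner_Integration.integrable_sum ih)+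
    also have "integral\<^sup>L N (\<lambda>x. \<Sum>j<?k. ?h j x) = (\<Sum>j<?k. integral\<^sup>L N (?h j))"
      by (rule Bochner_Integration.integral_sum[OF ih])
    also have "\<dots> = (\<Sum>j<?k. (c (q j) - c (q ?k)) * measure N {q j})"
    proof (rule sum.cong[OF refl])
      fix j
      have "integral\<^sup>L N (?h j) = (c (q j) - c (q ?k)) * integral\<^sup>L N (indicator {q j})"
        by (rule Bochner_Integration.integral_mult_right[OF ig])
      also have "integral\<^sup>L N (indicator {q j}) = measure N {q j}"
        using sing[of "q j"] sets.sets_into_space[OF sing[of "q j"]] by (simp add: Int_absorb2)
      finally show "integral\<^sup>L N (?h j) = (c (q j) - c (q ?k)) * measure N {q j}" .
    qed
    also have "integral\<^sup>L N (\<lambda>x. c (q ?k)) = c (q ?k)" by (simp add: prob_space)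
    finally show ?thesis .
  qed
  also have "\<dots> \<le> c (q ?k) + (\<Sum>j<?k. (c (q j) - c (q ?k)) * \<alpha>)"
    using dec atom by (intro add_left_mono sum_mono mult_left_mono) auto
  also have "\<dots> = \<alpha> * (\<Sum>j<?k. c (q j)) + (1 - \<alpha> * real ?k) * c (q ?k)"
    by (simp add: sum_distrib_right[symmetric] sum_subtractf sum_distrib_left algebra_simps)
  also have "\<dots> = EE (nu \<alpha>) (\<lambda>i. c (p i))" by (simp add: EE_nu[OF \<alpha>] p_def)
  finally show ?thesis using inj by blast
qed

section \<open>Replacing independent summands one at a time\<close>

lemma (in prob_space) indep_var_sum:
  fixes X :: "'i \<Rightarrow> 'a \<Rightarrow> 'b::{real_normed_vector, second_countable_topology}"
  assumes I: "finite I" "i \<notin> I" and indep: "indep_vars (\<lambda>_. borel) X (insert i I)"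
  shows "indep_var borel (X i) borel (\<lambda>\<omega>. \<Sum>i\<in>I. X i \<omega>)"
proof -
  have "indep_var
    borel ((\<lambda>f. f i) \<circ> (\<lambda>\<omega>. restrict (\<lambda>i. X i \<omega>) {i}))
    borel ((\<lambda>f. \<Sum>i\<in>I. f i) \<circ> (\<lambda>\<omega>. restrict (\<lambda>i. X i \<omega>) I))"
    using I by (intro indep_var_compose[OF indep_var_restrict[OF indep]]) auto
  also have "((\<lambda>f. f i) \<circ> (\<lambda>\<omega>. restrict (\<lambda>i. X i \<omega>) {i})) = X i" by auto
  also have "((\<lambda>f. \<Sum>i\<in>I. f i) \<circ> (\<lambda>\<omega>. restrict (\<lambda>i. X i \<omega>) I)) = (\<lambda>\<omega>. \<Sum>i\<in>I. X i \<omega>)"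
    by (auto cong: rev_conj_cong)
  finally show ?thesis .
qed

lemma (in prob_space) prob_add_eq:
  fixes X T :: "'a \<Rightarrow> 'b::{real_normed_vector, second_countable_topology}"
  assumes "indep_var borel X borel T"
  shows "(\<lambda>x. measure (distr M borel T) {a - x}) \<in> borel_measurable borel"
    and "prob {\<omega>\<in>space M. X \<omega> + T \<omega> = a} = (\<integral>x. measure (distr M borel T) {a - x} \<partial>distr M borel X)"
proof -
  have rv [measurable]: "random_variable borel X" "random_variable borel T"
    and eq: "distr M borel X \<Otimes>\<^sub>M distr M borel T = distr M (borel \<Otimes>\<^sub>M borel) (\<lambda>\<omega>. (X \<omega>, T \<omega>))"
    using assms unfolding indep_var_distribution_eq by auto
  let ?N = "distr M borel X" and ?K = "distr M borel T"
  interpret N: prob_space ?N by (rule prob_space_distr[OF rv(1)])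
  interpret K: prob_space ?K by (rule prob_space_distr[OF rv(2)])
  define A :: "('b \<times> 'b) set" where "A = {w. fst w + snd w = a}"
  have A [measurable]: "A \<in> sets (borel \<Otimes>\<^sub>M borel)"
  proof -
    have "{w \<in> space (borel \<Otimes>\<^sub>M borel). fst w + snd w = a} \<in> sets (borel \<Otimes>\<^sub>M (borel :: 'b measure))" by measurable
    then show ?thesis by (simp add: A_def space_pair_measure)
  qed
  have A': "A \<in> sets (?N \<Otimes>\<^sub>M ?K)" "A \<in> sets (borel \<Otimes>\<^sub>M ?K)"
  proof -
    have e: "sets (?N \<Otimes>\<^sub>M ?K) = sets (borel \<Otimes>\<^sub>M (borel :: 'b measure))"
      by (rule sets_pair_measure_cong[OF sets_distr sets_distr])
    have f: "sets (borel \<Otimes>\<^sub>M ?K) = sets (borel \<Otimes>\<^sub>M (borel :: 'b measure))"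
      by (rule sets_pair_measure_cong[OF refl sets_distr])
    show "A \<in> sets (?N \<Otimes>\<^sub>M ?K)" unfolding e by (rule A)
    show "A \<in> sets (borel \<Otimes>\<^sub>M ?K)" unfolding f by (rule A)
  qed
  have sec: "Pair x -` A = {a - x}" for x by (auto simp: A_def add_diff_eq)
  have "(\<lambda>x. measure ?K (Pair x -` A)) \<in> borel_measurable borel"
    using K.measurable_emeasure_Pair[OF A'(2)] by (simp add: measure_def)
  then show m: "(\<lambda>x. measure ?K {a - x}) \<in> borel_measurable borel" by (simp add: sec)
  have "prob {\<omega>\<in>space M. X \<omega> + T \<omega> = a} = measure (distr M (borel \<Otimes>\<^sub>M borel) (\<lambda>\<omega>. (X \<omega>, T \<omega>))) A"
    by (subst measure_distr[OF _ A]) (auto simp: A_def intro!: arg_cong[where f = prob])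
  also have "\<dots> = enn2real (\<integral>\<^sup>+x. emeasure ?K (Pair x -` A) \<partial>?N)"
    by (subst eq[symmetric], subst measure_def, subst K.emeasure_pair_measure_alt[OF A'(1)]) (rule refl)
  also have "\<dots> = enn2real (\<integral>\<^sup>+x. ennreal (measure ?K {a - x}) \<partial>?N)"
    by (simp only: sec K.emeasure_eq_measure)
  also have "\<dots> = (\<integral>x. measure ?K {a - x} \<partial>?N)"
    using m by (subst integral_eq_nn_integral) auto
  finally show "prob {\<omega>\<in>space M. X \<omega> + T \<omega> = a} = (\<integral>x. measure ?K {a - x} \<partial>?N)" .
qed

text \<open>The induction runs over weighted sums of point probabilities although a single point is
  wanted in the end: once a coordinate has been replaced by an extremal law, the probability of a
  point is a mixture over its translates. In each step \<open>c y\<close> is the weighted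
  probability when the current summand is frozen at \<open>y\<close>. Its sums over finite sets are
  at most the total weight, so the bathtub principle applies.\<close>

lemma (in prob_space) bathtub_sum:
  fixes X :: "nat \<Rightarrow> 'a \<Rightarrow> 'b::{real_normed_vector, second_countable_topology}"
  assumes "finite I" and inf: "infinite (UNIV :: 'b set)" and "indep_vars (\<lambda>_. borel) X I"
    and "\<And>i y. i \<in> I \<Longrightarrow> prob {\<omega>\<in>space M. X i \<omega> = y} \<le> \<alpha> i" "\<And>i. i \<in> I \<Longrightarrow> 0 < \<alpha> i \<and> \<alpha> i \<le> 1"
    and "finite W" "\<And>a. 0 \<le> (w a :: real)"
  shows "\<exists>p :: nat \<Rightarrow> int \<Rightarrow> 'b. (\<forall>i\<in>I. inj_on (p i) (set_pmf (nu (\<alpha> i)))) \<and>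
    (\<Sum>a\<in>W. w a * prob {\<omega>\<in>space M. (\<Sum>i\<in>I. X i \<omega>) = a}) \<le> (\<Sum>a\<in>W. w a * pmf (psum I (\<lambda>i. map_pmf (p i) (nu (\<alpha> i)))) a)"
  using assms(1,3-7)
proof (induction I arbitrary: W w rule: finite_induct)
  case empty
  have "prob {\<omega>\<in>space M. (\<Sum>i\<in>{}. X i \<omega>) = a} = pmf (psum {} q) a" for a and q :: "nat \<Rightarrow> 'b pmf"
    by (cases "a = 0") (auto simp: psum_def prob_space)
  then show ?case by simp
next
  case (insert j I)
  let ?T = "\<lambda>\<omega>. \<Sum>i\<in>I. X i \<omega>"
  let ?K = "distr M borel ?T" let ?N = "distr M borel (X j)"
  have ind: "indep_var borel (X j) borel ?T" by (rule indep_var_sum[OF insert.hyps insert.prems(1)])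
  have rv [measurable]: "random_variable borel (X j)" "random_variable borel ?T"
    using ind unfolding indep_var_distribution_eq by auto
  interpret N: prob_space ?N by (rule prob_space_distr[OF rv(1)])
  interpret K: prob_space ?K by (rule prob_space_distr[OF rv(2)])
  have meas: "(\<lambda>x. measure ?K {a - x}) \<in> borel_measurable borel" for a by (rule prob_add_eq(1)[OF ind])
  define c where "c y = (\<Sum>a\<in>W. w a * measure ?K {a - y})" for y
  have cm: "c \<in> borel_measurable borel" unfolding c_def by (intro borel_measurable_sum borel_measurable_times borel_measurable_const meas)
  have c0: "0 \<le> c y" for y unfolding c_def using insert.prems(5) by (intro sum_nonneg mult_nonneg_nonneg) auto
  have cB: "(\<Sum>y\<in>F. c y) \<le> (\<Sum>a\<in>W. w a)" if F: "finite F" for F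
  proof -
    have "(\<Sum>y\<in>F. c y) = (\<Sum>a\<in>W. \<Sum>y\<in>F. w a * measure ?K {a - y})" unfolding c_def by (rule sum.swap)
    also have "\<dots> \<le> (\<Sum>a\<in>W. w a)"
    proof (rule sum_mono)
      fix a
      have "(\<Sum>y\<in>F. measure ?K {a - y}) = (\<Sum>u\<in>(\<lambda>y. a - y) ` F. measure ?K {u})"
        by (subst sum.reindex) (auto simp: inj_on_def)
      also have "\<dots> = measure ?K ((\<lambda>y. a - y) ` F)"
        using F by (intro K.finite_measure_eq_sum_singleton[symmetric]) auto
      also have "\<dots> \<le> 1" by (rule K.prob_le_1)
      finally have le: "(\<Sum>y\<in>F. measure ?K {a - y}) \<le> 1" .
      have "w a * (\<Sum>y\<in>F. measure ?K {a - y}) \<le> w a * 1" by (rule mult_left_mono[OF le insert.prems(5)])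
      then show "(\<Sum>y\<in>F. w a * measure ?K {a - y}) \<le> w a" by (simp only: sum_distrib_left mult_1_right)
    qed
    finally show ?thesis .
  qed
  have aj: "0 < \<alpha> j" "\<alpha> j \<le> 1" using insert.prems(3)[of j] by auto
  have atom: "measure ?N {y} \<le> \<alpha> j" for y
  proof -
    have "measure ?N {y} = prob {\<omega>\<in>space M. X j \<omega> = y}"
      by (subst measure_distr[OF rv(1)]) (auto intro!: arg_cong[where f = prob])
    then show ?thesis using insert.prems(2)[of j y] by simp
  qed
  have "\<exists>p :: int \<Rightarrow> 'b. inj_on p (set_pmf (nu (\<alpha> j))) \<and> integral\<^sup>L ?N c \<le> EE (nu (\<alpha> j)) (\<lambda>i. c (p i))"
    by (rule bathtub[OF N.prob_space_axioms sets_distr atom aj inf cm c0 cB])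
  then obtain pj where pj: "inj_on pj (set_pmf (nu (\<alpha> j)))" "integral\<^sup>L ?N c \<le> EE (nu (\<alpha> j)) (\<lambda>i. c (pj i))" by (elim exE conjE) (rule that)
  define P where "P = set_pmf (nu (\<alpha> j))"
  have P: "finite P" unfolding P_def by (rule finite_set_nu[OF aj])
  have EEP: "EE (nu (\<alpha> j)) g = (\<Sum>i\<in>P. pmf (nu (\<alpha> j)) i * g i)" for g
    using P by (subst integral_measure_pmf[of P]) (auto simp: P_def)
  define t where "t i a = pmf (nu (\<alpha> j)) i * w a" for i a
  \<comment> \<open>The points and weights of the functional that remains for the sum over
    \<open>I\<close> after coordinate \<open>j\<close> has been given its optimal law. Distinct
    pairs may yield the same point, hence the sum in \<open>w'\<close>.\<close>
  define W' where "W' = (\<lambda>(i, a). a - pj i) ` (P \<times> W)"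
  have W': "finite W'" unfolding W'_def using P insert.prems(4) by (intro finite_imageI finite_cartesian_product)
  define w' where "w' b = (\<Sum>i\<in>P. \<Sum>a\<in>W. t i a * of_bool (a - pj i = b))" for b
  have w'0: "0 \<le> w' b" for b unfolding w'_def t_def using insert.prems(5) by (intro sum_nonneg mult_nonneg_nonneg) auto
  have expand: "(\<Sum>b\<in>W'. w' b * h b) = (\<Sum>i\<in>P. \<Sum>a\<in>W. t i a * h (a - pj i))" for h
  proof -
    have "(\<Sum>b\<in>W'. w' b * h b) = (\<Sum>b\<in>W'. \<Sum>i\<in>P. \<Sum>a\<in>W. t i a * of_bool (a - pj i = b) * h b)"
      unfolding w'_def by (simp only: sum_distrib_right)
    also have "\<dots> = (\<Sum>i\<in>P. \<Sum>b\<in>W'. \<Sum>a\<in>W. t i a * of_bool (a - pj i = b) * h b)" by (rule sum.swap)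
    also have "\<dots> = (\<Sum>i\<in>P. \<Sum>a\<in>W. \<Sum>b\<in>W'. t i a * of_bool (a - pj i = b) * h b)"
      by (rule sum.cong[OF refl]) (rule sum.swap)
    also have "\<dots> = (\<Sum>i\<in>P. \<Sum>a\<in>W. t i a * h (a - pj i))"
    proof (rule sum.cong[OF refl], rule sum.cong[OF refl])
      fix i a assume ia: "i \<in> P" "a \<in> W"
      have "(\<Sum>b\<in>W'. t i a * of_bool (a - pj i = b) * h b) = (\<Sum>b\<in>W'. if b = a - pj i then t i a * h b else 0)"
        by (rule sum.cong[OF refl]) auto
      also have "\<dots> = (if a - pj i \<in> W' then t i a * h (a - pj i) else 0)" using W' by (rule sum.delta)
      finally have e: "(\<Sum>b\<in>W'. t i a * of_bool (a - pj i = b) * h b) = (if a - pj i \<in> W' then t i a * h (a - pj i) else 0)" .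
      have "a - pj i \<in> W'" unfolding W'_def using ia by (intro image_eqI[of _ _ "(i, a)"]) auto
      then show "(\<Sum>b\<in>W'. t i a * of_bool (a - pj i = b) * h b) = t i a * h (a - pj i)" unfolding e by (rule if_P)
    qed
    finally show ?thesis .
  qed
  have mix: "(\<Sum>a\<in>W. w a * EE (nu (\<alpha> j)) (\<lambda>i. h (a - pj i))) = (\<Sum>b\<in>W'. w' b * h b)" for h
  proof -
    have "(\<Sum>a\<in>W. w a * EE (nu (\<alpha> j)) (\<lambda>i. h (a - pj i))) = (\<Sum>a\<in>W. \<Sum>i\<in>P. t i a * h (a - pj i))"
      unfolding EEP t_def sum_distrib_left by (intro sum.cong refl) (simp only: ac_simps)
    also have "\<dots> = (\<Sum>i\<in>P. \<Sum>a\<in>W. t i a * h (a - pj i))" by (rule sum.swap)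
    finally show ?thesis unfolding expand .
  qed
  have "\<exists>p. (\<forall>i\<in>I. inj_on (p i) (set_pmf (nu (\<alpha> i)))) \<and>
    (\<Sum>a\<in>W'. w' a * prob {\<omega>\<in>space M. (\<Sum>i\<in>I. X i \<omega>) = a}) \<le> (\<Sum>a\<in>W'. w' a * pmf (psum I (\<lambda>i. map_pmf (p i) (nu (\<alpha> i)))) a)"
  proof (rule insert.IH[OF _ _ _ W' w'0])
    show "indep_vars (\<lambda>_. borel) X I" by (rule indep_vars_subset[OF insert.prems(1)]) auto
  qed (use insert.prems in auto)
  then obtain p where p: "\<forall>i\<in>I. inj_on (p i) (set_pmf (nu (\<alpha> i)))"
    "(\<Sum>a\<in>W'. w' a * prob {\<omega>\<in>space M. (\<Sum>i\<in>I. X i \<omega>) = a}) \<le> (\<Sum>a\<in>W'. w' a * pmf (psum I (\<lambda>i. map_pmf (p i) (nu (\<alpha> i)))) a)" by (elim exE conjE) (rule that)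
  have KT: "measure ?K {b} = prob {\<omega>\<in>space M. ?T \<omega> = b}" for b
    by (subst measure_distr[OF rv(2)]) (auto intro!: arg_cong[where f = prob])
  define p' where "p' = p(j := pj)"
  define Q where "Q = psum I (\<lambda>i. map_pmf (p i) (nu (\<alpha> i)))"
  have fQ: "finite (set_pmf Q)" unfolding Q_def using insert.hyps insert.prems(3) by (intro finite_set_psum) auto
  have "psum I (\<lambda>i. map_pmf (p' i) (nu (\<alpha> i))) = Q"
    unfolding psum_def Q_def using insert.hyps by (intro arg_cong[where f = "map_pmf _"] Pi_pmf_cong) (auto simp: p'_def)
  then have Q': "psum (insert j I) (\<lambda>i. map_pmf (p' i) (nu (\<alpha> i))) = conv (map_pmf pj (nu (\<alpha> j))) Q"
    unfolding psum_insert[OF insert.hyps] by (simp add: p'_def)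
  have pmfQ: "pmf (conv (map_pmf pj (nu (\<alpha> j))) Q) a = EE (nu (\<alpha> j)) (\<lambda>i. pmf Q (a - pj i))" for a
  proof -
    let ?p = "map_pmf pj (nu (\<alpha> j))"
    have fp: "finite (set_pmf ?p)" using P by (simp add: P_def)
    have "pmf (conv ?p Q) a = (\<Sum>x\<in>set_pmf ?p. pmf ?p x * pmf Q (a - x))" by (rule pmf_conv[OF fp subset_refl fQ])
    also have "\<dots> = EE ?p (\<lambda>x. pmf Q (a - x))" using fp by (subst integral_measure_pmf[of "set_pmf ?p"]) auto
    finally show ?thesis by simp
  qed
  have "(\<Sum>a\<in>W. w a * prob {\<omega>\<in>space M. (\<Sum>i\<in>insert j I. X i \<omega>) = a}) = (\<Sum>a\<in>W. w a * (\<integral>x. measure ?K {a - x} \<partial>?N))"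
    unfolding sum.insert[OF insert.hyps] prob_add_eq(2)[OF ind] ..
  also have "\<dots> = integral\<^sup>L ?N c"
  proof -
    have i: "integrable ?N (\<lambda>x. measure ?K {a - x})" for a
      by (rule N.integrable_const_bound[where B = 1]) (use meas in auto)
    then have i2: "integrable ?N (\<lambda>x. w a * measure ?K {a - x})" for a by (rule integrable_mult_right)
    show ?thesis unfolding c_def Bochner_Integration.integral_sum[OF i2] by (intro sum.cong refl integral_mult_right_zero[symmetric])
  qed
  also have "\<dots> \<le> EE (nu (\<alpha> j)) (\<lambda>i. c (pj i))" by (rule pj(2))
  also have "\<dots> = (\<Sum>a\<in>W. w a * EE (nu (\<alpha> j)) (\<lambda>i. measure ?K {a - pj i}))"
    unfolding c_def EEP sum_distrib_left by (subst sum.swap) (intro sum.cong refl, simp only: ac_simps)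
  also have "\<dots> = (\<Sum>b\<in>W'. w' b * measure ?K {b})" by (rule mix)
  also have "\<dots> \<le> (\<Sum>b\<in>W'. w' b * pmf Q b)" using p(2) unfolding KT Q_def .
  also have "\<dots> = (\<Sum>a\<in>W. w a * pmf (psum (insert j I) (\<lambda>i. map_pmf (p' i) (nu (\<alpha> i)))) a)"
    unfolding Q' pmfQ by (rule mix[symmetric])
  finally have "(\<Sum>a\<in>W. w a * prob {\<omega>\<in>space M. (\<Sum>i\<in>insert j I. X i \<omega>) = a}) \<le> \<dots>" .
  moreover have "\<forall>i\<in>insert j I. inj_on (p' i) (set_pmf (nu (\<alpha> i)))" using p(1) pj(1) insert.hyps by (auto simp: p'_def)
  ultimately show ?case by (intro exI[of _ p'] conjI)
qed

text \<open>A finite set of vectors lies in no finite union of hyperplanes, so some linear functional separates it.\<close>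

lemma ex_inner_nonzero:
  fixes V :: "'b::real_inner set"
  assumes "finite V" "0 \<notin> V"
  shows "\<exists>w. \<forall>v\<in>V. inner v w \<noteq> 0"
  using assms
proof (induction V rule: finite_induct)
  case (insert v V)
  then obtain w where w: "\<forall>v\<in>V. inner v w \<noteq> 0" by auto
  define B where "B = insert (0::real) (insert (- inner v w / inner v v) ((\<lambda>u. - inner u w / inner u v) ` V))"
  have "finite B" using insert.hyps by (simp add: B_def)
  then obtain t where t: "t \<notin> B" using ex_new_if_finite[OF infinite_UNIV_char_0] by blast
  have "inner u (w + t *\<^sub>R v) \<noteq> 0" if u: "u \<in> insert v V" for u
  proof
    assume "inner u (w + t *\<^sub>R v) = 0"
    then have e: "t * inner u v = - inner u w" by (simp add: inner_add_right)
    show False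
    proof (cases "inner u v = 0")
      case True
      then have "u \<in> V" using u insert.prems by auto
      then show False using w e True by auto
    next
      case False
      then have "t = - inner u w / inner u v" using e by (metis nonzero_mult_div_cancel_right)
      then show False using t u by (auto simp: B_def)
    qed
  qed
  then show ?case by blast
qed simp

text \<open>A functional is injective on \<open>D\<close> as soon as it vanishes on no difference of
  distinct points of \<open>D\<close>.\<close>

lemma ex_inner_inj_on:
  fixes D :: "'b::real_inner set"
  assumes "finite D"
  shows "\<exists>w. inj_on (\<lambda>y. inner y w) D"
proof -
  define V where "V = (\<lambda>(x, y). x - y) ` (D \<times> D) - {0}"
  have "finite V" "0 \<notin> V" using assms by (auto simp: V_def)
  then obtain w where w: "\<forall>v\<in>V. inner v w \<noteq> 0" using ex_inner_nonzero by blast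
  have "x = y" if "x \<in> D" "y \<in> D" "inner x w = inner y w" for x y
  proof (rule ccontr)
    assume "x \<noteq> y"
    then have "x - y \<in> V" using that(1,2) by (auto simp: V_def)
    then have "inner (x - y) w \<noteq> 0" using w by blast
    then show False using that(3) by (simp add: inner_diff_left)
  qed
  then show ?thesis by (intro exI[of _ w] inj_onI)
qed

text \<open>The functional is chosen injective on the atoms of all summands together, hence on each
  support. Being linear it maps the sum to the sum of the images, and a point mass can only grow
  under such a map, by collisions.\<close>

lemma (in prob_space) prob_sum_le_psum:
  fixes X :: "nat \<Rightarrow> 'a \<Rightarrow> 'b::{real_inner, second_countable_topology}"
  assumes I: "finite I" and inf: "infinite (UNIV :: 'b set)" and ind: "indep_vars (\<lambda>_. borel) X I"
    and X: "\<And>i y. i \<in> I \<Longrightarrow> prob {\<omega>\<in>space M. X i \<omega> = y} \<le> \<alpha> i" and \<alpha>: "\<And>i. i \<in> I \<Longrightarrow> 0 < \<alpha> i \<and> \<alpha> i \<le> 1"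
  shows "\<exists>(f :: nat \<Rightarrow> int \<Rightarrow> real) u. (\<forall>i\<in>I. inj_on (f i) (set_pmf (nu (\<alpha> i)))) \<and>
    prob {\<omega>\<in>space M. (\<Sum>i\<in>I. X i \<omega>) = s} \<le> pmf (psum I (\<lambda>i. map_pmf (f i) (nu (\<alpha> i)))) u"
proof -
  have "\<exists>p :: nat \<Rightarrow> int \<Rightarrow> 'b. (\<forall>i\<in>I. inj_on (p i) (set_pmf (nu (\<alpha> i)))) \<and>
    (\<Sum>a\<in>{s}. 1 * prob {\<omega>\<in>space M. (\<Sum>i\<in>I. X i \<omega>) = a}) \<le> (\<Sum>a\<in>{s}. 1 * pmf (psum I (\<lambda>i. map_pmf (p i) (nu (\<alpha> i)))) a)"
    by (rule bathtub_sum[OF I inf ind X \<alpha>]) simp_all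
  then obtain p :: "nat \<Rightarrow> int \<Rightarrow> 'b" where p: "\<forall>i\<in>I. inj_on (p i) (set_pmf (nu (\<alpha> i)))"
    and le: "prob {\<omega>\<in>space M. (\<Sum>i\<in>I. X i \<omega>) = s} \<le> pmf (psum I (\<lambda>i. map_pmf (p i) (nu (\<alpha> i)))) s"
    by auto
  define D where "D = (\<Union>i\<in>I. p i ` set_pmf (nu (\<alpha> i)))"
  have "finite D" using I \<alpha> by (auto simp: D_def)
  then obtain w where w: "inj_on (\<lambda>y. inner y w) D" using ex_inner_inj_on by blast
  define f where "f i x = inner (p i x) w" for i x
  have "inj_on (f i) (set_pmf (nu (\<alpha> i)))" if i: "i \<in> I" for i
  proof -
    have "inj_on (\<lambda>y. inner y w) (p i ` set_pmf (nu (\<alpha> i)))" by (rule inj_on_subset[OF w]) (use i in \<open>auto simp: D_def\<close>)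
    then have "inj_on ((\<lambda>y. inner y w) \<circ> p i) (set_pmf (nu (\<alpha> i)))" using p i by (intro comp_inj_on) auto
    then show ?thesis unfolding f_def[abs_def] comp_def .
  qed
  moreover have "psum I (\<lambda>i. map_pmf (f i) (nu (\<alpha> i))) = map_pmf (\<lambda>y. inner y w) (psum I (\<lambda>i. map_pmf (p i) (nu (\<alpha> i))))"
  proof -
    have "Pi_pmf I 0 (\<lambda>i. map_pmf (f i) (nu (\<alpha> i))) = Pi_pmf I 0 (\<lambda>i. map_pmf (\<lambda>y. inner y w) (map_pmf (p i) (nu (\<alpha> i))))"
      by (simp add: map_pmf_comp f_def[abs_def])
    also have "\<dots> = map_pmf (\<lambda>h. (\<lambda>y. inner y w) \<circ> h) (Pi_pmf I 0 (\<lambda>i. map_pmf (p i) (nu (\<alpha> i))))"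
      using I by (intro Pi_pmf_map) simp_all
    finally show ?thesis by (simp add: psum_def map_pmf_comp inner_sum_left comp_def)
  qed
  moreover have "pmf q y \<le> pmf (map_pmf g q) (g y)" for q :: "'b pmf" and g :: "'b \<Rightarrow> real" and y
  proof -
    have "pmf q y = measure_pmf.prob q {y}" by (simp add: measure_pmf_single)
    also have "\<dots> \<le> measure_pmf.prob q (g -` {g y})" by (rule measure_pmf.finite_measure_mono) auto
    finally show ?thesis by (simp only: pmf_map)
  qed
  ultimately have "(\<forall>i\<in>I. inj_on (f i) (set_pmf (nu (\<alpha> i)))) \<and>
    prob {\<omega>\<in>space M. (\<Sum>i\<in>I. X i \<omega>) = s} \<le> pmf (psum I (\<lambda>i. map_pmf (f i) (nu (\<alpha> i)))) (inner s w)"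
    by (intro conjI ballI order_trans[OF le]) simp_all
  then show ?thesis by (intro exI)
qed

section \<open>From random variables to mass functions\<close>

lemma conc_ge:
  assumes "prob_space M"
  shows "measure M {\<omega> \<in> space M. X \<omega> = x} \<le> conc M X"
proof -
  interpret prob_space M by fact
  show ?thesis unfolding conc_def by (rule cSUP_upper) (auto intro!: bdd_aboveI[of _ 1])
qed

lemma conc_le: "(\<And>x. measure M {\<omega> \<in> space M. X \<omega> = x} \<le> c) \<Longrightarrow> conc M X \<le> c"
  unfolding conc_def by (rule cSUP_least) auto

text \<open>The sum is taken in the reals so that the convolution formula for Borel variables
  applies; the induction then follows \<open>psum_insert\<close>.\<close>

lemma (in prob_space) prob_nu_sum:
  fixes Y :: "nat \<Rightarrow> 'a \<Rightarrow> int"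
  assumes "finite I" and "indep_vars (\<lambda>_. count_space UNIV) Y I"
    and "\<And>i. i \<in> I \<Longrightarrow> 0 < \<alpha> i \<and> \<alpha> i \<le> 1"
    and "\<And>i. i \<in> I \<Longrightarrow> distr M (count_space UNIV) (Y i) = measure_pmf (nu (\<alpha> i))"
  shows "prob {\<omega>\<in>space M. (\<Sum>i\<in>I. real_of_int (Y i \<omega>)) = real_of_int z} = pmf (psum I (\<lambda>i. nu (\<alpha> i))) z"
  using assms
proof (induction I arbitrary: z rule: finite_induct)
  case empty
  then show ?case by (cases "z = 0") (auto simp: psum_def prob_space)
next
  case (insert j I)
  let ?T = "\<lambda>\<omega>. \<Sum>i\<in>I. real_of_int (Y i \<omega>)" and ?X = "\<lambda>\<omega>. real_of_int (Y j \<omega>)"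
  let ?K = "distr M borel ?T"
  have "indep_vars (\<lambda>_. borel) (\<lambda>i \<omega>. real_of_int (Y i \<omega>)) (insert j I)"
    by (rule indep_vars_compose2[OF insert.prems(1)]) simp
  then have ind: "indep_var borel ?X borel ?T" by (rule indep_var_sum[OF insert.hyps])
  have rv: "random_variable borel ?X" "random_variable borel ?T"
    using ind unfolding indep_var_distribution_eq by auto
  have Yj: "random_variable (count_space UNIV) (Y j)" using insert.prems(1) by (simp add: indep_vars_def)
  have KT: "measure ?K {b} = prob {\<omega>\<in>space M. ?T \<omega> = b}" for b
    by (subst measure_distr[OF rv(2)]) (auto intro!: arg_cong[where f = prob])
  have IH: "prob {\<omega>\<in>space M. ?T \<omega> = real_of_int y} = pmf (psum I (\<lambda>i. nu (\<alpha> i))) y" for y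
  proof (rule insert.IH)
    show "indep_vars (\<lambda>_. count_space UNIV) Y I" by (rule indep_vars_subset[OF insert.prems(1)]) auto
  qed (use insert.prems in auto)
  have aj: "0 < \<alpha> j" "\<alpha> j \<le> 1" using insert.prems(2)[of j] by auto
  have fI: "finite (set_pmf (psum I (\<lambda>i. nu (\<alpha> i))))" using insert.hyps insert.prems(2) by (intro finite_set_psum) auto
  have meas: "(\<lambda>x. measure ?K {real_of_int z - x}) \<in> borel_measurable borel" by (rule prob_add_eq(1)[OF ind])
  have "prob {\<omega>\<in>space M. (\<Sum>i\<in>insert j I. real_of_int (Y i \<omega>)) = real_of_int z}
    = (\<integral>x. measure ?K {real_of_int z - x} \<partial>distr M borel ?X)"
    unfolding sum.insert[OF insert.hyps] by (rule prob_add_eq(2)[OF ind])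
  also have "\<dots> = (\<integral>\<omega>. measure ?K {real_of_int z - ?X \<omega>} \<partial>M)" by (rule integral_distr[OF rv(1) meas])
  also have "\<dots> = (\<integral>i. measure ?K {real_of_int z - real_of_int i} \<partial>distr M (count_space UNIV) (Y j))"
    by (rule integral_distr[OF Yj, symmetric]) simp
  also have "\<dots> = EE (nu (\<alpha> j)) (\<lambda>i. pmf (psum I (\<lambda>i. nu (\<alpha> i))) (z - i))"
    using insert.prems(3)[of j] by (simp only: insertI1 KT of_int_diff[symmetric] IH)
  also have "\<dots> = (\<Sum>i\<in>set_pmf (nu (\<alpha> j)). pmf (nu (\<alpha> j)) i * pmf (psum I (\<lambda>i. nu (\<alpha> i))) (z - i))"
    using finite_set_nu[OF aj] by (subst integral_measure_pmf[of "set_pmf (nu (\<alpha> j))"]) auto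
  also have "\<dots> = pmf (psum (insert j I) (\<lambda>i. nu (\<alpha> i))) z"
    unfolding psum_insert[OF insert.hyps] by (rule pmf_conv[OF finite_set_nu[OF aj] subset_refl fI, symmetric])
  finally show ?case .
qed

text \<open>On the countable space of integers the point masses identify the law of the sum with
  \<open>psum\<close>, after which the variance is computed under the product law.\<close>

lemma (in prob_space) variance_nu_sum:
  fixes Y :: "nat \<Rightarrow> 'a \<Rightarrow> int"
  assumes I: "finite I" and ind: "indep_vars (\<lambda>_. count_space UNIV) Y I"
    and \<alpha>: "\<And>i. i \<in> I \<Longrightarrow> 0 < \<alpha> i \<and> \<alpha> i \<le> 1"
    and Y: "\<And>i. i \<in> I \<Longrightarrow> distr M (count_space UNIV) (Y i) = measure_pmf (nu (\<alpha> i))"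
  shows "variance (\<lambda>\<omega>. real_of_int (\<Sum>i\<in>I. Y i \<omega>)) = (\<Sum>i\<in>I. nu_variance (\<alpha> i))"
proof -
  let ?S = "\<lambda>\<omega>. \<Sum>i\<in>I. Y i \<omega>" and ?P = "psum I (\<lambda>i. nu (\<alpha> i))"
  have rvY: "random_variable borel (\<lambda>\<omega>. real_of_int (Y i \<omega>))" if "i \<in> I" for i
  proof -
    have "random_variable (count_space UNIV) (Y i)" using ind that by (simp add: indep_vars_def)
    then show ?thesis by (rule measurable_compose) simp
  qed
  have rvS: "random_variable borel (\<lambda>\<omega>. \<Sum>i\<in>I. real_of_int (Y i \<omega>))" by (rule borel_measurable_sum) (rule rvY)
  have vim: "?S -` {z} \<inter> space M = {\<omega>\<in>space M. (\<Sum>i\<in>I. real_of_int (Y i \<omega>)) = real_of_int z}" for z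
    unfolding of_int_sum[symmetric] of_int_eq_iff by auto
  have S: "random_variable (count_space UNIV) ?S"
    unfolding measurable_count_space_eq2_countable vim
  proof (intro conjI ballI)
    show "{\<omega>\<in>space M. (\<Sum>i\<in>I. real_of_int (Y i \<omega>)) = real_of_int z} \<in> events" for z
      by (rule borel_measurable_eq[OF rvS borel_measurable_const])
  qed simp
  have law: "distr M (count_space UNIV) ?S = measure_pmf ?P"
  proof (rule measure_eqI_countable[of _ UNIV])
    fix z :: int
    have "emeasure (distr M (count_space UNIV) ?S) {z} = ennreal (prob (?S -` {z} \<inter> space M))"
      by (subst emeasure_distr[OF S]) (auto simp: emeasure_eq_measure)
    also have "\<dots> = emeasure (measure_pmf ?P) {z}"
      unfolding vim by (simp add: emeasure_pmf_single) (rule prob_nu_sum[OF I ind \<alpha> Y])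
    finally show "emeasure (distr M (count_space UNIV) ?S) {z} = emeasure (measure_pmf ?P) {z}" .
  qed auto
  have ex: "(\<integral>\<omega>. g (?S \<omega>) \<partial>M) = EE ?P g" for g :: "int \<Rightarrow> real"
  proof -
    have "EE ?P g = integral\<^sup>L (distr M (count_space UNIV) ?S) g" by (simp only: law)
    also have "\<dots> = (\<integral>\<omega>. g (?S \<omega>) \<partial>M)" by (rule integral_distr[OF S, of g]) simp
    finally show ?thesis by (rule sym)
  qed
  have fS: "finite (set_pmf (nu (\<alpha> i)))" if "i \<in> I" for i using \<alpha>[OF that] by simp
  have "variance (\<lambda>\<omega>. real_of_int (?S \<omega>)) = Var ?P real_of_int"
    unfolding Var_def ex[of real_of_int] by (rule ex[of "\<lambda>x. (real_of_int x - EE ?P real_of_int)\<^sup>2"])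
  also have "\<dots> = Var (Pi_pmf I 0 (\<lambda>i. nu (\<alpha> i))) (\<lambda>w. \<Sum>i\<in>I. real_of_int (w i))"
    unfolding Var_def EE_psum by (simp only: of_int_sum)
  also have "\<dots> = (\<Sum>i\<in>I. nu_variance (\<alpha> i))"
    by (rule Var_Pi_sum[where I = I and q = "\<lambda>i. nu (\<alpha> i)" and d = 0 and f = "\<lambda>_. real_of_int", OF I fS])
  finally show ?thesis .
qed

text \<open>The threshold holds with \<open>a\<^sub>i = 1\<close> for every \<open>i\<close>.\<close>

lemma variance_threshold_exists:
  assumes "0 < \<delta>"
  shows "\<exists>V. variance_threshold TYPE(ell2) TYPE('w) TYPE('v) \<delta> V"
proof -
  from core_inequality[OF assms] obtain V where V: "\<forall>(I :: nat set) \<alpha>. finite I \<longrightarrow> (\<forall>i\<in>I. 0 < \<alpha> i \<and> \<alpha> i \<le> 1) \<longrightarrow> V \<le> (\<Sum>i\<in>I. nu_variance (\<alpha> i)) \<longrightarrow>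
    (\<exists>\<alpha>'. (\<forall>i\<in>I. \<alpha> i \<le> \<alpha>' i \<and> \<alpha>' i \<le> 1) \<and>
      (\<forall>f :: nat \<Rightarrow> int \<Rightarrow> real. (\<forall>i\<in>I. inj_on (f i) (set_pmf (nu (\<alpha>' i)))) \<longrightarrow>
        (\<exists>z. \<forall>s. pmf (psum I (\<lambda>i. map_pmf (f i) (nu (\<alpha>' i)))) s \<le> (1 + \<delta>) * pmf (psum I (\<lambda>i. nu (\<alpha> i))) z)))" ..
  \<comment> \<open>The bathtub principle enumerates infinitely many distinct points. The zero space
    is reached only later, through its embedding.\<close>
  have inf: "infinite (UNIV :: ell2 set)"
  proof
    assume "finite (UNIV :: ell2 set)"
    moreover have "inj (\<lambda>r. r *\<^sub>R ell2_unit 0)"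
    proof (rule injI)
      fix r s :: real assume "r *\<^sub>R ell2_unit 0 = s *\<^sub>R ell2_unit 0"
      then have "coord (r *\<^sub>R ell2_unit 0) 0 = coord (s *\<^sub>R ell2_unit 0) 0" by (rule arg_cong)
      then show "r = s" unfolding coord_scaleR coord_unit by simp
    qed
    ultimately have "finite (UNIV :: real set)" using finite_subset[OF subset_UNIV] finite_imageD by blast
    then show False using infinite_UNIV_char_0 by blast
  qed
  have "variance_threshold TYPE(ell2) TYPE('w) TYPE('v) \<delta> V"
    unfolding variance_threshold_def
  proof (intro allI impI, elim conjE)
    fix n :: nat and \<alpha> :: "nat \<Rightarrow> real" and M :: "'w measure" and X :: "nat \<Rightarrow> 'w \<Rightarrow> ell2" and N :: "'v measure" and Y :: "nat \<Rightarrow> 'v \<Rightarrow> int"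
    let ?I = "{1..n}"
    assume \<alpha>: "\<forall>i\<in>?I. 0 < \<alpha> i \<and> \<alpha> i \<le> 1" and M: "prob_space M"
      and indX: "prob_space.indep_vars M (\<lambda>_. borel) X ?I" and cX: "\<forall>i\<in>?I. conc M (X i) \<le> \<alpha> i" and N: "prob_space N"
      and indY: "prob_space.indep_vars N (\<lambda>_. count_space UNIV) Y ?I"
      and Y: "\<forall>i\<in>?I. distr N (count_space UNIV) (Y i) = measure_pmf (nu (\<alpha> i))"
      and var: "V \<le> prob_space.variance N (\<lambda>\<omega>. real_of_int (\<Sum>i=1..n. Y i \<omega>))"
    have "prob_space.variance N (\<lambda>\<omega>. real_of_int (\<Sum>i=1..n. Y i \<omega>)) = (\<Sum>i\<in>?I. nu_variance (\<alpha> i))"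
      by (rule prob_space.variance_nu_sum[OF N finite_atLeastAtMost indY \<alpha>[rule_format] Y[rule_format]])
    then have V': "V \<le> (\<Sum>i\<in>?I. nu_variance (\<alpha> i))" by (rule order_trans[OF var eq_refl])
    from V[THEN spec, THEN spec, THEN mp, THEN mp, THEN mp, OF finite_atLeastAtMost \<alpha> V']
    obtain \<alpha>' :: "nat \<Rightarrow> real" where \<alpha>': "\<forall>i\<in>?I. \<alpha> i \<le> \<alpha>' i \<and> \<alpha>' i \<le> 1"
      and core: "\<forall>f :: nat \<Rightarrow> int \<Rightarrow> real. (\<forall>i\<in>?I. inj_on (f i) (set_pmf (nu (\<alpha>' i)))) \<longrightarrow>
        (\<exists>z. \<forall>s. pmf (psum ?I (\<lambda>i. map_pmf (f i) (nu (\<alpha>' i)))) s \<le> (1 + \<delta>) * pmf (psum ?I (\<lambda>i. nu (\<alpha> i))) z)"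
      by (elim exE conjE) (rule that)
    have b: "0 < \<alpha>' i \<and> \<alpha>' i \<le> 1" if "i \<in> ?I" for i
      using bspec[OF \<alpha> that] bspec[OF \<alpha>' that] by linarith
    \<comment> \<open>Enlarging \<alpha> weakens the hypothesis on the X_i, so they may be reduced
      to the extremal laws of \<open>\<alpha>'\<close>, while the right side keeps the original
      \<alpha>.\<close>
    have pX: "measure M {\<omega>\<in>space M. X i \<omega> = y} \<le> \<alpha>' i" if "i \<in> ?I" for i y
      using conc_ge[OF M, of "X i" y] bspec[OF cX that] bspec[OF \<alpha>' that] by linarith
    have "conc M (\<lambda>\<omega>. \<Sum>i=1..n. X i \<omega>) \<le> (1 + \<delta>) * conc N (\<lambda>\<omega>. real_of_int (\<Sum>i=1..n. 1 * Y i \<omega>))"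
    proof (rule conc_le)
      fix s
      from prob_space.prob_sum_le_psum[OF M finite_atLeastAtMost inf indX pX b, of s]
      have "\<exists>(f :: nat \<Rightarrow> int \<Rightarrow> real) u. (\<forall>i\<in>?I. inj_on (f i) (set_pmf (nu (\<alpha>' i)))) \<and>
        measure M {\<omega>\<in>space M. (\<Sum>i\<in>?I. X i \<omega>) = s} \<le> pmf (psum ?I (\<lambda>i. map_pmf (f i) (nu (\<alpha>' i)))) u" by simp
      then obtain f :: "nat \<Rightarrow> int \<Rightarrow> real" and u where f: "\<forall>i\<in>?I. inj_on (f i) (set_pmf (nu (\<alpha>' i)))"
        and le: "measure M {\<omega>\<in>space M. (\<Sum>i\<in>?I. X i \<omega>) = s} \<le> pmf (psum ?I (\<lambda>i. map_pmf (f i) (nu (\<alpha>' i)))) u"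
        by (elim exE conjE) (rule that)
      from core[THEN spec, THEN mp, OF f] obtain z where
        z: "\<forall>s. pmf (psum ?I (\<lambda>i. map_pmf (f i) (nu (\<alpha>' i)))) s \<le> (1 + \<delta>) * pmf (psum ?I (\<lambda>i. nu (\<alpha> i))) z" ..
      note le
      also have "pmf (psum ?I (\<lambda>i. map_pmf (f i) (nu (\<alpha>' i)))) u \<le> (1 + \<delta>) * pmf (psum ?I (\<lambda>i. nu (\<alpha> i))) z" by (rule z[THEN spec])
      also have "\<dots> \<le> (1 + \<delta>) * conc N (\<lambda>\<omega>. real_of_int (\<Sum>i=1..n. 1 * Y i \<omega>))"
      proof (rule mult_left_mono)
        have "pmf (psum ?I (\<lambda>i. nu (\<alpha> i))) z = measure N {\<omega>\<in>space N. real_of_int (\<Sum>i=1..n. 1 * Y i \<omega>) = real_of_int z}"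
          using prob_space.prob_nu_sum[OF N finite_atLeastAtMost indY \<alpha>[rule_format] Y[rule_format], of z] by (simp only: mult_1_left of_int_sum)
        also have "\<dots> \<le> conc N (\<lambda>\<omega>. real_of_int (\<Sum>i=1..n. 1 * Y i \<omega>))" by (rule conc_ge[OF N])
        finally show "pmf (psum ?I (\<lambda>i. nu (\<alpha> i))) z \<le> conc N (\<lambda>\<omega>. real_of_int (\<Sum>i=1..n. 1 * Y i \<omega>))" .
      qed (use assms in simp)
      finally show "measure M {\<omega>\<in>space M. (\<Sum>i=1..n. X i \<omega>) = s} \<le> (1 + \<delta>) * conc N (\<lambda>\<omega>. real_of_int (\<Sum>i=1..n. 1 * Y i \<omega>))" .
    qed
    then show "\<exists>a :: nat \<Rightarrow> int. (\<forall>i\<in>{1..n}. a i \<in> {-1, 1}) \<and>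
      conc M (\<lambda>\<omega>. \<Sum>i=1..n. X i \<omega>) \<le> (1 + \<delta>) * conc N (\<lambda>\<omega>. real_of_int (\<Sum>i=1..n. a i * Y i \<omega>))"
      by (intro exI[of _ "\<lambda>_. 1"]) simp
  qed
  then show ?thesis ..
qed

section \<open>Change of the Hilbert space and of the sample spaces\<close>

text \<open>Under the joint law, the coordinate maps are a copy of the family on a sample space of
  functions. This is how an arbitrary sample space is exchanged for
  \<open>nat \<Rightarrow> ell2\<close> or \<open>nat \<Rightarrow> int\<close>.\<close>

lemma (in prob_space) canonical_family:
  fixes Z :: "'i \<Rightarrow> 'a \<Rightarrow> 's" and S :: "'s measure"
  assumes I: "I \<noteq> {}" and ind: "indep_vars (\<lambda>_. S) Z I"
  defines "P \<equiv> distr M (Pi\<^sub>M I (\<lambda>_. S)) (\<lambda>\<omega>. \<lambda>i\<in>I. Z i \<omega>)"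
  shows "prob_space P" and "prob_space.indep_vars P (\<lambda>_. S) (\<lambda>i x. x i) I"
    and "\<And>i. i \<in> I \<Longrightarrow> distr P S (\<lambda>x. x i) = distr M S (Z i)"
    and "(\<lambda>\<omega>. \<lambda>i\<in>I. Z i \<omega>) \<in> measurable M (Pi\<^sub>M I (\<lambda>_. S))"
proof -
  let ?Z = "\<lambda>\<omega>. \<lambda>i\<in>I. Z i \<omega>"
  have rv: "random_variable S (Z i)" if "i \<in> I" for i using ind that by (auto simp: indep_vars_def)
  show Z: "?Z \<in> measurable M (Pi\<^sub>M I (\<lambda>_. S))" by (rule measurable_restrict) (rule rv)
  show P: "prob_space P" unfolding P_def by (rule prob_space_distr[OF Z])
  have cp: "(\<lambda>x. x i) \<in> measurable P S" if "i \<in> I" for i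
    unfolding P_def measurable_distr_eq1 using that by (rule measurable_component_singleton)
  have cp': "(\<lambda>x. x i) \<in> measurable (Pi\<^sub>M I (\<lambda>_. S)) S" if "i \<in> I" for i
    using that by (rule measurable_component_singleton)
  show marg: "distr P S (\<lambda>x. x i) = distr M S (Z i)" if i: "i \<in> I" for i
    unfolding P_def distr_distr[OF cp'[OF i] Z] using i by (simp add: comp_def)
  have "distr P (Pi\<^sub>M I (\<lambda>_. S)) (\<lambda>x. \<lambda>i\<in>I. x i) = distr M (Pi\<^sub>M I (\<lambda>_. S)) ((\<lambda>x. \<lambda>i\<in>I. x i) \<circ> ?Z)"
    unfolding P_def by (rule distr_distr[OF _ Z]) (rule measurable_restrict, rule cp')
  also have "(\<lambda>x. \<lambda>i\<in>I. x i) \<circ> ?Z = ?Z" by (auto simp: fun_eq_iff)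
  also have "distr M (Pi\<^sub>M I (\<lambda>_. S)) ?Z = Pi\<^sub>M I (\<lambda>i. distr M S (Z i))"
    using indep_vars_iff_distr_eq_PiM'[OF I rv, of "\<lambda>i. i"] ind by simp
  also have "\<dots> = Pi\<^sub>M I (\<lambda>i. distr P S (\<lambda>x. x i))" by (rule PiM_cong) (simp_all add: marg)
  finally have eq: "distr P (Pi\<^sub>M I (\<lambda>_. S)) (\<lambda>x. \<lambda>i\<in>I. x i) = Pi\<^sub>M I (\<lambda>i. distr P S (\<lambda>x. x i))" .
  show "prob_space.indep_vars P (\<lambda>_. S) (\<lambda>i x. x i) I"
    by (rule iffD2[OF prob_space.indep_vars_iff_distr_eq_PiM'[OF P I cp, of "\<lambda>i. i"] eq])
qed

text \<open>A sequence of functionals that is total because it runs through a dense set, scaled to be square summable.\<close>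

lemma ex_embedding_ell2:
  "\<exists>T :: 'h::{real_inner, second_countable_topology} \<Rightarrow> ell2. linear T \<and> inj T \<and> T \<in> borel_measurable borel"
proof -
  obtain D :: "'h set" where D: "countable D" "\<And>X. open X \<Longrightarrow> X \<noteq> {} \<Longrightarrow> \<exists>d\<in>D. d \<in> X"
    using countable_dense_exists by blast
  have D0: "D \<noteq> {}" using D(2)[OF open_UNIV] by auto
  define d where "d = from_nat_into D"
  have rd: "range d = D" unfolding d_def by (rule range_from_nat_into[OF D0 D(1)])
  \<comment> \<open>By the Cauchy-Schwarz inequality the quotient is at most \<open>norm x\<close>
    in modulus, so the geometric weights make the sequence square summable, with norm at most
    \<open>2 * norm x\<close>.\<close>
  define g :: "'h \<Rightarrow> nat \<Rightarrow> real" where "g x k = (1/2) ^ k * (inner x (d k) / (1 + norm (d k)))" for x k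
  have gb: "\<bar>g x k\<bar> \<le> (1/2) ^ k * norm x" for x k
  proof -
    have "\<bar>inner x (d k)\<bar> \<le> norm x * norm (d k)" by (rule Cauchy_Schwarz_ineq2)
    also have "\<dots> \<le> norm x * (1 + norm (d k))" by (intro mult_left_mono) auto
    finally have "\<bar>inner x (d k)\<bar> / (1 + norm (d k)) \<le> norm x"
      by (simp add: divide_le_eq add_pos_nonneg)
    then show ?thesis unfolding g_def abs_mult abs_divide
      by (intro mult_mono) auto
  qed
  have sb: "(\<Sum>k<K. (g x k)\<^sup>2) \<le> (2 * norm x)\<^sup>2" for x K
  proof -
    have "(\<Sum>k<K. (g x k)\<^sup>2) \<le> (\<Sum>k<K. (1/4) ^ k * (norm x)\<^sup>2)"
    proof (rule sum_mono)
      fix k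
      have "\<bar>g x k\<bar>\<^sup>2 \<le> ((1/2) ^ k * norm x)\<^sup>2" by (rule power_mono[OF gb]) simp
      also have "\<dots> = ((1/2)\<^sup>2) ^ k * (norm x)\<^sup>2" by (simp only: power_mult_distrib power_mult[symmetric] mult.commute)
      also have "(1/2 :: real)\<^sup>2 = 1/4" by (simp add: power2_eq_square)
      finally show "(g x k)\<^sup>2 \<le> (1/4) ^ k * (norm x)\<^sup>2" by simp
    qed
    also have "\<dots> = (\<Sum>k<K. (1/4 :: real) ^ k) * (norm x)\<^sup>2" by (simp only: sum_distrib_right)
    also have "\<dots> \<le> 4 * (norm x)\<^sup>2"
    proof (rule mult_right_mono)
      have "(\<Sum>k<K. (1/4 :: real) ^ k) = (1 - (1/4) ^ K) / (3/4)" by (simp add: sum_gp_strict)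
      also have "\<dots> \<le> 1 / (3/4)" by (rule divide_right_mono) simp_all
      also have "\<dots> \<le> 4" by simp
      finally show "(\<Sum>k<K. (1/4 :: real) ^ k) \<le> 4" .
    qed simp
    finally show ?thesis by (simp add: power_mult_distrib)
  qed
  define T where "T x = Abs_ell2 (g x)" for x
  have cT: "coord (T x) = g x" for x
    unfolding T_def by (rule coord_Abs, rule square_sum_bound(1)[OF sb]) simp
  have nT: "norm (T x) \<le> norm x * 2" for x
    unfolding T_def using square_sum_bound(2)[OF sb, of x] by simp
  have bl: "bounded_linear T"
  proof (rule bounded_linear_intro[OF _ _ nT])
    show "T (x + y) = T x + T y" for x y
      by (rule ell2_eqI) (simp add: cT g_def inner_add_left add_divide_distrib distrib_left)
    show "T (r *\<^sub>R x) = r *\<^sub>R T x" for r x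
      by (rule ell2_eqI) (simp add: cT g_def)
  qed
  have lin: "linear T" using bl by (rule bounded_linear.linear)
  \<comment> \<open>A nonzero \<open>x\<close> has a point \<open>e\<close> of the dense set at
    distance less than \<open>norm x\<close>. If \<open>x\<close> were orthogonal to it, Pythagoras
    would give a distance of at least \<open>norm x\<close>.\<close>
  have "x = 0" if "T x = 0" for x
  proof (rule ccontr)
    assume x: "x \<noteq> 0"
    then have "ball x (norm x) \<noteq> {}" by simp
    then obtain e where e: "e \<in> D" "e \<in> ball x (norm x)" using D(2)[OF open_ball] by blast
    then obtain k where k: "e = d k" using rd by blast
    have "g x k = 0" using that cT[of x] by (metis coord_0)
    then have "inner x e = 0" using norm_ge_zero[of "d k"] by (auto simp: g_def k)
    moreover have "norm (x - e) < norm x" using e(2) by (simp add: dist_norm)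
    moreover have "(norm (x - e))\<^sup>2 = (norm x)\<^sup>2 + (norm e)\<^sup>2" using \<open>inner x e = 0\<close>
      unfolding power2_norm_eq_inner by (simp add: inner_diff_left inner_diff_right inner_commute)
    ultimately show False using power_strict_mono[of "norm (x - e)" "norm x" 2] by (simp add: not_less)
  qed
  then have "inj T" using lin by (simp add: linear_injective_0)
  moreover have "T \<in> borel_measurable borel"
    using bl by (intro borel_measurable_continuous_onI linear_continuous_on)
  ultimately show ?thesis using lin by blast
qed

text \<open>A linear injective Borel map sends the sum to the sum of the images and keeps the
  probability of every point, and points outside its range have probability 0. Point probabilities
  and the variance depend on joint laws only, so the canonical copies in \<open>ell2\<close> and in
  the integers satisfy the hypotheses with the same \<open>V\<close>, and their conclusion carries
  back with the same signs.\<close>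

lemma variance_threshold_transfer:
  assumes th: "variance_threshold TYPE(ell2) TYPE(nat \<Rightarrow> ell2) TYPE(nat \<Rightarrow> int) \<delta> V" and \<delta>: "0 < \<delta>"
  shows "variance_threshold TYPE('h::{real_inner, polish_space}) TYPE('w) TYPE('v) \<delta> V"
  unfolding variance_threshold_def
proof (intro allI impI, elim conjE)
  fix n :: nat and \<alpha> :: "nat \<Rightarrow> real" and M :: "'w measure" and X :: "nat \<Rightarrow> 'w \<Rightarrow> 'h" and N :: "'v measure" and Y :: "nat \<Rightarrow> 'v \<Rightarrow> int"
  let ?I = "{1..n}"
  assume n: "1 \<le> n" and \<alpha>: "\<forall>i\<in>?I. 0 < \<alpha> i \<and> \<alpha> i \<le> 1" and "prob_space M"
    and indX: "prob_space.indep_vars M (\<lambda>_. borel) X ?I" and cX: "\<forall>i\<in>?I. conc M (X i) \<le> \<alpha> i" and "prob_space N"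
    and indY: "prob_space.indep_vars N (\<lambda>_. count_space UNIV) Y ?I"
    and Y: "\<forall>i\<in>?I. distr N (count_space UNIV) (Y i) = measure_pmf (nu (\<alpha> i))"
    and var: "V \<le> prob_space.variance N (\<lambda>\<omega>. real_of_int (\<Sum>i=1..n. Y i \<omega>))"
  interpret M: prob_space M by fact
  interpret N: prob_space N by fact
  have I0: "?I \<noteq> {}" using n by simp
  obtain T :: "'h \<Rightarrow> ell2" where T: "linear T" "inj T" "T \<in> borel_measurable borel" using ex_embedding_ell2 by blast
  have rvX: "M.random_variable borel (X i)" if "i \<in> ?I" for i using indX that by (auto simp: M.indep_vars_def)
  have indT: "M.indep_vars (\<lambda>_. borel) (\<lambda>i \<omega>. T (X i \<omega>)) ?I"
    by (rule M.indep_vars_compose2[OF indX]) (rule T(3))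
  define P where "P = distr M (Pi\<^sub>M ?I (\<lambda>_. borel)) (\<lambda>\<omega>. \<lambda>i\<in>?I. T (X i \<omega>))"
  define Q where "Q = distr N (Pi\<^sub>M ?I (\<lambda>_. count_space UNIV)) (\<lambda>\<omega>. \<lambda>i\<in>?I. Y i \<omega>)"
  note canP = M.canonical_family[OF I0 indT, folded P_def]
  note canQ = N.canonical_family[OF I0 indY, folded Q_def]
  have mQ: "(\<lambda>x. h (\<lambda>i\<in>?I. x i)) \<in> borel_measurable (Pi\<^sub>M ?I (\<lambda>_. count_space UNIV))" if "h = (\<lambda>x. real_of_int (\<Sum>i\<in>?I. a i * x i))"
    for h and a :: "nat \<Rightarrow> int"
  proof -
    have "(\<lambda>x. \<Sum>i\<in>?I. real_of_int (a i * x i)) \<in> borel_measurable (Pi\<^sub>M ?I (\<lambda>_. count_space UNIV))"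
      by (intro borel_measurable_sum measurable_compose[OF measurable_component_singleton[of _ ?I "\<lambda>_. count_space UNIV"]]) auto
    then show ?thesis unfolding that by simp
  qed
  have QY: "measure Q {x\<in>space Q. real_of_int (\<Sum>i=1..n. a i * x i) = y} = N.prob {\<omega>\<in>space N. real_of_int (\<Sum>i=1..n. a i * Y i \<omega>) = y}"
    for a :: "nat \<Rightarrow> int" and y
  proof -
    let ?A = "{x\<in>space (Pi\<^sub>M ?I (\<lambda>_. count_space UNIV)). real_of_int (\<Sum>i=1..n. a i * x i) = y}"
    have "?A \<in> sets (Pi\<^sub>M ?I (\<lambda>_. count_space UNIV))"
      using mQ[OF refl, of a] by (intro borel_measurable_eq) simp_all
    then have "measure Q ?A = N.prob ((\<lambda>\<omega>. \<lambda>i\<in>?I. Y i \<omega>) -` ?A \<inter> space N)"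
      unfolding Q_def by (rule measure_distr[OF canQ(4)])
    also have "(\<lambda>\<omega>. \<lambda>i\<in>?I. Y i \<omega>) -` ?A \<inter> space N = {\<omega>\<in>space N. real_of_int (\<Sum>i=1..n. a i * Y i \<omega>) = y}"
      by (auto simp: space_PiM)
    finally show ?thesis by (simp add: Q_def)
  qed
  have var': "V \<le> prob_space.variance Q (\<lambda>x. real_of_int (\<Sum>i=1..n. x i))"
  proof -
    have "prob_space.variance Q (\<lambda>x. real_of_int (\<Sum>i=1..n. x i)) = (\<Sum>i\<in>?I. nu_variance (\<alpha> i))"
    proof (rule prob_space.variance_nu_sum[OF canQ(1) finite_atLeastAtMost canQ(2)])
      show "0 < \<alpha> i \<and> \<alpha> i \<le> 1" if "i \<in> ?I" for i using \<alpha> that by blast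
      show "distr Q (count_space UNIV) (\<lambda>x. x i) = measure_pmf (nu (\<alpha> i))" if "i \<in> ?I" for i
        using canQ(3)[OF that] Y that by simp
    qed
    also have "\<dots> = N.variance (\<lambda>\<omega>. real_of_int (\<Sum>i=1..n. Y i \<omega>))"
      by (rule N.variance_nu_sum[OF finite_atLeastAtMost indY \<alpha>[rule_format] Y[rule_format], symmetric])
    finally show ?thesis using var by simp
  qed
  have cP: "conc P (\<lambda>x. x i) \<le> \<alpha> i" if i: "i \<in> ?I" for i
  proof (rule conc_le)
    fix y
    have cp: "(\<lambda>x. x i) \<in> measurable P borel"
      unfolding P_def measurable_distr_eq1 using i by (rule measurable_component_singleton)
    have rvT: "M.random_variable borel (\<lambda>\<omega>. T (X i \<omega>))" by (rule measurable_compose[OF rvX[OF i] T(3)])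
    have "measure P {x\<in>space P. x i = y} = measure (distr P borel (\<lambda>x. x i)) {y}"
      by (subst measure_distr[OF cp]) (auto intro!: arg_cong[where f = "measure P"])
    also have "\<dots> = measure (distr M borel (\<lambda>\<omega>. T (X i \<omega>))) {y}" by (simp only: canP(3)[OF i])
    also have "\<dots> = M.prob {\<omega>\<in>space M. T (X i \<omega>) = y}"
      by (subst measure_distr[OF rvT]) (auto intro!: arg_cong[where f = M.prob])
    also have "\<dots> \<le> \<alpha> i"
    proof (cases "y \<in> range T")
      case True
      then obtain u where u: "y = T u" by blast
      have "{\<omega>\<in>space M. T (X i \<omega>) = y} = {\<omega>\<in>space M. X i \<omega> = u}" using T(2) by (auto simp: u inj_eq)
      then show ?thesis using conc_ge[OF M.prob_space_axioms, of "X i" u] bspec[OF cX i] by simp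
    next
      case False
      then have e: "{\<omega>\<in>space M. T (X i \<omega>) = y} = {}" by auto
      show ?thesis unfolding e measure_empty using bspec[OF \<alpha> i] by linarith
    qed
    finally show "measure P {x\<in>space P. x i = y} \<le> \<alpha> i" .
  qed
  have sumP: "M.prob {\<omega>\<in>space M. (\<Sum>i=1..n. X i \<omega>) = u} = measure P {x\<in>space P. (\<Sum>i=1..n. x i) = T u}" for u
  proof -
    let ?A = "{x\<in>space (Pi\<^sub>M ?I (\<lambda>_. borel)). (\<Sum>i=1..n. x i) = T u}"
    have "(\<lambda>x. \<Sum>i=1..n. x i) \<in> borel_measurable (Pi\<^sub>M ?I (\<lambda>_. borel :: ell2 measure))"
      by (intro borel_measurable_sum measurable_component_singleton)
    then have "(\<lambda>x. \<Sum>i=1..n. x i) -` {T u} \<inter> space (Pi\<^sub>M ?I (\<lambda>_. borel)) \<in> sets (Pi\<^sub>M ?I (\<lambda>_. borel))"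
      by (rule measurable_sets) simp
    also have "(\<lambda>x. \<Sum>i=1..n. x i) -` {T u} \<inter> space (Pi\<^sub>M ?I (\<lambda>_. borel)) = ?A" by auto
    finally have "measure P ?A = M.prob ((\<lambda>\<omega>. \<lambda>i\<in>?I. T (X i \<omega>)) -` ?A \<inter> space M)"
      unfolding P_def by (rule measure_distr[OF canP(4)])
    also have "(\<lambda>\<omega>. \<lambda>i\<in>?I. T (X i \<omega>)) -` ?A \<inter> space M = {\<omega>\<in>space M. T (\<Sum>i=1..n. X i \<omega>) = T u}"
      by (auto simp: space_PiM linear_sum[OF T(1)])
    also have "\<dots> = {\<omega>\<in>space M. (\<Sum>i=1..n. X i \<omega>) = u}" using T(2) by (auto simp: inj_eq)
    finally show ?thesis by (simp add: P_def)
  qed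
  have "\<exists>a :: nat \<Rightarrow> int. (\<forall>i\<in>?I. a i \<in> {-1, 1}) \<and>
    conc P (\<lambda>x. \<Sum>i=1..n. x i) \<le> (1 + \<delta>) * conc Q (\<lambda>x. real_of_int (\<Sum>i=1..n. a i * x i))"
    by (rule th[unfolded variance_threshold_def, THEN spec[of _ n], THEN spec[of _ \<alpha>], THEN spec[of _ P],
        THEN spec[of _ "\<lambda>i x. x i"], THEN spec[of _ Q], THEN spec[of _ "\<lambda>i x. x i"], THEN mp])
      (intro conjI ballI n \<alpha> canP(1,2) canQ(1,2) cP var' bspec[OF \<alpha>, THEN conjunct1] bspec[OF \<alpha>, THEN conjunct2]
        trans[OF canQ(3) bspec[OF Y]])
  then obtain a :: "nat \<Rightarrow> int" where a: "\<forall>i\<in>?I. a i \<in> {-1, 1}"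
    "conc P (\<lambda>x. \<Sum>i=1..n. x i) \<le> (1 + \<delta>) * conc Q (\<lambda>x. real_of_int (\<Sum>i=1..n. a i * x i))" by (elim exE conjE) (rule that)
  have "conc M (\<lambda>\<omega>. \<Sum>i=1..n. X i \<omega>) \<le> conc P (\<lambda>x. \<Sum>i=1..n. x i)"
    unfolding sumP by (rule conc_le, unfold sumP, rule conc_ge[OF canP(1)])
  also note a(2)
  also have "conc Q (\<lambda>x. real_of_int (\<Sum>i=1..n. a i * x i)) = conc N (\<lambda>\<omega>. real_of_int (\<Sum>i=1..n. a i * Y i \<omega>))"
    unfolding conc_def QY ..
  finally have c: "conc M (\<lambda>\<omega>. \<Sum>i=1..n. X i \<omega>) \<le> (1 + \<delta>) * conc N (\<lambda>\<omega>. real_of_int (\<Sum>i=1..n. a i * Y i \<omega>))" .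
  show "\<exists>a :: nat \<Rightarrow> int. (\<forall>i\<in>{1..n}. a i \<in> {-1, 1}) \<and>
    conc M (\<lambda>\<omega>. \<Sum>i=1..n. X i \<omega>) \<le> (1 + \<delta>) * conc N (\<lambda>\<omega>. real_of_int (\<Sum>i=1..n. a i * Y i \<omega>))"
    by (intro exI[of _ a] conjI a(1) c)
qed

theorem corollary1p2:
  shows "\<forall>\<delta>>0.
    (\<exists>V\<^sub>0. variance_threshold TYPE(ell2) TYPE(nat \<Rightarrow> ell2) TYPE(nat \<Rightarrow> int) \<delta> V\<^sub>0) \<and>
    (\<forall>V\<^sub>0. variance_threshold TYPE(ell2) TYPE(nat \<Rightarrow> ell2) TYPE(nat \<Rightarrow> int) \<delta> V\<^sub>0 \<longrightarrow>
      variance_threshold TYPE('h::{real_inner, polish_space}) TYPE('w) TYPE('v) \<delta> V\<^sub>0)"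
proof (intro allI impI conjI)
  fix \<delta> :: real assume \<delta>: "0 < \<delta>"
  show "\<exists>V\<^sub>0. variance_threshold TYPE(ell2) TYPE(nat \<Rightarrow> ell2) TYPE(nat \<Rightarrow> int) \<delta> V\<^sub>0"
    by (rule variance_threshold_exists[OF \<delta>])
  fix V\<^sub>0 assume "variance_threshold TYPE(ell2) TYPE(nat \<Rightarrow> ell2) TYPE(nat \<Rightarrow> int) \<delta> V\<^sub>0"
  then show "variance_threshold TYPE('h) TYPE('w) TYPE('v) \<delta> V\<^sub>0" by (rule variance_threshold_transfer[OF _ \<delta>])
qed

end
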